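(* Let $s>0$, $\delta\in\mathbb R$, and let $N$ be a positive integer with $N\ge[s]+1$. Let $F:\mathbb R^m\to\mathbb R^l$ be a $C^{N+1}$ function such that $F(0)=0$, and let $u\in H_{s,\delta}\cap L^\infty$ be $\mathbb R^m$-valued. Then $$\|F(u)\|_{H_{s,\delta}}\le K\|u\|_{H_{s,\delta}},$$ where $K\le C\,\|F\|_{C^{N+1}}\bigl(1+\|u\|_{L^\infty}^N\bigr)$ with a constant $C$ that depends in addition on $\delta$ (and on $s$, $N$) but not on $u$ or $F$.
   Context: Weighted spaces: let $K_0=\{x\in\mathbb R^3:|x|\le4\}$, $K_j=\{2^{j-3}\le|x|\le2^{j+2}\}$ for $j\ge1$. Fix $\psi_j\in C_0^\infty(\mathbb R^3)$ with $\psi_j=1$ on $K_j$, $\operatorname{supp}\psi_j\subset\{2^{j-4}\le|x|\le2^{j+3}\}$ for $j\ge1$, $\operatorname{supp}\psi_0\subset\{|x|\le8\}$, and $|\partial^\beta\psi_j|\le C_\beta2^{-|\beta|j}$ with $C_\beta$ independent of $j$. Write $f_\varepsilon(x)=f(\varepsilon x)$ and let $H^s$ be the Bessel potential space, $\|u\|_{H^s}^2=\int(1+|\xi|^2)^s|\hat u|^2d\xi$. For $s\ge0,\delta\in\mathbb R$, $H_{s,\delta}$ is the space of tempered distributions on $\mathbb R^3$ with finite norm $\|u\|_{H_{s,\delta}}^2=\sum_{j\ge0}2^{(\frac32+\delta)2j}\|(\psi_ju)_{2^j}\|_{H^s}^2$ (componentwise for vectors). $[s]$ is the integer part of $s$;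 $\|F\|_{C^{N+1}}$ is the sup-norm of $F$ and its derivatives up to order $N+1$. *)

theory Defs
  imports "HOL-Analysis.Analysis" "HOL-Probability.Essential_Supremum"
begin

section \<open>Classical derivatives\<close>

definition dir_deriv :: "'a::euclidean_space \<Rightarrow> ('a \<Rightarrow> 'b::real_normed_vector) \<Rightarrow> 'a \<Rightarrow> 'b" where
  "dir_deriv b f x = frechet_derivative f (at x) b"

text \<open>Multi-indices are encoded as lists of standard basis vectors; the order
  \<open>|\<beta>|\<close> is the length of the list.\<close>

definition multi_indices :: "'a::euclidean_space list set" where
  "multi_indices = {\<beta>. set \<beta> \<subseteq> Basis}"

definition iter_deriv ::
    "'a::euclidean_space list \<Rightarrow> ('a \<Rightarrow> 'b::real_normed_vector) \<Rightarrow> 'a \<Rightarrow> 'b" where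
  "iter_deriv \<beta> f = foldr dir_deriv \<beta> f"

primrec Ck :: "nat \<Rightarrow> ('a::euclidean_space \<Rightarrow> 'b::real_normed_vector) \<Rightarrow> bool" where
  "Ck 0 f \<longleftrightarrow> continuous_on UNIV f"
| "Ck (Suc k) f \<longleftrightarrow> (\<forall>x. f differentiable (at x)) \<and> (\<forall>b\<in>Basis. Ck k (dir_deriv b f))"

definition smooth :: "('a::euclidean_space \<Rightarrow> 'b::real_normed_vector) \<Rightarrow> bool" where
  "smooth f \<longleftrightarrow> (\<forall>k. Ck k f)"

text \<open>The norm may be infinite: a \<open>C\<^sup>k\<close> function on the whole space need not be bounded.\<close>

definition Ck_norm :: "nat \<Rightarrow> ('a::euclidean_space \<Rightarrow> 'b::real_normed_vector) \<Rightarrow> ennreal" where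
  "Ck_norm k f = (SUP \<beta>\<in>{\<beta>\<in>multi_indices. length \<beta> \<le> k}. SUP x. ennreal (norm (iter_deriv \<beta> f x)))"


section \<open>Tempered distributions on three-dimensional space\<close>

definition Schwartz :: "(real^3 \<Rightarrow> complex) set" where
  "Schwartz = {\<phi>. smooth \<phi> \<and>
     (\<forall>n. \<forall>\<beta>\<in>multi_indices. \<exists>B. \<forall>x. (1 + norm x)^n * norm (iter_deriv \<beta> \<phi> x) \<le> B)}"

definition Schwartz_seminorm :: "nat \<Rightarrow> (real^3 \<Rightarrow> complex) \<Rightarrow> real" where
  "Schwartz_seminorm n \<phi> =
     (SUP (\<beta>, x)\<in>{\<beta>\<in>multi_indices. length \<beta> \<le> n} \<times> UNIV. (1 + norm x)^n * norm (iter_deriv \<beta> \<phi> x))"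

text \<open>Only the values on \<^const>\<open>Schwartz\<close> are meaningful; all notions below depend on these alone.\<close>

type_synonym distr = "(real^3 \<Rightarrow> complex) \<Rightarrow> complex"

definition tempered :: "distr \<Rightarrow> bool" where
  "tempered T \<longleftrightarrow>
     (\<forall>\<phi>\<in>Schwartz. \<forall>\<eta>\<in>Schwartz. \<forall>a b. T (\<lambda>x. a * \<phi> x + b * \<eta> x) = a * T \<phi> + b * T \<eta>) \<and>
     (\<exists>n C. \<forall>\<phi>\<in>Schwartz. norm (T \<phi>) \<le> C * Schwartz_seminorm n \<phi>)"

definition represents :: "(real^3 \<Rightarrow> complex) \<Rightarrow> distr \<Rightarrow> bool" where
  "represents g T \<longleftrightarrow> g \<in> borel_measurable lebesgue \<and>
     (\<forall>\<phi>\<in>Schwartz. integrable lebesgue (\<lambda>x. g x * \<phi> x) \<and> T \<phi> = (LINT x|lebesgue. g x * \<phi> x))"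

definition distr_of :: "(real^3 \<Rightarrow> real^'n) \<Rightarrow> 'n \<Rightarrow> distr" where
  "distr_of u i = (\<lambda>\<phi>. LINT x|lebesgue. complex_of_real (u x $ i) * \<phi> x)"

definition mult_distr :: "(real^3 \<Rightarrow> real) \<Rightarrow> distr \<Rightarrow> distr" where
  "mult_distr \<psi> T = (\<lambda>\<phi>. T (\<lambda>x. complex_of_real (\<psi> x) * \<phi> x))"

text \<open>\<open>f\<^sub>\<epsilon>(x) = f(\<epsilon>x)\<close>, extended to distributions by the change of variables \<open>y = \<epsilon>x\<close>.\<close>

definition dilate :: "real \<Rightarrow> distr \<Rightarrow> distr" where
  "dilate \<epsilon> T = (\<lambda>\<phi>. complex_of_real (1 / \<epsilon>^3) * T (\<lambda>x. \<phi> (x /\<^sub>R \<epsilon>)))"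

text \<open>Unitary normalisation.\<close>

definition fourier :: "(real^3 \<Rightarrow> complex) \<Rightarrow> real^3 \<Rightarrow> complex" where
  "fourier \<phi> \<xi> = complex_of_real ((2 * pi) powr (-3/2)) * (LINT x|lebesgue. cis (- (x \<bullet> \<xi>)) * \<phi> x)"

definition fourier_distr :: "distr \<Rightarrow> distr" where
  "fourier_distr T = (\<lambda>\<phi>. T (fourier \<phi>))"


section \<open>Bessel potential and weighted spaces\<close>

text \<open>Square of the \<open>H\<^sup>s\<close> norm. The function \<open>g\<close> representing the Fourier transform is unique almost
  everywhere if it exists, so the infimum just selects it; if there is none, the value is \<open>\<infinity>\<close>.\<close>

definition Hs_norm_sq :: "real \<Rightarrow> distr \<Rightarrow> ennreal" where
  "Hs_norm_sq s T = (INF g\<in>{g. represents g (fourier_distr T)}.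
     \<integral>\<^sup>+ \<xi>. ennreal ((1 + (norm \<xi>)\<^sup>2) powr s * (norm (g \<xi>))\<^sup>2) \<partial>lebesgue)"

definition dyadic_shell :: "nat \<Rightarrow> (real^3) set" where
  "dyadic_shell j = (if j = 0 then {x. norm x \<le> 4}
     else {x. 2 powr (real j - 3) \<le> norm x \<and> norm x \<le> 2 powr (real j + 2)})"

definition wide_shell :: "nat \<Rightarrow> (real^3) set" where
  "wide_shell j = (if j = 0 then {x. norm x \<le> 8}
     else {x. 2 powr (real j - 4) \<le> norm x \<and> norm x \<le> 2 powr (real j + 3)})"

definition dyadic_cutoffs :: "(nat \<Rightarrow> real^3 \<Rightarrow> real) \<Rightarrow> bool" where
  "dyadic_cutoffs \<psi> \<longleftrightarrow>
     (\<forall>j. smooth (\<psi> j) \<and> (\<forall>x\<in>dyadic_shell j. \<psi> j x = 1) \<and>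
          closure {x. \<psi> j x \<noteq> 0} \<subseteq> wide_shell j) \<and>
     (\<forall>\<beta>\<in>multi_indices. \<exists>C. \<forall>j x.
          \<bar>iter_deriv \<beta> (\<psi> j) x\<bar> \<le> C * 2 powr (- real (length \<beta>) * real j))"

text \<open>Vector-valued distributions are given by their components.\<close>

definition Hsd_norm_sq ::
    "(nat \<Rightarrow> real^3 \<Rightarrow> real) \<Rightarrow> real \<Rightarrow> real \<Rightarrow> ('n::finite \<Rightarrow> distr) \<Rightarrow> ennreal" where
  "Hsd_norm_sq \<psi> s \<delta> T = (\<Sum>i\<in>UNIV. \<Sum>j.
     ennreal (2 powr ((3/2 + \<delta>) * 2 * real j)) * Hs_norm_sq s (dilate (2^j) (mult_distr (\<psi> j) (T i))))"

definition Hsd ::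
    "(nat \<Rightarrow> real^3 \<Rightarrow> real) \<Rightarrow> real \<Rightarrow> real \<Rightarrow> ('n::finite \<Rightarrow> distr) set" where
  "Hsd \<psi> s \<delta> = {T. (\<forall>i. tempered (T i)) \<and> Hsd_norm_sq \<psi> s \<delta> T < \<infinity>}"

definition Hsd_norm ::
    "(nat \<Rightarrow> real^3 \<Rightarrow> real) \<Rightarrow> real \<Rightarrow> real \<Rightarrow> ('n::finite \<Rightarrow> distr) \<Rightarrow> real" where
  "Hsd_norm \<psi> s \<delta> T = sqrt (enn2real (Hsd_norm_sq \<psi> s \<delta> T))"

definition Linf_norm :: "(real^3 \<Rightarrow> real^'n) \<Rightarrow> ennreal" where
  "Linf_norm u = esssup lebesgue (\<lambda>x. ennreal (norm (u x)))"

definition Linf :: "(real^3 \<Rightarrow> real^'n) set" where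
  "Linf = {u. u \<in> borel_measurable lebesgue \<and> Linf_norm u < \<infinity>}"

end

(* Meyer's paralinearisation. With smoothing operators S_i at frequency 2^i (here combinations of Gaussian
   means, chosen so that 1 minus the symbol of S_i vanishes to order 2N at the origin), a function splits into the
   telescoping sum of S_(i+1) f - S_i f, and the H^s norm is controlled by the square function of these differences.
   The composition telescopes as well: F(f) is the sum of the pieces F(S_(i+1) f) - F(S_i f). Up to N derivatives,
   measured in units of 2^(-i), each piece is bounded pointwise by a multiple of the corresponding derivatives of
   S_(i+1) f - S_i f, because the rescaled derivatives of S_i f are bounded by the sup norm of f; this costs N + 1
   derivatives of F and the factor (1 + |f|)^N. Since 0 < s < N, pieces of this kind can be summed in H^s with the
   help of the weights min(t^s, t^(s-N)), t = 2^(-i) (1 + |xi|^2)^(1/2). Applied with linear pieces, the same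
   summation shows that multiplication by a function with bounded derivatives is bounded on H^s. On the support of
   psi_j, u equals (psi_(j-1) + (1 - psi_(j-1)) psi_(j+1)) u, so each shell is controlled by its two neighbours. *)

theory Submission
  imports Defs "HOL-Probability.Probability"
begin

section \<open>Gaussians and the Fourier transform\<close>

text \<open>Gaussian means take the place of blocks with compact frequency support because every
  symbol and kernel is then built from polynomials times Gaussians, whose derivatives, transforms
  and decay are explicit. The price is that all differences overlap in frequency: orthogonality is
  replaced by decay on both sides, the vanishing at the origin winning against 2^(is) for large i
  and the Gaussian for small i. With S_0 = 0 the telescoping sum of F(S_i f) starts at F(0) = 0.

  The obstacle to localising is that psi_j F(u) is not F(psi_j u). The cure is a compactly supported
  v that agrees with u where psi_j lives; in psi_j F(u) = psi_j F(v) the cutoff is a mere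
  multiplier. So the analysis is done for bounded functions of bounded support, and distributions
  enter only when the norms of the statement are read off. Derivatives of F are used only on a ball
  of radius proportional to the sup norm of u, which keeps K finite even when the C^(N+1) norm of F
  is infinite.\<close>

lemma gaussian_fourier_1d:
  fixes a t :: real
  assumes "a > 0"
  shows "integrable lborel (\<lambda>s. exp (- a * s\<^sup>2))"
    and "(LINT s|lborel. cis (- (t * s)) * complex_of_real (exp (- a * s\<^sup>2)))
         = complex_of_real (sqrt (pi / a) * exp (- t\<^sup>2 / (4 * a)))"
proof -
  \<comment> \<open>Chosen so that a (c x)^2 = x^2 / 2: the substitution s = c x turns the integral
    into the characteristic function of the standard normal law.\<close>
  define c where "c = 1 / sqrt (2 * a)"
  have c: "c > 0" "c\<^sup>2 = 1 / (2 * a)" using assms by (auto simp: c_def power_divide)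
  have "integrable lborel (\<lambda>x. sqrt (2 * pi) * std_normal_density x)" by auto
  then have i0: "integrable lborel (\<lambda>x::real. exp (- x\<^sup>2 / 2))" by (simp add: normal_density_def)
  have e: "exp (- a * (0 + c * x)\<^sup>2) = exp (- x\<^sup>2 / 2)" for x
    using c(2) assms by (simp add: power_mult_distrib)
  show int: "integrable lborel (\<lambda>s. exp (- a * s\<^sup>2))"
    using c(1) i0 lborel_integrable_real_affine_iff[of c "\<lambda>s. exp (- a * s\<^sup>2)" 0] unfolding e by simp
  have "char std_normal_distribution (- t * c) =
      (LINT x|lborel. std_normal_density x *\<^sub>R cis (- t * c * x))"
    unfolding char_def
    by (subst integral_density) (auto simp: cis_conv_exp)
  also have "\<dots> = complex_of_real (1 / sqrt (2 * pi)) * (LINT x|lborel. cis (- t * c * x) * complex_of_real (exp (- x\<^sup>2 / 2)))"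
    by (subst integral_mult_right_zero[symmetric])
      (auto simp: normal_density_def scaleR_conv_of_real intro!: Bochner_Integration.integral_cong)
  finally have 1: "(LINT x|lborel. cis (- t * c * x) * complex_of_real (exp (- x\<^sup>2 / 2))) = 
     complex_of_real (sqrt (2 * pi)) * complex_of_real (exp (- (t * c)\<^sup>2 / 2))"
    by (simp add: char_std_normal_distribution field_simps)
  have "(LINT s|lborel. cis (- (t * s)) * complex_of_real (exp (- a * s\<^sup>2))) =
     c *\<^sub>R (LINT x|lborel. cis (- (t * (0 + c * x))) * complex_of_real (exp (- a * (0 + c * x)\<^sup>2)))"
    using c(1) lborel_integral_real_affine[of c "\<lambda>s. cis (- (t * s)) * complex_of_real (exp (- a * s\<^sup>2))" 0] by simp
  also have "\<dots> = complex_of_real (c * sqrt (2 * pi) * exp (- (t * c)\<^sup>2 / 2))"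
    unfolding e using 1 by (simp add: scaleR_conv_of_real mult.assoc)
  also have "c * sqrt (2 * pi) = sqrt (pi / a)"
    using assms by (simp add: c_def real_sqrt_divide real_sqrt_mult)
  also have "(t * c)\<^sup>2 / 2 = t\<^sup>2 / (4 * a)" using c(2) by (simp add: power_mult_distrib)
  then have "- (t * c)\<^sup>2 / 2 = - t\<^sup>2 / (4 * a)" by simp
  finally show "(LINT s|lborel. cis (- (t * s)) * complex_of_real (exp (- a * s\<^sup>2)))
         = complex_of_real (sqrt (pi / a) * exp (- t\<^sup>2 / (4 * a)))" .
qed

interpretation lborel_prod: product_sigma_finite "\<lambda>_::'a::euclidean_space. lborel :: real measure"
  by standard

text \<open>\<open>lborel_eq\<close> presents Lebesgue measure as the image of the product over
  \<open>Basis\<close>, where integrals of products factor. This reduces Gaussians in any dimension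
  to the line.\<close>

lemma
  fixes h :: "'a::euclidean_space \<Rightarrow> real \<Rightarrow> 'c::{real_normed_field,banach,second_countable_topology}"
  assumes "\<And>b. b \<in> Basis \<Longrightarrow> integrable lborel (h b)"
  shows integrable_lborel_prod_Basis: "integrable lborel (\<lambda>x::'a. \<Prod>b\<in>Basis. h b (x \<bullet> b))"
    and integral_lborel_prod_Basis: "(LINT x|lborel. (\<Prod>b\<in>Basis. h b (x \<bullet> b))) = (\<Prod>b\<in>Basis. (LINT t|lborel. h b t))"
proof -
  have m: "(\<lambda>f. \<Sum>b\<in>Basis. f b *\<^sub>R b) \<in> (\<Pi>\<^sub>M b\<in>(Basis::'a set). lborel) \<rightarrow>\<^sub>M borel"
    by measurable
  have h[measurable]: "b \<in> Basis \<Longrightarrow> h b \<in> borel_measurable borel" for b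
    using assms borel_measurable_integrable by fastforce
  have m2: "(\<lambda>x::'a. \<Prod>b\<in>Basis. h b (x \<bullet> b)) \<in> borel_measurable borel"
    by (intro borel_measurable_prod measurable_compose[OF _ h]) auto
  have e: "(\<Prod>b\<in>Basis. h b ((\<Sum>i\<in>Basis. f i *\<^sub>R i) \<bullet> b)) = (\<Prod>b\<in>Basis. h b (f b))" for f :: "'a \<Rightarrow> real"
    by (intro prod.cong) auto
  show "integrable lborel (\<lambda>x::'a. \<Prod>b\<in>Basis. h b (x \<bullet> b))"
    unfolding lborel_eq[where 'a='a]
    by (subst integrable_distr_eq[OF m m2]) (simp add: e lborel_prod.product_integrable_prod assms)
  show "(LINT x|lborel. (\<Prod>b\<in>Basis. h b (x \<bullet> b))) = (\<Prod>b\<in>Basis. (LINT t|lborel. h b t))"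
    unfolding lborel_eq[where 'a='a]
    by (subst integral_distr[OF m m2]) (simp add: e lborel_prod.product_integral_prod assms)
qed

section \<open>Gaussians, the Fourier integral and its mean square bound\<close>

definition gauss :: "real \<Rightarrow> 'a::euclidean_space \<Rightarrow> real" where
  "gauss a x = exp (- a * (norm x)\<^sup>2)"

text \<open>Unnormalised, in contrast to \<^const>\<open>fourier\<close>.\<close>

definition ft :: "('a::euclidean_space \<Rightarrow> complex) \<Rightarrow> 'a \<Rightarrow> complex" where
  "ft f \<xi> = (LINT x|lborel. cis (- (x \<bullet> \<xi>)) * f x)"

text \<open>The whole factor (2 pi)^(-n) sits in the inverse, so that a symbol \<open>q\<close> acts
  exactly as convolution with \<open>ift q\<close>, see \<open>ift_conv\<close>.\<close>

definition ift :: "('a::euclidean_space \<Rightarrow> complex) \<Rightarrow> 'a \<Rightarrow> complex" where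
  "ift f x = ft f (- x) / complex_of_real ((2 * pi) ^ DIM('a))"

lemma gauss_prod: "gauss a (x::'a::euclidean_space) = (\<Prod>b\<in>Basis. exp (- a * (x \<bullet> b)\<^sup>2))"
  by (simp add: gauss_def exp_sum[symmetric] sum_distrib_left power2_norm_eq_inner
      euclidean_inner[of x x] power2_eq_square[of "x \<bullet> _"] sum_negf)

lemma continuous_on_gauss: "continuous_on A (gauss a)"
  unfolding gauss_def by (intro continuous_intros)

lemma borel_measurable_gauss[measurable]: "gauss a \<in> borel_measurable borel"
  by (intro borel_measurable_continuous_onI continuous_on_gauss)

lemma gauss_pos: "gauss a x > 0" by (simp add: gauss_def)

lemma gauss_le_one: "a \<ge> 0 \<Longrightarrow> gauss a x \<le> 1" by (simp add: gauss_def)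

lemma integrable_gauss: "a > 0 \<Longrightarrow> integrable lborel (gauss a :: 'a::euclidean_space \<Rightarrow> real)"
  unfolding gauss_prod[abs_def]
  by (rule integrable_lborel_prod_Basis) (rule gaussian_fourier_1d)

lemma cis_sum: "finite A \<Longrightarrow> cis (sum f A) = (\<Prod>i\<in>A. cis (f i))"
  by (induction A rule: finite_induct) (auto simp: cis_mult[symmetric])

lemma borel_measurable_cis[measurable]: "cis \<in> borel_measurable borel"
  by (intro borel_measurable_continuous_onI continuous_intros)

lemma borel_measurable_cnj[measurable]: "cnj \<in> borel_measurable borel"
  by (intro borel_measurable_continuous_onI continuous_intros)

lemma integrable_cis_mult:
  fixes f :: "'a::euclidean_space \<Rightarrow> complex"
  assumes "integrable lborel f" and [measurable]: "h \<in> borel_measurable borel"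
  shows "integrable lborel (\<lambda>x. cis (h x) * f x)"
proof (rule Bochner_Integration.integrable_bound[OF assms(1)])
  have [measurable]: "f \<in> borel_measurable borel" using assms(1) borel_measurable_integrable by fastforce
  show "(\<lambda>x. cis (h x) * f x) \<in> borel_measurable lborel" by measurable
qed (simp add: norm_mult)

lemma ft_gauss:
  fixes \<xi> :: "'a::euclidean_space"
  assumes "a > 0"
  shows "ft (\<lambda>x. complex_of_real (gauss a x)) \<xi> = complex_of_real (sqrt (pi / a) ^ DIM('a) * gauss (1 / (4 * a)) \<xi>)"
proof -
  have "ft (\<lambda>x. complex_of_real (gauss a x)) \<xi> =
     (LINT x|lborel. (\<Prod>b\<in>Basis. cis (- ((\<xi> \<bullet> b) * (x \<bullet> b))) * complex_of_real (exp (- a * (x \<bullet> b)\<^sup>2))))"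
    unfolding ft_def
  proof (intro Bochner_Integration.integral_cong refl)
    fix x :: 'a
    have "- (x \<bullet> \<xi>) = (\<Sum>b\<in>Basis. - ((\<xi> \<bullet> b) * (x \<bullet> b)))"
      by (simp add: euclidean_inner[of x \<xi>] sum_negf mult.commute)
    then show "cis (- (x \<bullet> \<xi>)) * complex_of_real (gauss a x) = (\<Prod>b\<in>Basis. cis (- ((\<xi> \<bullet> b) * (x \<bullet> b))) * complex_of_real (exp (- a * (x \<bullet> b)\<^sup>2)))"
      by (simp add: cis_sum gauss_prod prod.distrib)
  qed
  also have "\<dots> = (\<Prod>b\<in>Basis. complex_of_real (sqrt (pi / a) * exp (- (\<xi> \<bullet> b)\<^sup>2 / (4 * a))))"
    using gaussian_fourier_1d[OF assms]
    by (subst integral_lborel_prod_Basis) (auto intro!: integrable_cis_mult)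
  also have "\<dots> = complex_of_real (sqrt (pi / a) ^ DIM('a) * gauss (1 / (4 * a)) \<xi>)"
    by (simp add: prod.distrib gauss_prod)
  finally show ?thesis .
qed

lemma integral_gauss: "a > 0 \<Longrightarrow> (LINT x|lborel. gauss a (x::'a::euclidean_space)) = sqrt (pi / a) ^ DIM('a)"
proof -
  assume a: "a > 0"
  have "complex_of_real (LINT x|lborel. gauss a (x::'a)) = complex_of_real (sqrt (pi / a) ^ DIM('a))"
    using ft_gauss[OF a, of "0::'a"] by (simp add: ft_def gauss_def del: of_real_power of_real_mult)
  then show ?thesis by (simp only: of_real_eq_iff)
qed

lemma norm_ft_le:
  assumes "integrable lborel f"
  shows "norm (ft f \<xi>) \<le> (LINT x|lborel. norm (f x))"
  unfolding ft_def
  by (rule order_trans[OF integral_norm_bound]) (simp add: norm_mult)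

lemma borel_measurable_ft[measurable]:
  assumes [measurable]: "f \<in> borel_measurable borel"
  shows "ft f \<in> borel_measurable borel"
  unfolding ft_def[abs_def] by measurable

lemma borel_measurable_ift[measurable]:
  assumes [measurable]: "f \<in> borel_measurable borel"
  shows "ift f \<in> borel_measurable borel"
  unfolding ift_def[abs_def] by measurable

lemma integrable_borel: "integrable lborel f \<Longrightarrow> f \<in> borel_measurable borel"
  using borel_measurable_integrable by fastforce

lemma integrable_bounded_mult:
  fixes f g :: "'a::euclidean_space \<Rightarrow> 'b::{real_normed_field,banach,second_countable_topology}"
  assumes "integrable lborel g" "f \<in> borel_measurable borel" "\<And>x. norm (f x) \<le> B"
  shows "integrable lborel (\<lambda>x. f x * g x)"
proof (rule Bochner_Integration.integrable_bound)
  show "integrable lborel (\<lambda>x. B * norm (g x))" using assms by auto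
  show "(\<lambda>x. f x * g x) \<in> borel_measurable lborel"
    using assms(2) integrable_borel[OF assms(1)] by measurable
  show "AE x in lborel. norm (f x * g x) \<le> norm (B * norm (g x))"
    using assms(3) by (auto simp: norm_mult intro!: order_trans[OF mult_right_mono[OF assms(3)]] abs_ge_self)
qed

text \<open>Fubini, since cis (-(x . xi)) f(x) g(xi) is integrable on the product. It serves three
  times: for the convolution formula, for the mean square bound, and for the transform of a
  distribution given by a function.\<close>

lemma ft_mult_swap:
  fixes f g :: "'a::euclidean_space \<Rightarrow> complex"
  assumes f: "integrable lborel f" and g: "integrable lborel g"
  shows "(LINT \<xi>|lborel. ft f \<xi> * g \<xi>) = (LINT x|lborel. f x * ft g x)"
proof -
  note [measurable] = integrable_borel[OF f] integrable_borel[OF g]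
  have int: "integrable (lborel \<Otimes>\<^sub>M lborel) (\<lambda>(x, \<xi>). cis (- (x \<bullet> \<xi>)) * f x * g \<xi>)"
  proof (rule lborel_pair.Fubini_integrable)
    show "(\<lambda>(x, \<xi>). cis (- (x \<bullet> \<xi>)) * f x * g \<xi>) \<in> borel_measurable (lborel \<Otimes>\<^sub>M lborel)" by measurable
    show "integrable lborel (\<lambda>x. LINT y|lborel. norm (case (x, y) of (x, \<xi>) \<Rightarrow> cis (- (x \<bullet> \<xi>)) * f x * g \<xi>))"
      using f by (simp add: norm_mult)
    show "AE x in lborel. integrable lborel (\<lambda>y. case (x, y) of (x, \<xi>) \<Rightarrow> cis (- (x \<bullet> \<xi>)) * f x * g \<xi>)"
      using integrable_cis_mult[OF g] by (auto simp: mult.assoc mult.left_commute[of _ "f _"])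
  qed
  have "(LINT \<xi>|lborel. ft f \<xi> * g \<xi>) = (LINT \<xi>|lborel. LINT x|lborel. cis (- (x \<bullet> \<xi>)) * f x * g \<xi>)"
    unfolding ft_def by (simp add: integral_mult_left_zero)
  also have "\<dots> = (LINT x|lborel. LINT \<xi>|lborel. cis (- (x \<bullet> \<xi>)) * f x * g \<xi>)"
    using lborel_pair.Fubini_integral[OF int] by simp
  also have "\<dots> = (LINT x|lborel. f x * ft g x)"
    unfolding ft_def
    by (simp add: inner_commute mult.commute mult.left_commute flip: integral_mult_right_zero)
  finally show ?thesis .
qed

lemma ft_modulate: "ft (\<lambda>\<xi>. cis (x \<bullet> \<xi>) * q \<xi>) y = ft q (y - x)"
  unfolding ft_def
  by (intro Bochner_Integration.integral_cong refl)
    (simp add: cis_mult inner_diff_right inner_commute algebra_simps flip: mult.assoc)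

text \<open>The convolution theorem is \<open>ft_mult_swap\<close> for the modulated symbol cis (x .
  xi) q(xi), whose transform at y is \<open>ft q (y - x)\<close>.\<close>

lemma ift_conv:
  fixes f q :: "'a::euclidean_space \<Rightarrow> complex"
  assumes "integrable lborel f" "integrable lborel q"
  shows "ift (\<lambda>\<xi>. q \<xi> * ft f \<xi>) x = (LINT y|lborel. f y * ift q (x - y))"
proof -
  have "ft (\<lambda>\<xi>. q \<xi> * ft f \<xi>) (- x) = (LINT \<xi>|lborel. ft f \<xi> * (cis (x \<bullet> \<xi>) * q \<xi>))"
    unfolding ft_def[of _ "-x"] by (simp add: inner_commute mult_ac)
  also have "\<dots> = (LINT y|lborel. f y * ft q (y - x))"
    using assms by (subst ft_mult_swap) (auto intro!: integrable_cis_mult simp: ft_modulate)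
  finally show ?thesis by (simp add: ift_def)
qed

lemma
  fixes t :: "'a::euclidean_space"
  assumes c: "c \<noteq> 0"
  shows nn_integral_lborel_affine: "f \<in> borel_measurable borel \<Longrightarrow>
      (\<integral>\<^sup>+x. f x \<partial>lborel) = ennreal (\<bar>c\<bar> ^ DIM('a)) * (\<integral>\<^sup>+x. f (t + c *\<^sub>R x) \<partial>lborel)"
    and integrable_lborel_affine: "integrable lborel (g :: 'a \<Rightarrow> 'b::{banach,second_countable_topology}) \<Longrightarrow>
      integrable lborel (\<lambda>x. g (t + c *\<^sub>R x))"
    and integral_lborel_affine: "g \<in> borel_measurable borel \<Longrightarrow>
      (LINT x|lborel. g x) = (\<bar>c\<bar> ^ DIM('a)) *\<^sub>R (LINT x|lborel. g (t + c *\<^sub>R x))"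
proof -
  note l = lborel_affine[OF c, of t]
  show 1: "(\<integral>\<^sup>+x. f x \<partial>lborel) = ennreal (\<bar>c\<bar> ^ DIM('a)) * (\<integral>\<^sup>+x. f (t + c *\<^sub>R x) \<partial>lborel)"
    if [measurable]: "f \<in> borel_measurable borel" for f
    using arg_cong[OF l, of "\<lambda>M. integral\<^sup>N M f"]
    by (simp add: nn_integral_density nn_integral_distr nn_integral_cmult)
  show "integrable lborel (\<lambda>x. g (t + c *\<^sub>R x))" if g: "integrable lborel g"
  proof (rule integrableI_bounded)
    note [measurable] = integrable_borel[OF g]
    show "(\<lambda>x. g (t + c *\<^sub>R x)) \<in> borel_measurable lborel" by measurable
    have "ennreal (\<bar>c\<bar> ^ DIM('a)) * (\<integral>\<^sup>+x. ennreal (norm (g (t + c *\<^sub>R x))) \<partial>lborel) < \<infinity>"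
      using g 1[of "\<lambda>x. ennreal (norm (g x))"] by (simp add: integrable_iff_bounded)
    then show "(\<integral>\<^sup>+x. ennreal (norm (g (t + c *\<^sub>R x))) \<partial>lborel) < \<infinity>"
      using c by (auto simp: ennreal_mult_less_top ennreal_mult_eq_top_iff less_top)
  qed
  show "(LINT x|lborel. g x) = (\<bar>c\<bar> ^ DIM('a)) *\<^sub>R (LINT x|lborel. g (t + c *\<^sub>R x))"
    if [measurable]: "g \<in> borel_measurable borel"
  proof -
    have "(LINT x|lborel. g x) = integral\<^sup>L (density (distr lborel borel (\<lambda>x. t + c *\<^sub>R x)) (\<lambda>_. ennreal (\<bar>c\<bar> ^ DIM('a)))) g"
      using arg_cong[OF l, of "\<lambda>M. integral\<^sup>L M g"] .
    also have "\<dots> = (LINT x|distr lborel borel (\<lambda>x. t + c *\<^sub>R x). \<bar>c\<bar> ^ DIM('a) *\<^sub>R g x)"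
      by (rule integral_density) auto
    also have "\<dots> = (LINT x|lborel. \<bar>c\<bar> ^ DIM('a) *\<^sub>R g (t + c *\<^sub>R x))"
      by (rule integral_distr) auto
    finally show ?thesis by simp
  qed
qed

lemma ennreal_mult_le_sum_squares:
  "ennreal a * ennreal b \<le> ennreal (1/2) * (ennreal (a\<^sup>2) + ennreal (b\<^sup>2))" if "a \<ge> 0" "b \<ge> 0"
proof -
  have "a * b \<le> 1/2 * (a\<^sup>2 + b\<^sup>2)" using sum_squares_bound[of a b] by (simp add: field_simps)
  then have "ennreal (a * b) \<le> ennreal (1/2 * (a\<^sup>2 + b\<^sup>2))" by (rule ennreal_leI)
  also have "\<dots> = ennreal (1/2) * ennreal (a\<^sup>2 + b\<^sup>2)" by (rule ennreal_mult) auto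
  also have "ennreal (a\<^sup>2 + b\<^sup>2) = ennreal (a\<^sup>2) + ennreal (b\<^sup>2)" by (rule ennreal_plus) auto
  finally show ?thesis using that by (simp only: ennreal_mult)
qed

lemma ennreal_half_double: "ennreal (1/2) * (X + X) = X"
proof -
  have "ennreal (1/2) * ennreal 2 = ennreal (1/2 * 2)" by (rule ennreal_mult[symmetric]) auto
  then have "ennreal (1/2) * 2 = 1" by (simp only: ennreal_numeral) simp
  then show ?thesis by (simp only: mult_2[symmetric] mult.assoc[symmetric] mult_1)
qed

text \<open>Only this half of Plancherel's theorem is needed; inserting a Gaussian weight makes Fubini applicable.\<close>

lemma ft_L2_le:
  fixes f :: "'a::euclidean_space \<Rightarrow> complex"
  assumes f: "integrable lborel f"
  shows "(\<integral>\<^sup>+\<xi>. ennreal ((norm (ft f \<xi>))\<^sup>2) \<partial>lborel) \<le>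
    ennreal ((2 * pi) ^ DIM('a)) * (\<integral>\<^sup>+x. ennreal ((norm (f x))\<^sup>2) \<partial>lborel)"
proof -
  note [measurable] = integrable_borel[OF f]
  define M where "M = (LINT x|lborel. norm (f x))"
  have M: "norm (ft f \<xi>) \<le> M" for \<xi> unfolding M_def by (rule norm_ft_le[OF f])
  have M0: "M \<ge> 0" unfolding M_def by simp
  define J where "J = (\<integral>\<^sup>+x. ennreal ((norm (f x))\<^sup>2) \<partial>lborel)"
  \<comment> \<open>With the weight, the integral becomes the double integral of f(x) cnj (f(y)) G(y
    - x). Here G, the transform of the weight, is nonnegative, and its total mass (2 pi)^n does not
    depend on \<epsilon>.\<close>
  have eps: "(\<integral>\<^sup>+\<xi>. ennreal (gauss \<epsilon> \<xi> * (norm (ft f \<xi>))\<^sup>2) \<partial>lborel) \<le> ennreal ((2 * pi) ^ DIM('a)) * J"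
    if e: "\<epsilon> > 0" for \<epsilon>
  proof -
    define G where "G z = sqrt (pi / \<epsilon>) ^ DIM('a) * gauss (1 / (4 * \<epsilon>)) z" for z :: 'a
    have G: "ft (\<lambda>x. complex_of_real (gauss \<epsilon> x)) = (\<lambda>z. complex_of_real (G z))"
      unfolding G_def by (rule ext) (rule ft_gauss[OF e])
    have G0: "G z \<ge> 0" for z unfolding G_def using e by (simp add: gauss_def)
    have G_int: "integrable lborel G"
      unfolding G_def using e by (intro integrable_mult_right integrable_gauss) auto
    have "sqrt (pi / \<epsilon>) * sqrt (pi / (1 / (4 * \<epsilon>))) = sqrt ((2 * pi)\<^sup>2)"
      unfolding real_sqrt_mult[symmetric] using e by (simp add: power2_eq_square)
    then have "sqrt (pi / \<epsilon>) ^ DIM('a) * sqrt (pi / (1 / (4 * \<epsilon>))) ^ DIM('a) = (2 * pi) ^ DIM('a)"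
      unfolding power_mult_distrib[symmetric] by (simp only: real_sqrt_abs) simp
    then have Gv: "(LINT z|lborel. G z) = (2 * pi) ^ DIM('a)"
      using e unfolding G_def by (simp add: integral_gauss)
    have GB: "\<bar>G z\<bar> \<le> sqrt (pi / \<epsilon>) ^ DIM('a)" for z
      using G0[of z] gauss_le_one[of "1 / (4 * \<epsilon>)" z] e by (auto simp: G_def intro!: mult_left_le)
    have [measurable]: "G \<in> borel_measurable borel" using integrable_borel[OF G_int] .
    have Gsym: "G (x - y) = G (y - x)" for x y unfolding G_def gauss_def by (simp add: norm_minus_commute)
    have Gnn: "(\<integral>\<^sup>+y. ennreal (G (y - x)) \<partial>lborel) = ennreal ((2 * pi) ^ DIM('a))" for x
      using nn_integral_lborel_affine[of 1 "\<lambda>y. ennreal (G y)" "-x"] nn_integral_eq_integral[OF G_int] Gv G0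
      by (simp add: algebra_simps)
    have gi: "integrable lborel (\<lambda>\<xi>. complex_of_real (gauss \<epsilon> \<xi>))" using integrable_gauss[OF e] by auto
    define g where "g \<xi> = complex_of_real (gauss \<epsilon> \<xi>) * cnj (ft f \<xi>)" for \<xi>
    have g_int: "integrable lborel g"
      unfolding g_def using integrable_bounded_mult[OF gi, of "\<lambda>\<xi>. cnj (ft f \<xi>)" M] M by (simp add: mult.commute)
    have ft_g: "ft g x = cnj (LINT y|lborel. f y * complex_of_real (G (y - x)))" for x
    proof -
      have "ft g x = cnj (LINT \<xi>|lborel. ft f \<xi> * (cis (x \<bullet> \<xi>) * complex_of_real (gauss \<epsilon> \<xi>)))"
        unfolding ft_def[of g] g_def by (simp add: cis_cnj inner_commute mult_ac flip: Bochner_Integration.integral_cnj)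
      also have "(LINT \<xi>|lborel. ft f \<xi> * (cis (x \<bullet> \<xi>) * complex_of_real (gauss \<epsilon> \<xi>))) =
          (LINT y|lborel. f y * complex_of_real (G (y - x)))"
        by (subst ft_mult_swap[OF f]) (auto intro!: integrable_cis_mult gi simp: ft_modulate G)
      finally show ?thesis .
    qed
    have Re: "(LINT \<xi>|lborel. complex_of_real (gauss \<epsilon> \<xi> * (norm (ft f \<xi>))\<^sup>2)) = (LINT x|lborel. f x * ft g x)"
      unfolding ft_mult_swap[OF f g_int, symmetric] g_def
      by (intro Bochner_Integration.integral_cong refl)
        (simp only: mult.left_commute[of "ft f _"] complex_norm_square of_real_mult)
    have i1: "integrable lborel (\<lambda>\<xi>. gauss \<epsilon> \<xi> * (norm (ft f \<xi>))\<^sup>2)"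
      using integrable_bounded_mult[OF integrable_gauss[OF e], of "\<lambda>\<xi>. (norm (ft f \<xi>))\<^sup>2" "M\<^sup>2"] M
      by (simp add: mult.commute power_mono)
    have "(\<integral>\<^sup>+\<xi>. ennreal (gauss \<epsilon> \<xi> * (norm (ft f \<xi>))\<^sup>2) \<partial>lborel) = ennreal (LINT \<xi>|lborel. gauss \<epsilon> \<xi> * (norm (ft f \<xi>))\<^sup>2)"
      using i1 by (intro nn_integral_eq_integral) (auto simp: gauss_def)
    also have "(LINT \<xi>|lborel. gauss \<epsilon> \<xi> * (norm (ft f \<xi>))\<^sup>2) = norm (LINT x|lborel. f x * ft g x)"
      unfolding Re[symmetric] integral_complex_of_real norm_of_real
      by (intro abs_of_nonneg[symmetric] integral_nonneg) (simp add: gauss_def)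
    also have "ennreal \<dots> \<le> (\<integral>\<^sup>+x. ennreal (norm (f x * ft g x)) \<partial>lborel)"
      by (rule integral_norm_bound_ennreal)
        (use integrable_bounded_mult[OF f, of "ft g"] norm_ft_le[OF g_int] integrable_borel[OF g_int] in \<open>auto simp: mult.commute\<close>)
    also have "\<dots> \<le> (\<integral>\<^sup>+x. \<integral>\<^sup>+y. ennreal (norm (f x)) * (ennreal (norm (f y)) * ennreal (G (y - x))) \<partial>lborel \<partial>lborel)"
    proof (rule nn_integral_mono)
      fix x
      have "integrable lborel (\<lambda>y. f y * complex_of_real (G (y - x)))"
        using integrable_bounded_mult[OF f, of "\<lambda>y. complex_of_real (G (y - x))" "sqrt (pi / \<epsilon>) ^ DIM('a)"] e
          GB by (auto simp: mult.commute)
      then have "ennreal (norm (ft g x)) \<le> (\<integral>\<^sup>+y. ennreal (norm (f y * complex_of_real (G (y - x)))) \<partial>lborel)"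
        unfolding ft_g complex_mod_cnj by (rule integral_norm_bound_ennreal)
      then have "ennreal (norm (f x)) * ennreal (norm (ft g x)) \<le> ennreal (norm (f x)) * (\<integral>\<^sup>+y. ennreal (norm (f y)) * ennreal (G (y - x)) \<partial>lborel)"
        by (intro mult_left_mono) (auto simp: norm_mult ennreal_mult G0)
      then show "ennreal (norm (f x * ft g x)) \<le> (\<integral>\<^sup>+y. ennreal (norm (f x)) * (ennreal (norm (f y)) * ennreal (G (y - x))) \<partial>lborel)"
        by (simp add: norm_mult ennreal_mult nn_integral_cmult)
    qed
    \<comment> \<open>The simplest Schur test: |f(x)| |f(y)| is at most half the sum of the squares,
      and in either half one variable meets only G and integrates to (2 pi)^n.\<close>
    also have "\<dots> \<le> (\<integral>\<^sup>+x. \<integral>\<^sup>+y. ennreal (1/2) * (ennreal ((norm (f x))\<^sup>2) * ennreal (G (y - x)) + ennreal ((norm (f y))\<^sup>2) * ennreal (G (y - x))) \<partial>lborel \<partial>lborel)"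
    proof (intro nn_integral_mono)
      fix x y
      have "ennreal (norm (f x)) * ennreal (norm (f y)) * ennreal (G (y - x)) \<le>
        ennreal (1/2) * (ennreal ((norm (f x))\<^sup>2) + ennreal ((norm (f y))\<^sup>2)) * ennreal (G (y - x))"
        by (intro mult_right_mono ennreal_mult_le_sum_squares) auto
      then show "ennreal (norm (f x)) * (ennreal (norm (f y)) * ennreal (G (y - x))) \<le>
        ennreal (1/2) * (ennreal ((norm (f x))\<^sup>2) * ennreal (G (y - x)) + ennreal ((norm (f y))\<^sup>2) * ennreal (G (y - x)))"
        by (simp only: mult.assoc distrib_right)
    qed
    also have "\<dots> = ennreal (1/2) * ((\<integral>\<^sup>+x. \<integral>\<^sup>+y. ennreal ((norm (f x))\<^sup>2) * ennreal (G (y - x)) \<partial>lborel \<partial>lborel) +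
       (\<integral>\<^sup>+x. \<integral>\<^sup>+y. ennreal ((norm (f y))\<^sup>2) * ennreal (G (y - x)) \<partial>lborel \<partial>lborel))"
      by (simp add: nn_integral_cmult nn_integral_add)
    also have "(\<integral>\<^sup>+x. \<integral>\<^sup>+y. ennreal ((norm (f y))\<^sup>2) * ennreal (G (y - x)) \<partial>lborel \<partial>lborel) =
       (\<integral>\<^sup>+y. \<integral>\<^sup>+x. ennreal ((norm (f y))\<^sup>2) * ennreal (G (x - y)) \<partial>lborel \<partial>lborel)"
      by (subst lborel_pair.Fubini') (auto simp: Gsym)
    also have "(\<integral>\<^sup>+x. \<integral>\<^sup>+y. ennreal ((norm (f x))\<^sup>2) * ennreal (G (y - x)) \<partial>lborel \<partial>lborel) = ennreal ((2 * pi) ^ DIM('a)) * J"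
      by (simp add: nn_integral_cmult Gnn J_def nn_integral_multc mult.commute)
    also have "ennreal (1/2) * (ennreal ((2 * pi) ^ DIM('a)) * J + ennreal ((2 * pi) ^ DIM('a)) * J) = ennreal ((2 * pi) ^ DIM('a)) * J"
      by (rule ennreal_half_double)
    finally show ?thesis .
  qed
  have "(\<integral>\<^sup>+\<xi>. ennreal ((norm (ft f \<xi>))\<^sup>2) \<partial>lborel) = (\<integral>\<^sup>+\<xi>. liminf (\<lambda>n. ennreal (gauss (1 / real (Suc n)) \<xi> * (norm (ft f \<xi>))\<^sup>2)) \<partial>lborel)"
  proof (intro nn_integral_cong)
    fix \<xi> :: 'a
    have "(\<lambda>n. gauss (1 / real (Suc n)) \<xi>) \<longlonglongrightarrow> exp (- 0 * (norm \<xi>)\<^sup>2)"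
      unfolding gauss_def by (intro tendsto_intros LIMSEQ_Suc[OF lim_1_over_n])
    then have "(\<lambda>n. ennreal (gauss (1 / real (Suc n)) \<xi> * (norm (ft f \<xi>))\<^sup>2)) \<longlonglongrightarrow> ennreal (1 * (norm (ft f \<xi>))\<^sup>2)"
      by (intro tendsto_intros) simp
    then show "ennreal ((norm (ft f \<xi>))\<^sup>2) = liminf (\<lambda>n. ennreal (gauss (1 / real (Suc n)) \<xi> * (norm (ft f \<xi>))\<^sup>2))"
      by (simp add: lim_imp_Liminf)
  qed
  \<comment> \<open>The weights tend to 1 as \<epsilon> = 1 / (n + 1) tends to 0, and Fatou removes
    them.\<close>
  also have "\<dots> \<le> liminf (\<lambda>n. \<integral>\<^sup>+\<xi>. ennreal (gauss (1 / real (Suc n)) \<xi> * (norm (ft f \<xi>))\<^sup>2) \<partial>lborel)"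
    by (rule nn_integral_liminf) measurable
  also have "\<dots> \<le> liminf (\<lambda>n::nat. ennreal ((2 * pi) ^ DIM('a)) * J)"
    by (intro Liminf_mono always_eventually allI eps) simp
  finally show ?thesis by (simp add: J_def Liminf_const)
qed

section \<open>Symbols with all moments; polynomials times Gaussians\<close>

lemma dir_deriv_eqI: "(f has_derivative f') (at x) \<Longrightarrow> dir_deriv b f x = f' b"
  unfolding dir_deriv_def using frechet_derivative_at by metis

text \<open>One term of the exponential series gives (1 + r)^n <= n! exp (1 + r), and completing the
  square bounds r - a r^2 by 1 / (4a).\<close>

lemma poly_exp_bound:
  fixes a :: real
  assumes "a > 0"
  shows "\<exists>B\<ge>0. \<forall>r\<ge>0. (1 + r) ^ n * exp (- a * r\<^sup>2) \<le> B"
proof (intro exI conjI allI impI)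
  show "fact n * exp (1 + 1 / (4 * a)) \<ge> (0::real)" by simp
  fix r :: real assume r: "r \<ge> 0"
  have "(1 + r) ^ n / fact n \<le> exp (1 + r)"
  proof -
    have "(\<Sum>k\<in>{n}. (1 + r) ^ k /\<^sub>R fact k) \<le> (\<Sum>k. (1 + r) ^ k /\<^sub>R fact k)"
      using r by (intro sum_le_suminf summable_exp_generic) auto
    then show ?thesis by (simp add: exp_def divide_inverse mult.commute)
  qed
  then have 1: "(1 + r) ^ n \<le> fact n * exp (1 + r)" by (simp add: field_simps)
  have "0 \<le> a * (r - 1 / (2 * a))\<^sup>2" using assms by simp
  also have "\<dots> = a * r\<^sup>2 - r + 1 / (4 * a)" using assms by (simp add: power2_eq_square field_simps)
  finally have "r - a * r\<^sup>2 \<le> 1 / (4 * a)" by simp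
  then have 2: "exp (1 + r) * exp (- a * r\<^sup>2) \<le> exp (1 + 1 / (4 * a))" by (simp add: exp_add[symmetric])
  have "(1 + r) ^ n * exp (- a * r\<^sup>2) \<le> fact n * exp (1 + r) * exp (- a * r\<^sup>2)"
    by (intro mult_right_mono 1) auto
  also have "\<dots> \<le> fact n * exp (1 + 1 / (4 * a))" using 2 by (simp add: mult.assoc)
  finally show "(1 + r) ^ n * exp (- a * r\<^sup>2) \<le> fact n * exp (1 + 1 / (4 * a))" .
qed

text \<open>Moments are asked for in the mean, not pointwise: this is what differentiation under the
  integral consumes, and it survives multiplication by bounded measurable factors such as
  \<open>ft f\<close>.\<close>

definition rapid :: "('a::euclidean_space \<Rightarrow> complex) \<Rightarrow> bool" where
  "rapid m \<longleftrightarrow> m \<in> borel_measurable borel \<and> (\<forall>n. integrable lborel (\<lambda>\<xi>. (1 + norm \<xi>) ^ n * norm (m \<xi>)))"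

lemma rapid_borel: "rapid m \<Longrightarrow> m \<in> borel_measurable borel" by (simp add: rapid_def)

lemma rapid_integrable: "rapid m \<Longrightarrow> integrable lborel m"
  unfolding rapid_def by (subst integrable_norm_iff[symmetric]) (auto dest: spec[of _ 0])

lemma rapid_moment: "rapid m \<Longrightarrow> integrable lborel (\<lambda>\<xi>. (1 + norm \<xi>) ^ n * norm (m \<xi>))"
  by (simp add: rapid_def)

lemma rapid_dominated:
  assumes "rapid m" "g \<in> borel_measurable borel" "\<And>\<xi>. norm (g \<xi>) \<le> B * (1 + norm \<xi>) ^ k * norm (m \<xi>)"
  shows "rapid g"
  unfolding rapid_def
proof (intro conjI allI assms(2))
  fix n
  note [measurable] = assms(2)
  show "integrable lborel (\<lambda>\<xi>. (1 + norm \<xi>) ^ n * norm (g \<xi>))"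
  proof (rule Bochner_Integration.integrable_bound)
    show "integrable lborel (\<lambda>\<xi>. B * ((1 + norm \<xi>) ^ (n + k) * norm (m \<xi>)))"
      by (intro integrable_mult_right rapid_moment assms)
    show "AE \<xi> in lborel. norm ((1 + norm \<xi>) ^ n * norm (g \<xi>)) \<le> norm (B * ((1 + norm \<xi>) ^ (n + k) * norm (m \<xi>)))"
    proof (rule AE_I2)
      fix \<xi> :: 'a
      have "(1 + norm \<xi>) ^ n * norm (g \<xi>) \<le> (1 + norm \<xi>) ^ n * (B * (1 + norm \<xi>) ^ k * norm (m \<xi>))"
        by (intro mult_left_mono assms) auto
      also have "\<dots> = B * ((1 + norm \<xi>) ^ (n + k) * norm (m \<xi>))" by (simp add: power_add mult_ac)
      finally show "norm ((1 + norm \<xi>) ^ n * norm (g \<xi>)) \<le> norm (B * ((1 + norm \<xi>) ^ (n + k) * norm (m \<xi>)))"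
        by simp
    qed
  qed measurable
qed

lemma rapid_mult_coord: "rapid m \<Longrightarrow> rapid (\<lambda>\<xi>. \<i> * complex_of_real (\<xi> \<bullet> b) * m \<xi>)"
proof (rule rapid_dominated[where B="norm b" and k=1])
  fix \<xi>
  have "\<bar>\<xi> \<bullet> b\<bar> \<le> norm b * (1 + norm \<xi>)"
    using Cauchy_Schwarz_ineq2[of \<xi> b] by (simp add: algebra_simps) (smt (verit) norm_ge_zero)
  then show "norm (\<i> * complex_of_real (\<xi> \<bullet> b) * m \<xi>) \<le> norm b * (1 + norm \<xi>) ^ 1 * norm (m \<xi>)"
    by (simp add: norm_mult mult_right_mono)
qed (auto dest: rapid_borel)

lemma rapid_mult_bounded:
  "rapid m \<Longrightarrow> g \<in> borel_measurable borel \<Longrightarrow> (\<And>\<xi>. norm (g \<xi>) \<le> B) \<Longrightarrow> rapid (\<lambda>\<xi>. m \<xi> * g \<xi>)"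
  by (rule rapid_dominated[where B=B and k=0 and m=m])
    (auto dest!: rapid_borel simp: norm_mult mult.commute[of B] intro: mult_left_mono)

lemma rapid_cmult: "rapid m \<Longrightarrow> rapid (\<lambda>\<xi>. c * m \<xi>)"
  using rapid_mult_bounded[of m "\<lambda>_. c" "norm c"] by (simp add: mult.commute)

lemma rapid_0: "rapid (\<lambda>\<xi>. 0)" by (simp add: rapid_def)

lemma rapid_add: "rapid m \<Longrightarrow> rapid n \<Longrightarrow> rapid (\<lambda>\<xi>. m \<xi> + n \<xi>)"
  unfolding rapid_def
proof safe
  fix k assume *: "\<forall>k. integrable lborel (\<lambda>\<xi>. (1 + norm \<xi>) ^ k * norm (m \<xi>))" "\<forall>k. integrable lborel (\<lambda>\<xi>. (1 + norm \<xi>) ^ k * norm (n \<xi>))"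
    and [measurable]: "m \<in> borel_measurable borel" "n \<in> borel_measurable borel"
  show "integrable lborel (\<lambda>\<xi>. (1 + norm \<xi>) ^ k * norm (m \<xi> + n \<xi>))"
    by (rule Bochner_Integration.integrable_bound[OF Bochner_Integration.integrable_add[OF *[THEN spec, of k]]])
      (auto simp flip: distrib_left intro!: mult_left_mono norm_triangle_ineq)
qed auto

lemma rapid_diff: "rapid m \<Longrightarrow> rapid n \<Longrightarrow> rapid (\<lambda>\<xi>. m \<xi> - n \<xi>)"
  using rapid_add[of m "\<lambda>\<xi>. -1 * n \<xi>"] rapid_cmult[of n "-1"] by simp

lemma rapid_sum: "finite A \<Longrightarrow> (\<And>i. i \<in> A \<Longrightarrow> rapid (m i)) \<Longrightarrow> rapid (\<lambda>\<xi>. \<Sum>i\<in>A. m i \<xi>)"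
  by (induction A rule: finite_induct) (auto intro: rapid_0 rapid_add)

lemma rapid_gauss:
  assumes "a > 0" shows "rapid (\<lambda>\<xi>. complex_of_real (gauss a \<xi>))"
  unfolding rapid_def
proof (intro conjI allI)
  fix n
  \<comment> \<open>Half of the exponent pays for the polynomial weight, the other half stays
    integrable.\<close>
  obtain B where B: "B \<ge> 0" "\<And>r. r \<ge> 0 \<Longrightarrow> (1 + r) ^ n * exp (- (a/2) * r\<^sup>2) \<le> B"
    using poly_exp_bound[of "a/2" n] assms by auto
  show "integrable lborel (\<lambda>\<xi>::'a. (1 + norm \<xi>) ^ n * norm (complex_of_real (gauss a \<xi>)))"
  proof (rule Bochner_Integration.integrable_bound)
    show "integrable lborel (\<lambda>\<xi>::'a. B * gauss (a/2) \<xi>)" using assms by (intro integrable_mult_right integrable_gauss) auto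
    show "AE \<xi>::'a in lborel. norm ((1 + norm \<xi>) ^ n * norm (complex_of_real (gauss a \<xi>))) \<le> norm (B * gauss (a/2) \<xi>)"
    proof (rule AE_I2)
      fix \<xi> :: 'a
      have "gauss a \<xi> = exp (- (a/2) * (norm \<xi>)\<^sup>2) * gauss (a/2) \<xi>"
        by (simp add: gauss_def flip: exp_add)
      then have "(1 + norm \<xi>) ^ n * gauss a \<xi> \<le> B * gauss (a/2) \<xi>"
        using mult_right_mono[OF B(2)[of "norm \<xi>"], of "gauss (a/2) \<xi>"] gauss_pos[of "a/2" \<xi>] by (simp add: mult.assoc)
      then show "norm ((1 + norm \<xi>) ^ n * norm (complex_of_real (gauss a \<xi>))) \<le> norm (B * gauss (a/2) \<xi>)"
        using gauss_pos[of a \<xi>] gauss_pos[of "a/2" \<xi>] B(1) by (simp add: abs_mult)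
    qed
  qed measurable
qed measurable

lemma ft_add: "integrable lborel f \<Longrightarrow> integrable lborel g \<Longrightarrow> ft (\<lambda>x. f x + g x) \<xi> = ft f \<xi> + ft g \<xi>"
  unfolding ft_def by (simp add: distrib_left integrable_cis_mult)

lemma ft_diff: "integrable lborel f \<Longrightarrow> integrable lborel g \<Longrightarrow> ft (\<lambda>x. f x - g x) \<xi> = ft f \<xi> - ft g \<xi>"
  unfolding ft_def by (simp add: right_diff_distrib integrable_cis_mult)

lemma ft_cmult: "ft (\<lambda>x. c * f x) \<xi> = c * ft f \<xi>"
  unfolding ft_def by (simp add: mult.left_commute[of _ c])

text \<open>Differentiation under the integral with an explicit remainder: |cis t - 1 - i t| <= t^2
  / 2 bounds the error by |h|^2 times K, a second moment of \<open>m\<close>. The same K bounds the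
  candidate derivative.\<close>

lemma ft_has_derivative:
  fixes m :: "'a::euclidean_space \<Rightarrow> complex"
  assumes m: "rapid m"
  shows "(ft m has_derivative (\<lambda>h. ft (\<lambda>\<xi>. - \<i> * complex_of_real (\<xi> \<bullet> h) * m \<xi>) x)) (at x)"
proof -
  define L where "L h = ft (\<lambda>\<xi>. - \<i> * complex_of_real (\<xi> \<bullet> h) * m \<xi>) x" for h
  define K where "K = (LINT \<xi>|lborel. (1 + norm \<xi>) ^ 2 * norm (m \<xi>))"
  have ri: "integrable lborel (\<lambda>\<xi>. - \<i> * complex_of_real (\<xi> \<bullet> h) * m \<xi>)" for h
    using rapid_integrable[OF rapid_cmult[OF rapid_mult_coord[OF m, of h], of "-1"]] by simp
  have bl: "bounded_linear L"
  proof (rule bounded_linear_intro)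
    show "L (a + b) = L a + L b" for a b
      unfolding L_def using ft_add[OF ri[of a] ri[of b], of x] by (simp add: inner_add_right algebra_simps)
    show "L (c *\<^sub>R a) = c *\<^sub>R L a" for a c
      unfolding L_def using ft_cmult[of "complex_of_real c" "\<lambda>\<xi>. - \<i> * complex_of_real (\<xi> \<bullet> a) * m \<xi>" x]
      by (simp add: scaleR_conv_of_real mult_ac)
    show "norm (L a) \<le> norm a * K" for a
    proof -
      have "norm (L a) \<le> (LINT \<xi>|lborel. norm (- \<i> * complex_of_real (\<xi> \<bullet> a) * m \<xi>))"
        unfolding L_def by (rule norm_ft_le[OF ri])
      also have "\<dots> \<le> (LINT \<xi>|lborel. norm a * ((1 + norm \<xi>) ^ 2 * norm (m \<xi>)))"
      proof (rule integral_mono)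
        show "integrable lborel (\<lambda>\<xi>. norm a * ((1 + norm \<xi>) ^ 2 * norm (m \<xi>)))" by (intro integrable_mult_right rapid_moment m)
        fix \<xi> :: 'a
        have "norm \<xi> \<le> (1 + norm \<xi>)\<^sup>2" by (simp add: power2_eq_square algebra_simps)
        then have "\<bar>\<xi> \<bullet> a\<bar> \<le> norm a * (1 + norm \<xi>) ^ 2"
          using Cauchy_Schwarz_ineq2[of \<xi> a] mult_right_mono[of "norm \<xi>" "(1 + norm \<xi>) ^ 2" "norm a"]
          by (simp add: mult.commute)
        from mult_right_mono[OF this, of "norm (m \<xi>)"]
        show "norm (- \<i> * complex_of_real (\<xi> \<bullet> a) * m \<xi>) \<le> norm a * ((1 + norm \<xi>) ^ 2 * norm (m \<xi>))"
          by (simp add: norm_mult mult.assoc)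
      qed (use ri in auto)
      finally show ?thesis by (simp add: K_def)
    qed
  qed
  have "(ft m has_derivative L) (at x)"
  proof (rule has_derivativeI_sandwich[where e=1 and H="\<lambda>y. K * norm (y - x)"])
    show "((\<lambda>y. K * norm (y - x)) \<longlongrightarrow> 0) (at x)" by (auto intro!: tendsto_eq_intros)
    fix y assume y: "y \<noteq> x"
    define h where "h = y - x"
    have "ft m y - ft m x - L h = (LINT \<xi>|lborel. (cis (- (\<xi> \<bullet> h)) - 1 + \<i> * complex_of_real (\<xi> \<bullet> h)) * cis (- (\<xi> \<bullet> x)) * m \<xi>)"
    proof -
      have "ft m y - ft m x - L h = (LINT \<xi>|lborel. cis (- (\<xi> \<bullet> y)) * m \<xi> - cis (- (\<xi> \<bullet> x)) * m \<xi> - cis (- (\<xi> \<bullet> x)) * (- \<i> * complex_of_real (\<xi> \<bullet> h) * m \<xi>))"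
        unfolding ft_def L_def
        by (subst Bochner_Integration.integral_diff, (intro Bochner_Integration.integrable_diff integrable_cis_mult ri rapid_integrable m; measurable)+)+ simp
      moreover have "cis (- (\<xi> \<bullet> y)) = cis (- (\<xi> \<bullet> h)) * cis (- (\<xi> \<bullet> x))" for \<xi> :: 'a
        by (simp add: cis_mult h_def inner_diff_right)
      ultimately show ?thesis by (simp add: algebra_simps)
    qed
    also have "norm \<dots> \<le> (LINT \<xi>|lborel. (norm h)\<^sup>2 * ((1 + norm \<xi>) ^ 2 * norm (m \<xi>)))"
    proof (rule Bochner_Integration.integral_norm_bound_integral)
      show "integrable lborel (\<lambda>\<xi>. (norm h)\<^sup>2 * ((1 + norm \<xi>) ^ 2 * norm (m \<xi>)))" by (intro integrable_mult_right rapid_moment m)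
      have "integrable lborel (\<lambda>\<xi>. cis (- (\<xi> \<bullet> h)) * (cis (- (\<xi> \<bullet> x)) * m \<xi>) - cis (- (\<xi> \<bullet> x)) * m \<xi> - cis (- (\<xi> \<bullet> x)) * (- \<i> * complex_of_real (\<xi> \<bullet> h) * m \<xi>))"
        by (intro Bochner_Integration.integrable_diff integrable_cis_mult ri rapid_integrable m; measurable)
      then show "integrable lborel (\<lambda>\<xi>. (cis (- (\<xi> \<bullet> h)) - 1 + \<i> * complex_of_real (\<xi> \<bullet> h)) * cis (- (\<xi> \<bullet> x)) * m \<xi>)"
        by (simp add: algebra_simps)
      fix \<xi> :: 'a
      have "norm (cis (- (\<xi> \<bullet> h)) - 1 + \<i> * complex_of_real (\<xi> \<bullet> h)) \<le> \<bar>\<xi> \<bullet> h\<bar>\<^sup>2 / 2"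
        using iexp_approx1[of "- (\<xi> \<bullet> h)" 1]
        by (simp add: cis_conv_exp algebra_simps power2_eq_square)
      also have "\<dots> \<le> \<bar>\<xi> \<bullet> h\<bar>\<^sup>2" by simp
      also have "\<dots> \<le> (norm \<xi> * norm h)\<^sup>2" by (intro power_mono Cauchy_Schwarz_ineq2) auto
      also have "\<dots> \<le> (norm h)\<^sup>2 * (1 + norm \<xi>) ^ 2"
        unfolding power_mult_distrib mult.commute[of "(norm \<xi>)\<^sup>2"] by (intro mult_left_mono power_mono) auto
      finally show "norm ((cis (- (\<xi> \<bullet> h)) - 1 + \<i> * complex_of_real (\<xi> \<bullet> h)) * cis (- (\<xi> \<bullet> x)) * m \<xi>) \<le> (norm h)\<^sup>2 * ((1 + norm \<xi>) ^ 2 * norm (m \<xi>))"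
        using mult_right_mono[of _ _ "norm (m \<xi>)"] by (simp add: norm_mult mult.assoc[symmetric])
    qed
    also have "\<dots> = K * norm h * norm h" by (simp add: K_def power2_eq_square)
    finally show "norm (ft m y - ft m x - L (y - x)) / norm (y - x) \<le> K * norm (y - x)"
      using y by (simp add: h_def field_simps)
  qed (use bl in auto)
  then show ?thesis by (simp add: L_def[abs_def])
qed

lemma ift_has_derivative:
  fixes m :: "'a::euclidean_space \<Rightarrow> complex"
  assumes m: "rapid m"
  shows "(ift m has_derivative (\<lambda>h. ift (\<lambda>\<xi>. \<i> * complex_of_real (\<xi> \<bullet> h) * m \<xi>) x)) (at x)"
proof -
  have "((\<lambda>x. ft m (- x)) has_derivative (\<lambda>h. ft (\<lambda>\<xi>. - \<i> * complex_of_real (\<xi> \<bullet> (- h)) * m \<xi>) (- x))) (at x)"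
    by (rule has_derivative_compose[of uminus uminus, OF _ ft_has_derivative[OF m]]) (auto intro!: derivative_eq_intros)
  from has_derivative_mult_left[OF this, of "1 / complex_of_real ((2 * pi) ^ DIM('a))"]
  show ?thesis unfolding ift_def[abs_def] by simp
qed

lemma dir_deriv_Re_ift:
  assumes "rapid m"
  shows "dir_deriv b (\<lambda>x. Re (ift m x)) = (\<lambda>x. Re (ift (\<lambda>\<xi>. \<i> * complex_of_real (\<xi> \<bullet> b) * m \<xi>) x))"
    and "(\<lambda>x. Re (ift m x)) differentiable (at x)"
proof -
  have "((\<lambda>x. Re (ift m x)) has_derivative (\<lambda>h. Re (ift (\<lambda>\<xi>. \<i> * complex_of_real (\<xi> \<bullet> h) * m \<xi>) x))) (at x)" for x
    by (intro has_derivative_Re ift_has_derivative assms)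
  then show "dir_deriv b (\<lambda>x. Re (ift m x)) = (\<lambda>x. Re (ift (\<lambda>\<xi>. \<i> * complex_of_real (\<xi> \<bullet> b) * m \<xi>) x))"
    and "(\<lambda>x. Re (ift m x)) differentiable (at x)"
    by (auto intro!: dir_deriv_eqI differentiableI)
qed

lemma Ck_Re_ift: "rapid m \<Longrightarrow> Ck k (\<lambda>x. Re (ift m x))"
proof (induction k arbitrary: m)
  case 0
  then show ?case using dir_deriv_Re_ift(2)
    by (auto simp: continuous_on_eq_continuous_at intro: differentiable_imp_continuous_within)
next
  case (Suc k)
  then show ?case by (auto simp: dir_deriv_Re_ift rapid_mult_coord)
qed

text \<open>Polynomials times a Gaussian, generated instead of normalised, so that closure under
  derivatives and under \<open>ift\<close>, as well as decay, are rule inductions. A centre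
  \<open>c\<close> other than 0 arises from the product of two Gaussians in
  \<open>gauss_mult_gauss_Schwartz\<close>.\<close>

inductive poly_gauss :: "real \<Rightarrow> 'a::euclidean_space \<Rightarrow> ('a \<Rightarrow> complex) \<Rightarrow> bool" for a c where
  gauss: "poly_gauss a c (\<lambda>x. complex_of_real (gauss a (x - c)))"
| coord: "poly_gauss a c f \<Longrightarrow> poly_gauss a c (\<lambda>x. complex_of_real ((x - c) \<bullet> v) * f x)"
| add: "poly_gauss a c f \<Longrightarrow> poly_gauss a c g \<Longrightarrow> poly_gauss a c (\<lambda>x. f x + g x)"
| cmult: "poly_gauss a c f \<Longrightarrow> poly_gauss a c (\<lambda>x. z * f x)"

lemma poly_gauss_has_derivative:
  "poly_gauss a c f \<Longrightarrow> \<exists>f'. (\<forall>x. (f has_derivative f' x) (at x)) \<and> (\<forall>v. poly_gauss a c (\<lambda>x. f' x v))"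
proof (induction rule: poly_gauss.induct)
  case gauss
  let ?f' = "\<lambda>x h. complex_of_real (- 2 * a) * (complex_of_real ((x - c) \<bullet> h) * complex_of_real (gauss a (x - c)))"
  have "((\<lambda>x. gauss a (x - c)) has_derivative (\<lambda>h. - 2 * a * ((x - c) \<bullet> h) * gauss a (x - c))) (at x)" for x
    unfolding gauss_def power2_norm_eq_inner
    by (auto intro!: derivative_eq_intros simp: inner_commute algebra_simps)
  then have "((\<lambda>x. complex_of_real (gauss a (x - c))) has_derivative ?f' x) (at x)" for x
    by (rule has_derivative_eq_rhs[OF has_derivative_of_real]) (auto simp: algebra_simps)
  moreover have "poly_gauss a c (\<lambda>x. ?f' x v)" for v
    by (intro poly_gauss.intros)
  ultimately show ?case by (intro exI[of _ ?f']) blast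
next
  case (coord f w)
  then obtain f' where f': "\<And>x. (f has_derivative f' x) (at x)" "\<And>v. poly_gauss a c (\<lambda>x. f' x v)" by blast
  let ?g' = "\<lambda>x h. complex_of_real ((x - c) \<bullet> w) * f' x h + complex_of_real (h \<bullet> w) * f x"
  have "((\<lambda>x. complex_of_real ((x - c) \<bullet> w)) has_derivative (\<lambda>h. complex_of_real (h \<bullet> w))) (at x)" for x
    by (intro has_derivative_of_real) (auto intro!: derivative_eq_intros)
  then have "((\<lambda>x. complex_of_real ((x - c) \<bullet> w) * f x) has_derivative ?g' x) (at x)" for x
    using has_derivative_mult[OF _ f'(1)] by blast
  moreover have "poly_gauss a c (\<lambda>x. ?g' x v)" for v
    using coord f' by (intro poly_gauss.intros) auto
  ultimately show ?case by (intro exI[of _ ?g']) blast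
next
  case (add f g)
  then obtain f' g' where f': "\<And>x. (f has_derivative f' x) (at x)" "\<And>v. poly_gauss a c (\<lambda>x. f' x v)"
     "\<And>x. (g has_derivative g' x) (at x)" "\<And>v. poly_gauss a c (\<lambda>x. g' x v)" by blast
  then show ?case
    by (intro exI[of _ "\<lambda>x h. f' x h + g' x h"]) (auto intro!: has_derivative_add poly_gauss.intros)
next
  case (cmult f z)
  then obtain f' where f': "\<And>x. (f has_derivative f' x) (at x)" "\<And>v. poly_gauss a c (\<lambda>x. f' x v)" by blast
  then show ?case
    by (intro exI[of _ "\<lambda>x h. z * f' x h"]) (auto intro!: has_derivative_mult_right poly_gauss.intros)
qed

lemma poly_gauss_dir_deriv:
  assumes "poly_gauss a c f"
  shows "poly_gauss a c (dir_deriv b f)" and "f differentiable (at x)"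
proof -
  obtain f' where f': "\<And>x. (f has_derivative f' x) (at x)" "\<And>v. poly_gauss a c (\<lambda>x. f' x v)"
    using poly_gauss_has_derivative[OF assms] by blast
  have "dir_deriv b f = (\<lambda>x. f' x b)" using dir_deriv_eqI[OF f'(1)] by auto
  then show "poly_gauss a c (dir_deriv b f)" "f differentiable (at x)" using f' by (auto intro: differentiableI)
qed

lemma poly_gauss_Ck: "poly_gauss a c f \<Longrightarrow> Ck k f"
  by (induction k arbitrary: f)
    (auto simp: poly_gauss_dir_deriv continuous_on_eq_continuous_at intro: differentiable_imp_continuous_within poly_gauss_dir_deriv(2))

lemma poly_gauss_iter_deriv: "poly_gauss a c f \<Longrightarrow> poly_gauss a c (iter_deriv \<beta> f)"
  unfolding iter_deriv_def by (induction \<beta>) (auto intro: poly_gauss_dir_deriv)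

text \<open>The induction runs over all \<open>n\<close> at once, because a coordinate factor costs
  one further power of 1 + |x|.\<close>

lemma poly_gauss_decay:
  assumes "poly_gauss a c f" "a > 0"
  shows "\<exists>B. \<forall>x. (1 + norm x) ^ n * norm (f x) \<le> B"
  using assms(1)
proof (induction arbitrary: n rule: poly_gauss.induct)
  case gauss
  obtain B where B: "B \<ge> 0" "\<And>r. r \<ge> 0 \<Longrightarrow> (1 + r) ^ n * exp (- a * r\<^sup>2) \<le> B"
    using poly_exp_bound[OF assms(2)] by blast
  have "(1 + norm x) ^ n * gauss a (x - c) \<le> (1 + norm c) ^ n * B" for x
  proof -
    have "1 + norm x \<le> (1 + norm c) * (1 + norm (x - c))"
      using norm_triangle_sub[of x c] mult_nonneg_nonneg[OF norm_ge_zero norm_ge_zero, of c "x - c"] unfolding distrib_left distrib_right by linarith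
    then have "(1 + norm x) ^ n \<le> (1 + norm c) ^ n * (1 + norm (x - c)) ^ n"
      unfolding power_mult_distrib[symmetric] by (intro power_mono) auto
    then have "(1 + norm x) ^ n * gauss a (x - c) \<le> (1 + norm c) ^ n * ((1 + norm (x - c)) ^ n * gauss a (x - c))"
      unfolding mult.assoc[symmetric] by (intro mult_right_mono) (auto simp: gauss_def)
    also have "\<dots> \<le> (1 + norm c) ^ n * B"
      unfolding gauss_def by (intro mult_left_mono B) auto
    finally show ?thesis .
  qed
  then show ?case by (auto simp: gauss_pos less_imp_le)
next
  case (coord f v)
  obtain B where B: "\<And>x. (1 + norm x) ^ (Suc n) * norm (f x) \<le> B" using coord by blast
  have "(1 + norm x) ^ n * norm (complex_of_real ((x - c) \<bullet> v) * f x) \<le> (1 + norm c) * norm v * B" for x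
  proof -
    have "\<bar>(x - c) \<bullet> v\<bar> \<le> norm (x - c) * norm v" by (rule Cauchy_Schwarz_ineq2)
    also have "norm (x - c) \<le> (1 + norm c) * (1 + norm x)"
      using norm_triangle_ineq4[of x c] mult_nonneg_nonneg[OF norm_ge_zero norm_ge_zero, of c x] unfolding distrib_left distrib_right by linarith
    then have "norm (x - c) * norm v \<le> (1 + norm c) * (1 + norm x) * norm v" by (intro mult_right_mono) auto
    finally have "(1 + norm x) ^ n * norm (complex_of_real ((x - c) \<bullet> v) * f x) \<le>
      (1 + norm x) ^ n * ((1 + norm c) * (1 + norm x) * norm v * norm (f x))"
      by (simp only: norm_mult norm_of_real) (intro mult_left_mono mult_right_mono, auto)
    also have "\<dots> = (1 + norm c) * norm v * ((1 + norm x) ^ (Suc n) * norm (f x))" by (simp add: mult_ac)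
    also have "\<dots> \<le> (1 + norm c) * norm v * B" by (intro mult_left_mono B) auto
    finally show ?thesis .
  qed
  then show ?case by blast
next
  case (add f g)
  obtain B B' where B: "\<And>x. (1 + norm x) ^ n * norm (f x) \<le> B" "\<And>x. (1 + norm x) ^ n * norm (g x) \<le> B'" using add by meson
  have "(1 + norm x) ^ n * norm (f x + g x) \<le> B + B'" for x
  proof -
    have "(1 + norm x) ^ n * norm (f x + g x) \<le> (1 + norm x) ^ n * (norm (f x) + norm (g x))"
      by (intro mult_left_mono norm_triangle_ineq) auto
    also have "\<dots> \<le> B + B'" using B[of x] by (simp add: distrib_left)
    finally show ?thesis .
  qed
  then show ?case by blast
next
  case (cmult f z)
  obtain B where B: "\<And>x. (1 + norm x) ^ n * norm (f x) \<le> B" using cmult by meson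
  have "(1 + norm x) ^ n * norm (z * f x) \<le> norm z * B" for x
    using mult_left_mono[OF B[of x], of "norm z"] by (simp add: norm_mult mult_ac)
  then show ?case by blast
qed

text \<open>Comparison with the product over the coordinates of 1 / (1 + x_b^2), which is integrable
  on the line: (1 + |x|)^2 dominates each 1 + x_b^2, whence the exponent 2 DIM, which is 6 in the
  application.\<close>

lemma integrable_inverse_power:
  "integrable lborel (\<lambda>x::'a::euclidean_space. inverse ((1 + norm x) ^ (2 * DIM('a))))"
proof (rule Bochner_Integration.integrable_bound)
  have "integrable lborel (\<lambda>x::real. inverse (1 + x\<^sup>2))"
    using integrable_inverse_1_plus_square by (simp add: set_integrable_def)
  then show "integrable lborel (\<lambda>x::'a. \<Prod>b\<in>Basis. inverse (1 + (x \<bullet> b)\<^sup>2))"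
    by (intro integrable_lborel_prod_Basis)
  show "AE x::'a in lborel. norm (inverse ((1 + norm x) ^ (2 * DIM('a)))) \<le> norm (\<Prod>b\<in>Basis. inverse (1 + (x \<bullet> b)\<^sup>2))"
  proof (rule AE_I2)
    fix x :: 'a
    have "inverse ((1 + norm x)\<^sup>2) \<le> inverse (1 + (x \<bullet> b)\<^sup>2)" if "b \<in> Basis" for b
    proof (rule le_imp_inverse_le)
      have "(x \<bullet> b)\<^sup>2 \<le> (norm x)\<^sup>2" using Basis_le_norm[OF that, of x] by (metis abs_le_square_iff abs_norm_cancel)
      moreover have "(1 + norm x)\<^sup>2 = 1 + 2 * norm x + (norm x)\<^sup>2" by (simp add: power2_eq_square algebra_simps)
      ultimately show "1 + (x \<bullet> b)\<^sup>2 \<le> (1 + norm x)\<^sup>2" using norm_ge_zero[of x] by linarith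
      show "0 < 1 + (x \<bullet> b)\<^sup>2" by (simp add: add_pos_nonneg)
    qed
    then have "(\<Prod>b\<in>(Basis::'a set). inverse ((1 + norm x)\<^sup>2)) \<le> (\<Prod>b\<in>Basis. inverse (1 + (x \<bullet> b)\<^sup>2))"
      by (intro prod_mono) auto
    then have "inverse ((1 + norm x) ^ (2 * DIM('a))) \<le> (\<Prod>b\<in>Basis. inverse (1 + (x \<bullet> b)\<^sup>2))"
      by (simp add: power_mult power_inverse)
    then show "norm (inverse ((1 + norm x) ^ (2 * DIM('a)))) \<le> norm (\<Prod>b\<in>Basis. inverse (1 + (x \<bullet> b)\<^sup>2))"
      by (simp add: abs_prod)
  qed
qed measurable

lemma integrable_of_decay:
  fixes f :: "'a::euclidean_space \<Rightarrow> complex"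
  assumes "f \<in> borel_measurable borel" "\<And>x. (1 + norm x) ^ (2 * DIM('a)) * norm (f x) \<le> B"
  shows "integrable lborel f"
proof (rule Bochner_Integration.integrable_bound)
  show "integrable lborel (\<lambda>x::'a. B * inverse ((1 + norm x) ^ (2 * DIM('a))))"
    by (intro integrable_mult_right integrable_inverse_power)
  have "norm (f x) \<le> B * inverse ((1 + norm x) ^ (2 * DIM('a)))" for x
  proof -
    have "(1 + norm x) ^ (2 * DIM('a)) > 0" by (simp add: add_pos_nonneg)
    then show ?thesis using assms(2)[of x] by (simp add: divide_inverse[symmetric] pos_le_divide_eq mult.commute)
  qed
  then show "AE x in lborel. norm (f x) \<le> norm (B * inverse ((1 + norm x) ^ (2 * DIM('a))))"
    by (auto intro: order_trans abs_ge_self)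
qed (use assms(1) in simp)

lemma poly_gauss_borel: "poly_gauss a c f \<Longrightarrow> f \<in> borel_measurable borel"
  using poly_gauss_Ck[of a c f 0] by (auto intro: borel_measurable_continuous_onI)

lemma poly_gauss_integrable: "poly_gauss a c f \<Longrightarrow> a > 0 \<Longrightarrow> integrable lborel f"
  using poly_gauss_decay integrable_of_decay poly_gauss_borel by metis

lemma poly_gauss_rapid:
  fixes f :: "'a::euclidean_space \<Rightarrow> complex"
  assumes "poly_gauss a c f" "a > 0" shows "rapid f"
  unfolding rapid_def
proof (intro conjI allI)
  show b[measurable]: "f \<in> borel_measurable borel" using poly_gauss_borel assms by blast
  fix n
  obtain B where "\<And>x. (1 + norm x) ^ (2 * DIM('a) + n) * norm (f x) \<le> B" using poly_gauss_decay[OF assms] by blast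
  moreover have "norm (complex_of_real ((1 + norm x) ^ n * norm (f x))) = (1 + norm x) ^ n * norm (f x)" for x
    by (simp only: norm_of_real) simp
  ultimately have "integrable lborel (\<lambda>x. complex_of_real ((1 + norm x) ^ n * norm (f x)))"
    by (intro integrable_of_decay[of _ B]) (auto simp only: power_add mult.assoc, measurable)
  then show "integrable lborel (\<lambda>x. (1 + norm x) ^ n * norm (f x))"
    by (simp only: complex_of_real_integrable_eq)
qed

lemma ift_gauss:
  fixes x :: "'a::euclidean_space"
  assumes "t > 0"
  shows "ift (\<lambda>\<xi>. complex_of_real (gauss t \<xi>)) x =
    complex_of_real (sqrt (pi / t) ^ DIM('a) / (2 * pi) ^ DIM('a) * gauss (1 / (4 * t)) x)"
  unfolding ift_def ft_gauss[OF assms] by (simp add: gauss_def)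

lemma ift_add: "integrable lborel f \<Longrightarrow> integrable lborel g \<Longrightarrow> ift (\<lambda>x. f x + g x) \<xi> = ift f \<xi> + ift g \<xi>"
  by (simp add: ift_def ft_add add_divide_distrib)

lemma ift_cmult: "ift (\<lambda>x. c * f x) \<xi> = c * ift f \<xi>"
  by (simp add: ift_def ft_cmult)

text \<open>A coordinate factor in frequency is -i times a derivative of the inverse transform, and
  derivatives do not leave the class. The Gaussian itself is explicit.\<close>

lemma poly_gauss_ift:
  assumes "poly_gauss t 0 m" "t > 0"
  shows "poly_gauss (1 / (4 * t)) 0 (ift m)"
  using assms(1)
proof (induction rule: poly_gauss.induct)
  case gauss
  have "poly_gauss (1 / (4 * t)) 0 (\<lambda>x::'a. complex_of_real (sqrt (pi / t) ^ DIM('a) / (2 * pi) ^ DIM('a)) * complex_of_real (gauss (1 / (4 * t)) (x - 0)))"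
    by (intro poly_gauss.intros)
  moreover have "ift (\<lambda>\<xi>::'a. complex_of_real (gauss t \<xi>)) = (\<lambda>x::'a. complex_of_real (sqrt (pi / t) ^ DIM('a) / (2 * pi) ^ DIM('a)) * complex_of_real (gauss (1 / (4 * t)) (x - 0)))"
    by (rule ext) (simp only: ift_gauss[OF assms(2)] of_real_mult diff_0_right)
  ultimately show ?case by simp
next
  case (coord f v)
  have r: "rapid f" using poly_gauss_rapid coord(1) assms(2) by blast
  have d: "dir_deriv v (ift f) = ift (\<lambda>\<xi>. \<i> * complex_of_real (\<xi> \<bullet> v) * f \<xi>)"
    using dir_deriv_eqI[OF ift_has_derivative[OF r]] by auto
  have e: "ift (\<lambda>x. complex_of_real ((x - 0) \<bullet> v) * f x) = (\<lambda>x. - \<i> * dir_deriv v (ift f) x)"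
    unfolding d by (simp add: ift_cmult mult.assoc flip: mult.assoc[of \<i> \<i>])
  show ?case unfolding e by (intro poly_gauss.cmult poly_gauss_dir_deriv coord.IH)
next
  case (add f g)
  have "ift (\<lambda>x. f x + g x) = (\<lambda>x. ift f x + ift g x)"
    using add by (intro ext ift_add poly_gauss_integrable[OF _ assms(2)])
  then show ?case using poly_gauss.add[OF add(3,4)] by simp
next
  case (cmult f z)
  then show ?case by (simp add: ift_cmult[abs_def] poly_gauss.cmult)
qed

section \<open>Gaussian means\<close>

text \<open>A measurable function is an almost everywhere limit of continuous ones. Clipping their
  values at M and cutting off beyond radius R + 1 keeps continuity and the limit, and provides the
  dominating function.\<close>

lemma continuous_approx_L1:
  fixes f :: "'a::euclidean_space \<Rightarrow> real"
  assumes [measurable]: "f \<in> borel_measurable borel" and M: "\<And>x. \<bar>f x\<bar> \<le> M" and R: "\<And>x. norm x > R \<Longrightarrow> f x = 0"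
  shows "\<exists>g. (\<forall>n. continuous_on UNIV (g n) \<and> (\<forall>x. \<bar>g n x\<bar> \<le> M) \<and> (\<forall>x. norm x > R + 1 \<longrightarrow> g n x = (0::real))) \<and>
     (\<lambda>n. \<integral>\<^sup>+x. ennreal \<bar>g n x - f x\<bar> \<partial>lborel) \<longlonglongrightarrow> 0"
proof -
  have "f measurable_on UNIV"
  proof -
    have "f \<in> borel_measurable lebesgue" by (intro measurable_completion) simp
    then show ?thesis by (simp add: measurable_on_iff_borel_measurable measurable_restrict_space1)
  qed
  then obtain N g where N: "negligible N" and g: "\<And>n. continuous_on UNIV (g n)"
    and lim: "\<And>x. x \<notin> N \<Longrightarrow> (\<lambda>n. g n x) \<longlonglongrightarrow> f x"
    unfolding measurable_on_def by auto
  have M0: "M \<ge> 0" using M[of 0] by simp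
  define cut where "cut x = max 0 (min 1 (R + 1 - norm x))" for x :: 'a
  define h where "h n x = cut x * max (- M) (min M (g n x))" for n x
  have cut: "0 \<le> cut x" "cut x \<le> 1" for x unfolding cut_def by auto
  have h_bd: "\<bar>h n x\<bar> \<le> M" for n x
  proof -
    have "\<bar>h n x\<bar> \<le> 1 * M" unfolding h_def abs_mult using cut[of x] M0 by (intro mult_mono) auto
    then show ?thesis by simp
  qed
  have h_0: "h n x = 0" if "norm x > R + 1" for n x unfolding h_def cut_def using that by auto
  have h_cont: "continuous_on UNIV (h n)" for n
    unfolding h_def cut_def by (intro continuous_intros g)
  have [measurable]: "h n \<in> borel_measurable borel" for n
    by (rule borel_measurable_continuous_onI[OF h_cont])
  have hlim: "(\<lambda>n. h n x) \<longlonglongrightarrow> f x" if "x \<notin> N" for x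
  proof -
    have "(\<lambda>n. h n x) \<longlonglongrightarrow> cut x * max (- M) (min M (f x))"
      unfolding h_def by (intro tendsto_intros lim that)
    also have "cut x * max (- M) (min M (f x)) = f x"
      using M[of x] R[of x] by (cases "norm x > R") (auto simp: cut_def max_def min_def abs_le_iff)
    finally show ?thesis .
  qed
  have "(\<lambda>n. \<integral>\<^sup>+x. ennreal \<bar>h n x - f x\<bar> \<partial>lborel) \<longlonglongrightarrow> integral\<^sup>N lborel (\<lambda>x::'a. 0)"
  proof (rule nn_integral_dominated_convergence[where w="\<lambda>x::'a. ennreal (2 * M) * indicator (cball 0 (R + 1)) x"])
    show "AE x in lborel. ennreal \<bar>h n x - f x\<bar> \<le> ennreal (2 * M) * indicator (cball 0 (R + 1)) x" for n
    proof (rule AE_I2)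
      fix x
      show "ennreal \<bar>h n x - f x\<bar> \<le> ennreal (2 * M) * indicator (cball 0 (R + 1)) x"
        using h_bd[of n x] M[of x] h_0[of x n] R[of x] by (cases "norm x \<le> R + 1") (auto intro!: ennreal_leI)
    qed
    have "emeasure lborel (cball (0::'a) (R + 1)) < \<infinity>" by (rule emeasure_lborel_cball_finite)
    then show "(\<integral>\<^sup>+ x. ennreal (2 * M) * indicator (cball (0::'a) (R + 1)) x \<partial>lborel) < \<infinity>"
      by (simp add: nn_integral_cmult_indicator ennreal_mult_less_top)
    have "N \<in> null_sets lebesgue" using N by (simp add: negligible_iff_null_sets)
    then have "AE x in lborel. x \<notin> N" using AE_not_in[of N lebesgue] by (simp add: AE_completion_iff)
    then show "AE x in lborel. (\<lambda>n. ennreal \<bar>h n x - f x\<bar>) \<longlonglongrightarrow> 0"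
    proof (rule AE_mp, intro AE_I2 impI)
      fix x assume "x \<notin> N"
      then have "(\<lambda>n. \<bar>h n x - f x\<bar>) \<longlonglongrightarrow> \<bar>f x - f x\<bar>" by (intro tendsto_intros hlim)
      then show "(\<lambda>n. ennreal \<bar>h n x - f x\<bar>) \<longlonglongrightarrow> 0" using tendsto_ennrealI by fastforce
    qed
    have "cball (0::'a) (R + 1) \<in> sets borel" by simp
    then show "(\<lambda>x::'a. ennreal (2 * M) * indicator (cball 0 (R + 1)) x) \<in> borel_measurable lborel"
      by measurable
  qed measurable
  then show ?thesis using h_bd h_0 h_cont by (intro exI[of _ h]) auto
qed

text \<open>For continuous functions of bounded support this is dominated convergence. The
  approximation passes it on to \<open>f\<close>, since by translation invariance both error terms
  equal the same \<open>a k\<close>.\<close>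

lemma translation_continuous_L1:
  fixes f :: "'a::euclidean_space \<Rightarrow> real"
  assumes f[measurable]: "f \<in> borel_measurable borel" and M: "\<And>x. \<bar>f x\<bar> \<le> M" and R: "\<And>x. norm x > R \<Longrightarrow> f x = 0"
    and h: "h \<longlonglongrightarrow> 0"
  shows "(\<lambda>n. \<integral>\<^sup>+x. ennreal \<bar>f (x + h n) - f x\<bar> \<partial>lborel) \<longlonglongrightarrow> 0"
proof -
  obtain g where g: "\<And>k. continuous_on UNIV (g k)" "\<And>k x. \<bar>g k x\<bar> \<le> M" "\<And>k x. norm x > R + 1 \<Longrightarrow> g k x = 0"
    and lim: "(\<lambda>k. \<integral>\<^sup>+x. ennreal \<bar>g k x - f x\<bar> \<partial>lborel) \<longlonglongrightarrow> 0"
    using continuous_approx_L1[OF f M R] by blast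
  have [measurable]: "g k \<in> borel_measurable borel" for k
    by (rule borel_measurable_continuous_onI[OF g(1)])
  have M0: "M \<ge> 0" using M[of 0] by simp
  obtain K where K: "\<And>n. norm (h n) \<le> K" using convergent_imp_Bseq[OF convergentI[OF h]] by (auto simp: Bseq_def)
  have gt: "(\<lambda>n. \<integral>\<^sup>+x. ennreal \<bar>g k (x + h n) - g k x\<bar> \<partial>lborel) \<longlonglongrightarrow> integral\<^sup>N lborel (\<lambda>x::'a. 0)" for k
  proof (rule nn_integral_dominated_convergence[where w="\<lambda>x::'a. ennreal (2 * M) * indicator (cball 0 (R + 1 + K)) x"])
    show "AE x in lborel. ennreal \<bar>g k (x + h n) - g k x\<bar> \<le> ennreal (2 * M) * indicator (cball 0 (R + 1 + K)) x" for n
    proof (rule AE_I2)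
      fix x
      have K0: "K \<ge> 0" using K[of 0] norm_ge_zero order_trans by blast
      show "ennreal \<bar>g k (x + h n) - g k x\<bar> \<le> ennreal (2 * M) * indicator (cball 0 (R + 1 + K)) x"
      proof (cases "norm x \<le> R + 1 + K")
        case True
        then show ?thesis using g(2)[of k x] g(2)[of k "x + h n"] by (auto intro!: ennreal_leI)
      next
        case False
        then have "norm (x + h n) > R + 1" using norm_triangle_ineq4[of "x + h n" "h n"] K[of n] by simp
        then show ?thesis using False K0 g(3)[of x k] g(3)[of "x + h n" k] by simp
      qed
    qed
    have "emeasure lborel (cball (0::'a) (R + 1 + K)) < \<infinity>" by (rule emeasure_lborel_cball_finite)
    then show "(\<integral>\<^sup>+ x. ennreal (2 * M) * indicator (cball (0::'a) (R + 1 + K)) x \<partial>lborel) < \<infinity>"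
      by (simp add: nn_integral_cmult_indicator ennreal_mult_less_top)
    show "AE x in lborel. (\<lambda>n. ennreal \<bar>g k (x + h n) - g k x\<bar>) \<longlonglongrightarrow> 0"
    proof (rule AE_I2)
      fix x
      have "(\<lambda>n. x + h n) \<longlonglongrightarrow> x + 0" by (intro tendsto_intros h)
      moreover have "isCont (g k) (x + 0)" using g(1) by (simp add: continuous_on_eq_continuous_at)
      ultimately have "(\<lambda>n. g k (x + h n)) \<longlonglongrightarrow> g k (x + 0)" using isCont_tendsto_compose by blast
      then have "(\<lambda>n. \<bar>g k (x + h n) - g k x\<bar>) \<longlonglongrightarrow> \<bar>g k (x + 0) - g k x\<bar>" by (intro tendsto_intros)
      then show "(\<lambda>n. ennreal \<bar>g k (x + h n) - g k x\<bar>) \<longlonglongrightarrow> 0" using tendsto_ennrealI by fastforce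
    qed
    have "cball (0::'a) (R + 1 + K) \<in> sets borel" by simp
    then show "(\<lambda>x::'a. ennreal (2 * M) * indicator (cball 0 (R + 1 + K)) x) \<in> borel_measurable lborel"
      by measurable
  qed measurable
  define a where "a k = (\<integral>\<^sup>+x. ennreal \<bar>g k x - f x\<bar> \<partial>lborel)" for k
  have le: "(\<integral>\<^sup>+x. ennreal \<bar>f (x + h n) - f x\<bar> \<partial>lborel) \<le> 2 * a k + (\<integral>\<^sup>+x. ennreal \<bar>g k (x + h n) - g k x\<bar> \<partial>lborel)" for k n
  proof -
    have "(\<integral>\<^sup>+x. ennreal \<bar>f (x + h n) - f x\<bar> \<partial>lborel) \<le> (\<integral>\<^sup>+x. ennreal \<bar>g k (x + h n) - f (x + h n)\<bar> + (ennreal \<bar>g k x - f x\<bar> + ennreal \<bar>g k (x + h n) - g k x\<bar>) \<partial>lborel)"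
    proof (intro nn_integral_mono)
      fix x
      have "\<bar>f (x + h n) - f x\<bar> \<le> \<bar>g k (x + h n) - f (x + h n)\<bar> + (\<bar>g k x - f x\<bar> + \<bar>g k (x + h n) - g k x\<bar>)"
        by linarith
      then show "ennreal \<bar>f (x + h n) - f x\<bar> \<le> ennreal \<bar>g k (x + h n) - f (x + h n)\<bar> + (ennreal \<bar>g k x - f x\<bar> + ennreal \<bar>g k (x + h n) - g k x\<bar>)"
        by (metis ennreal_leI ennreal_plus abs_ge_zero add_nonneg_nonneg)
    qed
    also have "\<dots> = (\<integral>\<^sup>+x. ennreal \<bar>g k (h n + 1 *\<^sub>R x) - f (h n + 1 *\<^sub>R x)\<bar> \<partial>lborel) + (a k + (\<integral>\<^sup>+x. ennreal \<bar>g k (x + h n) - g k x\<bar> \<partial>lborel))"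
      unfolding a_def by (simp add: nn_integral_add add.commute[of "h n"])
    also have "(\<integral>\<^sup>+x. ennreal \<bar>g k (h n + 1 *\<^sub>R x) - f (h n + 1 *\<^sub>R x)\<bar> \<partial>lborel) = a k"
      unfolding a_def by (subst nn_integral_lborel_affine[of 1 "\<lambda>x. ennreal \<bar>g k x - f x\<bar>" "h n"]) auto
    finally show ?thesis by (simp add: mult_2 add.assoc)
  qed
  \<comment> \<open>For each fixed k the upper limit over n is at most 2 a_k; only afterwards does k
    tend to infinity.\<close>
  define L where "L = limsup (\<lambda>n. \<integral>\<^sup>+x. ennreal \<bar>f (x + h n) - f x\<bar> \<partial>lborel)"
  have "L \<le> 2 * a k" for k
  proof -
    have "(\<lambda>n. 2 * a k + (\<integral>\<^sup>+x. ennreal \<bar>g k (x + h n) - g k x\<bar> \<partial>lborel)) \<longlonglongrightarrow> 2 * a k + 0"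
      using gt[of k] by (intro tendsto_intros) simp
    then have "limsup (\<lambda>n. 2 * a k + (\<integral>\<^sup>+x. ennreal \<bar>g k (x + h n) - g k x\<bar> \<partial>lborel)) = 2 * a k"
      by (simp add: lim_imp_Limsup)
    moreover have "L \<le> limsup (\<lambda>n. 2 * a k + (\<integral>\<^sup>+x. ennreal \<bar>g k (x + h n) - g k x\<bar> \<partial>lborel))"
      unfolding L_def by (intro Limsup_mono always_eventually allI le)
    ultimately show ?thesis by simp
  qed
  moreover have "(\<lambda>k. 2 * a k) \<longlonglongrightarrow> 2 * 0"
    using lim by (intro ennreal_tendsto_cmult) (auto simp: a_def[abs_def])
  ultimately have "L \<le> 2 * 0" by (intro LIMSEQ_le_const[where X="\<lambda>k. 2 * a k"]) blast+
  then have L: "L = 0" by simp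
  have "liminf (\<lambda>n. \<integral>\<^sup>+x. ennreal \<bar>f (x + h n) - f x\<bar> \<partial>lborel) \<le> L"
    unfolding L_def by (rule Liminf_le_Limsup) simp
  then have "liminf (\<lambda>n. \<integral>\<^sup>+x. ennreal \<bar>f (x + h n) - f x\<bar> \<partial>lborel) = 0" unfolding L by simp
  moreover have "limsup (\<lambda>n. \<integral>\<^sup>+x. ennreal \<bar>f (x + h n) - f x\<bar> \<partial>lborel) = 0" using L unfolding L_def .
  ultimately show ?thesis by (rule Liminf_eq_Limsup[OF sequentially_bot])
qed

lemma ift_scale:
  fixes m :: "'a::euclidean_space \<Rightarrow> complex"
  assumes "c > 0" and [measurable]: "m \<in> borel_measurable borel"
  shows "ift (\<lambda>\<xi>. m (\<xi> /\<^sub>R c)) x = complex_of_real (c ^ DIM('a)) * ift m (c *\<^sub>R x)"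
proof -
  have "ft (\<lambda>\<xi>. m (\<xi> /\<^sub>R c)) y = complex_of_real (c ^ DIM('a)) * ft m (c *\<^sub>R y)" for y
    unfolding ft_def using assms(1)
    by (subst integral_lborel_affine[of c _ 0]) (auto simp: scaleR_conv_of_real)
  from this[of "-x"] show ?thesis by (simp add: ift_def)
qed

lemma gauss_scale: "c > 0 \<Longrightarrow> gauss (a / c\<^sup>2) \<xi> = gauss a (\<xi> /\<^sub>R c)"
  by (simp add: gauss_def power_mult_distrib power_divide divide_inverse power_inverse)

text \<open>The mean is convolution with a probability kernel shrunk by 2^n. Its error is at most
  the kernel average of the L1 modulus of continuity of \<open>f\<close>, which tends to 0 by
  dominated convergence.\<close>

lemma gauss_mean_tendsto_L1:
  fixes f :: "'a::euclidean_space \<Rightarrow> real"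
  assumes f[measurable]: "f \<in> borel_measurable borel" and M: "\<And>x. \<bar>f x\<bar> \<le> M" and R: "\<And>x. norm x > R \<Longrightarrow> f x = 0"
    and fi: "integrable lborel f" and c: "c > 0"
  shows "(\<lambda>n. \<integral>\<^sup>+x. ennreal \<bar>Re (ift (\<lambda>\<xi>. complex_of_real (gauss (c / 4 ^ n) \<xi>) * ft (\<lambda>x. complex_of_real (f x)) \<xi>) x) - f x\<bar> \<partial>lborel) \<longlonglongrightarrow> 0"
proof -
  \<comment> \<open>The inverse transform of \<open>gauss c\<close>: nonnegative with total mass
    1.\<close>
  define kern where "kern z = sqrt (pi / c) ^ DIM('a) / (2 * pi) ^ DIM('a) * gauss (1 / (4 * c)) z" for z :: 'a
  have k0: "kern z \<ge> 0" for z unfolding kern_def using c by (simp add: gauss_pos less_imp_le)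
  have ki: "integrable lborel kern"
    unfolding kern_def using c by (intro integrable_mult_right integrable_gauss) auto
  note [measurable] = integrable_borel[OF ki]
  have "sqrt (pi / c) * sqrt (pi / (1 / (4 * c))) = sqrt ((2 * pi)\<^sup>2)"
    unfolding real_sqrt_mult[symmetric] using c by (simp add: power2_eq_square)
  then have "sqrt (pi / c) ^ DIM('a) * sqrt (pi / (1 / (4 * c))) ^ DIM('a) = (2 * pi) ^ DIM('a)"
    unfolding power_mult_distrib[symmetric] by (simp only: real_sqrt_abs) simp
  then have k1: "(LINT z|lborel. kern z) = 1"
    using c unfolding kern_def by (simp add: integral_gauss power_mult_distrib)
  have k1n: "(\<integral>\<^sup>+z. ennreal (kern z) \<partial>lborel) = 1"
    using nn_integral_eq_integral[OF ki] k0 k1 by simp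
  \<comment> \<open>The L1 distance of \<open>f\<close> to its translate by -z / 2^n; at most twice
    the L1 norm, and null in the limit for every fixed z.\<close>
  define \<omega> where "\<omega> n z = (\<integral>\<^sup>+x. ennreal \<bar>f (x + (- (1 / 2 ^ n)) *\<^sub>R z) - f x\<bar> \<partial>lborel)" for n z
  define J where "J = (\<integral>\<^sup>+x. ennreal \<bar>f x\<bar> \<partial>lborel)"
  have J: "J < \<infinity>" using fi by (simp add: J_def integrable_iff_bounded)
  have \<omega>_le: "\<omega> n z \<le> 2 * J" for n z
  proof -
    have "\<omega> n z \<le> (\<integral>\<^sup>+x. ennreal \<bar>f ((- (1 / 2 ^ n)) *\<^sub>R z + 1 *\<^sub>R x)\<bar> + ennreal \<bar>f x\<bar> \<partial>lborel)"
      unfolding \<omega>_def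
    proof (intro nn_integral_mono)
      fix x
      have "\<bar>f (x + (- (1 / 2 ^ n)) *\<^sub>R z) - f x\<bar> \<le> \<bar>f ((- (1 / 2 ^ n)) *\<^sub>R z + 1 *\<^sub>R x)\<bar> + \<bar>f x\<bar>"
        unfolding scaleR_one add.commute[of _ x] by linarith
      then show "ennreal \<bar>f (x + (- (1 / 2 ^ n)) *\<^sub>R z) - f x\<bar> \<le> ennreal \<bar>f ((- (1 / 2 ^ n)) *\<^sub>R z + 1 *\<^sub>R x)\<bar> + ennreal \<bar>f x\<bar>"
        by (metis ennreal_leI ennreal_plus abs_ge_zero)
    qed
    also have "\<dots> = (\<integral>\<^sup>+x. ennreal \<bar>f ((- (1 / 2 ^ n)) *\<^sub>R z + 1 *\<^sub>R x)\<bar> \<partial>lborel) + J"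
      unfolding J_def by (rule nn_integral_add) auto
    also have "(\<integral>\<^sup>+x. ennreal \<bar>f ((- (1 / 2 ^ n)) *\<^sub>R z + 1 *\<^sub>R x)\<bar> \<partial>lborel) = J"
      unfolding J_def by (subst nn_integral_lborel_affine[of 1 "\<lambda>x. ennreal \<bar>f x\<bar>" "(- (1 / 2 ^ n)) *\<^sub>R z"]) auto
    finally show ?thesis by (simp add: mult_2)
  qed
  have rep: "Re (ift (\<lambda>\<xi>. complex_of_real (gauss (c / 4 ^ n) \<xi>) * ft (\<lambda>x. complex_of_real (f x)) \<xi>) x) =
     (LINT z|lborel. f (x + (- (1 / 2 ^ n)) *\<^sub>R z) * kern z)" for n x
  proof -
    have gs: "(\<lambda>\<xi>::'a. complex_of_real (gauss (c / 4 ^ n) \<xi>)) = (\<lambda>\<xi>. complex_of_real (gauss c (\<xi> /\<^sub>R 2 ^ n)))"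
      using gauss_scale[where c="2 ^ n" and a=c and 'a='a] by (simp add: power2_eq_square flip: power_mult_distrib)
    have ig: "ift (\<lambda>\<xi>::'a. complex_of_real (gauss (c / 4 ^ n) \<xi>)) z = complex_of_real ((2 ^ n) ^ DIM('a) * kern (2 ^ n *\<^sub>R z))" for z
      unfolding gs kern_def by (subst ift_scale[of "2^n" "\<lambda>\<xi>. complex_of_real (gauss c \<xi>)"]) (auto simp: ift_gauss[OF c])
    have "ift (\<lambda>\<xi>. complex_of_real (gauss (c / 4 ^ n) \<xi>) * ft (\<lambda>x. complex_of_real (f x)) \<xi>) x =
       (LINT y|lborel. complex_of_real (f y * ((2 ^ n) ^ DIM('a) * kern (2 ^ n *\<^sub>R (x - y)))))"
      using c fi by (subst ift_conv) (auto simp: ig intro!: integrable_gauss)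
    also have "\<dots> = complex_of_real (LINT y|lborel. f y * ((2 ^ n) ^ DIM('a) * kern (2 ^ n *\<^sub>R (x - y))))"
      by (rule integral_complex_of_real)
    also have "(LINT y|lborel. f y * ((2 ^ n) ^ DIM('a) * kern (2 ^ n *\<^sub>R (x - y)))) = 
       (LINT z|lborel. f (x + (- (1 / 2 ^ n)) *\<^sub>R z) * kern z)"
    proof -
      have "(LINT y|lborel. f y * ((2 ^ n) ^ DIM('a) * kern (2 ^ n *\<^sub>R (x - y)))) = (1 / 2 ^ n) ^ DIM('a) *
          (LINT z|lborel. (2 ^ n) ^ DIM('a) * (f (x + (- (1 / 2 ^ n)) *\<^sub>R z) * kern z))"
        by (subst integral_lborel_affine[of "- (1 / 2 ^ n)" _ x]) (auto simp: mult.left_commute)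
      also have "\<dots> = ((1 / 2 ^ n) ^ DIM('a) * (2 ^ n) ^ DIM('a)) * (LINT z|lborel. f (x + (- (1 / 2 ^ n)) *\<^sub>R z) * kern z)"
        by (simp only: integral_mult_right_zero mult.assoc)
      also have "(1 / 2 ^ n) ^ DIM('a) * (2 ^ n) ^ DIM('a) = (1::real)"
        by (simp flip: power_mult_distrib)
      finally show ?thesis by simp
    qed
    finally show ?thesis by simp
  qed
  have main: "(\<integral>\<^sup>+x. ennreal \<bar>Re (ift (\<lambda>\<xi>. complex_of_real (gauss (c / 4 ^ n) \<xi>) * ft (\<lambda>x. complex_of_real (f x)) \<xi>) x) - f x\<bar> \<partial>lborel)
     \<le> (\<integral>\<^sup>+z. ennreal (kern z) * \<omega> n z \<partial>lborel)" for n
  proof -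
    have i1: "integrable lborel (\<lambda>z. f (x + (- (1 / 2 ^ n)) *\<^sub>R z) * kern z)" for x
      by (rule integrable_bounded_mult[OF ki]) (use M in auto)
    have e: "\<bar>Re (ift (\<lambda>\<xi>. complex_of_real (gauss (c / 4 ^ n) \<xi>) * ft (\<lambda>x. complex_of_real (f x)) \<xi>) x) - f x\<bar>
       = norm (LINT z|lborel. (f (x + (- (1 / 2 ^ n)) *\<^sub>R z) - f x) * kern z)" for x
    proof -
      have "(LINT z|lborel. (f (x + (- (1 / 2 ^ n)) *\<^sub>R z) - f x) * kern z) =
        (LINT z|lborel. f (x + (- (1 / 2 ^ n)) *\<^sub>R z) * kern z) - (LINT z|lborel. f x * kern z)"
        unfolding left_diff_distrib by (rule Bochner_Integration.integral_diff[OF i1]) (use ki in auto)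
      then show ?thesis unfolding rep by (simp add: k1)
    qed
    have "(\<integral>\<^sup>+x. ennreal \<bar>Re (ift (\<lambda>\<xi>. complex_of_real (gauss (c / 4 ^ n) \<xi>) * ft (\<lambda>x. complex_of_real (f x)) \<xi>) x) - f x\<bar> \<partial>lborel)
      \<le> (\<integral>\<^sup>+x. \<integral>\<^sup>+z. ennreal (kern z) * ennreal \<bar>f (x + (- (1 / 2 ^ n)) *\<^sub>R z) - f x\<bar> \<partial>lborel \<partial>lborel)"
    proof (intro nn_integral_mono, unfold e)
      fix x
      have "integrable lborel (\<lambda>z. (f (x + (- (1 / 2 ^ n)) *\<^sub>R z) - f x) * kern z)"
        unfolding left_diff_distrib using i1 ki by auto
      from integral_norm_bound_ennreal[OF this]
      show "ennreal (norm (LINT z|lborel. (f (x + (- (1 / 2 ^ n)) *\<^sub>R z) - f x) * kern z)) \<le>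
         (\<integral>\<^sup>+z. ennreal (kern z) * ennreal \<bar>f (x + (- (1 / 2 ^ n)) *\<^sub>R z) - f x\<bar> \<partial>lborel)"
        by (simp add: abs_mult k0 ennreal_mult mult.commute)
    qed
    also have "\<dots> = (\<integral>\<^sup>+z. \<integral>\<^sup>+x. ennreal (kern z) * ennreal \<bar>f (x + (- (1 / 2 ^ n)) *\<^sub>R z) - f x\<bar> \<partial>lborel \<partial>lborel)"
      by (rule lborel_pair.Fubini') measurable
    also have "\<dots> = (\<integral>\<^sup>+z. ennreal (kern z) * \<omega> n z \<partial>lborel)"
      unfolding \<omega>_def by (simp add: nn_integral_cmult)
    finally show ?thesis .
  qed
  have \<omega>m[measurable]: "\<omega> n \<in> borel_measurable borel" for n unfolding \<omega>_def[abs_def] by measurable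
  have "(\<lambda>n. \<integral>\<^sup>+z. ennreal (kern z) * \<omega> n z \<partial>lborel) \<longlonglongrightarrow> integral\<^sup>N lborel (\<lambda>x::'a. 0)"
  proof (rule nn_integral_dominated_convergence[where w="\<lambda>z. ennreal (kern z) * (2 * J)"])
    show "AE z in lborel. ennreal (kern z) * \<omega> n z \<le> ennreal (kern z) * (2 * J)" for n
      by (intro AE_I2 mult_left_mono \<omega>_le) auto
    show "(\<integral>\<^sup>+z. ennreal (kern z) * (2 * J) \<partial>lborel) < \<infinity>"
      using J by (simp add: nn_integral_multc k1n ennreal_mult_less_top)
    show "AE z in lborel. (\<lambda>n. ennreal (kern z) * \<omega> n z) \<longlonglongrightarrow> 0"
    proof (rule AE_I2)
      fix z :: 'a
      have "(\<lambda>n. (1/2::real) ^ n) \<longlonglongrightarrow> 0" by (rule LIMSEQ_power_zero) simp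
      from tendsto_scaleR[OF tendsto_minus[OF this] tendsto_const[of z]]
      have "(\<lambda>n. (- (1 / 2 ^ n)) *\<^sub>R z) \<longlonglongrightarrow> 0" by (simp only: power_one_over minus_zero scaleR_zero_left)
      then have "(\<lambda>n. \<omega> n z) \<longlonglongrightarrow> 0"
        unfolding \<omega>_def using M R by (intro translation_continuous_L1[OF f, where h="\<lambda>n. (- (1 / 2 ^ n)) *\<^sub>R z"]) blast+
      then have "(\<lambda>n. ennreal (kern z) * \<omega> n z) \<longlonglongrightarrow> ennreal (kern z) * 0" by (intro ennreal_tendsto_cmult) auto
      then show "(\<lambda>n. ennreal (kern z) * \<omega> n z) \<longlonglongrightarrow> 0" by simp
    qed
  qed auto
  then have "(\<lambda>n. \<integral>\<^sup>+z. ennreal (kern z) * \<omega> n z \<partial>lborel) \<longlonglongrightarrow> 0" by simp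
  then show ?thesis
    by (rule tendsto_sandwich[OF _ _ tendsto_const, rotated 2]) (auto intro!: main always_eventually)
qed

section \<open>Derivatives of products and compositions\<close>

lemma Ck_Suc_imp: "Ck (Suc k) f \<Longrightarrow> Ck k f"
proof (induction k arbitrary: f)
  case 0
  then show ?case
    by (auto simp: continuous_on_eq_continuous_at intro: differentiable_imp_continuous_within)
qed auto

lemma Ck_le:
  assumes "Ck k f" "j \<le> k" shows "Ck j f"
  using assms(2,1) by (induction rule: dec_induct) (auto dest: Ck_Suc_imp simp del: Ck.simps)

lemma Ck_continuous: "Ck k f \<Longrightarrow> continuous_on UNIV f"
  using Ck_le[of k f 0] by simp

lemma Ck_borel: "Ck k f \<Longrightarrow> f \<in> borel_measurable borel"
  by (intro borel_measurable_continuous_onI Ck_continuous)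

lemma has_derivative_frechet: "f differentiable (at x) \<Longrightarrow> (f has_derivative (\<lambda>h. dir_deriv h f x)) (at x)"
  unfolding dir_deriv_def by (simp add: frechet_derivative_works)

lemma dir_deriv_add:
  "f differentiable (at x) \<Longrightarrow> g differentiable (at x) \<Longrightarrow> dir_deriv b (\<lambda>x. f x + g x) x = dir_deriv b f x + dir_deriv b g x"
  by (rule dir_deriv_eqI) (intro has_derivative_add has_derivative_frechet)

lemma dir_deriv_diff:
  "f differentiable (at x) \<Longrightarrow> g differentiable (at x) \<Longrightarrow> dir_deriv b (\<lambda>x. f x - g x) x = dir_deriv b f x - dir_deriv b g x"
  by (rule dir_deriv_eqI) (intro has_derivative_diff has_derivative_frechet)

lemma dir_deriv_mult:
  fixes f g :: "'a::euclidean_space \<Rightarrow> real"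
  shows "f differentiable (at x) \<Longrightarrow> g differentiable (at x) \<Longrightarrow> dir_deriv b (\<lambda>x. f x * g x) x = dir_deriv b f x * g x + f x * dir_deriv b g x"
  by (rule trans[OF dir_deriv_eqI[OF has_derivative_mult[OF has_derivative_frechet has_derivative_frechet]]]) auto

lemma dir_deriv_const [simp]: "dir_deriv b (\<lambda>x. c) = (\<lambda>x. 0)"
  by (rule ext, rule dir_deriv_eqI) simp

lemma Ck_const [simp]: "Ck k (\<lambda>x. c)"
  by (induction k arbitrary: c) auto

lemma Ck_add: "Ck k f \<Longrightarrow> Ck k g \<Longrightarrow> Ck k (\<lambda>x. f x + g x)"
proof (induction k arbitrary: f g)
  case (Suc k)
  then have "dir_deriv b (\<lambda>x. f x + g x) = (\<lambda>x. dir_deriv b f x + dir_deriv b g x)" for b by (auto simp: dir_deriv_add)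
  with Suc show ?case by auto
qed (auto intro: continuous_intros)

lemma Ck_diff: "Ck k f \<Longrightarrow> Ck k g \<Longrightarrow> Ck k (\<lambda>x. f x - g x)"
proof (induction k arbitrary: f g)
  case (Suc k)
  then have "dir_deriv b (\<lambda>x. f x - g x) = (\<lambda>x. dir_deriv b f x - dir_deriv b g x)" for b by (auto simp: dir_deriv_diff)
  with Suc show ?case by auto
qed (auto intro: continuous_intros)

lemma Ck_mult:
  fixes f g :: "'a::euclidean_space \<Rightarrow> real"
  shows "Ck k f \<Longrightarrow> Ck k g \<Longrightarrow> Ck k (\<lambda>x. f x * g x)"
proof (induction k arbitrary: f g)
  case (Suc k)
  then have "dir_deriv b (\<lambda>x. f x * g x) = (\<lambda>x. dir_deriv b f x * g x + f x * dir_deriv b g x)" for b by (auto simp: dir_deriv_mult)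
  moreover have c: "Ck k f" "Ck k g" using Suc.prems Ck_Suc_imp by blast+
  have "Ck k (\<lambda>x. dir_deriv b f x * g x + f x * dir_deriv b g x)" if "b \<in> Basis" for b
    using Suc.prems that by (intro Ck_add Suc.IH[OF _ c(2)] Suc.IH[OF c(1)]) auto
  ultimately show ?case using Suc.prems by auto
qed (auto intro: continuous_intros)

lemma Ck_sum: "finite A \<Longrightarrow> (\<And>i. i \<in> A \<Longrightarrow> Ck k (f i)) \<Longrightarrow> Ck k (\<lambda>x. \<Sum>i\<in>A. f i x)"
  by (induction A rule: finite_induct) (auto intro: Ck_add)

text \<open>The chain rule in coordinates, so that all later calculus on vector-valued maps can be
  done with their real components.\<close>

lemma
  fixes F :: "'c::euclidean_space \<Rightarrow> real" and g :: "'a::euclidean_space \<Rightarrow> 'c"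
  assumes F: "\<And>y. F differentiable (at y)" and g: "\<And>a x. a \<in> Basis \<Longrightarrow> (\<lambda>x. g x \<bullet> a) differentiable (at x)"
  shows dir_deriv_compose: "dir_deriv b (\<lambda>x. F (g x)) = (\<lambda>x. \<Sum>a\<in>Basis. dir_deriv a F (g x) * dir_deriv b (\<lambda>x. g x \<bullet> a) x)"
    and differentiable_compose_components: "(\<lambda>x. F (g x)) differentiable (at x)"
proof -
  have "((\<lambda>x. F (g x)) has_derivative (\<lambda>h. \<Sum>a\<in>Basis. dir_deriv a F (g x) * dir_deriv h (\<lambda>x. g x \<bullet> a) x)) (at x)" for x
  proof -
    define g' where "g' h = (\<Sum>a\<in>Basis. dir_deriv h (\<lambda>x. g x \<bullet> a) x *\<^sub>R a)" for h
    have g': "(g has_derivative g') (at x)"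
      unfolding has_derivative_componentwise_within[of g]
      using has_derivative_frechet[OF g] by (auto simp: g'_def inner_sum_left inner_Basis if_distrib cong: if_cong)
    define D where "D h = dir_deriv h F (g x)" for h
    have lin: "linear D"
      using has_derivative_linear[OF has_derivative_frechet[OF F]] unfolding D_def[abs_def] .
    have e: "dir_deriv (g' h) F (g x) = (\<Sum>a\<in>Basis. dir_deriv a F (g x) * dir_deriv h (\<lambda>x. g x \<bullet> a) x)" for h
      unfolding D_def[symmetric] g'_def by (simp add: linear_sum[OF lin] linear_scale[OF lin] mult.commute)
    show ?thesis using has_derivative_compose[OF g' has_derivative_frechet[OF F]] unfolding e .
  qed
  then show "dir_deriv b (\<lambda>x. F (g x)) = (\<lambda>x. \<Sum>a\<in>Basis. dir_deriv a F (g x) * dir_deriv b (\<lambda>x. g x \<bullet> a) x)"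
    "(\<lambda>x. F (g x)) differentiable (at x)"
    by (auto intro!: dir_deriv_eqI differentiableI)
qed

lemma Ck_compose:
  fixes F :: "'c::euclidean_space \<Rightarrow> real" and g :: "'a::euclidean_space \<Rightarrow> 'c"
  shows "Ck k F \<Longrightarrow> (\<And>a. a \<in> Basis \<Longrightarrow> Ck k (\<lambda>x. g x \<bullet> a)) \<Longrightarrow> Ck k (\<lambda>x. F (g x))"
proof (induction k arbitrary: F)
  case 0
  then have "continuous_on UNIV g" by (subst continuous_on_componentwise) auto
  with 0 show ?case by (auto intro: continuous_on_compose2[of UNIV F])
next
  case (Suc k)
  have dF: "F differentiable (at y)" for y using Suc.prems(1) by simp
  have dg: "(\<lambda>x. g x \<bullet> a) differentiable (at x)" if "a \<in> Basis" for a x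
    using Suc.prems(2)[OF that] by simp
  note d = dF dg
  have "Ck k (\<lambda>x. \<Sum>a\<in>Basis. dir_deriv a F (g x) * dir_deriv b (\<lambda>x. g x \<bullet> a) x)" if b: "b \<in> Basis" for b
  proof (intro Ck_sum Ck_mult)
    fix a :: 'c assume a: "a \<in> Basis"
    show "Ck k (\<lambda>x. dir_deriv a F (g x))"
    proof (rule Suc.IH)
      show "Ck k (dir_deriv a F)" using Suc.prems(1) a by simp
      show "Ck k (\<lambda>x. g x \<bullet> a)" if "a \<in> Basis" for a by (rule Ck_Suc_imp[OF Suc.prems(2)[OF that]])
    qed
    show "Ck k (dir_deriv b (\<lambda>x. g x \<bullet> a))" using Suc.prems(2)[OF a] b by simp
  qed simp
  then show ?case
    using differentiable_compose_components[OF d] by (simp add: dir_deriv_compose[OF d])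
qed

section \<open>Jets: scaled sums of derivatives\<close>

text \<open>The sum of \<open>l\<^sup>n |\<partial>\<^sup>\<beta> f x|\<close> over all index words \<open>\<beta>\<close> of length \<open>n \<le> k\<close>.\<close>

primrec jet :: "real \<Rightarrow> nat \<Rightarrow> ('a::euclidean_space \<Rightarrow> real) \<Rightarrow> 'a \<Rightarrow> real" where
  "jet l 0 f x = \<bar>f x\<bar>"
| "jet l (Suc k) f x = \<bar>f x\<bar> + l * (\<Sum>b\<in>Basis. jet l k (dir_deriv b f) x)"

context fixes l :: real assumes l: "l \<ge> 0" begin

lemma jet_nonneg: "jet l k f x \<ge> 0"
  by (induction k arbitrary: f) (auto intro!: add_nonneg_nonneg mult_nonneg_nonneg sum_nonneg l)

lemma jet_ge_abs: "\<bar>f x\<bar> \<le> jet l k f x"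
  by (cases k) (auto intro!: mult_nonneg_nonneg sum_nonneg jet_nonneg l)

lemma jet_mono: "jet l k f x \<le> jet l (Suc k) f x"
proof (induction k arbitrary: f)
  case 0
  show ?case using jet_ge_abs[of f x "Suc 0"] by simp
next
  case (Suc k)
  show ?case by (subst (1 2) jet.simps(2)) (intro add_left_mono mult_left_mono sum_mono Suc l)
qed

lemma jet_dir_deriv: "b \<in> Basis \<Longrightarrow> l * jet l k (dir_deriv b f) x \<le> jet l (Suc k) f x"
  using l by (auto intro!: add_increasing mult_left_mono member_le_sum jet_nonneg)

lemma jet_add: "Ck k f \<Longrightarrow> Ck k g \<Longrightarrow> jet l k (\<lambda>x. f x + g x) x \<le> jet l k f x + jet l k g x"
proof (induction k arbitrary: f g)
  case (Suc k)
  then have d: "dir_deriv b (\<lambda>x. f x + g x) = (\<lambda>x. dir_deriv b f x + dir_deriv b g x)" for b by (auto simp: dir_deriv_add)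
  have "(\<Sum>b\<in>Basis. jet l k (dir_deriv b (\<lambda>x. f x + g x)) x) \<le> (\<Sum>b\<in>Basis. jet l k (dir_deriv b f) x + jet l k (dir_deriv b g) x)"
    unfolding d using Suc by (intro sum_mono) auto
  from mult_left_mono[OF this l] show ?case by (simp add: sum.distrib distrib_left)
qed auto

lemma jet_cmult: "Ck k f \<Longrightarrow> jet l k (\<lambda>x. c * f x) x = \<bar>c\<bar> * jet l k f x"
proof (induction k arbitrary: f)
  case (Suc k)
  then have d: "dir_deriv b (\<lambda>x. c * f x) = (\<lambda>x. c * dir_deriv b f x)" for b by (auto simp: dir_deriv_mult)
  show ?case using Suc by (simp add: d abs_mult distrib_left sum_distrib_left mult_ac)
qed (auto simp: abs_mult)

lemma jet_zero: "jet l k (\<lambda>x. 0) x = 0"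
  using jet_cmult[of k "\<lambda>x. 0" 0 x] by simp

lemma jet_diff: "Ck k f \<Longrightarrow> Ck k g \<Longrightarrow> jet l k (\<lambda>x. f x - g x) x \<le> jet l k f x + jet l k g x"
  using jet_add[of k f "\<lambda>x. (-1) * g x" x] jet_cmult[of k g "-1" x] Ck_mult[of k "\<lambda>_. -1" g] by simp

lemma jet_sum: "finite A \<Longrightarrow> (\<And>i. i \<in> A \<Longrightarrow> Ck k (f i)) \<Longrightarrow> jet l k (\<lambda>x. \<Sum>i\<in>A. f i x) x \<le> (\<Sum>i\<in>A. jet l k (f i) x)"
proof (induction A rule: finite_induct)
  case (insert i A)
  then have "jet l k (\<lambda>x. f i x + (\<Sum>i\<in>A. f i x)) x \<le> jet l k (f i) x + jet l k (\<lambda>x. \<Sum>i\<in>A. f i x) x"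
    by (intro jet_add Ck_sum) auto
  with insert show ?case by simp
qed (simp add: jet_zero)

text \<open>Submultiplicative up to a factor 3 per order: the Leibniz rule gives two products of
  jets, and the undifferentiated term is the third.\<close>

lemma jet_mult: "Ck k f \<Longrightarrow> Ck k g \<Longrightarrow> jet l k (\<lambda>x. f x * g x) x \<le> 3 ^ k * (jet l k f x * jet l k g x)"
proof (induction k arbitrary: f g)
  case (Suc k)
  let ?J = "jet l (Suc k)"
  have d: "dir_deriv b (\<lambda>x. f x * g x) = (\<lambda>x. dir_deriv b f x * g x + f x * dir_deriv b g x)" for b
    using Suc.prems by (auto simp: dir_deriv_mult)
  have c: "Ck k f" "Ck k g" "\<And>b. b \<in> Basis \<Longrightarrow> Ck k (dir_deriv b f)" "\<And>b. b \<in> Basis \<Longrightarrow> Ck k (dir_deriv b g)"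
    using Suc.prems Ck_Suc_imp by auto
  have s: "l * (\<Sum>b\<in>Basis. jet l k (dir_deriv b f) x) \<le> ?J f x" "l * (\<Sum>b\<in>Basis. jet l k (dir_deriv b g) x) \<le> ?J g x" by auto
  have "l * (\<Sum>b\<in>Basis. jet l k (dir_deriv b (\<lambda>x. f x * g x)) x) \<le>
     l * (\<Sum>b\<in>Basis. 3 ^ k * (jet l k (dir_deriv b f) x * jet l k g x) + 3 ^ k * (jet l k f x * jet l k (dir_deriv b g) x))"
    unfolding d
    by (intro mult_left_mono sum_mono l order_trans[OF jet_add] add_mono Suc.IH Ck_mult c)
  also have "\<dots> = 3 ^ k * ((l * (\<Sum>b\<in>Basis. jet l k (dir_deriv b f) x)) * jet l k g x + jet l k f x * (l * (\<Sum>b\<in>Basis. jet l k (dir_deriv b g) x)))"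
    by (simp add: sum.distrib sum_distrib_left sum_distrib_right distrib_left mult_ac)
  also have "\<dots> \<le> 3 ^ k * (?J f x * ?J g x + ?J f x * ?J g x)"
    by (intro mult_left_mono add_mono mult_mono s jet_mono jet_nonneg mult_nonneg_nonneg sum_nonneg l) auto
  finally have 1: "l * (\<Sum>b\<in>Basis. jet l k (dir_deriv b (\<lambda>x. f x * g x)) x) \<le> 2 * 3 ^ k * (?J f x * ?J g x)" by simp
  have "\<bar>f x * g x\<bar> \<le> 1 * (?J f x * ?J g x)"
    unfolding abs_mult mult_1 by (intro mult_mono jet_ge_abs jet_nonneg) auto
  also have "\<dots> \<le> 3 ^ k * (?J f x * ?J g x)" by (intro mult_right_mono mult_nonneg_nonneg jet_nonneg) auto
  finally show ?case using 1 by simp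
qed (simp add: abs_mult)

lemma continuous_jet: "Ck k f \<Longrightarrow> continuous_on UNIV (jet l k f)"
proof (induction k arbitrary: f)
  case (Suc k)
  have "continuous_on UNIV f" using Ck_continuous[OF Suc.prems] .
  moreover have "continuous_on UNIV (jet l k (dir_deriv b f))" if "b \<in> Basis" for b
    using Suc.prems that by (intro Suc.IH) simp
  ultimately have "continuous_on UNIV (\<lambda>x. \<bar>f x\<bar> + l * (\<Sum>b\<in>Basis. jet l k (dir_deriv b f) x))"
    by (intro continuous_intros)
  then show ?case by (simp add: jet.simps(2)[abs_def])
qed (auto intro: continuous_intros)

text \<open>Passing to the next order keeps the function itself and adds one term for each basis
  vector, hence the factor 1 + DIM per order.\<close>

lemma jet_le_iter_deriv:
  fixes f :: "'a::euclidean_space \<Rightarrow> real"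
  assumes "\<And>\<beta>. \<beta> \<in> multi_indices \<Longrightarrow> length \<beta> \<le> k \<Longrightarrow> l ^ length \<beta> * \<bar>iter_deriv \<beta> f x\<bar> \<le> M"
  shows "jet l k f x \<le> (1 + real DIM('a)) ^ k * M"
  using assms
proof (induction k arbitrary: f M)
  case 0
  from 0[of "[]"] show ?case by (simp add: multi_indices_def iter_deriv_def)
next
  case (Suc k)
  have fx: "\<bar>f x\<bar> \<le> M" using Suc.prems[of "[]"] by (simp add: multi_indices_def iter_deriv_def)
  then have M: "M \<ge> 0" by linarith
  have "l * jet l k (dir_deriv b f) x \<le> (1 + real DIM('a)) ^ k * M" if b: "b \<in> Basis" for b
  \<comment> \<open>The induction hypothesis is applied to the derivative with the bound M / l, so
    the unit must not vanish.\<close>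
  proof (cases "l = 0")
    case False
    then have l': "l > 0" using l by simp
    have "jet l k (dir_deriv b f) x \<le> (1 + real DIM('a)) ^ k * (M / l)"
    proof (rule Suc.IH)
      fix \<beta> :: "'a list" assume "\<beta> \<in> multi_indices" "length \<beta> \<le> k"
      then have "l ^ length (\<beta> @ [b]) * \<bar>iter_deriv (\<beta> @ [b]) f x\<bar> \<le> M"
        using b by (intro Suc.prems) (auto simp: multi_indices_def)
      then show "l ^ length \<beta> * \<bar>iter_deriv \<beta> (dir_deriv b f) x\<bar> \<le> M / l"
        using l' by (simp add: iter_deriv_def field_simps)
    qed
    then show ?thesis using l' by (simp add: field_simps)
  qed (use M in simp)
  then have "(\<Sum>b\<in>Basis. l * jet l k (dir_deriv b f) x) \<le> (\<Sum>b\<in>(Basis::'a set). (1 + real DIM('a)) ^ k * M)"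
    by (intro sum_mono)
  moreover have "M \<le> (1 + real DIM('a)) ^ k * M"
    using mult_right_mono[of 1 "(1 + real DIM('a)) ^ k" M] M by simp
  ultimately show ?case using fx by (simp add: sum_distrib_left[symmetric] algebra_simps)
qed

end

section \<open>Jets of dilations, compositions and differences of compositions\<close>

lemma dir_deriv_dilate:
  assumes "f differentiable (at (c *\<^sub>R x))"
  shows "dir_deriv b (\<lambda>x. f (c *\<^sub>R x)) x = c *\<^sub>R dir_deriv b f (c *\<^sub>R x)"
    and "(\<lambda>x. f (c *\<^sub>R x)) differentiable (at x)"
proof -
  have "((\<lambda>x. f (c *\<^sub>R x)) has_derivative (\<lambda>h. dir_deriv (c *\<^sub>R h) f (c *\<^sub>R x))) (at x)"
    by (rule has_derivative_compose[where f="\<lambda>x. c *\<^sub>R x" and g=f and f'="\<lambda>h. c *\<^sub>R h", OF _ has_derivative_frechet[OF assms]])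
      (auto intro!: derivative_eq_intros)
  moreover have "dir_deriv (c *\<^sub>R h) f (c *\<^sub>R x) = c *\<^sub>R dir_deriv h f (c *\<^sub>R x)" for h
    using linear_scale[OF has_derivative_linear[OF has_derivative_frechet[OF assms]], of c h] .
  ultimately show "dir_deriv b (\<lambda>x. f (c *\<^sub>R x)) x = c *\<^sub>R dir_deriv b f (c *\<^sub>R x)"
    "(\<lambda>x. f (c *\<^sub>R x)) differentiable (at x)"
    by (auto intro!: dir_deriv_eqI differentiableI)
qed

lemma Ck_dilate:
  fixes f :: "'a::euclidean_space \<Rightarrow> real"
  shows "Ck k f \<Longrightarrow> Ck k (\<lambda>x. f (c *\<^sub>R x))"
proof (induction k arbitrary: f)
  case 0
  then show ?case by (auto intro!: continuous_on_compose2[of UNIV f] continuous_intros)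
next
  case (Suc k)
  then have "dir_deriv b (\<lambda>x. f (c *\<^sub>R x)) = (\<lambda>x. c * dir_deriv b f (c *\<^sub>R x))" for b
    by (auto simp: dir_deriv_dilate)
  with Suc show ?case by (auto intro!: dir_deriv_dilate(2) Ck_mult)
qed

text \<open>Each derivative of a dilate brings out one factor \<open>c\<close>, which the unit
  \<open>l\<close> absorbs.\<close>

lemma jet_dilate:
  fixes f :: "'a::euclidean_space \<Rightarrow> real"
  assumes "l \<ge> 0" "c \<ge> 0"
  shows "Ck k f \<Longrightarrow> jet l k (\<lambda>x. f (c *\<^sub>R x)) x = jet (l * c) k f (c *\<^sub>R x)"
proof (induction k arbitrary: f)
  case (Suc k)
  have d: "dir_deriv b (\<lambda>x. f (c *\<^sub>R x)) = (\<lambda>x. c * dir_deriv b f (c *\<^sub>R x))" for b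
    using Suc.prems by (auto simp: dir_deriv_dilate)
  have "jet l k (\<lambda>x. c * dir_deriv b f (c *\<^sub>R x)) x = c * jet (l * c) k (dir_deriv b f) (c *\<^sub>R x)" if "b \<in> Basis" for b
  proof -
    have "Ck k (dir_deriv b f)" using Suc.prems that by simp
    then show ?thesis
      using jet_cmult[OF assms(1) Ck_dilate[of k "dir_deriv b f" c], of c x] Suc.IH[of "dir_deriv b f"] assms(2) by simp
  qed
  then show ?case by (simp add: d sum_distrib_left mult.assoc)
qed auto

text \<open>The last letter of a word acts first. An induction that replaces \<open>F\<close> by one
  of its derivatives therefore extends words on the right.\<close>

lemma iter_deriv_append_dir: "iter_deriv (\<beta> @ [b]) F = iter_deriv \<beta> (dir_deriv b F)"
  by (simp add: iter_deriv_def)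

text \<open>The recursion of the induction in \<open>jet_compose\<close>: D counts the pairs of a
  direction and a component, and 3^k comes from \<open>jet_mult\<close>.\<close>

primrec compose_const :: "nat \<Rightarrow> nat \<Rightarrow> real" where
  "compose_const D 0 = 1"
| "compose_const D (Suc k) = 1 + real D * 3 ^ k * compose_const D k"

lemma compose_const_nonneg: "compose_const D k \<ge> 0" by (induction k) auto

text \<open>Induction in place of the formula of Faa di Bruno: one chain rule leaves
  \<open>dir_deriv a F\<close> after \<open>h\<close>, with one order less to go, times a derivative
  of a component of \<open>h\<close> whose jet, multiplied by \<open>l\<close>, is at most A. Each
  order thus costs one factor 1 + A.\<close>

lemma jet_compose:
  fixes F :: "'c::euclidean_space \<Rightarrow> real" and h :: "'a::euclidean_space \<Rightarrow> 'c"
  assumes l: "l \<ge> 0" and A: "A \<ge> 0"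
  shows "Ck k F \<Longrightarrow> (\<And>a. a \<in> Basis \<Longrightarrow> Ck k (\<lambda>x. h x \<bullet> a)) \<Longrightarrow>
    (\<And>a. a \<in> Basis \<Longrightarrow> jet l k (\<lambda>x. h x \<bullet> a) x \<le> A) \<Longrightarrow>
    (\<And>\<beta>. \<beta> \<in> multi_indices \<Longrightarrow> length \<beta> \<le> k \<Longrightarrow> \<bar>iter_deriv \<beta> F (h x)\<bar> \<le> B) \<Longrightarrow>
    jet l k (\<lambda>x. F (h x)) x \<le> compose_const (DIM('a) * DIM('c)) k * B * (1 + A) ^ k"
proof (induction k arbitrary: F)
  case 0
  from 0(4)[of "[]"] show ?case by (simp add: multi_indices_def iter_deriv_def)
next
  case (Suc k)
  let ?c = "compose_const (DIM('a) * DIM('c)) k"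
  have Fx: "\<bar>F (h x)\<bar> \<le> B" using Suc.prems(4)[of "[]"] by (simp add: multi_indices_def iter_deriv_def)
  then have B: "B \<ge> 0" by linarith
  have dF: "F differentiable (at y)" for y using Suc.prems(1) by simp
  have dh: "(\<lambda>x. h x \<bullet> a) differentiable (at x)" if "a \<in> Basis" for a x
    using Suc.prems(2)[OF that] by simp
  have C: "Ck k (\<lambda>x. h x \<bullet> a)" if "a \<in> Basis" for a using Suc.prems(2)[OF that] Ck_Suc_imp by blast
  have jF: "jet l k (\<lambda>x. dir_deriv a F (h x)) x \<le> ?c * B * (1 + A) ^ k" and CF: "Ck k (\<lambda>x. dir_deriv a F (h x))" if a: "a \<in> Basis" for a
  proof -
    have CF': "Ck k (dir_deriv a F)" using Suc.prems(1) a by simp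
    show "jet l k (\<lambda>x. dir_deriv a F (h x)) x \<le> ?c * B * (1 + A) ^ k"
    proof (rule Suc.IH[OF CF' C])
      show "jet l k (\<lambda>x. h x \<bullet> a') x \<le> A" if "a' \<in> Basis" for a'
        using jet_mono[OF l] Suc.prems(3)[OF that] order_trans by blast
      show "\<bar>iter_deriv \<beta> (dir_deriv a F) (h x)\<bar> \<le> B" if "\<beta> \<in> multi_indices" "length \<beta> \<le> k" for \<beta>
        using Suc.prems(4)[of "\<beta> @ [a]"] that a by (simp add: iter_deriv_append_dir multi_indices_def)
    qed
    show "Ck k (\<lambda>x. dir_deriv a F (h x))" by (rule Ck_compose[OF CF' C])
  qed
  have "l * jet l k (dir_deriv b (\<lambda>x. F (h x))) x \<le> (\<Sum>a\<in>(Basis::'c set). 3 ^ k * (?c * B * (1 + A) ^ k * A))" if b: "b \<in> Basis" for b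
  proof -
    have Cb: "Ck k (dir_deriv b (\<lambda>x. h x \<bullet> a))" if "a \<in> Basis" for a using Suc.prems(2)[OF that] b by simp
    have d: "dir_deriv b (\<lambda>x. F (h x)) = (\<lambda>x. \<Sum>a\<in>Basis. dir_deriv a F (h x) * dir_deriv b (\<lambda>x. h x \<bullet> a) x)"
      by (rule dir_deriv_compose[OF dF dh])
    have "jet l k (dir_deriv b (\<lambda>x. F (h x))) x \<le> (\<Sum>a\<in>Basis. jet l k (\<lambda>x. dir_deriv a F (h x) * dir_deriv b (\<lambda>x. h x \<bullet> a) x) x)"
      unfolding d by (rule jet_sum[OF l]) (auto intro!: Ck_mult CF Cb)
    also have "\<dots> \<le> (\<Sum>a\<in>Basis. 3 ^ k * ((?c * B * (1 + A) ^ k) * jet l k (dir_deriv b (\<lambda>x. h x \<bullet> a)) x))"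
      by (intro sum_mono order_trans[OF jet_mult[OF l CF Cb]] mult_left_mono mult_right_mono jF jet_nonneg[OF l]) auto
    finally have "l * jet l k (dir_deriv b (\<lambda>x. F (h x))) x \<le> (\<Sum>a\<in>Basis. 3 ^ k * ((?c * B * (1 + A) ^ k) * (l * jet l k (dir_deriv b (\<lambda>x. h x \<bullet> a)) x)))"
      using l by (auto dest: mult_left_mono[OF _ l] simp: sum_distrib_left mult_ac)
    also have "\<dots> \<le> (\<Sum>a\<in>(Basis::'c set). 3 ^ k * ((?c * B * (1 + A) ^ k) * A))"
    proof (intro sum_mono mult_left_mono)
      fix a :: 'c assume a: "a \<in> Basis"
      show "l * jet l k (dir_deriv b (\<lambda>x. h x \<bullet> a)) x \<le> A"
        by (rule order_trans[OF jet_dir_deriv[OF l b] Suc.prems(3)[OF a]])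
    qed (use B A compose_const_nonneg in auto)
    finally show ?thesis .
  qed
  then have "(\<Sum>b\<in>Basis. l * jet l k (dir_deriv b (\<lambda>x. F (h x))) x) \<le> (\<Sum>b\<in>(Basis::'a set). \<Sum>a\<in>(Basis::'c set). 3 ^ k * (?c * B * (1 + A) ^ k * A))"
    by (intro sum_mono)
  also have "\<dots> = real (DIM('a) * DIM('c)) * 3 ^ k * ?c * B * ((1 + A) ^ k * A)" by simp
  also have "\<dots> \<le> real (DIM('a) * DIM('c)) * 3 ^ k * ?c * B * ((1 + A) ^ Suc k)"
    using A B compose_const_nonneg by (intro mult_left_mono) (auto simp: algebra_simps)
  finally have 1: "l * (\<Sum>b\<in>Basis. jet l k (dir_deriv b (\<lambda>x. F (h x))) x) \<le> real (DIM('a) * DIM('c)) * 3 ^ k * ?c * B * (1 + A) ^ Suc k"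
    by (simp add: sum_distrib_left)
  have "B * 1 \<le> B * (1 + A) ^ Suc k" using A by (intro mult_left_mono B one_le_power) auto
  with 1 Fx show ?case by (simp add: distrib_right)
qed

text \<open>The mean value theorem on the segment from z to y. Because the segment stays in the
  convex set S, bounds on the derivatives of F are called for only there; S will be a ball.\<close>

lemma abs_diff_le_dir_deriv:
  fixes F :: "'c::euclidean_space \<Rightarrow> real"
  assumes F: "\<And>y. F differentiable (at y)" and S: "convex S" "y \<in> S" "z \<in> S"
    and B: "\<And>a w. a \<in> Basis \<Longrightarrow> w \<in> S \<Longrightarrow> \<bar>dir_deriv a F w\<bar> \<le> B"
  shows "\<bar>F y - F z\<bar> \<le> B * (\<Sum>a\<in>Basis. \<bar>(y - z) \<bullet> a\<bar>)"
proof -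
  define \<phi> where "\<phi> t = F (z + t *\<^sub>R (y - z))" for t :: real
  have "((\<lambda>t. F (z + t *\<^sub>R (y - z))) has_derivative (\<lambda>h. dir_deriv (h *\<^sub>R (y - z)) F (z + t *\<^sub>R (y - z)))) (at t within {0..1})" for t :: real
    by (rule has_derivative_compose[where f="\<lambda>t. z + t *\<^sub>R (y - z)" and f'="\<lambda>h. h *\<^sub>R (y - z)" and g=F, OF _ has_derivative_frechet[OF F]])
      (auto intro!: derivative_eq_intros)
  then obtain t where t: "t \<in> {0<..<1}" "\<phi> 1 - \<phi> 0 = dir_deriv ((1 - 0) *\<^sub>R (y - z)) F (z + t *\<^sub>R (y - z))"
    unfolding \<phi>_def using mvt_simple[of 0 1 "\<lambda>t. F (z + t *\<^sub>R (y - z))" "\<lambda>t h. dir_deriv (h *\<^sub>R (y - z)) F (z + t *\<^sub>R (y - z))"] by auto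
  define w where "w = z + t *\<^sub>R (y - z)"
  have "w = (1 - t) *\<^sub>R z + t *\<^sub>R y" by (simp add: w_def algebra_simps)
  then have w: "w \<in> S" using S t(1) by (auto simp: convex_alt)
  define D where "D v = dir_deriv v F w" for v
  have lin: "linear D" using has_derivative_linear[OF has_derivative_frechet[OF F]] unfolding D_def[abs_def] .
  have "F y - F z = D (y - z)" using t(2) by (simp add: \<phi>_def D_def w_def)
  also have "\<dots> = D (\<Sum>a\<in>Basis. ((y - z) \<bullet> a) *\<^sub>R a)" by (simp only: euclidean_representation)
  also have "\<dots> = (\<Sum>a\<in>Basis. ((y - z) \<bullet> a) * D a)"
    by (simp add: linear_sum[OF lin] linear_scale[OF lin])
  also have "\<bar>\<dots>\<bar> \<le> (\<Sum>a\<in>Basis. \<bar>((y - z) \<bullet> a) * D a\<bar>)" by (rule sum_abs)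
  also have "\<dots> \<le> (\<Sum>a\<in>Basis. \<bar>(y - z) \<bullet> a\<bar> * B)"
    unfolding abs_mult D_def by (intro sum_mono mult_left_mono B w) auto
  finally show ?thesis by (simp add: sum_distrib_left mult.commute)
qed

primrec compose_diff_const :: "nat \<Rightarrow> nat \<Rightarrow> real" where
  "compose_diff_const D 0 = 1"
| "compose_diff_const D (Suc k) = 1 + real D * 3 ^ k * (compose_diff_const D k + compose_const D k)"

lemma compose_diff_const_nonneg: "compose_diff_const D k \<ge> 0"
  using compose_const_nonneg[of D] by (induction k) auto

text \<open>Every term must stay linear in the jets of g - h, so that the square function of the
  differences controls it. The derivative is split as (dF(g) - dF(h)) dg + dF(h) (dg - dh): the
  induction handles the first summand, \<open>jet_compose\<close> the second. The base case is the
  mean value theorem; it accounts for the additional derivative of F.\<close>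

lemma jet_compose_diff:
  fixes F :: "'c::euclidean_space \<Rightarrow> real" and g h :: "'a::euclidean_space \<Rightarrow> 'c"
  assumes l: "l \<ge> 0" and A: "A \<ge> 0" and S: "convex S" "g x \<in> S" "h x \<in> S"
  shows "Ck (Suc k) F \<Longrightarrow>
    (\<And>a. a \<in> Basis \<Longrightarrow> Ck k (\<lambda>x. g x \<bullet> a)) \<Longrightarrow> (\<And>a. a \<in> Basis \<Longrightarrow> Ck k (\<lambda>x. h x \<bullet> a)) \<Longrightarrow>
    (\<And>a. a \<in> Basis \<Longrightarrow> jet l k (\<lambda>x. g x \<bullet> a) x \<le> A) \<Longrightarrow> (\<And>a. a \<in> Basis \<Longrightarrow> jet l k (\<lambda>x. h x \<bullet> a) x \<le> A) \<Longrightarrow>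
    (\<And>\<beta> a y. \<beta> \<in> multi_indices \<Longrightarrow> length \<beta> \<le> k \<Longrightarrow> a \<in> Basis \<Longrightarrow> y \<in> S \<Longrightarrow> \<bar>iter_deriv \<beta> (dir_deriv a F) y\<bar> \<le> B) \<Longrightarrow>
    jet l k (\<lambda>x. F (g x) - F (h x)) x \<le> compose_diff_const (DIM('a) * DIM('c)) k * B * (1 + A) ^ k *
      (\<Sum>a\<in>Basis. jet l k (\<lambda>x. g x \<bullet> a - h x \<bullet> a) x)"
proof (induction k arbitrary: F)
  case 0
  have "\<bar>F (g x) - F (h x)\<bar> \<le> B * (\<Sum>a\<in>Basis. \<bar>(g x - h x) \<bullet> a\<bar>)"
    using 0(1) 0(6)[of "[]"] by (intro abs_diff_le_dir_deriv[OF _ S]) (auto simp: multi_indices_def iter_deriv_def)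
  then show ?case by (simp add: inner_diff_left)
next
  case (Suc k)
  let ?D = "DIM('a) * DIM('c)"
  let ?c = "compose_const ?D k" and ?d = "compose_diff_const ?D k"
  define E where "E = (\<Sum>a\<in>Basis. jet l (Suc k) (\<lambda>x. g x \<bullet> a - h x \<bullet> a) x)"
  \<comment> \<open>E enlarged by one factor 1 + A, so that both summands of the product estimate
    end with the power Suc k.\<close>
  define E2 where "E2 = (1 + A) * E"
  have E0: "E \<ge> 0" unfolding E_def by (intro sum_nonneg jet_nonneg l)
  have B1: "\<bar>dir_deriv a F y\<bar> \<le> B" if "a \<in> Basis" "y \<in> S" for a y
    using Suc.prems(6)[of "[]" a y] that by (simp add: multi_indices_def iter_deriv_def)
  have B: "B \<ge> 0" using B1[OF SOME_Basis S(2)] by linarith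
  have dF: "F differentiable (at y)" for y using Suc.prems(1) by simp
  have dg: "(\<lambda>x. g x \<bullet> a) differentiable (at x)" if "a \<in> Basis" for a x using Suc.prems(2)[OF that] by simp
  have dh: "(\<lambda>x. h x \<bullet> a) differentiable (at x)" if "a \<in> Basis" for a x using Suc.prems(3)[OF that] by simp
  have Cg: "Ck k (\<lambda>x. g x \<bullet> a)" if "a \<in> Basis" for a using Suc.prems(2)[OF that] Ck_Suc_imp by blast
  have Ch: "Ck k (\<lambda>x. h x \<bullet> a)" if "a \<in> Basis" for a using Suc.prems(3)[OF that] Ck_Suc_imp by blast
  have jg: "jet l k (\<lambda>x. g x \<bullet> a) x \<le> A" if "a \<in> Basis" for a
    using jet_mono[OF l] Suc.prems(4)[OF that] order_trans by blast
  have jh: "jet l k (\<lambda>x. h x \<bullet> a) x \<le> A" if "a \<in> Basis" for a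
    using jet_mono[OF l] Suc.prems(5)[OF that] order_trans by blast
  have CF: "Ck (Suc k) (dir_deriv a F)" if "a \<in> Basis" for a using Suc.prems(1) that by (subst (asm) Ck.simps(2)) blast
  have CF': "Ck k (dir_deriv a F)" if "a \<in> Basis" for a using CF[OF that] Ck_Suc_imp by blast
  have j1: "jet l k (\<lambda>x. dir_deriv a F (g x) - dir_deriv a F (h x)) x \<le> ?d * B * (1 + A) ^ k * E" if a: "a \<in> Basis" for a
  proof -
    have "jet l k (\<lambda>x. dir_deriv a F (g x) - dir_deriv a F (h x)) x \<le> ?d * B * (1 + A) ^ k * (\<Sum>a\<in>Basis. jet l k (\<lambda>x. g x \<bullet> a - h x \<bullet> a) x)"
    proof (rule Suc.IH[OF CF[OF a] Cg Ch jg jh])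
      show "\<bar>iter_deriv \<beta> (dir_deriv a' (dir_deriv a F)) y\<bar> \<le> B" if "\<beta> \<in> multi_indices" "length \<beta> \<le> k" "a' \<in> Basis" "y \<in> S" for \<beta> a' y
        using Suc.prems(6)[of "\<beta> @ [a']" a y] that a by (simp add: iter_deriv_append_dir multi_indices_def)
    qed
    also have "\<dots> \<le> ?d * B * (1 + A) ^ k * E"
      unfolding E_def using A B compose_diff_const_nonneg by (intro mult_left_mono sum_mono jet_mono l) auto
    finally show ?thesis .
  qed
  have j2: "jet l k (\<lambda>x. dir_deriv a F (h x)) x \<le> ?c * B * (1 + A) ^ k" if a: "a \<in> Basis" for a
    using Suc.prems(6) S(3) a by (intro jet_compose[OF l A CF'[OF a] Ch jh]) auto
  have "l * jet l k (dir_deriv b (\<lambda>x. F (g x) - F (h x))) x \<le> (\<Sum>a\<in>(Basis::'c set). 3 ^ k * ((?d + ?c) * B * (1 + A) ^ Suc k * E))" if b: "b \<in> Basis" for b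
  proof -
    let ?gb = "\<lambda>a. dir_deriv b (\<lambda>x. g x \<bullet> a)" and ?hb = "\<lambda>a. dir_deriv b (\<lambda>x. h x \<bullet> a)"
    have Cgb: "Ck k (?gb a)" if "a \<in> Basis" for a using Suc.prems(2)[OF that] b by simp
    have Chb: "Ck k (?hb a)" if "a \<in> Basis" for a using Suc.prems(3)[OF that] b by simp
    \<comment> \<open>The term dF(h) dg is subtracted and added, which puts every factor in the form
      of \<open>j1\<close>, of \<open>j2\<close> or of a difference of derivatives.\<close>
    have d: "dir_deriv b (\<lambda>x. F (g x) - F (h x)) = (\<lambda>x. \<Sum>a\<in>Basis.
       (dir_deriv a F (g x) - dir_deriv a F (h x)) * ?gb a x + dir_deriv a F (h x) * (?gb a x - ?hb a x))"
    proof -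
      have "(\<lambda>x. F (g x)) differentiable (at x)" "(\<lambda>x. F (h x)) differentiable (at x)" for x
        by (rule differentiable_compose_components[OF dF dg], assumption) (rule differentiable_compose_components[OF dF dh])
      then have "dir_deriv b (\<lambda>x. F (g x) - F (h x)) = (\<lambda>x. dir_deriv b (\<lambda>x. F (g x)) x - dir_deriv b (\<lambda>x. F (h x)) x)"
        by (auto simp: dir_deriv_diff)
      moreover have "dir_deriv b (\<lambda>x. F (g x)) = (\<lambda>x. \<Sum>a\<in>Basis. dir_deriv a F (g x) * ?gb a x)"
        by (rule dir_deriv_compose[OF dF dg])
      moreover have "dir_deriv b (\<lambda>x. F (h x)) = (\<lambda>x. \<Sum>a\<in>Basis. dir_deriv a F (h x) * ?hb a x)"
        by (rule dir_deriv_compose[OF dF dh])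
      ultimately show ?thesis by (simp add: algebra_simps sum.distrib sum_subtractf)
    qed
    have C1: "Ck k (\<lambda>x. dir_deriv a F (g x) - dir_deriv a F (h x))" "Ck k (\<lambda>x. dir_deriv a F (h x))"
      "Ck k (\<lambda>x. ?gb a x - ?hb a x)" if a: "a \<in> Basis" for a
    proof -
      show h: "Ck k (\<lambda>x. dir_deriv a F (h x))" by (rule Ck_compose[OF CF'[OF a] Ch])
      have "Ck k (\<lambda>x. dir_deriv a F (g x))" by (rule Ck_compose[OF CF'[OF a] Cg])
      then show "Ck k (\<lambda>x. dir_deriv a F (g x) - dir_deriv a F (h x))" using h by (rule Ck_diff)
      show "Ck k (\<lambda>x. ?gb a x - ?hb a x)" by (rule Ck_diff[OF Cgb[OF a] Chb[OF a]])
    qed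
    have "jet l k (dir_deriv b (\<lambda>x. F (g x) - F (h x))) x \<le> (\<Sum>a\<in>Basis. 
       3 ^ k * (jet l k (\<lambda>x. dir_deriv a F (g x) - dir_deriv a F (h x)) x * jet l k (?gb a) x) +
       3 ^ k * (jet l k (\<lambda>x. dir_deriv a F (h x)) x * jet l k (\<lambda>x. ?gb a x - ?hb a x) x))"
      unfolding d
    proof (rule order_trans[OF jet_sum[OF l finite_Basis] sum_mono])
      fix a :: 'c assume a: "a \<in> Basis"
      note m = Ck_mult[OF C1(1)[OF a] Cgb[OF a]] Ck_mult[OF C1(2)[OF a] C1(3)[OF a]]
      show "Ck k (\<lambda>x. (dir_deriv a F (g x) - dir_deriv a F (h x)) * ?gb a x + dir_deriv a F (h x) * (?gb a x - ?hb a x))"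
        by (rule Ck_add[OF m])
      show "jet l k (\<lambda>x. (dir_deriv a F (g x) - dir_deriv a F (h x)) * ?gb a x + dir_deriv a F (h x) * (?gb a x - ?hb a x)) x \<le>
         3 ^ k * (jet l k (\<lambda>x. dir_deriv a F (g x) - dir_deriv a F (h x)) x * jet l k (?gb a) x) +
         3 ^ k * (jet l k (\<lambda>x. dir_deriv a F (h x)) x * jet l k (\<lambda>x. ?gb a x - ?hb a x) x)"
        by (rule order_trans[OF jet_add[OF l m] add_mono[OF jet_mult[OF l C1(1)[OF a] Cgb[OF a]] jet_mult[OF l C1(2)[OF a] C1(3)[OF a]]]])
    qed
    from mult_left_mono[OF this l]
    have "l * jet l k (dir_deriv b (\<lambda>x. F (g x) - F (h x))) x \<le> (\<Sum>a\<in>Basis. 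
       3 ^ k * (jet l k (\<lambda>x. dir_deriv a F (g x) - dir_deriv a F (h x)) x * (l * jet l k (?gb a) x) +
        jet l k (\<lambda>x. dir_deriv a F (h x)) x * (l * jet l k (\<lambda>x. ?gb a x - ?hb a x) x)))"
      by (simp add: sum_distrib_left algebra_simps)
    also have "\<dots> \<le> (\<Sum>a\<in>(Basis::'c set). 3 ^ k * ((?d * B * (1 + A) ^ k * E) * (1 + A) + (?c * B * (1 + A) ^ k) * E2))"
    proof (intro sum_mono mult_left_mono add_mono mult_mono)
      fix a :: 'c assume a: "a \<in> Basis"
      show "jet l k (\<lambda>x. dir_deriv a F (g x) - dir_deriv a F (h x)) x \<le> ?d * B * (1 + A) ^ k * E" by (rule j1[OF a])
      show "jet l k (\<lambda>x. dir_deriv a F (h x)) x \<le> ?c * B * (1 + A) ^ k" by (rule j2[OF a])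
      show "l * jet l k (?gb a) x \<le> 1 + A" using jet_dir_deriv[OF l b, of k "\<lambda>x. g x \<bullet> a" x] Suc.prems(4)[OF a] by linarith
      have "(\<lambda>x. ?gb a x - ?hb a x) = dir_deriv b (\<lambda>x. g x \<bullet> a - h x \<bullet> a)"
        using dir_deriv_diff[OF dg[OF a] dh[OF a]] by auto
      then have "l * jet l k (\<lambda>x. ?gb a x - ?hb a x) x \<le> jet l (Suc k) (\<lambda>x. g x \<bullet> a - h x \<bullet> a) x"
        using jet_dir_deriv[OF l b, of k "\<lambda>x. g x \<bullet> a - h x \<bullet> a" x] by simp
      also have "\<dots> \<le> E" unfolding E_def using a by (intro member_le_sum jet_nonneg l) auto
      also have "E \<le> E2" using mult_right_mono[of 1 "1 + A" E] A E0 by (simp add: E2_def)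
      finally show "l * jet l k (\<lambda>x. ?gb a x - ?hb a x) x \<le> E2" .
    qed (use A B E0 compose_const_nonneg compose_diff_const_nonneg l in \<open>auto intro!: mult_nonneg_nonneg jet_nonneg\<close>)
    also have "\<dots> = (\<Sum>a\<in>(Basis::'c set). 3 ^ k * ((?d + ?c) * B * (1 + A) ^ Suc k * E))"
      by (intro sum.cong refl) (simp add: E2_def algebra_simps)
    finally show ?thesis .
  qed
  then have "(\<Sum>b\<in>Basis. l * jet l k (dir_deriv b (\<lambda>x. F (g x) - F (h x))) x) \<le> (\<Sum>b\<in>(Basis::'a set). \<Sum>a\<in>(Basis::'c set). 3 ^ k * ((?d + ?c) * B * (1 + A) ^ Suc k * E))"
    by (intro sum_mono)
  also have "\<dots> = (real ?D * 3 ^ k * (?d + ?c)) * (B * (1 + A) ^ Suc k * E)" by simp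
  finally have 1: "l * (\<Sum>b\<in>Basis. jet l k (dir_deriv b (\<lambda>x. F (g x) - F (h x))) x) \<le> (real ?D * 3 ^ k * (?d + ?c)) * (B * (1 + A) ^ Suc k * E)"
    by (simp add: sum_distrib_left)
  have "\<bar>F (g x) - F (h x)\<bar> \<le> B * (\<Sum>a\<in>Basis. \<bar>(g x - h x) \<bullet> a\<bar>)"
    by (intro abs_diff_le_dir_deriv[OF dF S] B1)
  also have "\<dots> \<le> B * E"
    unfolding E_def inner_diff_left
    by (intro mult_left_mono sum_mono B jet_ge_abs[OF l, of "\<lambda>x. g x \<bullet> _ - h x \<bullet> _"])
  also have "\<dots> \<le> B * (1 + A) ^ Suc k * E"
  proof -
    have "B * 1 * E \<le> B * (1 + A) ^ Suc k * E" using A by (intro mult_left_mono mult_right_mono B E0 one_le_power) auto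
    then show ?thesis by simp
  qed
  finally have "jet l (Suc k) (\<lambda>x. F (g x) - F (h x)) x \<le> B * (1 + A) ^ Suc k * E + (real ?D * 3 ^ k * (?d + ?c)) * (B * (1 + A) ^ Suc k * E)"
    using 1 by simp
  also have "\<dots> = compose_diff_const ?D (Suc k) * B * (1 + A) ^ Suc k * E"
    by (simp add: distrib_right del: power_Suc)
  finally show ?case unfolding E_def .
qed

section \<open>Derivatives and the Fourier transform in the mean square\<close>

text \<open>The integral of H(b + x) - H(x) vanishes by translation invariance. Writing the
  difference as the integral of the derivative along the segment and exchanging the integrals turns
  it into the claim; integrability takes the role of decay at infinity.\<close>

lemma integral_has_derivative_0:
  fixes H :: "'a::euclidean_space \<Rightarrow> complex"
  assumes H: "\<And>x. (H has_derivative H' x) (at x)" and i: "integrable lborel H" "integrable lborel (\<lambda>x. H' x b)"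
    and c: "continuous_on UNIV (\<lambda>x. H' x b)"
  shows "(LINT x|lborel. H' x b) = 0"
proof -
  let ?f = "\<lambda>(s, x). indicator {0..1} s *\<^sub>R H' (s *\<^sub>R b + x) b"
  have [measurable]: "(\<lambda>x. H' x b) \<in> borel_measurable borel" using c by (rule borel_measurable_continuous_onI)
  have ish: "integrable lborel (\<lambda>x. H' (s *\<^sub>R b + x) b)" for s
    using integrable_lborel_affine[of 1 "\<lambda>x. H' x b" "s *\<^sub>R b"] i(2) by simp
  have nsh: "(LINT x|lborel. norm (H' (s *\<^sub>R b + x) b)) = (LINT x|lborel. norm (H' x b))" for s
    using integral_lborel_affine[of 1 "\<lambda>x. norm (H' x b)" "s *\<^sub>R b"] by simp
  have vsh: "(LINT x|lborel. H' (s *\<^sub>R b + x) b) = (LINT x|lborel. H' x b)" for s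
    using integral_lborel_affine[of 1 "\<lambda>x. H' x b" "s *\<^sub>R b"] by simp
  have int: "integrable (lborel \<Otimes>\<^sub>M lborel) ?f"
  proof (rule lborel_pair.Fubini_integrable)
    show "?f \<in> borel_measurable (lborel \<Otimes>\<^sub>M lborel)" by measurable
    have "integrable lborel (\<lambda>s. indicator {0..1::real} s *\<^sub>R (LINT x|lborel. norm (H' x b)))"
      by (intro integrable_scaleR_left integrable_real_indicator) auto
    then show "integrable lborel (\<lambda>s. LINT x|lborel. norm (case (s, x) of (s, x) \<Rightarrow> indicator {0..1} s *\<^sub>R H' (s *\<^sub>R b + x) b))"
      by (simp add: nsh)
    show "AE s in lborel. integrable lborel (\<lambda>x. case (s, x) of (s, x) \<Rightarrow> indicator {0..1} s *\<^sub>R H' (s *\<^sub>R b + x) b)"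
      using ish by auto
  qed
  have inner: "(LINT s|lborel. indicator {0..1} s *\<^sub>R H' (s *\<^sub>R b + x) b) = H (b + x) - H x" for x
  proof -
    have "((\<lambda>s. H (s *\<^sub>R b + x)) has_vector_derivative H' (s *\<^sub>R b + x) b) (at s within {0..1})" for s
    proof -
      have "((\<lambda>s. H (s *\<^sub>R b + x)) has_derivative (\<lambda>h. H' (s *\<^sub>R b + x) (h *\<^sub>R b))) (at s within {0..1})"
        by (rule has_derivative_compose[where f="\<lambda>s. s *\<^sub>R b + x" and f'="\<lambda>h. h *\<^sub>R b" and g=H, OF _ H])
          (auto intro!: derivative_eq_intros)
      then show ?thesis
        unfolding has_vector_derivative_def using linear_scale[OF has_derivative_linear[OF H]] by simp
    qed
    moreover have "continuous_on {0..1} (\<lambda>s. H' (s *\<^sub>R b + x) b)"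
      by (rule continuous_on_compose2[OF c]) (auto intro!: continuous_intros)
    ultimately show ?thesis
      using integral_FTC_Icc[of 0 1 "\<lambda>s. H (s *\<^sub>R b + x)" "\<lambda>s. H' (s *\<^sub>R b + x) b"] by simp
  qed
  have "(LINT x|lborel. H' x b) = (LINT s|lborel. indicator {0..1::real} s *\<^sub>R (LINT x|lborel. H' x b))"
    by simp
  also have "\<dots> = (LINT s|lborel. LINT x|lborel. indicator {0..1} s *\<^sub>R H' (s *\<^sub>R b + x) b)"
    by (simp add: vsh)
  also have "\<dots> = (LINT x|lborel. LINT s|lborel. indicator {0..1} s *\<^sub>R H' (s *\<^sub>R b + x) b)"
    using lborel_pair.Fubini_integral[OF int] by simp
  also have "\<dots> = (LINT x|lborel. H (b + x) - H x)" by (simp add: inner)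
  also have "\<dots> = (LINT x|lborel. H (b + x)) - (LINT x|lborel. H x)"
    using integrable_lborel_affine[of 1 H b] i by (intro Bochner_Integration.integral_diff) auto
  also have "(LINT x|lborel. H (b + x)) = (LINT x|lborel. H x)"
    using integral_lborel_affine[of 1 H b] integrable_borel[OF i(1)] by simp
  finally show ?thesis by simp
qed

text \<open>Integration by parts, obtained by applying \<open>integral_has_derivative_0\<close> to
  the product cis (-(x . xi)) w(x).\<close>

lemma ft_dir_deriv:
  fixes w :: "'a::euclidean_space \<Rightarrow> real"
  assumes w: "\<And>x. w differentiable (at x)" "continuous_on UNIV (dir_deriv b w)" "integrable lborel w" "integrable lborel (dir_deriv b w)"
  shows "ft (\<lambda>x. complex_of_real (dir_deriv b w x)) \<xi> = \<i> * complex_of_real (b \<bullet> \<xi>) * ft (\<lambda>x. complex_of_real (w x)) \<xi>"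
proof -
  define H where "H x = cis (- (x \<bullet> \<xi>)) * complex_of_real (w x)" for x
  define H' where "H' x h = cis (- (x \<bullet> \<xi>)) * complex_of_real (dir_deriv h w x) + (- \<i> * complex_of_real (h \<bullet> \<xi>)) * (cis (- (x \<bullet> \<xi>)) * complex_of_real (w x))" for x h
  have "((\<lambda>x. cis (- (x \<bullet> \<xi>))) has_derivative (\<lambda>h. - \<i> * complex_of_real (h \<bullet> \<xi>) * cis (- (x \<bullet> \<xi>)))) (at x)" for x
    by (rule has_derivative_eq_rhs[OF has_derivative_cis[of "\<lambda>x. - (x \<bullet> \<xi>)" "\<lambda>h. - (h \<bullet> \<xi>)"]])
      (auto intro!: derivative_eq_intros simp: scaleR_conv_of_real mult_ac)
  from has_derivative_mult[OF this has_derivative_of_real[OF has_derivative_frechet[OF w(1)]]]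
  have dH: "(H has_derivative H' x) (at x)" for x
    unfolding H_def H'_def by (simp add: mult_ac)
  have wi: "integrable lborel (\<lambda>x. complex_of_real (w x))" "integrable lborel (\<lambda>x. complex_of_real (dir_deriv b w x))"
    using w by auto
  have iH0: "integrable lborel (\<lambda>x. cis (- (x \<bullet> \<xi>)) * complex_of_real (w x))" by (rule integrable_cis_mult[OF wi(1)]) measurable
  then have iH: "integrable lborel H" unfolding H_def[abs_def] .
  have i2: "integrable lborel (\<lambda>x. cis (- (x \<bullet> \<xi>)) * complex_of_real (dir_deriv b w x))"
    by (rule integrable_cis_mult[OF wi(2)]) measurable
  have iH': "integrable lborel (\<lambda>x. H' x b)"
    unfolding H'_def by (intro Bochner_Integration.integrable_add integrable_mult_right i2 iH0)
  have "continuous_on UNIV w" using w(1) by (auto simp: continuous_on_eq_continuous_at intro: differentiable_imp_continuous_within)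
  then have "continuous_on UNIV (\<lambda>x. H' x b)" unfolding H'_def using w(2) by (intro continuous_intros)
  from integral_has_derivative_0[OF dH iH iH' this]
  have "(LINT x|lborel. cis (- (x \<bullet> \<xi>)) * complex_of_real (dir_deriv b w x)) + (LINT x|lborel. (- \<i> * complex_of_real (b \<bullet> \<xi>)) * (cis (- (x \<bullet> \<xi>)) * complex_of_real (w x))) = 0"
    unfolding H'_def by (subst (asm) Bochner_Integration.integral_add[OF i2 integrable_mult_right[OF iH0]])
  then show ?thesis by (simp add: ft_def)
qed

text \<open>The l1 norm fits the recursion of \<open>jet\<close>: one further order multiplies the
  symbol by 1 + l * norm1, with the summand 1 for the function and one summand for each basis
  vector.\<close>

definition norm1 :: "'a::euclidean_space \<Rightarrow> real" where "norm1 \<xi> = (\<Sum>b\<in>Basis. \<bar>\<xi> \<bullet> b\<bar>)"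

lemma norm1_nonneg: "norm1 \<xi> \<ge> 0" by (simp add: norm1_def sum_nonneg)

lemma borel_measurable_norm1[measurable]: "norm1 \<in> borel_measurable borel"
  unfolding norm1_def[abs_def] by measurable

text \<open>Cauchy-Schwarz for DIM + 1 summands, the additional one being \<open>a\<close>.\<close>

lemma sum_Basis_squares_le:
  fixes a :: real and f :: "'a::euclidean_space \<Rightarrow> real"
  shows "(a + (\<Sum>b\<in>Basis. f b))\<^sup>2 \<le> (1 + real DIM('a)) * (a\<^sup>2 + (\<Sum>b\<in>Basis. (f b)\<^sup>2))"
proof -
  define s d where "s = (\<Sum>b\<in>Basis. f b)" and "d = real DIM('a)"
  have d: "d > 0" by (simp add: d_def)
  have s: "s\<^sup>2 \<le> d * (\<Sum>b\<in>Basis. (f b)\<^sup>2)"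
    unfolding s_def d_def using sum_squared_le_sum_of_squares[of f Basis] by (simp add: mult.commute)
  have "(a + s)\<^sup>2 \<le> (1 + d) * a\<^sup>2 + (1 + 1 / d) * s\<^sup>2"
  proof -
    have "0 \<le> (d * a - s)\<^sup>2 / d" using d by simp
    also have "\<dots> = d * a\<^sup>2 - 2 * a * s + s\<^sup>2 / d" using d by (simp add: power2_eq_square field_simps)
    finally show ?thesis by (simp add: power2_eq_square algebra_simps)
  qed
  also have "(1 + 1 / d) * s\<^sup>2 \<le> (1 + 1 / d) * (d * (\<Sum>b\<in>Basis. (f b)\<^sup>2))" using s d by (intro mult_left_mono) auto
  also have "\<dots> = (1 + d) * (\<Sum>b\<in>Basis. (f b)\<^sup>2)" using d by (simp add: field_simps)
  finally show ?thesis by (simp add: s_def d_def distrib_left)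
qed

text \<open>One factor 1 + DIM is Cauchy-Schwarz, the other counts the terms bounded by K. This is
  the inductive step of both \<open>ft_jet_L2\<close> and \<open>jet_ift_L2\<close>.\<close>

lemma nn_integral_sum_squares:
  fixes u :: "'a::euclidean_space \<Rightarrow> real" and v :: "'a \<Rightarrow> 'a \<Rightarrow> real"
  assumes [measurable]: "u \<in> borel_measurable borel" "\<And>b. b \<in> Basis \<Longrightarrow> v b \<in> borel_measurable borel"
    and u: "(\<integral>\<^sup>+x. ennreal ((u x)\<^sup>2) \<partial>lborel) \<le> K" and v: "\<And>b. b \<in> Basis \<Longrightarrow> (\<integral>\<^sup>+x. ennreal ((v b x)\<^sup>2) \<partial>lborel) \<le> K"
  shows "(\<integral>\<^sup>+x. ennreal ((u x + (\<Sum>b\<in>Basis. v b x))\<^sup>2) \<partial>lborel) \<le> ennreal ((1 + real DIM('a))\<^sup>2) * K"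
proof -
  let ?d = "1 + real DIM('a)"
  have "(\<integral>\<^sup>+x. ennreal ((u x + (\<Sum>b\<in>Basis. v b x))\<^sup>2) \<partial>lborel) \<le>
     (\<integral>\<^sup>+x. ennreal ?d * (ennreal ((u x)\<^sup>2) + (\<Sum>b\<in>Basis. ennreal ((v b x)\<^sup>2))) \<partial>lborel)"
  proof (rule nn_integral_mono)
    fix x
    have "ennreal ((u x + (\<Sum>b\<in>Basis. v b x))\<^sup>2) \<le> ennreal (?d * ((u x)\<^sup>2 + (\<Sum>b\<in>Basis. (v b x)\<^sup>2)))"
      by (intro ennreal_leI sum_Basis_squares_le)
    also have "\<dots> = ennreal ?d * (ennreal ((u x)\<^sup>2) + (\<Sum>b\<in>Basis. ennreal ((v b x)\<^sup>2)))"
      by (subst ennreal_mult) (auto simp: sum_nonneg sum_ennreal)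
    finally show "ennreal ((u x + (\<Sum>b\<in>Basis. v b x))\<^sup>2) \<le> ennreal ?d * (ennreal ((u x)\<^sup>2) + (\<Sum>b\<in>Basis. ennreal ((v b x)\<^sup>2)))" .
  qed
  also have "\<dots> = ennreal ?d * ((\<integral>\<^sup>+x. ennreal ((u x)\<^sup>2) \<partial>lborel) + (\<Sum>b\<in>Basis. \<integral>\<^sup>+x. ennreal ((v b x)\<^sup>2) \<partial>lborel))"
    by (simp add: nn_integral_cmult nn_integral_add nn_integral_sum del: sum_ennreal)
  also have "\<dots> \<le> ennreal ?d * (K + (\<Sum>b\<in>(Basis::'a set). K))"
    by (intro mult_left_mono add_mono u sum_mono v) auto
  also have "K + (\<Sum>b\<in>(Basis::'a set). K) = ennreal ?d * K"
    by (simp add: distrib_right ennreal_of_nat_eq_real_of_nat)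
  also have "ennreal ?d * (ennreal ?d * K) = ennreal (?d\<^sup>2) * K"
  proof -
    have "ennreal (?d\<^sup>2) = ennreal ?d * ennreal ?d" unfolding power2_eq_square by (rule ennreal_mult) auto
    then show ?thesis by (simp only: mult.assoc)
  qed
  finally show ?thesis .
qed

lemma jet_borel: "l \<ge> 0 \<Longrightarrow> Ck k f \<Longrightarrow> jet l k f \<in> borel_measurable borel"
  by (intro borel_measurable_continuous_onI continuous_jet)

lemma integrable_of_jet:
  assumes "l \<ge> 0" "Ck k f" "integrable lborel (jet l k f)"
  shows "integrable lborel f"
proof (rule Bochner_Integration.integrable_bound[OF assms(3)])
  have "norm (f x) \<le> norm (jet l k f x)" for x
    using jet_ge_abs[OF assms(1), of f x k] by simp
  then show "AE x in lborel. norm (f x) \<le> norm (jet l k f x)" by simp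
qed (use Ck_borel[OF assms(2)] in simp)

text \<open>Order 0 is \<open>ft_L2_le\<close>; each further factor 1 + l * norm1 is split between
  the function and its derivatives in units of l, where the transform of a derivative is known from
  \<open>ft_dir_deriv\<close>. Used for synthesis.\<close>

lemma ft_jet_L2:
  fixes w :: "'a::euclidean_space \<Rightarrow> real"
  assumes l: "l > 0"
  shows "Ck k w \<Longrightarrow> integrable lborel (jet l k w) \<Longrightarrow>
    (\<integral>\<^sup>+\<xi>. ennreal (((1 + l * norm1 \<xi>) ^ k * norm (ft (\<lambda>x. complex_of_real (w x)) \<xi>))\<^sup>2) \<partial>lborel) \<le>
      ennreal ((2 * pi) ^ DIM('a) * (1 + real DIM('a)) ^ (2 * k)) * (\<integral>\<^sup>+x. ennreal ((jet l k w x)\<^sup>2) \<partial>lborel)"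
proof (induction k arbitrary: w)
  case 0
  have "integrable lborel (\<lambda>x. complex_of_real (w x))" using integrable_of_jet[of l 0 w] 0 l by simp
  from ft_L2_le[OF this] show ?case by simp
next
  case (Suc k)
  have l0: "l \<ge> 0" using l by simp
  have C: "Ck k w" "\<And>b. b \<in> Basis \<Longrightarrow> Ck k (dir_deriv b w)" using Suc.prems(1) Ck_Suc_imp by auto
  define J where "J = (\<integral>\<^sup>+x. ennreal ((jet l (Suc k) w x)\<^sup>2) \<partial>lborel)"
  define K where "K = ennreal ((2 * pi) ^ DIM('a) * (1 + real DIM('a)) ^ (2 * k)) * J"
  have jm: "jet l (Suc k) w \<in> borel_measurable borel" by (rule jet_borel[OF l0 Suc.prems(1)])
  have i1: "integrable lborel (jet l k w)"
  proof (rule Bochner_Integration.integrable_bound[OF Suc.prems(2)])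
    have "norm (jet l k w x) \<le> norm (jet l (Suc k) w x)" for x
      using jet_mono[OF l0, of k w x] jet_nonneg[OF l0, of k w x] unfolding real_norm_def by linarith
    then show "AE x in lborel. norm (jet l k w x) \<le> norm (jet l (Suc k) w x)" by (intro AE_I2)
  qed (use jet_borel[OF l0 C(1)] in simp)
  have i2: "integrable lborel (jet l k (dir_deriv b w))" if b: "b \<in> Basis" for b
  proof (rule Bochner_Integration.integrable_bound)
    show "integrable lborel (\<lambda>x. (1 / l) * jet l (Suc k) w x)" by (intro integrable_mult_right Suc.prems(2))
    show "AE x in lborel. norm (jet l k (dir_deriv b w) x) \<le> norm ((1 / l) * jet l (Suc k) w x)"
      using jet_dir_deriv[OF l0 b, of k w] jet_nonneg[OF l0, of k "dir_deriv b w"] jet_nonneg[OF l0, of "Suc k" w] l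
      by (auto simp: field_simps simp del: jet.simps)
  qed (use jet_borel[OF l0 C(2)[OF b]] in simp)
  have wi: "integrable lborel w" by (rule integrable_of_jet[OF l0 C(1) i1])
  have wm[measurable]: "(\<lambda>x. complex_of_real (w x)) \<in> borel_measurable borel" using integrable_borel[OF wi] by simp
  have ftd: "ft (\<lambda>x. complex_of_real (dir_deriv b w x)) \<xi> = \<i> * complex_of_real (b \<bullet> \<xi>) * ft (\<lambda>x. complex_of_real (w x)) \<xi>" if b: "b \<in> Basis" for b \<xi>
  proof (rule ft_dir_deriv)
    show "w differentiable (at x)" for x using Suc.prems(1) by simp
    show "continuous_on UNIV (dir_deriv b w)" by (rule Ck_continuous[OF C(2)[OF b]])
    show "integrable lborel (dir_deriv b w)" by (rule integrable_of_jet[OF l0 C(2)[OF b] i2[OF b]])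
  qed (rule wi)
  let ?u = "\<lambda>\<xi>. (1 + l * norm1 \<xi>) ^ k * norm (ft (\<lambda>x. complex_of_real (w x)) \<xi>)"
  let ?v = "\<lambda>b \<xi>. l * ((1 + l * norm1 \<xi>) ^ k * norm (ft (\<lambda>x. complex_of_real (dir_deriv b w x)) \<xi>))"
  have e: "(1 + l * norm1 \<xi>) ^ Suc k * norm (ft (\<lambda>x. complex_of_real (w x)) \<xi>) = ?u \<xi> + (\<Sum>b\<in>Basis. ?v b \<xi>)" for \<xi>
    by (simp add: ftd norm_mult norm1_def sum_distrib_left sum_distrib_right algebra_simps inner_commute)
  have "(\<integral>\<^sup>+\<xi>. ennreal ((?u \<xi> + (\<Sum>b\<in>Basis. ?v b \<xi>))\<^sup>2) \<partial>lborel) \<le> ennreal ((1 + real DIM('a))\<^sup>2) * K"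
  proof (rule nn_integral_sum_squares)
    show "?u \<in> borel_measurable borel" by measurable
    show "?v b \<in> borel_measurable borel" if "b \<in> Basis" for b
      using Ck_borel[OF C(2)[OF that]] by measurable
    have "(\<integral>\<^sup>+x. ennreal ((jet l k w x)\<^sup>2) \<partial>lborel) \<le> J"
      unfolding J_def by (intro nn_integral_mono ennreal_leI power_mono jet_mono jet_nonneg l0)
    then show "(\<integral>\<^sup>+\<xi>. ennreal ((?u \<xi>)\<^sup>2) \<partial>lborel) \<le> K"
      unfolding K_def by (intro order_trans[OF Suc.IH[OF C(1) i1]] mult_left_mono) auto
    show "(\<integral>\<^sup>+\<xi>. ennreal ((?v b \<xi>)\<^sup>2) \<partial>lborel) \<le> K" if b: "b \<in> Basis" for b
    proof -
      have [measurable]: "(\<lambda>x. complex_of_real (dir_deriv b w x)) \<in> borel_measurable borel" "jet l k (dir_deriv b w) \<in> borel_measurable borel"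
        using Ck_borel[OF C(2)[OF b]] jet_borel[OF l0 C(2)[OF b]] by auto
      have "(\<integral>\<^sup>+\<xi>. ennreal ((?v b \<xi>)\<^sup>2) \<partial>lborel) = ennreal (l\<^sup>2) * (\<integral>\<^sup>+\<xi>. ennreal (((1 + l * norm1 \<xi>) ^ k * norm (ft (\<lambda>x. complex_of_real (dir_deriv b w x)) \<xi>))\<^sup>2) \<partial>lborel)"
        by (subst nn_integral_cmult[symmetric]) (auto simp: power_mult_distrib ennreal_mult)
      also have "\<dots> \<le> ennreal (l\<^sup>2) * (ennreal ((2 * pi) ^ DIM('a) * (1 + real DIM('a)) ^ (2 * k)) * (\<integral>\<^sup>+x. ennreal ((jet l k (dir_deriv b w) x)\<^sup>2) \<partial>lborel))"
        by (intro mult_left_mono Suc.IH C(2) i2 b) auto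
      also have "\<dots> = ennreal ((2 * pi) ^ DIM('a) * (1 + real DIM('a)) ^ (2 * k)) * (\<integral>\<^sup>+x. ennreal ((l * jet l k (dir_deriv b w) x)\<^sup>2) \<partial>lborel)"
        by (simp add: power_mult_distrib ennreal_mult nn_integral_cmult mult.left_commute)
      also have "\<dots> \<le> K"
        unfolding K_def J_def
        by (intro mult_left_mono nn_integral_mono ennreal_leI power_mono jet_dir_deriv b l0 mult_nonneg_nonneg jet_nonneg) auto
      finally show ?thesis .
    qed
  qed
  also have "\<dots> = ennreal ((2 * pi) ^ DIM('a) * (1 + real DIM('a)) ^ (2 * Suc k)) * J"
    unfolding K_def mult.assoc[symmetric] by (subst ennreal_mult[symmetric]) (auto simp: power2_eq_square mult_ac)
  finally show ?case unfolding e J_def .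
qed

text \<open>The two normalisations leave a factor (2 pi)^(-n), which is simply estimated by
  1.\<close>

lemma ift_L2_le:
  fixes m :: "'a::euclidean_space \<Rightarrow> complex"
  assumes m: "integrable lborel m"
  shows "(\<integral>\<^sup>+x. ennreal ((norm (ift m x))\<^sup>2) \<partial>lborel) \<le> (\<integral>\<^sup>+\<xi>. ennreal ((norm (m \<xi>))\<^sup>2) \<partial>lborel)"
proof -
  let ?P = "(2 * pi) ^ DIM('a)"
  note [measurable] = integrable_borel[OF m]
  have "(\<integral>\<^sup>+x. ennreal ((norm (ift m x))\<^sup>2) \<partial>lborel) = (\<integral>\<^sup>+x. ennreal (1 / ?P\<^sup>2) * ennreal ((norm (ft m (0 + (-1) *\<^sub>R x)))\<^sup>2) \<partial>lborel)"
    by (intro nn_integral_cong) (simp add: ift_def norm_divide norm_power norm_mult power_divide flip: ennreal_mult)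
  also have "\<dots> = ennreal (1 / ?P\<^sup>2) * (\<integral>\<^sup>+x. ennreal ((norm (ft m x))\<^sup>2) \<partial>lborel)"
    by (subst nn_integral_lborel_affine[of "-1" "\<lambda>x. ennreal ((norm (ft m x))\<^sup>2)" 0]) (auto simp: nn_integral_cmult)
  also have "\<dots> \<le> ennreal (1 / ?P\<^sup>2) * (ennreal ?P * (\<integral>\<^sup>+\<xi>. ennreal ((norm (m \<xi>))\<^sup>2) \<partial>lborel))"
    by (intro mult_left_mono ft_L2_le m) auto
  also have "\<dots> = ennreal (1 / ?P) * (\<integral>\<^sup>+\<xi>. ennreal ((norm (m \<xi>))\<^sup>2) \<partial>lborel)"
    unfolding mult.assoc[symmetric] by (subst ennreal_mult[symmetric]) (auto simp: power2_eq_square)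
  also have "\<dots> \<le> 1 * (\<integral>\<^sup>+\<xi>. ennreal ((norm (m \<xi>))\<^sup>2) \<partial>lborel)"
  proof (intro mult_right_mono)
    have "1 \<le> ?P" by (rule one_le_power) (use pi_ge_two in linarith)
    then show "ennreal (1 / ?P) \<le> 1" by (subst ennreal_1[symmetric], intro ennreal_leI) simp
  qed auto
  finally show ?thesis by simp
qed

text \<open>The counterpart of \<open>ft_jet_L2\<close>, used for analysis: derivatives of an
  inverse transform are again inverse transforms, so the induction runs on the symbol.\<close>

lemma jet_ift_L2:
  fixes m :: "'a::euclidean_space \<Rightarrow> complex"
  assumes l: "l \<ge> 0"
  shows "rapid m \<Longrightarrow> (\<integral>\<^sup>+x. ennreal ((jet l k (\<lambda>x. Re (ift m x)) x)\<^sup>2) \<partial>lborel) \<le>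
     ennreal ((1 + real DIM('a)) ^ (2 * k)) * (\<integral>\<^sup>+\<xi>. ennreal (((1 + l * norm1 \<xi>) ^ k * norm (m \<xi>))\<^sup>2) \<partial>lborel)"
proof (induction k arbitrary: m)
  case 0
  have "(\<integral>\<^sup>+x. ennreal (\<bar>Re (ift m x)\<bar>\<^sup>2) \<partial>lborel) \<le> (\<integral>\<^sup>+x. ennreal ((norm (ift m x))\<^sup>2) \<partial>lborel)"
    by (intro nn_integral_mono ennreal_leI power_mono abs_Re_le_cmod) auto
  also note ift_L2_le[OF rapid_integrable[OF 0]]
  finally show ?case by simp
next
  case (Suc k)
  note [measurable] = rapid_borel[OF Suc.prems]
  let ?mb = "\<lambda>b \<xi>. \<i> * complex_of_real (\<xi> \<bullet> b) * m \<xi>"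
  have rb: "rapid (?mb b)" for b by (rule rapid_mult_coord[OF Suc.prems])
  define J where "J = (\<integral>\<^sup>+\<xi>. ennreal (((1 + l * norm1 \<xi>) ^ Suc k * norm (m \<xi>))\<^sup>2) \<partial>lborel)"
  define K where "K = ennreal ((1 + real DIM('a)) ^ (2 * k)) * J"
  have pw: "1 \<le> (1 + l * norm1 \<xi>) ^ k" for \<xi> :: 'a using l norm1_nonneg[of \<xi>] by (intro one_le_power) auto
  have "(\<integral>\<^sup>+x. ennreal ((jet l k (\<lambda>x. Re (ift m x)) x + (\<Sum>b\<in>Basis. l * jet l k (\<lambda>x. Re (ift (?mb b) x)) x))\<^sup>2) \<partial>lborel) \<le> ennreal ((1 + real DIM('a))\<^sup>2) * K"
  proof (rule nn_integral_sum_squares)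
    show "jet l k (\<lambda>x. Re (ift m x)) \<in> borel_measurable borel" by (intro jet_borel l Ck_Re_ift Suc.prems)
    show "(\<lambda>x. l * jet l k (\<lambda>x. Re (ift (?mb b) x)) x) \<in> borel_measurable borel" for b
      by (intro borel_measurable_times borel_measurable_const jet_borel l Ck_Re_ift rb)
    have "(\<integral>\<^sup>+\<xi>. ennreal (((1 + l * norm1 \<xi>) ^ k * norm (m \<xi>))\<^sup>2) \<partial>lborel) \<le> J"
      unfolding J_def using l norm1_nonneg
      by (intro nn_integral_mono ennreal_leI power_mono mult_right_mono power_increasing)
        (auto intro!: mult_nonneg_nonneg zero_le_power add_nonneg_nonneg)
    then show "(\<integral>\<^sup>+x. ennreal ((jet l k (\<lambda>x. Re (ift m x)) x)\<^sup>2) \<partial>lborel) \<le> K"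
      unfolding K_def by (intro order_trans[OF Suc.IH[OF Suc.prems]] mult_left_mono) auto
    show "(\<integral>\<^sup>+x. ennreal ((l * jet l k (\<lambda>x. Re (ift (?mb b) x)) x)\<^sup>2) \<partial>lborel) \<le> K" if b: "b \<in> Basis" for b
    proof -
      have [measurable]: "jet l k (\<lambda>x. Re (ift (?mb b) x)) \<in> borel_measurable borel" by (intro jet_borel l Ck_Re_ift rb)
      have "(\<integral>\<^sup>+x. ennreal ((l * jet l k (\<lambda>x. Re (ift (?mb b) x)) x)\<^sup>2) \<partial>lborel) = ennreal (l\<^sup>2) * (\<integral>\<^sup>+x. ennreal ((jet l k (\<lambda>x. Re (ift (?mb b) x)) x)\<^sup>2) \<partial>lborel)"
        by (simp add: power_mult_distrib ennreal_mult nn_integral_cmult)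
      also have "\<dots> \<le> ennreal (l\<^sup>2) * (ennreal ((1 + real DIM('a)) ^ (2 * k)) * (\<integral>\<^sup>+\<xi>. ennreal (((1 + l * norm1 \<xi>) ^ k * norm (?mb b \<xi>))\<^sup>2) \<partial>lborel))"
        by (intro mult_left_mono Suc.IH rb) auto
      also have "\<dots> = ennreal ((1 + real DIM('a)) ^ (2 * k)) * (\<integral>\<^sup>+\<xi>. ennreal ((l * ((1 + l * norm1 \<xi>) ^ k * norm (?mb b \<xi>)))\<^sup>2) \<partial>lborel)"
        by (subst power_mult_distrib[of l]) (simp add: ennreal_mult nn_integral_cmult mult.left_commute)
      also have "\<dots> \<le> K"
        unfolding K_def J_def
      proof (intro mult_left_mono nn_integral_mono ennreal_leI power_mono)
        fix \<xi> :: 'a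
        have "\<bar>\<xi> \<bullet> b\<bar> \<le> norm1 \<xi>" unfolding norm1_def using b by (intro member_le_sum) auto
        then have "l * \<bar>\<xi> \<bullet> b\<bar> \<le> 1 + l * norm1 \<xi>" using l mult_left_mono[of "\<bar>\<xi> \<bullet> b\<bar>" "norm1 \<xi>" l] by linarith
        then have "(l * \<bar>\<xi> \<bullet> b\<bar>) * ((1 + l * norm1 \<xi>) ^ k * norm (m \<xi>)) \<le> (1 + l * norm1 \<xi>) * ((1 + l * norm1 \<xi>) ^ k * norm (m \<xi>))"
          using pw[of \<xi>] by (intro mult_right_mono mult_nonneg_nonneg) auto
        then show "l * ((1 + l * norm1 \<xi>) ^ k * norm (?mb b \<xi>)) \<le> (1 + l * norm1 \<xi>) ^ Suc k * norm (m \<xi>)"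
          by (simp add: norm_mult mult_ac)
        show "0 \<le> l * ((1 + l * norm1 \<xi>) ^ k * norm (?mb b \<xi>))"
          using pw[of \<xi>] l by (intro mult_nonneg_nonneg) auto
      qed auto
      finally show ?thesis .
    qed
  qed
  also have "\<dots> = ennreal ((1 + real DIM('a)) ^ (2 * Suc k)) * J"
    unfolding K_def mult.assoc[symmetric] by (subst ennreal_mult[symmetric]) (auto simp: power2_eq_square mult.assoc)
  finally have main: "(\<integral>\<^sup>+x. ennreal ((jet l k (\<lambda>x. Re (ift m x)) x + (\<Sum>b\<in>Basis. l * jet l k (\<lambda>x. Re (ift (?mb b) x)) x))\<^sup>2) \<partial>lborel)
     \<le> ennreal ((1 + real DIM('a)) ^ (2 * Suc k)) * J" .
  \<comment> \<open>The recursion of \<open>jet\<close> starts with the absolute value of the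
    function. It is enlarged to its jet of order k, which gives the form to which the estimate
    \<open>main\<close> applies.\<close>
  have "(\<integral>\<^sup>+x. ennreal ((jet l (Suc k) (\<lambda>x. Re (ift m x)) x)\<^sup>2) \<partial>lborel) \<le>
    (\<integral>\<^sup>+x. ennreal ((jet l k (\<lambda>x. Re (ift m x)) x + (\<Sum>b\<in>Basis. l * jet l k (\<lambda>x. Re (ift (?mb b) x)) x))\<^sup>2) \<partial>lborel)"
  proof (intro nn_integral_mono ennreal_leI power_mono jet_nonneg l)
    fix x
    have "\<bar>Re (ift m x)\<bar> \<le> jet l k (\<lambda>x. Re (ift m x)) x" by (rule jet_ge_abs[OF l])
    then show "jet l (Suc k) (\<lambda>x. Re (ift m x)) x \<le> jet l k (\<lambda>x. Re (ift m x)) x + (\<Sum>b\<in>Basis. l * jet l k (\<lambda>x. Re (ift (?mb b) x)) x)"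
      by (simp add: dir_deriv_Re_ift[OF Suc.prems] sum_distrib_left)
  qed
  with main show ?case unfolding J_def by (rule order_trans[rotated])
qed

section \<open>Littlewood--Paley approximation\<close>

text \<open>The L1 counterpart of \<open>jet\<close> for the kernel \<open>ift m\<close>, with every
  derivative written as multiplication of the symbol. By Young's inequality it bounds the jets of a
  convolution with that kernel.\<close>

primrec kern_norm :: "real \<Rightarrow> nat \<Rightarrow> ('a::euclidean_space \<Rightarrow> complex) \<Rightarrow> real" where
  "kern_norm l 0 m = (LINT x|lborel. norm (ift m x))"
| "kern_norm l (Suc k) m = (LINT x|lborel. norm (ift m x)) + l * (\<Sum>b\<in>Basis. kern_norm l k (\<lambda>\<xi>. \<i> * complex_of_real (\<xi> \<bullet> b) * m \<xi>))"

lemma kern_norm_nonneg: "l \<ge> 0 \<Longrightarrow> kern_norm l k m \<ge> 0"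
  by (induction k arbitrary: m) (auto intro!: add_nonneg_nonneg mult_nonneg_nonneg sum_nonneg)

lemma kern_norm_cmult: "kern_norm l k (\<lambda>\<xi>. z * m \<xi>) = norm z * kern_norm l k m"
proof (induction k arbitrary: m)
  case (Suc k)
  have "(\<lambda>\<xi>. \<i> * complex_of_real (\<xi> \<bullet> b) * (z * m \<xi>)) = (\<lambda>\<xi>. z * (\<i> * complex_of_real (\<xi> \<bullet> b) * m \<xi>))" for b
    by (simp add: mult_ac)
  then have e: "kern_norm l k (\<lambda>\<xi>. \<i> * complex_of_real (\<xi> \<bullet> b) * (z * m \<xi>)) = norm z * kern_norm l k (\<lambda>\<xi>. \<i> * complex_of_real (\<xi> \<bullet> b) * m \<xi>)" for b
    using Suc.IH[of "\<lambda>\<xi>. \<i> * complex_of_real (\<xi> \<bullet> b) * m \<xi>"] by simp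
  show ?case unfolding kern_norm.simps(2) e ift_cmult
    by (simp add: norm_mult distrib_left sum_distrib_left[symmetric] mult.left_commute)
qed (simp add: ift_cmult norm_mult)

lemma kern_norm_mono: "0 \<le> l \<Longrightarrow> l \<le> l' \<Longrightarrow> kern_norm l k m \<le> kern_norm l' k m"
proof (induction k arbitrary: m)
  case (Suc k)
  then show ?case by (auto intro!: mult_mono sum_mono sum_nonneg kern_norm_nonneg)
qed simp

lemma integral_norm_ift_scale:
  fixes m :: "'a::euclidean_space \<Rightarrow> complex"
  assumes "c > 0" and [measurable]: "m \<in> borel_measurable borel"
  shows "(LINT x|lborel. norm (ift (\<lambda>\<xi>. m (\<xi> /\<^sub>R c)) x)) = (LINT x|lborel. norm (ift m x))"
proof -
  have "(LINT x|lborel. norm (ift (\<lambda>\<xi>. m (\<xi> /\<^sub>R c)) x)) = (LINT x|lborel. c ^ DIM('a) * norm (ift m (0 + c *\<^sub>R x)))"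
    using assms(1) by (simp add: ift_scale[OF assms] norm_mult norm_power)
  also have "\<dots> = (LINT x|lborel. norm (ift m x))"
    using assms(1) by (subst integral_lborel_affine[of c "\<lambda>x. norm (ift m x)" 0]) auto
  finally show ?thesis .
qed

text \<open>The dilation in the symbol is an L1-preserving dilation of the kernel, so the scale
  survives only in the unit in which derivatives are measured.\<close>

lemma kern_norm_scale:
  fixes m :: "'a::euclidean_space \<Rightarrow> complex"
  assumes "c > 0"
  shows "m \<in> borel_measurable borel \<Longrightarrow> kern_norm l k (\<lambda>\<xi>. m (\<xi> /\<^sub>R c)) = kern_norm (l * c) k m"
proof (induction k arbitrary: m)
  case (Suc k)
  note [measurable] = Suc.prems
  have "kern_norm l k (\<lambda>\<xi>. \<i> * complex_of_real (\<xi> \<bullet> b) * m (\<xi> /\<^sub>R c)) = c * kern_norm (l * c) k (\<lambda>\<xi>. \<i> * complex_of_real (\<xi> \<bullet> b) * m \<xi>)" for b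
  proof -
    have "(\<lambda>\<xi>. \<i> * complex_of_real (\<xi> \<bullet> b) * m (\<xi> /\<^sub>R c)) = (\<lambda>\<xi>. complex_of_real c * (\<i> * complex_of_real ((\<xi> /\<^sub>R c) \<bullet> b) * m (\<xi> /\<^sub>R c)))"
      using assms by (auto simp: fun_eq_iff)
    then have "kern_norm l k (\<lambda>\<xi>. \<i> * complex_of_real (\<xi> \<bullet> b) * m (\<xi> /\<^sub>R c)) = c * kern_norm l k (\<lambda>\<xi>. \<i> * complex_of_real ((\<xi> /\<^sub>R c) \<bullet> b) * m (\<xi> /\<^sub>R c))"
      using assms by (simp only: kern_norm_cmult) simp
    also have "kern_norm l k (\<lambda>\<xi>. \<i> * complex_of_real ((\<xi> /\<^sub>R c) \<bullet> b) * m (\<xi> /\<^sub>R c)) = kern_norm (l * c) k (\<lambda>\<xi>. \<i> * complex_of_real (\<xi> \<bullet> b) * m \<xi>)"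
      by (rule Suc.IH[of "\<lambda>\<xi>. \<i> * complex_of_real (\<xi> \<bullet> b) * m \<xi>"]) measurable
    finally show ?thesis .
  qed
  then show ?case
    using integral_norm_ift_scale[OF assms Suc.prems] by (simp add: sum_distrib_left mult.assoc)
qed (use integral_norm_ift_scale[OF assms] in auto)

lemma poly_gauss_mult_coord: "poly_gauss t 0 m \<Longrightarrow> poly_gauss t 0 (\<lambda>\<xi>. \<i> * complex_of_real (\<xi> \<bullet> b) * m \<xi>)"
  using poly_gauss.cmult[OF poly_gauss.coord[of t 0 m b], of \<i>] by (simp add: mult.assoc)

section \<open>Gaussian multipliers and the approximating operators\<close>

lemma integrable_convolution:
  fixes f g :: "'a::euclidean_space \<Rightarrow> complex"
  assumes f: "integrable lborel f" and g: "integrable lborel g"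
  shows "integrable lborel (\<lambda>x. LINT y|lborel. f y * g (x - y))"
proof -
  note [measurable] = integrable_borel[OF f] integrable_borel[OF g]
  have int: "integrable (lborel \<Otimes>\<^sub>M lborel) (\<lambda>(y, x). f y * g (x - y))"
  proof (rule lborel_pair.Fubini_integrable)
    show "(\<lambda>(y, x). f y * g (x - y)) \<in> borel_measurable (lborel \<Otimes>\<^sub>M lborel)" by measurable
    have "(LINT x|lborel. norm (g (x - y))) = (LINT x|lborel. norm (g x))" for y
      using integral_lborel_affine[of 1 "\<lambda>x. norm (g x)" "- y"] by (simp add: algebra_simps)
    then show "integrable lborel (\<lambda>y. LINT x|lborel. norm (case (y, x) of (y, x) \<Rightarrow> f y * g (x - y)))"
      using f by (simp add: norm_mult)
    have "integrable lborel (\<lambda>x. g (x - y))" for y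
      using integrable_lborel_affine[of 1 g "- y"] g by (simp add: algebra_simps)
    then show "AE y in lborel. integrable lborel (\<lambda>x. case (y, x) of (y, x) \<Rightarrow> f y * g (x - y))" by simp
  qed
  from lborel_pair.integrable_snd[OF int] show ?thesis by simp
qed

context
  fixes f :: "'a::euclidean_space \<Rightarrow> real" and M :: real
  assumes f: "integrable lborel f" and M: "\<And>x. \<bar>f x\<bar> \<le> M"
begin

abbreviation (input) "ftf \<equiv> ft (\<lambda>x. complex_of_real (f x))"

lemma rapid_mult_ft: "rapid m \<Longrightarrow> rapid (\<lambda>\<xi>. m \<xi> * ftf \<xi>)"
  using f integrable_borel[OF f]
  by (intro rapid_mult_bounded[where B="LINT x|lborel. norm (complex_of_real (f x))"] norm_ft_le borel_measurable_ft) auto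

lemma abs_Re_ift_le:
  assumes "poly_gauss t 0 m" "t > 0"
  shows "\<bar>Re (ift (\<lambda>\<xi>. m \<xi> * ftf \<xi>) x)\<bar> \<le> M * (LINT x|lborel. norm (ift m x))"
proof -
  have im: "integrable lborel (ift m)" using poly_gauss_integrable[OF poly_gauss_ift[OF assms]] assms(2) by simp
  note [measurable] = integrable_borel[OF im] integrable_borel[OF f]
  have sh: "integrable lborel (\<lambda>y. ift m (x - y))"
    using integrable_lborel_affine[of "-1" "ift m" x] im by simp
  have "norm (ift (\<lambda>\<xi>. m \<xi> * ftf \<xi>) x) = norm (LINT y|lborel. complex_of_real (f y) * ift m (x - y))"
    using ift_conv[of "\<lambda>x. complex_of_real (f x)" m x] f poly_gauss_integrable[OF assms] by simp
  also have "\<dots> \<le> (LINT y|lborel. M * norm (ift m (x - y)))"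
    by (rule Bochner_Integration.integral_norm_bound_integral)
      (use sh M in \<open>auto intro!: integrable_bounded_mult[OF sh, of _ M] mult_right_mono simp: norm_mult\<close>)
  also have "\<dots> = M * (LINT x|lborel. norm (ift m x))"
    using integral_lborel_affine[of "-1" "\<lambda>x. norm (ift m x)" x] by simp
  finally show ?thesis using abs_Re_le_cmod order_trans by blast
qed

lemma dir_deriv_Re_ift_mult:
  assumes "rapid m"
  shows "dir_deriv b (\<lambda>x. Re (ift (\<lambda>\<xi>. m \<xi> * ftf \<xi>) x)) = (\<lambda>x. Re (ift (\<lambda>\<xi>. (\<i> * complex_of_real (\<xi> \<bullet> b) * m \<xi>) * ftf \<xi>) x))"
  unfolding dir_deriv_Re_ift(1)[OF rapid_mult_ft[OF assms]] by (simp add: mult.assoc)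

text \<open>A Bernstein inequality: all derivatives fall on the kernel, so \<open>f\<close> enters
  through its sup norm alone.\<close>

lemma jet_Re_ift_le:
  assumes "l \<ge> 0" "t > 0"
  shows "poly_gauss t 0 m \<Longrightarrow> jet l k (\<lambda>x. Re (ift (\<lambda>\<xi>. m \<xi> * ftf \<xi>) x)) x \<le> M * kern_norm l k m"
proof (induction k arbitrary: m)
  case 0
  then show ?case using abs_Re_ift_le[OF _ assms(2)] by simp
next
  case (Suc k)
  have "(\<Sum>b\<in>Basis. jet l k (dir_deriv b (\<lambda>x. Re (ift (\<lambda>\<xi>. m \<xi> * ftf \<xi>) x))) x) \<le> (\<Sum>b\<in>Basis. M * kern_norm l k (\<lambda>\<xi>. \<i> * complex_of_real (\<xi> \<bullet> b) * m \<xi>))"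
    unfolding dir_deriv_Re_ift_mult[OF poly_gauss_rapid[OF Suc.prems assms(2)]]
    by (intro sum_mono Suc.IH poly_gauss_mult_coord Suc.prems)
  from mult_left_mono[OF this assms(1)] abs_Re_ift_le[OF Suc.prems assms(2), of x]
  show ?case by (simp add: distrib_left sum_distrib_left mult.left_commute)
qed

lemma integrable_jet_Re_ift:
  assumes "l \<ge> 0" "t > 0"
  shows "poly_gauss t 0 m \<Longrightarrow> integrable lborel (jet l k (\<lambda>x. Re (ift (\<lambda>\<xi>. m \<xi> * ftf \<xi>) x)))"
proof (induction k arbitrary: m)
  have base: "integrable lborel (\<lambda>x. \<bar>Re (ift (\<lambda>\<xi>. m \<xi> * ftf \<xi>) x)\<bar>)" if m: "poly_gauss t 0 m" for m
  proof -
    have im: "integrable lborel (ift m)" using poly_gauss_integrable[OF poly_gauss_ift[OF m assms(2)]] assms(2) by simp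
    have "integrable lborel (\<lambda>x. complex_of_real (f x))" using f by simp
    moreover have "ift (\<lambda>\<xi>. m \<xi> * ftf \<xi>) = (\<lambda>x. LINT y|lborel. complex_of_real (f y) * ift m (x - y))"
      using f poly_gauss_integrable[OF m assms(2)] by (intro ext ift_conv) auto
    ultimately have "integrable lborel (ift (\<lambda>\<xi>. m \<xi> * ftf \<xi>))"
      using integrable_convolution[OF _ im] by simp
    then show ?thesis by (intro integrable_abs integrable_Re)
  qed
  case 0
  then show ?case using base[of m] by (simp add: jet.simps(1)[abs_def])
  case (Suc k)
  have "integrable lborel (\<lambda>x. \<bar>Re (ift (\<lambda>\<xi>. m \<xi> * ftf \<xi>) x)\<bar> + l * (\<Sum>b\<in>Basis. jet l k (dir_deriv b (\<lambda>x. Re (ift (\<lambda>\<xi>. m \<xi> * ftf \<xi>) x))) x))"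
    unfolding dir_deriv_Re_ift_mult[OF poly_gauss_rapid[OF Suc.prems assms(2)]]
    by (intro Bochner_Integration.integrable_add integrable_mult_right Bochner_Integration.integrable_sum Suc.IH poly_gauss_mult_coord Suc.prems base)
  then show ?case by (simp add: jet.simps(2)[abs_def])
qed

end

text \<open>For j > 0, the coefficient of g^j in 1 - (1 - g)^N. Since that polynomial has no
  constant term, the approximations are combinations of honest Gaussian means; the value at g = 1
  shows that the coefficients sum to 1.\<close>

definition lp_coeff :: "nat \<Rightarrow> nat \<Rightarrow> real" where "lp_coeff N j = - (real (N choose j) * (- 1) ^ j)"

text \<open>Index \<open>Suc i\<close> belongs to the frequency scale 2^i. Index 0 is the zero
  operator and not a first low-pass filter, so telescoping sums start from the zero function. A
  power of a Gaussian is a Gaussian, which keeps every symbol a finite combination of them.\<close>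

fun lp_symbol :: "nat \<Rightarrow> nat \<Rightarrow> 'a::euclidean_space \<Rightarrow> real" where
  "lp_symbol N 0 \<xi> = 0"
| "lp_symbol N (Suc i) \<xi> = 1 - (1 - gauss (1 / 4 ^ i) \<xi>) ^ N"

lemma lp_expand: "1 - (1 - g) ^ N = (\<Sum>j\<in>{1..N}. lp_coeff N j * g ^ j)" for g :: real
proof -
  have "(1 - g) ^ N = (- g + 1) ^ N" by simp
  also have "\<dots> = (\<Sum>j\<le>N. real (N choose j) * (- g) ^ j * 1 ^ (N - j))" by (rule binomial_ring)
  also have "\<dots> = 1 + (\<Sum>j\<in>{1..N}. real (N choose j) * (- g) ^ j)"
    by (simp add: atMost_atLeast0 sum.atLeast_Suc_atMost)
  finally show ?thesis by (simp add: lp_coeff_def sum_negf[symmetric] power_minus[of g] mult.assoc)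
qed

lemma sum_lp_coeff: "N > 0 \<Longrightarrow> (\<Sum>j\<in>{1..N}. lp_coeff N j) = 1"
  using lp_expand[of 1 N] by (simp add: power_0_left)

lemma gauss_power: "gauss a \<xi> ^ j = gauss (real j * a) \<xi>"
  by (simp add: gauss_def mult_ac flip: exp_of_nat_mult)

lemma lp_symbol_Suc: "lp_symbol N (Suc i) \<xi> = (\<Sum>j\<in>{1..N}. lp_coeff N j * gauss (real j / 4 ^ i) \<xi>)"
  by (simp add: lp_expand gauss_power)

definition lp_approx :: "nat \<Rightarrow> nat \<Rightarrow> ('a::euclidean_space \<Rightarrow> real) \<Rightarrow> 'a \<Rightarrow> real" where
  "lp_approx N i f x = Re (ift (\<lambda>\<xi>. complex_of_real (lp_symbol N i \<xi>) * ft (\<lambda>x. complex_of_real (f x)) \<xi>) x)"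

lemma poly_gauss_gauss: "poly_gauss a 0 (\<lambda>\<xi>. complex_of_real (gauss a \<xi>))"
  using poly_gauss.gauss[of a 0] by simp

lemma rapid_lp_symbol: "rapid (\<lambda>\<xi>. complex_of_real (lp_symbol N i \<xi>))"
proof (cases i)
  case (Suc j)
  have "rapid (\<lambda>\<xi>. \<Sum>k\<in>{1..N}. complex_of_real (lp_coeff N k) * complex_of_real (gauss (real k / 4 ^ j) \<xi>))"
    by (intro rapid_sum rapid_cmult rapid_gauss) auto
  then show ?thesis unfolding Suc lp_symbol_Suc by simp
qed (simp add: rapid_0)

lemma lp_approx_0 [simp]: "lp_approx N 0 f = (\<lambda>x. 0)"
  by (simp add: lp_approx_def[abs_def] ift_def ft_def)

context
  fixes f :: "'a::euclidean_space \<Rightarrow> real" and M :: real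
  assumes f: "integrable lborel f" and M: "\<And>x. \<bar>f x\<bar> \<le> M"
begin

abbreviation (input) "gm k i \<equiv> (\<lambda>x. Re (ift (\<lambda>\<xi>. complex_of_real (gauss (real k / 4 ^ i) \<xi>) * ft (\<lambda>x. complex_of_real (f x)) \<xi>) x))"

lemma lp_approx_Suc: "lp_approx N (Suc i) f = (\<lambda>x. \<Sum>k\<in>{1..N}. lp_coeff N k * gm k i x)"
proof
  fix x
  let ?F = "ft (\<lambda>x. complex_of_real (f x))"
  have r: "rapid (\<lambda>\<xi>. complex_of_real (lp_coeff N k) * (complex_of_real (gauss (real k / 4 ^ i) \<xi>) * ?F \<xi>))" if "k \<in> {1..N}" for k
    using that by (intro rapid_cmult rapid_mult_ft[OF f M] rapid_gauss) auto
  have "ift (\<lambda>\<xi>. \<Sum>k\<in>A. complex_of_real (lp_coeff N k) * (complex_of_real (gauss (real k / 4 ^ i) \<xi>) * ?F \<xi>)) x =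
     (\<Sum>k\<in>A. complex_of_real (lp_coeff N k) * ift (\<lambda>\<xi>. complex_of_real (gauss (real k / 4 ^ i) \<xi>) * ?F \<xi>) x)" if "A \<subseteq> {1..N}" for A
    using finite_subset[OF that finite_atLeastAtMost] that
  proof (induction A rule: finite_induct)
    case empty
    then show ?case by (simp add: ift_def ft_def)
  next
    case (insert a A)
    then show ?case
      using r rapid_integrable[OF r[of a]] rapid_integrable[OF rapid_sum[OF insert(1), of "\<lambda>k \<xi>. complex_of_real (lp_coeff N k) * (complex_of_real (gauss (real k / 4 ^ i) \<xi>) * ?F \<xi>)"]]
      by (subst sum.insert) (auto simp: ift_add ift_cmult subset_eq)
  qed
  from this[of "{1..N}"] show "lp_approx N (Suc i) f x = (\<Sum>k\<in>{1..N}. lp_coeff N k * gm k i x)"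
    unfolding lp_approx_def lp_symbol_Suc by (simp add: sum_distrib_right mult.assoc)
qed

lemma rapid_lp: "rapid (\<lambda>\<xi>. complex_of_real (lp_symbol N i \<xi>) * ft (\<lambda>x. complex_of_real (f x)) \<xi>)"
  by (rule rapid_mult_ft[OF f M rapid_lp_symbol])

lemma Ck_lp_approx: "Ck k (lp_approx N i f)"
  unfolding lp_approx_def[abs_def] by (rule Ck_Re_ift[OF rapid_lp])

lemma jet_lp_approx_le_sum:
  assumes "l \<ge> 0"
  shows "jet l n (lp_approx N (Suc i) f) x \<le> (\<Sum>k\<in>{1..N}. \<bar>lp_coeff N k\<bar> * jet l n (gm k i) x)"
proof -
  have C: "Ck n (gm k i)" if "k \<in> {1..N}" for k
    using that by (intro Ck_Re_ift rapid_mult_ft[OF f M] rapid_gauss) auto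
  have "jet l n (lp_approx N (Suc i) f) x \<le> (\<Sum>k\<in>{1..N}. jet l n (\<lambda>x. lp_coeff N k * gm k i x) x)"
    unfolding lp_approx_Suc using C by (intro jet_sum assms Ck_mult) auto
  also have "\<dots> = (\<Sum>k\<in>{1..N}. \<bar>lp_coeff N k\<bar> * jet l n (gm k i) x)"
    by (intro sum.cong refl jet_cmult assms C)
  finally show ?thesis .
qed

lemma integrable_jet_lp_approx:
  assumes "l \<ge> 0"
  shows "integrable lborel (jet l n (lp_approx N i f))"
proof (cases i)
  case 0
  have "jet l n (\<lambda>x::'a. 0) = (\<lambda>x. 0)" using jet_zero[OF assms] by auto
  then show ?thesis using 0 by simp
next
  case (Suc j)
  show ?thesis
  proof (rule Bochner_Integration.integrable_bound)
    show "integrable lborel (\<lambda>x. \<Sum>k\<in>{1..N}. \<bar>lp_coeff N k\<bar> * jet l n (gm k j) x)"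
      by (intro Bochner_Integration.integrable_sum integrable_mult_right integrable_jet_Re_ift[OF f M assms _ poly_gauss_gauss]) auto
    show "jet l n (lp_approx N i f) \<in> borel_measurable lborel" using jet_borel[OF assms Ck_lp_approx] by simp
    show "AE x in lborel. norm (jet l n (lp_approx N i f) x) \<le> norm (\<Sum>k\<in>{1..N}. \<bar>lp_coeff N k\<bar> * jet l n (gm k j) x)"
    proof (rule AE_I2)
      fix x
      show "norm (jet l n (lp_approx N i f) x) \<le> norm (\<Sum>k\<in>{1..N}. \<bar>lp_coeff N k\<bar> * jet l n (gm k j) x)"
        using jet_lp_approx_le_sum[OF assms, of n N j x] jet_nonneg[OF assms, of n "lp_approx N i f" x]
        unfolding Suc real_norm_def by linarith
    qed
  qed
qed

text \<open>By \<open>kern_norm_scale\<close> the kernels of scale 2^i have, in units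
  \<open>l\<close>, the derivative norms of scale 1 in units l * 2^i <= 1. Hence the bound is the
  same for all i.\<close>

lemma jet_lp_approx_le:
  assumes "l \<ge> 0" "l * 2 ^ i \<le> 1"
  shows "jet l n (lp_approx N (Suc i) f) x \<le> M * (\<Sum>k\<in>{1..N}. \<bar>lp_coeff N k\<bar> * kern_norm 1 n (\<lambda>\<xi>::'a. complex_of_real (gauss (real k) \<xi>)))"
proof -
  have M0: "M \<ge> 0" using M[of 0] by linarith
  have "jet l n (gm k i) x \<le> M * kern_norm 1 n (\<lambda>\<xi>::'a. complex_of_real (gauss (real k) \<xi>))" if k: "k \<in> {1..N}" for k
  proof -
    have "jet l n (gm k i) x \<le> M * kern_norm l n (\<lambda>\<xi>::'a. complex_of_real (gauss (real k / 4 ^ i) \<xi>))"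
      using k by (intro jet_Re_ift_le[OF f M assms(1) _ poly_gauss_gauss]) auto
    also have ke: "kern_norm l n (\<lambda>\<xi>::'a. complex_of_real (gauss (real k / 4 ^ i) \<xi>)) = kern_norm (l * 2 ^ i) n (\<lambda>\<xi>::'a. complex_of_real (gauss (real k) \<xi>))"
    proof -
      have "(\<lambda>\<xi>::'a. complex_of_real (gauss (real k / 4 ^ i) \<xi>)) = (\<lambda>\<xi>. complex_of_real (gauss (real k) (\<xi> /\<^sub>R 2 ^ i)))"
        using gauss_scale[where c="2 ^ i" and a="real k" and 'a='a] by (simp add: power2_eq_square flip: power_mult_distrib)
      then show ?thesis using kern_norm_scale[of "2 ^ i" "\<lambda>\<xi>::'a. complex_of_real (gauss (real k) \<xi>)" l n] by simp
    qed
    also have "kern_norm (l * 2 ^ i) n (\<lambda>\<xi>::'a. complex_of_real (gauss (real k) \<xi>)) \<le> kern_norm 1 n (\<lambda>\<xi>::'a. complex_of_real (gauss (real k) \<xi>))"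
      using assms by (intro kern_norm_mono) auto
    finally show ?thesis using M0 by (simp add: mult_left_mono)
  qed
  then have "(\<Sum>k\<in>{1..N}. \<bar>lp_coeff N k\<bar> * jet l n (gm k i) x) \<le> (\<Sum>k\<in>{1..N}. \<bar>lp_coeff N k\<bar> * (M * kern_norm 1 n (\<lambda>\<xi>::'a. complex_of_real (gauss (real k) \<xi>))))"
    by (intro sum_mono mult_left_mono) auto
  with jet_lp_approx_le_sum[OF assms(1), of n N i x] show ?thesis
    by (simp add: sum_distrib_left mult_ac)
qed

text \<open>Because the coefficients sum to 1, the error is the same combination of the errors of
  the Gaussian means with parameters 1 to N, each of which tends to 0 by
  \<open>gauss_mean_tendsto_L1\<close>.\<close>

lemma lp_approx_tendsto_L1:
  assumes N: "N > 0" and R: "\<And>x. norm x > R \<Longrightarrow> f x = 0"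
  shows "(\<lambda>i. \<integral>\<^sup>+x. ennreal \<bar>lp_approx N i f x - f x\<bar> \<partial>lborel) \<longlonglongrightarrow> 0"
proof -
  note [measurable] = integrable_borel[OF f]
  have gmm: "gm k i \<in> borel_measurable borel" if "k \<in> {1..N}" for k i
    using that by (intro Ck_borel[of 0] Ck_Re_ift rapid_mult_ft[OF f M] rapid_gauss) auto
  let ?a = "\<lambda>k i. \<integral>\<^sup>+x. ennreal \<bar>gm k i x - f x\<bar> \<partial>lborel"
  have "(\<lambda>i. \<Sum>k\<in>{1..N}. ennreal \<bar>lp_coeff N k\<bar> * ?a k i) \<longlonglongrightarrow> (\<Sum>k\<in>{1..N}. ennreal \<bar>lp_coeff N k\<bar> * 0)"
  proof (intro tendsto_sum ennreal_tendsto_cmult)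
    fix k assume "k \<in> {1..N}"
    then show "(\<lambda>i. ?a k i) \<longlonglongrightarrow> 0"
      using M R by (intro gauss_mean_tendsto_L1[of f M R] f) auto
  qed auto
  then have lim: "(\<lambda>i. \<Sum>k\<in>{1..N}. ennreal \<bar>lp_coeff N k\<bar> * ?a k i) \<longlonglongrightarrow> 0" by simp
  have le: "(\<integral>\<^sup>+x. ennreal \<bar>lp_approx N (Suc i) f x - f x\<bar> \<partial>lborel) \<le> (\<Sum>k\<in>{1..N}. ennreal \<bar>lp_coeff N k\<bar> * ?a k i)" for i
  proof -
    have "(\<integral>\<^sup>+x. ennreal \<bar>lp_approx N (Suc i) f x - f x\<bar> \<partial>lborel) \<le> (\<integral>\<^sup>+x. (\<Sum>k\<in>{1..N}. ennreal \<bar>lp_coeff N k\<bar> * ennreal \<bar>gm k i x - f x\<bar>) \<partial>lborel)"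
    proof (rule nn_integral_mono)
      fix x
      have "f x = (\<Sum>k\<in>{1..N}. lp_coeff N k * f x)"
        unfolding sum_distrib_right[symmetric] sum_lp_coeff[OF N] by simp
      then have "lp_approx N (Suc i) f x - f x = (\<Sum>k\<in>{1..N}. lp_coeff N k * (gm k i x - f x))"
        unfolding lp_approx_Suc by (simp add: right_diff_distrib sum_subtractf)
      also have "\<bar>\<dots>\<bar> \<le> (\<Sum>k\<in>{1..N}. \<bar>lp_coeff N k\<bar> * \<bar>gm k i x - f x\<bar>)"
        unfolding abs_mult[symmetric] by (rule sum_abs)
      finally have "ennreal \<bar>lp_approx N (Suc i) f x - f x\<bar> \<le> ennreal (\<Sum>k\<in>{1..N}. \<bar>lp_coeff N k\<bar> * \<bar>gm k i x - f x\<bar>)"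
        by (rule ennreal_leI)
      also have "\<dots> = (\<Sum>k\<in>{1..N}. ennreal \<bar>lp_coeff N k\<bar> * ennreal \<bar>gm k i x - f x\<bar>)"
        by (subst sum_ennreal[symmetric]) (auto simp: ennreal_mult)
      finally show "ennreal \<bar>lp_approx N (Suc i) f x - f x\<bar> \<le> (\<Sum>k\<in>{1..N}. ennreal \<bar>lp_coeff N k\<bar> * ennreal \<bar>gm k i x - f x\<bar>)" .
    qed
    also have "\<dots> = (\<Sum>k\<in>{1..N}. ennreal \<bar>lp_coeff N k\<bar> * ?a k i)"
      using gmm by (subst nn_integral_sum) (auto intro!: sum.cong nn_integral_cmult)
    finally show ?thesis .
  qed
  have "(\<lambda>i. \<integral>\<^sup>+x. ennreal \<bar>lp_approx N (Suc i) f x - f x\<bar> \<partial>lborel) \<longlonglongrightarrow> 0"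
  proof (rule tendsto_sandwich[OF _ _ tendsto_const lim])
    show "\<forall>\<^sub>F i in sequentially. (\<integral>\<^sup>+x. ennreal \<bar>lp_approx N (Suc i) f x - f x\<bar> \<partial>lborel) \<le> (\<Sum>k\<in>{1..N}. ennreal \<bar>lp_coeff N k\<bar> * ?a k i)"
      by (intro always_eventually allI le)
  qed simp
  then show ?thesis by (rule LIMSEQ_imp_Suc)
qed

end

section \<open>Dyadic sums and two-sided bounds on the difference symbols\<close>

lemma sum_power_inj_le:
  fixes u :: real
  assumes "0 \<le> u" "u < 1" "finite A" "inj_on f A"
  shows "(\<Sum>i\<in>A. u ^ f i) \<le> 1 / (1 - u)"
proof -
  have "(\<Sum>i\<in>A. u ^ f i) = (\<Sum>j\<in>f ` A. u ^ j)" using assms(4) by (simp add: sum.reindex)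
  also have "\<dots> \<le> (\<Sum>j. u ^ j)" using assms by (intro sum_le_suminf summable_geometric) auto
  also have "\<dots> = 1 / (1 - u)" using assms by (intro suminf_geometric) auto
  finally show ?thesis .
qed

text \<open>The sum is split at k = floor (log2 T). Up to k the quotient T / 2^i is at least 2^(k -
  i), so the negative power decays geometrically away from k; beyond k it is at most 2^(k + 1 - i),
  and the positive power does. Two geometric series bound the sum for all T and n.\<close>

lemma dyadic_sum_bounded:
  fixes p q :: real
  assumes "p > 0" "q > 0"
  shows "\<exists>C>0. \<forall>T\<ge>1. \<forall>n. (\<Sum>i<n. min ((T / 2 ^ i) powr p) ((T / 2 ^ i) powr (- q))) \<le> C"
proof -
  define u v where "u = 2 powr (- q)" and "v = 2 powr (- p)"
  have u: "0 \<le> u" "u < 1" and v: "0 \<le> v" "v < 1"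
    using assms powr_less_mono[of "-q" 0 2] powr_less_mono[of "-p" 0 2] by (auto simp: u_def v_def)
  have "(\<Sum>i<n. min ((T / 2 ^ i) powr p) ((T / 2 ^ i) powr (- q))) \<le> 1 / (1 - u) + 1 / (1 - v)" if T: "T \<ge> 1" for T :: real and n
  proof -
    define k where "k = nat \<lfloor>log 2 T\<rfloor>"
    have lg: "log 2 T \<ge> 0" using T by simp
    have k: "real k \<le> log 2 T" "log 2 T < real k + 1" unfolding k_def using lg by (auto simp: floor_correct)
    have T1: "2 powr real k \<le> T" "T \<le> 2 powr (real k + 1)"
      using k T by (auto simp: powr_le_iff le_powr_iff less_imp_le)
    have Ti: "T / 2 ^ i = T * 2 powr (- real i)" for i by (simp add: powr_minus powr_realpow divide_inverse)
    have a: "(T / 2 ^ i) powr (- q) \<le> u ^ (k - i)" if "i \<le> k" for i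
    proof -
      have "2 powr (real k - real i) \<le> T / 2 ^ i"
        unfolding Ti diff_conv_add_uminus powr_add using T1(1) by (intro mult_right_mono) auto
      then have "(T / 2 ^ i) powr (- q) \<le> (2 powr (real k - real i)) powr (- q)"
        using assms by (intro powr_mono2') auto
      also have "\<dots> = u powr (real (k - i))" using that by (simp add: u_def powr_powr of_nat_diff mult.commute)
      also have "\<dots> = u ^ (k - i)" by (rule powr_realpow) (simp add: u_def)
      finally show ?thesis .
    qed
    have b: "(T / 2 ^ i) powr p \<le> v ^ (i - Suc k)" if "i > k" for i
    proof -
      have "T / 2 ^ i \<le> 2 powr (real k + 1 - real i)"
        unfolding Ti diff_conv_add_uminus[of "real k + 1"] powr_add[of 2 "real k + 1"] using T1(2) by (intro mult_right_mono) auto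
      then have "(T / 2 ^ i) powr p \<le> (2 powr (real k + 1 - real i)) powr p"
        using assms T by (intro powr_mono2) auto
      also have "\<dots> = v powr (real (i - Suc k))"
        using that by (simp add: v_def powr_powr of_nat_diff algebra_simps)
      also have "\<dots> = v ^ (i - Suc k)" by (rule powr_realpow) (simp add: v_def)
      finally show ?thesis .
    qed
    have "(\<Sum>i<n. min ((T / 2 ^ i) powr p) ((T / 2 ^ i) powr (- q))) =
       (\<Sum>i\<in>{i\<in>{..<n}. i \<le> k}. min ((T / 2 ^ i) powr p) ((T / 2 ^ i) powr (- q))) + (\<Sum>i\<in>{i\<in>{..<n}. i > k}. min ((T / 2 ^ i) powr p) ((T / 2 ^ i) powr (- q)))"
      by (subst sum.union_disjoint[symmetric]) (auto intro!: sum.cong)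
    also have "\<dots> \<le> (\<Sum>i\<in>{i\<in>{..<n}. i \<le> k}. u ^ (k - i)) + (\<Sum>i\<in>{i\<in>{..<n}. i > k}. v ^ (i - Suc k))"
      by (intro add_mono sum_mono) (auto intro: min.coboundedI1 min.coboundedI2 a b)
    also have "\<dots> \<le> 1 / (1 - u) + 1 / (1 - v)"
      by (intro add_mono sum_power_inj_le u v) (auto simp: inj_on_def)
    finally show ?thesis .
  qed
  moreover have "1 / (1 - u) + 1 / (1 - v) > 0" using u v by (intro add_pos_pos) auto
  ultimately show ?thesis by blast
qed

definition japanese :: "'a::euclidean_space \<Rightarrow> real" where "japanese \<xi> = sqrt (1 + (norm \<xi>)\<^sup>2)"

lemma japanese_ge_one: "japanese \<xi> \<ge> 1" by (simp add: japanese_def)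

lemma japanese_square: "(japanese \<xi>)\<^sup>2 = 1 + (norm \<xi>)\<^sup>2" by (simp add: japanese_def add_nonneg_nonneg)

lemma norm_le_japanese: "norm \<xi> \<le> japanese \<xi>" unfolding japanese_def by (rule real_le_rsqrt) simp

lemma norm1_le: "norm1 (\<xi>::'a::euclidean_space) \<le> real DIM('a) * norm \<xi>"
  unfolding norm1_def using sum_mono[of Basis "\<lambda>b. \<bar>\<xi> \<bullet> b\<bar>" "\<lambda>_. norm \<xi>"] Basis_le_norm by auto

lemma japanese_le_norm1: "japanese \<xi> \<le> 1 + norm1 \<xi>"
proof -
  have "norm \<xi> \<le> norm1 \<xi>" unfolding norm1_def by (rule norm_le_l1)
  then have "(norm \<xi>)\<^sup>2 \<le> (norm1 \<xi>)\<^sup>2" by (intro power_mono) auto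
  then have "1 + (norm \<xi>)\<^sup>2 \<le> (1 + norm1 \<xi>)\<^sup>2"
  proof -
    have "(1 + norm1 \<xi>)\<^sup>2 = 1 + 2 * norm1 \<xi> + (norm1 \<xi>)\<^sup>2" by (simp add: power2_sum)
    with \<open>(norm \<xi>)\<^sup>2 \<le> (norm1 \<xi>)\<^sup>2\<close> norm1_nonneg[of \<xi>] show ?thesis by linarith
  qed
  then show ?thesis unfolding japanese_def using norm1_nonneg[of \<xi>] by (intro real_le_lsqrt) auto
qed

lemma borel_measurable_japanese[measurable]: "japanese \<in> borel_measurable borel"
  unfolding japanese_def[abs_def] by measurable

lemma one_minus_power_le: "0 \<le> g \<Longrightarrow> g \<le> 1 \<Longrightarrow> 1 - (1 - g) ^ N \<le> real N * g" for g :: real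
  using Bernoulli_inequality[of "- g" N] by simp

text \<open>With \<open>\<tau> = |\<xi>|\<^sup>2 / 4\<^sup>i\<close>, the \<open>i\<close>-th difference is \<open>(1 - exp (-4\<tau>))\<^sup>N - (1 - exp (-\<tau>))\<^sup>N\<close> for \<open>i > 0\<close>: it vanishes to
  order \<open>\<tau>\<^sup>N\<close> at the origin and decays like \<open>exp (-\<tau>)\<close>.\<close>

lemma lp_symbol_diff_bounds:
  fixes \<xi> :: "'a::euclidean_space" and i N :: nat
  defines "q \<equiv> lp_symbol N (Suc i) \<xi> - lp_symbol N i \<xi>" and "t \<equiv> japanese \<xi> / 2 ^ i"
  shows "\<bar>q\<bar> \<le> real N * exp 1 * exp (- t\<^sup>2)" and "t < 1 \<Longrightarrow> \<bar>q\<bar> \<le> 4 ^ N * t ^ N"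
proof -
  define g where "g = gauss (1 / 4 ^ i) \<xi>"
  have g: "0 < g" "g \<le> 1" unfolding g_def by (auto simp: gauss_pos gauss_le_one)
  have t2: "t\<^sup>2 = 1 / 4 ^ i + (norm \<xi>)\<^sup>2 / 4 ^ i"
    unfolding t_def by (simp add: power_divide japanese_square add_divide_distrib power2_eq_square[of "2 ^ i"] flip: power_mult_distrib)
  \<comment> \<open>t^2 exceeds |xi|^2 / 4^i by 1 / 4^i, which is at most 1 and costs the factor
    e.\<close>
  have "g = exp (1 / 4 ^ i) * exp (- t\<^sup>2)"
    unfolding g_def gauss_def t2 by (simp flip: exp_add)
  also have "\<dots> \<le> exp 1 * exp (- t\<^sup>2)" by (intro mult_right_mono) auto
  finally have "real N * g \<le> real N * (exp 1 * exp (- t\<^sup>2))" by (intro mult_left_mono) auto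
  moreover have up: "1 - (1 - g) ^ N \<le> real N * g" using g by (intro one_minus_power_le) auto
  moreover have "0 \<le> q \<and> q \<le> 1 - (1 - g) ^ N"
  proof (cases i)
    case 0
    then show ?thesis using g by (auto simp: q_def g_def power_le_one)
  next
    case (Suc j)
    have g4: "gauss (1 / 4 ^ j) \<xi> = g ^ 4" unfolding g_def Suc gauss_power by simp
    have "g ^ 4 \<le> g ^ 1" using g by (intro power_decreasing) auto
    then have "(1 - g) ^ N \<le> (1 - g ^ 4) ^ N" using g by (intro power_mono) auto
    moreover have "(1 - g ^ 4) ^ N \<le> 1" using g by (intro power_le_one) (auto simp: power_le_one)
    moreover have "q = (1 - g ^ 4) ^ N - (1 - g) ^ N" unfolding q_def Suc lp_symbol.simps g4 using g_def Suc by simp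
    ultimately show ?thesis by simp
  qed
  ultimately show "\<bar>q\<bar> \<le> real N * exp 1 * exp (- t\<^sup>2)" by (simp add: mult.assoc)
  show "\<bar>q\<bar> \<le> 4 ^ N * t ^ N" if t: "t < 1"
  proof (cases i)
    \<comment> \<open>Here t is the Japanese bracket itself, hence at least 1, and the assumption t
      < 1 is contradictory.\<close>
    case 0
    then show ?thesis using t japanese_ge_one[of \<xi>] by (simp add: t_def)
  next
    case (Suc j)
    define \<tau> where "\<tau> = (norm \<xi>)\<^sup>2 / 4 ^ i"
    have t0: "t \<ge> 0" unfolding t_def using japanese_ge_one[of \<xi>] by simp
    have g4: "gauss (1 / 4 ^ j) \<xi> = g ^ 4" unfolding g_def Suc gauss_power by simp
    have "g = exp (- \<tau>)" by (simp add: g_def gauss_def \<tau>_def)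
    then have "g ^ 4 = exp (- 4 * \<tau>)" by (simp flip: exp_of_nat_mult)
    then have "1 - g ^ 4 \<le> 4 * \<tau>" using exp_ge_add_one_self[of "- 4 * \<tau>"] by simp
    \<comment> \<open>Half of the order of vanishing is given away: for t < 1, \<tau> <= t^2 <= t,
      and t^N is enough since s < N in the applications.\<close>
    also have "\<dots> \<le> 4 * t"
    proof -
      have "t\<^sup>2 \<le> t" using t0 t mult_left_mono[of t 1 t] by (simp add: power2_eq_square)
      moreover have "\<tau> \<le> t\<^sup>2" unfolding t2 \<tau>_def by simp
      ultimately show ?thesis by linarith
    qed
    finally have "(1 - g ^ 4) ^ N \<le> (4 * t) ^ N" using g by (intro power_mono) (auto simp: power_le_one)
    moreover have "q = (1 - g ^ 4) ^ N - (1 - g) ^ N" unfolding q_def Suc lp_symbol.simps g4 using g_def Suc by simp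
    moreover have "(1 - g) ^ N \<ge> 0" using g by simp
    moreover have "q \<ge> 0" using \<open>0 \<le> q \<and> q \<le> 1 - (1 - g) ^ N\<close> by simp
    ultimately show ?thesis by (simp add: power_mult_distrib)
  qed
qed

text \<open>For t < 1 the weight is bounded and the vanishing at the origin supplies t^N. For t >= 1
  the factor exp (-t^2) absorbs the weight and one further power of t. The decay t^(-1) stands for
  any fixed negative power.\<close>

lemma lp_symbol_diff_weighted:
  assumes N: "N > 0"
  shows "\<exists>C\<ge>0. \<forall>i. \<forall>\<xi>::'a::euclidean_space. (1 + norm1 \<xi> / 2 ^ i) ^ N * \<bar>lp_symbol N (Suc i) \<xi> - lp_symbol N i \<xi>\<bar> \<le>
     C * min ((japanese \<xi> / 2 ^ i) powr real N) ((japanese \<xi> / 2 ^ i) powr (- 1))"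
proof -
  let ?d = "real DIM('a)"
  \<comment> \<open>N powers of 1 + r for the weight, and one more to gain 1 / t.\<close>
  obtain B :: real where B: "B \<ge> 0" "\<And>r. r \<ge> 0 \<Longrightarrow> (1 + r) ^ (Suc N) * exp (- 1 * r\<^sup>2) \<le> B"
    using poly_exp_bound[of 1 "Suc N", OF zero_less_one] by blast
  define C where "C = (1 + ?d) ^ N * (4 ^ N + real N * exp 1 * B)"
  have C0: "C \<ge> 0" unfolding C_def using B(1) by auto
  have "(1 + norm1 \<xi> / 2 ^ i) ^ N * \<bar>lp_symbol N (Suc i) \<xi> - lp_symbol N i \<xi>\<bar> \<le>
     C * min ((japanese \<xi> / 2 ^ i) powr real N) ((japanese \<xi> / 2 ^ i) powr (- 1))" for i and \<xi> :: 'a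
  proof -
    define q where "q = lp_symbol N (Suc i) \<xi> - lp_symbol N i \<xi>"
    define t where "t = japanese \<xi> / 2 ^ i"
    have t0: "t > 0" unfolding t_def using japanese_ge_one[of \<xi>] by simp
    have q: "\<bar>q\<bar> \<le> real N * exp 1 * exp (- t\<^sup>2)" "t < 1 \<Longrightarrow> \<bar>q\<bar> \<le> 4 ^ N * t ^ N"
      unfolding q_def t_def by (rule lp_symbol_diff_bounds, rule lp_symbol_diff_bounds) 
    have "norm1 \<xi> \<le> ?d * japanese \<xi>"
      by (rule order_trans[OF norm1_le mult_left_mono[OF norm_le_japanese]]) simp
    then have "norm1 \<xi> / 2 ^ i \<le> ?d * t" by (simp add: t_def divide_right_mono)
    then have n1: "(1 + norm1 \<xi> / 2 ^ i) ^ N \<le> (1 + ?d * t) ^ N"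
      using norm1_nonneg[of \<xi>] by (intro power_mono) (auto intro!: add_nonneg_nonneg)
    have P: "(1 + norm1 \<xi> / 2 ^ i) ^ N \<ge> 0" using norm1_nonneg[of \<xi>] by (auto intro!: add_nonneg_nonneg zero_le_power)
    show ?thesis
    proof (cases "t < 1")
      case True
      have "(1 + ?d * t) ^ N \<le> (1 + ?d) ^ N" using True t0 by (intro power_mono) (auto simp: mult_left_le)
      then have "(1 + norm1 \<xi> / 2 ^ i) ^ N * \<bar>q\<bar> \<le> (1 + ?d) ^ N * (4 ^ N * t ^ N)"
        using n1 q(2)[OF True] by (intro mult_mono order_trans[OF n1]) auto
      also have "\<dots> \<le> C * t ^ N"
        unfolding C_def mult.assoc[symmetric] using B(1) t0 by (intro mult_right_mono) (auto simp: distrib_left mult.assoc)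
      also have "t ^ N = min (t powr real N) (t powr (- 1))"
      proof -
        have "t ^ N \<le> 1" using True t0 by (intro power_le_one) auto
        also have "1 \<le> t powr (- 1)" using True t0 by (simp add: powr_minus one_le_inverse_iff)
        finally show ?thesis using t0 by (simp add: powr_realpow min_def)
      qed
      finally show ?thesis by (simp add: q_def t_def)
    next
      case False
      have "1 + ?d * t \<le> (1 + ?d) * (1 + t)" using t0 by (simp add: algebra_simps)
      then have "(1 + ?d * t) ^ N \<le> (1 + ?d) ^ N * (1 + t) ^ N"
        unfolding power_mult_distrib[symmetric] using t0 by (intro power_mono) auto
      then have "(1 + norm1 \<xi> / 2 ^ i) ^ N * \<bar>q\<bar> * t \<le> ((1 + ?d) ^ N * (1 + t) ^ N) * (real N * exp 1 * exp (- t\<^sup>2)) * (1 + t)"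
        using n1 q(1) t0 P by (intro mult_mono order_trans[OF n1]) auto
      also have "\<dots> = (1 + ?d) ^ N * (real N * exp 1) * ((1 + t) ^ Suc N * exp (- 1 * t\<^sup>2))" by (simp add: mult_ac)
      also have "\<dots> \<le> (1 + ?d) ^ N * (real N * exp 1) * B" using t0 by (intro mult_left_mono B) auto
      also have "\<dots> \<le> C" unfolding C_def mult.assoc by (intro mult_left_mono) auto
      finally have "(1 + norm1 \<xi> / 2 ^ i) ^ N * \<bar>q\<bar> \<le> C / t" using t0 by (simp add: pos_le_divide_eq)
      also have "C / t = C * min (t powr real N) (t powr (- 1))"
      proof -
        have "t powr (- 1) \<le> t powr real N" using False by (intro powr_mono) auto
        then show ?thesis using t0 by (simp add: min_def powr_minus divide_inverse)
      qed
      finally show ?thesis by (simp add: q_def t_def)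
    qed
  qed
  with C0 show ?thesis by blast
qed

section \<open>Square function and synthesis\<close>

text \<open>The squared Sobolev norm of a function in terms of the unnormalised \<open>ft\<close>;
  \<open>Hs_norm_sq_eq\<close> adds the factor (2 pi)^(-3).\<close>

definition sobolev_integral :: "real \<Rightarrow> ('a::euclidean_space \<Rightarrow> real) \<Rightarrow> ennreal" where
  "sobolev_integral s f = (\<integral>\<^sup>+\<xi>. ennreal (japanese \<xi> powr (2 * s) * (norm (ft (\<lambda>x. complex_of_real (f x)) \<xi>))\<^sup>2) \<partial>lborel)"

lemma dyadic_powr: "T > 0 \<Longrightarrow> (2 ^ i) powr r = T powr r * (T / 2 ^ i) powr (- r)" for T r :: real
  by (simp add: powr_divide powr_minus field_simps)

text \<open>\<open>jet_ift_L2\<close> moves the sum to the frequency side. With T the Japanese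
  bracket and t = T / 2^i one has 2^(2is) = T^(2s) t^(-2s), and t^(-2s) times the square of min(t^N,
  t^(-1)) is at most the smaller of t^(2N - 2s) and t^(-2 - 2s). Both exponents have the sign that
  \<open>dyadic_sum_bounded\<close> asks for.\<close>

lemma lp_square_function:
  assumes N: "N > 0" and s: "0 < s" "s < real N"
  shows "\<exists>C\<ge>0. \<forall>(f::'a::euclidean_space \<Rightarrow> real) M n. integrable lborel f \<longrightarrow> (\<forall>x. \<bar>f x\<bar> \<le> M) \<longrightarrow>
    (\<Sum>i<n. ennreal ((2 ^ i) powr (2 * s)) * (\<integral>\<^sup>+x. ennreal ((jet (1 / 2 ^ i) N (\<lambda>x. lp_approx N (Suc i) f x - lp_approx N i f x) x)\<^sup>2) \<partial>lborel))
      \<le> ennreal C * sobolev_integral s f"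
proof -
  obtain C1 where C1: "C1 \<ge> 0" "\<And>i (\<xi>::'a). (1 + norm1 \<xi> / 2 ^ i) ^ N * \<bar>lp_symbol N (Suc i) \<xi> - lp_symbol N i \<xi>\<bar> \<le>
     C1 * min ((japanese \<xi> / 2 ^ i) powr real N) ((japanese \<xi> / 2 ^ i) powr (- 1))"
    using lp_symbol_diff_weighted[OF N, where 'a='a] by blast
  obtain C2 where C2: "C2 > 0" "\<And>T n. T \<ge> 1 \<Longrightarrow> (\<Sum>i<n. min ((T / 2 ^ i) powr (2 * real N - 2 * s)) ((T / 2 ^ i) powr (- (2 + 2 * s)))) \<le> C2"
    using dyadic_sum_bounded[of "2 * real N - 2 * s" "2 + 2 * s"] s by auto
  define E where "E = (1 + real DIM('a)) ^ (2 * N)"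
  have E0: "E \<ge> 0" by (simp add: E_def)
  have "(\<Sum>i<n. ennreal ((2 ^ i) powr (2 * s)) * (\<integral>\<^sup>+x. ennreal ((jet (1 / 2 ^ i) N (\<lambda>x. lp_approx N (Suc i) f x - lp_approx N i f x) x)\<^sup>2) \<partial>lborel))
      \<le> ennreal (E * (C1\<^sup>2 * C2)) * sobolev_integral s f"
    if f: "integrable lborel f" and M: "\<And>x. \<bar>f x\<bar> \<le> M" for f :: "'a \<Rightarrow> real" and M n
  proof -
    let ?F = "ft (\<lambda>x. complex_of_real (f x))"
    define q where "q i \<xi> = lp_symbol N (Suc i) \<xi> - lp_symbol N i \<xi>" for i and \<xi> :: 'a
    have Fm[measurable]: "?F \<in> borel_measurable borel" using integrable_borel[OF f] by measurable
    have "rapid (\<lambda>\<xi>::'a. complex_of_real (lp_symbol N i \<xi>))" for i by (rule rapid_lp_symbol)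
    from rapid_borel[OF this] have "(\<lambda>\<xi>::'a. Re (complex_of_real (lp_symbol N i \<xi>))) \<in> borel_measurable borel" for i by measurable
    then have lm: "(lp_symbol N i :: 'a \<Rightarrow> real) \<in> borel_measurable borel" for i :: nat by simp
    have [measurable]: "q i \<in> borel_measurable borel" for i unfolding q_def using lm[of "Suc i"] lm[of i] by measurable
    note r = rapid_lp[OF f M, of N]
    have d: "(\<lambda>x. lp_approx N (Suc i) f x - lp_approx N i f x) = (\<lambda>x. Re (ift (\<lambda>\<xi>. complex_of_real (q i \<xi>) * ?F \<xi>) x))" for i
    proof
      fix x
      have "ift (\<lambda>\<xi>. complex_of_real (q i \<xi>) * ?F \<xi>) x = ift (\<lambda>\<xi>. complex_of_real (lp_symbol N (Suc i) \<xi>) * ?F \<xi>) x - ift (\<lambda>\<xi>. complex_of_real (lp_symbol N i \<xi>) * ?F \<xi>) x"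
        unfolding q_def of_real_diff left_diff_distrib ift_def
        using ft_diff[OF rapid_integrable[OF r[of "Suc i"]] rapid_integrable[OF r[of i]]] by (simp add: diff_divide_distrib)
      then show "lp_approx N (Suc i) f x - lp_approx N i f x = Re (ift (\<lambda>\<xi>. complex_of_real (q i \<xi>) * ?F \<xi>) x)"
        unfolding lp_approx_def by simp
    qed
    have rq: "rapid (\<lambda>\<xi>. complex_of_real (q i \<xi>) * ?F \<xi>)" for i
      using rapid_diff[OF r[of "Suc i"] r[of i]] by (simp add: q_def left_diff_distrib)
    have "(\<Sum>i<n. ennreal ((2 ^ i) powr (2 * s)) * (\<integral>\<^sup>+x. ennreal ((jet (1 / 2 ^ i) N (\<lambda>x. lp_approx N (Suc i) f x - lp_approx N i f x) x)\<^sup>2) \<partial>lborel))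
      \<le> (\<Sum>i<n. ennreal ((2 ^ i) powr (2 * s)) * (ennreal E * (\<integral>\<^sup>+\<xi>. ennreal (((1 + 1 / 2 ^ i * norm1 \<xi>) ^ N * norm (complex_of_real (q i \<xi>) * ?F \<xi>))\<^sup>2) \<partial>lborel)))"
      unfolding d E_def by (intro sum_mono mult_left_mono jet_ift_L2 rq) auto
    also have "\<dots> = ennreal E * (\<integral>\<^sup>+\<xi>. (\<Sum>i<n. ennreal ((2 ^ i) powr (2 * s)) * ennreal (((1 + 1 / 2 ^ i * norm1 \<xi>) ^ N * norm (complex_of_real (q i \<xi>) * ?F \<xi>))\<^sup>2)) \<partial>lborel)"
      by (subst nn_integral_sum) (auto simp: nn_integral_cmult sum_distrib_left mult.left_commute)
    also have "\<dots> \<le> ennreal E * (\<integral>\<^sup>+\<xi>. ennreal (C1\<^sup>2 * C2) * ennreal (japanese \<xi> powr (2 * s) * (norm (?F \<xi>))\<^sup>2) \<partial>lborel)"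
    proof (intro mult_left_mono nn_integral_mono)
      fix \<xi> :: 'a
      define T where "T = japanese \<xi>"
      have T: "T \<ge> 1" unfolding T_def by (rule japanese_ge_one)
      have trm: "(2 ^ i) powr (2 * s) * ((1 + 1 / 2 ^ i * norm1 \<xi>) ^ N * norm (complex_of_real (q i \<xi>) * ?F \<xi>))\<^sup>2 \<le>
         (C1\<^sup>2 * (T powr (2 * s) * (norm (?F \<xi>))\<^sup>2)) * min ((T / 2 ^ i) powr (2 * real N - 2 * s)) ((T / 2 ^ i) powr (- (2 + 2 * s)))" for i
      proof -
        define t where "t = T / 2 ^ i"
        have t: "t > 0" unfolding t_def using T by simp
        define \<mu> where "\<mu> = min (t powr real N) (t powr (- 1))"
        have \<mu>0: "\<mu> \<ge> 0" by (simp add: \<mu>_def)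
        have "(1 + 1 / 2 ^ i * norm1 \<xi>) ^ N * \<bar>q i \<xi>\<bar> \<le> C1 * \<mu>"
          using C1(2)[of \<xi> i] by (simp add: q_def \<mu>_def t_def T_def)
        then have "((1 + 1 / 2 ^ i * norm1 \<xi>) ^ N * \<bar>q i \<xi>\<bar>)\<^sup>2 \<le> (C1 * \<mu>)\<^sup>2"
          using norm1_nonneg[of \<xi>] by (intro power_mono) (auto intro!: mult_nonneg_nonneg zero_le_power add_nonneg_nonneg)
        then have 1: "((1 + 1 / 2 ^ i * norm1 \<xi>) ^ N * norm (complex_of_real (q i \<xi>) * ?F \<xi>))\<^sup>2 \<le> C1\<^sup>2 * \<mu>\<^sup>2 * (norm (?F \<xi>))\<^sup>2"
          using mult_right_mono[of _ _ "(norm (?F \<xi>))\<^sup>2", OF \<open>((1 + 1 / 2 ^ i * norm1 \<xi>) ^ N * \<bar>q i \<xi>\<bar>)\<^sup>2 \<le> (C1 * \<mu>)\<^sup>2\<close>]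
          by (simp add: norm_mult power_mult_distrib mult.assoc)
        have 2: "t powr (- (2 * s)) * \<mu>\<^sup>2 \<le> min (t powr (2 * real N - 2 * s)) (t powr (- (2 + 2 * s)))"
        proof (rule min.boundedI)
          have "\<mu>\<^sup>2 \<le> (t powr real N)\<^sup>2" using \<mu>0 by (intro power_mono) (auto simp: \<mu>_def)
          also have "\<dots> = t powr (2 * real N)" using t by (simp add: power2_eq_square flip: powr_add)
          finally have "t powr (- (2 * s)) * \<mu>\<^sup>2 \<le> t powr (- (2 * s)) * t powr (2 * real N)" by (intro mult_left_mono) auto
          then show "t powr (- (2 * s)) * \<mu>\<^sup>2 \<le> t powr (2 * real N - 2 * s)" by (simp flip: powr_add)
          have "\<mu>\<^sup>2 \<le> (t powr (- 1))\<^sup>2" using \<mu>0 by (intro power_mono) (auto simp: \<mu>_def)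
          also have "\<dots> = t powr (- 2)" unfolding power2_eq_square powr_add[symmetric] by simp
          finally have "t powr (- (2 * s)) * \<mu>\<^sup>2 \<le> t powr (- (2 * s)) * t powr (- 2)" by (intro mult_left_mono) auto
          then show "t powr (- (2 * s)) * \<mu>\<^sup>2 \<le> t powr (- (2 + 2 * s))" by (simp add: algebra_simps flip: powr_add)
        qed
        have "(2 ^ i) powr (2 * s) * ((1 + 1 / 2 ^ i * norm1 \<xi>) ^ N * norm (complex_of_real (q i \<xi>) * ?F \<xi>))\<^sup>2
           \<le> (T powr (2 * s) * t powr (- (2 * s))) * (C1\<^sup>2 * \<mu>\<^sup>2 * (norm (?F \<xi>))\<^sup>2)"
          unfolding t_def using dyadic_powr[of T i "2 * s"] T 1 by (simp add: mult_left_mono)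
        also have "\<dots> = (C1\<^sup>2 * (T powr (2 * s) * (norm (?F \<xi>))\<^sup>2)) * (t powr (- (2 * s)) * \<mu>\<^sup>2)" by (simp add: mult_ac)
        also have "\<dots> \<le> (C1\<^sup>2 * (T powr (2 * s) * (norm (?F \<xi>))\<^sup>2)) * min (t powr (2 * real N - 2 * s)) (t powr (- (2 + 2 * s)))"
          by (intro mult_left_mono 2) auto
        finally show ?thesis by (simp add: t_def)
      qed
      have "(\<Sum>i<n. (2 ^ i) powr (2 * s) * ((1 + 1 / 2 ^ i * norm1 \<xi>) ^ N * norm (complex_of_real (q i \<xi>) * ?F \<xi>))\<^sup>2) \<le>
         (C1\<^sup>2 * (T powr (2 * s) * (norm (?F \<xi>))\<^sup>2)) * (\<Sum>i<n. min ((T / 2 ^ i) powr (2 * real N - 2 * s)) ((T / 2 ^ i) powr (- (2 + 2 * s))))"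
        unfolding sum_distrib_left by (intro sum_mono trm)
      also have "\<dots> \<le> (C1\<^sup>2 * (T powr (2 * s) * (norm (?F \<xi>))\<^sup>2)) * C2"
        by (intro mult_left_mono C2 T) auto
      finally have "ennreal (\<Sum>i<n. (2 ^ i) powr (2 * s) * ((1 + 1 / 2 ^ i * norm1 \<xi>) ^ N * norm (complex_of_real (q i \<xi>) * ?F \<xi>))\<^sup>2) \<le>
         ennreal ((C1\<^sup>2 * C2) * (T powr (2 * s) * (norm (?F \<xi>))\<^sup>2))" by (intro ennreal_leI) (simp add: mult_ac)
      also have "\<dots> = ennreal (C1\<^sup>2 * C2) * ennreal (T powr (2 * s) * (norm (?F \<xi>))\<^sup>2)"
        using C2(1) by (intro ennreal_mult) auto
      finally show "(\<Sum>i<n. ennreal ((2 ^ i) powr (2 * s)) * ennreal (((1 + 1 / 2 ^ i * norm1 \<xi>) ^ N * norm (complex_of_real (q i \<xi>) * ?F \<xi>))\<^sup>2)) \<le>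
         ennreal (C1\<^sup>2 * C2) * ennreal (japanese \<xi> powr (2 * s) * (norm (?F \<xi>))\<^sup>2)"
        by (subst (asm) sum_ennreal[symmetric]) (auto simp: T_def ennreal_mult)
    qed auto
    also have "\<dots> = ennreal (E * (C1\<^sup>2 * C2)) * sobolev_integral s f"
      unfolding sobolev_integral_def using E0 C2(1) by (subst nn_integral_cmult) (auto simp: ennreal_mult mult.assoc)
    finally show ?thesis .
  qed
  moreover have "E * (C1\<^sup>2 * C2) \<ge> 0" using E0 C2(1) by simp
  ultimately show ?thesis by blast
qed

text \<open>Cauchy-Schwarz for sqrt (b) and sqrt (b) x, followed by b <= 1 in the second factor
  only.\<close>

lemma sum_weighted_square_le:
  fixes b x :: "'i \<Rightarrow> real"
  assumes "\<And>i. i \<in> A \<Longrightarrow> 0 \<le> b i" "\<And>i. i \<in> A \<Longrightarrow> b i \<le> 1"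
  shows "(\<Sum>i\<in>A. b i * x i)\<^sup>2 \<le> (\<Sum>i\<in>A. b i) * (\<Sum>i\<in>A. (x i)\<^sup>2)"
proof -
  have "(\<Sum>i\<in>A. b i * x i)\<^sup>2 = (\<Sum>i\<in>A. sqrt (b i) * (sqrt (b i) * x i))\<^sup>2"
    using assms(1) by (intro arg_cong[where f="\<lambda>z. z\<^sup>2"] sum.cong) (auto simp: mult.assoc[symmetric])
  also have "\<dots> \<le> (\<Sum>i\<in>A. (sqrt (b i))\<^sup>2) * (\<Sum>i\<in>A. (sqrt (b i) * x i)\<^sup>2)"
    by (rule Cauchy_Schwarz_ineq_sum)
  also have "(\<Sum>i\<in>A. (sqrt (b i))\<^sup>2) = (\<Sum>i\<in>A. b i)" using assms(1) by (intro sum.cong) auto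
  also have "(\<Sum>i\<in>A. b i) * (\<Sum>i\<in>A. (sqrt (b i) * x i)\<^sup>2) \<le> (\<Sum>i\<in>A. b i) * (\<Sum>i\<in>A. (x i)\<^sup>2)"
  proof (intro mult_left_mono sum_mono sum_nonneg)
    fix i assume "i \<in> A"
    then show "(sqrt (b i) * x i)\<^sup>2 \<le> (x i)\<^sup>2"
      using assms[of i] mult_right_mono[of "b i" 1 "(x i)\<^sup>2"] by (simp add: power_mult_distrib)
  qed (use assms in auto)
  finally show ?thesis .
qed

text \<open>The pieces need not be localised in frequency. Having N derivatives in units of 2^(-i),
  a piece has a transform bounded by G_i and by t^(-N) G_i, where G_i carries the jet weight;
  multiplied by t^s these bounds give weights that are at most 1 and have uniformly bounded sum, so
  \<open>sum_weighted_square_le\<close> yields the square sum. L1 convergence of \<open>W i\<close>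
  gives convergence of the transforms at every frequency, and Fatou finishes.\<close>

lemma sobolev_synthesis:
  assumes N: "N > 0" and s: "0 < s" "s < real N"
  shows "\<exists>C\<ge>0. \<forall>(W::nat \<Rightarrow> 'a::euclidean_space \<Rightarrow> real) w I. (\<forall>i. Ck N (W i)) \<longrightarrow> W 0 = (\<lambda>x. 0) \<longrightarrow>
    (\<forall>i. integrable lborel (jet (1 / 2 ^ i) N (\<lambda>x. W (Suc i) x - W i x))) \<longrightarrow> integrable lborel w \<longrightarrow>
    (\<lambda>i. \<integral>\<^sup>+x. ennreal \<bar>W i x - w x\<bar> \<partial>lborel) \<longlonglongrightarrow> 0 \<longrightarrow>
    (\<forall>n. (\<Sum>i<n. ennreal ((2 ^ i) powr (2 * s)) * (\<integral>\<^sup>+x. ennreal ((jet (1 / 2 ^ i) N (\<lambda>x. W (Suc i) x - W i x) x)\<^sup>2) \<partial>lborel)) \<le> I) \<longrightarrow>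
    sobolev_integral s w \<le> ennreal C * I"
proof -
  obtain C2 where C2: "C2 > 0" "\<And>T n. T \<ge> 1 \<Longrightarrow> (\<Sum>i<n. min ((T / 2 ^ i) powr s) ((T / 2 ^ i) powr (- (real N - s)))) \<le> C2"
    using dyadic_sum_bounded[of s "real N - s"] s by auto
  define E where "E = (2 * pi) ^ DIM('a) * (1 + real DIM('a)) ^ (2 * N)"
  have E0: "E \<ge> 0" by (simp add: E_def)
  have "sobolev_integral s w \<le> ennreal (C2 * E) * I"
    if C: "\<And>i. Ck N (W i)" and W0: "W 0 = (\<lambda>x. 0)"
      and ji: "\<And>i. integrable lborel (jet (1 / 2 ^ i) N (\<lambda>x. W (Suc i) x - W i x))" and wi: "integrable lborel w"
      and lim: "(\<lambda>i. \<integral>\<^sup>+x. ennreal \<bar>W i x - w x\<bar> \<partial>lborel) \<longlonglongrightarrow> 0"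
      and I: "\<And>n. (\<Sum>i<n. ennreal ((2 ^ i) powr (2 * s)) * (\<integral>\<^sup>+x. ennreal ((jet (1 / 2 ^ i) N (\<lambda>x. W (Suc i) x - W i x) x)\<^sup>2) \<partial>lborel)) \<le> I"
    for W :: "nat \<Rightarrow> 'a \<Rightarrow> real" and w I
  proof -
    let ?w = "\<lambda>i x. W (Suc i) x - W i x"
    let ?f = "\<lambda>h. ft (\<lambda>x. complex_of_real (h x))"
    have Cw: "Ck N (?w i)" for i by (intro Ck_diff C)
    have wii: "integrable lborel (?w i)" for i by (rule integrable_of_jet[OF _ Cw ji]) simp
    have Wi: "integrable lborel (W i)" for i
    proof (induction i)
      case (Suc i)
      from Bochner_Integration.integrable_add[OF Suc wii[of i]] show ?case by simp
    qed (simp add: W0)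
    have ftW: "?f (W n) \<xi> = (\<Sum>i<n. ?f (?w i) \<xi>)" for n \<xi>
    proof (induction n)
      case (Suc n)
      have "?f (?w n) \<xi> = ?f (W (Suc n)) \<xi> - ?f (W n) \<xi>"
        using ft_diff[of "\<lambda>x. complex_of_real (W (Suc n) x)" "\<lambda>x. complex_of_real (W n x)"] Wi by simp
      then show ?case using Suc by simp
    qed (simp add: W0 ft_def)
    have ftlim: "(\<lambda>n. ?f (W n) \<xi>) \<longlonglongrightarrow> ?f w \<xi>" for \<xi>
    proof (rule LIM_zero_cancel, rule tendsto_norm_zero_cancel)
      have "ennreal (norm (?f (W n) \<xi> - ?f w \<xi>)) \<le> (\<integral>\<^sup>+x. ennreal \<bar>W n x - w x\<bar> \<partial>lborel)" for n
      proof -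
        have i: "integrable lborel (\<lambda>x. complex_of_real (W n x - w x))" using Wi wi by auto
        have "?f (W n) \<xi> - ?f w \<xi> = ft (\<lambda>x. complex_of_real (W n x - w x)) \<xi>"
          using ft_diff[of "\<lambda>x. complex_of_real (W n x)" "\<lambda>x. complex_of_real (w x)"] Wi wi by simp
        also have "ennreal (norm \<dots>) \<le> ennreal (LINT x|lborel. norm (complex_of_real (W n x - w x)))"
          by (intro ennreal_leI norm_ft_le i)
        also have "\<dots> = (\<integral>\<^sup>+x. ennreal \<bar>W n x - w x\<bar> \<partial>lborel)"
          using Wi[of n] wi by (subst nn_integral_eq_integral) (auto simp del: of_real_diff)
        finally show ?thesis .
      qed
      then have "(\<lambda>n. ennreal (norm (?f (W n) \<xi> - ?f w \<xi>))) \<longlonglongrightarrow> ennreal 0"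
        unfolding ennreal_0 by (intro tendsto_sandwich[OF _ _ tendsto_const lim]) auto
      then show "(\<lambda>n. norm (?f (W n) \<xi> - ?f w \<xi>)) \<longlonglongrightarrow> 0"
        by (subst (asm) tendsto_ennreal_iff) auto
    qed
    have [measurable]: "?f (W n) \<in> borel_measurable borel" "?f (?w n) \<in> borel_measurable borel" for n
    proof -
      have [measurable]: "W n \<in> borel_measurable borel" for n by (rule integrable_borel[OF Wi])
      show "?f (W n) \<in> borel_measurable borel" "?f (?w n) \<in> borel_measurable borel"
        by (intro borel_measurable_ft, measurable)+
    qed
    have fin: "(\<integral>\<^sup>+\<xi>. ennreal (japanese \<xi> powr (2 * s) * (norm (?f (W n) \<xi>))\<^sup>2) \<partial>lborel) \<le> ennreal (C2 * E) * I" for n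
    proof -
      have "(\<integral>\<^sup>+\<xi>. ennreal (japanese \<xi> powr (2 * s) * (norm (?f (W n) \<xi>))\<^sup>2) \<partial>lborel) \<le>
         (\<integral>\<^sup>+\<xi>. ennreal C2 * (\<Sum>i<n. ennreal ((2 ^ i) powr (2 * s)) * ennreal (((1 + 1 / 2 ^ i * norm1 \<xi>) ^ N * norm (?f (?w i) \<xi>))\<^sup>2)) \<partial>lborel)"
      proof (rule nn_integral_mono)
        fix \<xi> :: 'a
        define T where "T = japanese \<xi>"
        have T: "T \<ge> 1" unfolding T_def by (rule japanese_ge_one)
        define b where "b i = min ((T / 2 ^ i) powr s) ((T / 2 ^ i) powr (- (real N - s)))" for i :: nat
        define G where "G i = (1 + 1 / 2 ^ i * norm1 \<xi>) ^ N * norm (?f (?w i) \<xi>)" for i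
        have G0: "G i \<ge> 0" for i unfolding G_def using norm1_nonneg[of \<xi>] by (intro mult_nonneg_nonneg zero_le_power) (auto intro!: add_nonneg_nonneg)
        have b: "0 \<le> b i" "b i \<le> 1" for i
        proof -
          show "0 \<le> b i" by (simp add: b_def)
          have t: "T / 2 ^ i > 0" using T by simp
          show "b i \<le> 1"
          proof (cases "T / 2 ^ i \<le> 1")
            case True
            then have "(T / 2 ^ i) powr s \<le> 1" using s t T by (intro powr_le1) auto
            then show ?thesis by (simp add: b_def min.coboundedI1)
          next
            case False
            then have "(T / 2 ^ i) powr (- (real N - s)) \<le> (T / 2 ^ i) powr 0" using s by (intro powr_mono) auto
            then have "(T / 2 ^ i) powr (- (real N - s)) \<le> 1" using T by simp
            then show ?thesis unfolding b_def by (rule min.coboundedI2)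
          qed
        qed
        have trm: "T powr s * norm (?f (?w i) \<xi>) \<le> b i * ((2 ^ i) powr s * G i)" for i
        proof -
          define t where "t = T / 2 ^ i"
          have t: "t > 0" unfolding t_def using T by simp
          have Ts: "T powr s = (2 ^ i) powr s * t powr s" unfolding t_def using T by (simp add: powr_divide)
          have base: "1 \<le> 1 + 1 / 2 ^ i * norm1 \<xi>" using norm1_nonneg[of \<xi>] by simp
          have "t \<le> 1 + 1 / 2 ^ i * norm1 \<xi>"
          proof -
            have "t \<le> (1 + norm1 \<xi>) / 2 ^ i" unfolding t_def T_def by (intro divide_right_mono japanese_le_norm1) auto
            also have "\<dots> \<le> 1 + 1 / 2 ^ i * norm1 \<xi>" by (simp add: add_divide_distrib)
            finally show ?thesis .
          qed
          then have "t ^ N \<le> (1 + 1 / 2 ^ i * norm1 \<xi>) ^ N" using t by (intro power_mono) auto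
          then have g1: "t ^ N * norm (?f (?w i) \<xi>) \<le> G i" unfolding G_def by (intro mult_right_mono) auto
          have g2: "1 * norm (?f (?w i) \<xi>) \<le> G i" unfolding G_def by (intro mult_right_mono one_le_power base) auto
          \<comment> \<open>t^s is written as t^(s - N) t^N, and the power t^N is paid for by the
            jet weight in G_i.\<close>
          have e: "t powr s = t powr (- (real N - s)) * t ^ N"
            using t by (simp flip: powr_realpow powr_add)
          have a1: "t powr s * norm (?f (?w i) \<xi>) \<le> t powr s * G i" using g2 by (intro mult_left_mono) auto
          have a2: "t powr s * norm (?f (?w i) \<xi>) \<le> t powr (- (real N - s)) * G i"
            unfolding e mult.assoc by (intro mult_left_mono g1) auto
          have "t powr s * norm (?f (?w i) \<xi>) \<le> b i * G i"
            using a1 a2 G0[of i] unfolding b_def t_def[symmetric] by (auto simp: min_def)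
          from mult_left_mono[OF this, of "(2 ^ i) powr s"] show ?thesis unfolding Ts by (simp add: mult_ac)
        qed
        have "japanese \<xi> powr (2 * s) * (norm (?f (W n) \<xi>))\<^sup>2 = (T powr s * norm (\<Sum>i<n. ?f (?w i) \<xi>))\<^sup>2"
          unfolding ftW using T by (simp add: T_def power_mult_distrib power2_eq_square flip: powr_add)
        also have "\<dots> \<le> (\<Sum>i<n. T powr s * norm (?f (?w i) \<xi>))\<^sup>2"
          unfolding sum_distrib_left[symmetric] by (intro power_mono mult_left_mono norm_sum) auto
        also have "\<dots> \<le> (\<Sum>i<n. b i * ((2 ^ i) powr s * G i))\<^sup>2"
          by (intro power_mono sum_mono trm sum_nonneg) auto
        also have "\<dots> \<le> (\<Sum>i<n. b i) * (\<Sum>i<n. ((2 ^ i) powr s * G i)\<^sup>2)"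
          by (intro sum_weighted_square_le b)
        also have "\<dots> \<le> C2 * (\<Sum>i<n. ((2 ^ i) powr s * G i)\<^sup>2)"
          unfolding b_def by (intro mult_right_mono C2 T sum_nonneg) auto
        also have "(\<Sum>i<n. ((2 ^ i) powr s * G i)\<^sup>2) = (\<Sum>i<n. (2 ^ i) powr (2 * s) * (G i)\<^sup>2)"
        proof -
          have "((2 ^ i) powr s)\<^sup>2 = (2 ^ i) powr (2 * s)" for i :: nat
            by (simp only: power2_eq_square powr_add[symmetric] mult_2)
          then show ?thesis by (simp only: power_mult_distrib)
        qed
        finally have "ennreal (japanese \<xi> powr (2 * s) * (norm (?f (W n) \<xi>))\<^sup>2) \<le> ennreal (C2 * (\<Sum>i<n. (2 ^ i) powr (2 * s) * (G i)\<^sup>2))"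
          by (rule ennreal_leI)
        also have "\<dots> = ennreal C2 * (\<Sum>i<n. ennreal ((2 ^ i) powr (2 * s)) * ennreal ((G i)\<^sup>2))"
          using C2(1) by (subst ennreal_mult) (auto simp: sum_nonneg ennreal_mult simp flip: sum_ennreal)
        finally show "ennreal (japanese \<xi> powr (2 * s) * (norm (?f (W n) \<xi>))\<^sup>2) \<le>
           ennreal C2 * (\<Sum>i<n. ennreal ((2 ^ i) powr (2 * s)) * ennreal (((1 + 1 / 2 ^ i * norm1 \<xi>) ^ N * norm (?f (?w i) \<xi>))\<^sup>2))"
          unfolding G_def .
      qed
      also have "\<dots> = ennreal C2 * (\<Sum>i<n. ennreal ((2 ^ i) powr (2 * s)) * (\<integral>\<^sup>+\<xi>. ennreal (((1 + 1 / 2 ^ i * norm1 \<xi>) ^ N * norm (?f (?w i) \<xi>))\<^sup>2) \<partial>lborel))"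
      proof -
        define H where "H i \<xi> = ennreal (((1 + 1 / 2 ^ i * norm1 \<xi>) ^ N * norm (?f (?w i) \<xi>))\<^sup>2)" for i \<xi>
        have [measurable]: "H i \<in> borel_measurable borel" for i unfolding H_def[abs_def] by measurable
        show ?thesis unfolding H_def[symmetric] by (simp add: nn_integral_cmult nn_integral_sum)
      qed
      also have "\<dots> \<le> ennreal C2 * (\<Sum>i<n. ennreal ((2 ^ i) powr (2 * s)) * (ennreal E * (\<integral>\<^sup>+x. ennreal ((jet (1 / 2 ^ i) N (?w i) x)\<^sup>2) \<partial>lborel)))"
        unfolding E_def by (intro mult_left_mono sum_mono ft_jet_L2 Cw ji) auto
      also have "\<dots> = ennreal C2 * (ennreal E * (\<Sum>i<n. ennreal ((2 ^ i) powr (2 * s)) * (\<integral>\<^sup>+x. ennreal ((jet (1 / 2 ^ i) N (?w i) x)\<^sup>2) \<partial>lborel)))"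
        by (simp add: sum_distrib_left mult.left_commute)
      also have "\<dots> \<le> ennreal C2 * (ennreal E * I)" by (intro mult_left_mono I) auto
      also have "\<dots> = ennreal (C2 * E) * I" using C2(1) E0 by (simp add: ennreal_mult mult.assoc)
      finally show ?thesis .
    qed
    have "sobolev_integral s w = (\<integral>\<^sup>+\<xi>. liminf (\<lambda>n. ennreal (japanese \<xi> powr (2 * s) * (norm (?f (W n) \<xi>))\<^sup>2)) \<partial>lborel)"
      unfolding sobolev_integral_def
    proof (intro nn_integral_cong)
      fix \<xi> :: 'a
      have "(\<lambda>n. ennreal (japanese \<xi> powr (2 * s) * (norm (?f (W n) \<xi>))\<^sup>2)) \<longlonglongrightarrow> ennreal (japanese \<xi> powr (2 * s) * (norm (?f w \<xi>))\<^sup>2)"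
        by (intro tendsto_intros tendsto_ennrealI ftlim)
      then show "ennreal (japanese \<xi> powr (2 * s) * (norm (?f w \<xi>))\<^sup>2) = liminf (\<lambda>n. ennreal (japanese \<xi> powr (2 * s) * (norm (?f (W n) \<xi>))\<^sup>2))"
        by (rule lim_imp_Liminf[OF sequentially_bot, symmetric])
    qed
    also have "\<dots> \<le> liminf (\<lambda>n. \<integral>\<^sup>+\<xi>. ennreal (japanese \<xi> powr (2 * s) * (norm (?f (W n) \<xi>))\<^sup>2) \<partial>lborel)"
      by (rule nn_integral_liminf) measurable
    also have "\<dots> \<le> liminf (\<lambda>n::nat. ennreal (C2 * E) * I)"
      by (intro Liminf_mono always_eventually allI fin)
    finally show ?thesis by (simp add: Liminf_const)
  qed
  moreover have "C2 * E \<ge> 0" using C2(1) E0 by simp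
  ultimately show ?thesis by blast
qed

section \<open>Transfer of Sobolev bounds to products and compositions\<close>

lemma jet_mono_scale: "0 \<le> l \<Longrightarrow> l \<le> l' \<Longrightarrow> jet l k f x \<le> jet l' k f x"
proof (induction k arbitrary: f)
  case (Suc k)
  then show ?case by (auto intro!: mult_mono sum_mono sum_nonneg jet_nonneg)
qed simp

lemma nn_integral_jet_sum_le:
  fixes D :: "'i \<Rightarrow> 'a::euclidean_space \<Rightarrow> real"
  assumes "finite A" "K \<ge> 0" "\<And>a. a \<in> A \<Longrightarrow> D a \<in> borel_measurable borel"
    "\<And>x. 0 \<le> g x" "\<And>x. g x \<le> K * (\<Sum>a\<in>A. D a x)"
  shows "(\<integral>\<^sup>+x. ennreal ((g x)\<^sup>2) \<partial>lborel) \<le> ennreal (K\<^sup>2 * real (card A)) * (\<Sum>a\<in>A. \<integral>\<^sup>+x. ennreal ((D a x)\<^sup>2) \<partial>lborel)"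
proof -
  have "(\<integral>\<^sup>+x. ennreal ((g x)\<^sup>2) \<partial>lborel) \<le> (\<integral>\<^sup>+x. ennreal (K\<^sup>2 * real (card A)) * (\<Sum>a\<in>A. ennreal ((D a x)\<^sup>2)) \<partial>lborel)"
  proof (rule nn_integral_mono)
    fix x
    have "(g x)\<^sup>2 \<le> (K * (\<Sum>a\<in>A. D a x))\<^sup>2" using assms by (intro power_mono) auto
    also have "\<dots> \<le> K\<^sup>2 * ((\<Sum>a\<in>A. (D a x)\<^sup>2) * real (card A))"
      unfolding power_mult_distrib by (intro mult_left_mono sum_squared_le_sum_of_squares) auto
    finally have "ennreal ((g x)\<^sup>2) \<le> ennreal ((K\<^sup>2 * real (card A)) * (\<Sum>a\<in>A. (D a x)\<^sup>2))"
      by (intro ennreal_leI) (simp add: mult_ac)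
    also have "\<dots> = ennreal (K\<^sup>2 * real (card A)) * (\<Sum>a\<in>A. ennreal ((D a x)\<^sup>2))"
      by (subst ennreal_mult) (auto simp: sum_nonneg)
    finally show "ennreal ((g x)\<^sup>2) \<le> ennreal (K\<^sup>2 * real (card A)) * (\<Sum>a\<in>A. ennreal ((D a x)\<^sup>2))" .
  qed
  also have "\<dots> = ennreal (K\<^sup>2 * real (card A)) * (\<Sum>a\<in>A. \<integral>\<^sup>+x. ennreal ((D a x)\<^sup>2) \<partial>lborel)"
    using assms(3) by (subst nn_integral_cmult, measurable) (subst nn_integral_sum, auto)
  finally show ?thesis .
qed

text \<open>The functions \<open>W i\<close> will be \<open>m S\<^sub>i f\<close> for products and \<open>m G (S\<^sub>i f)\<close> for compositions.\<close>

lemma sobolev_transfer: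
  assumes N: "N > 0" and s: "0 < s" "s < real N"
  shows "\<exists>C\<ge>0. \<forall>(A::'i set) (f::'i \<Rightarrow> 'a::euclidean_space \<Rightarrow> real) M R W w K K'.
    finite A \<longrightarrow> K \<ge> 0 \<longrightarrow> K' \<ge> 0 \<longrightarrow>
    (\<forall>a\<in>A. integrable lborel (f a) \<and> (\<forall>x. \<bar>f a x\<bar> \<le> M) \<and> (\<forall>x. norm x > R \<longrightarrow> f a x = 0)) \<longrightarrow>
    (\<forall>i. Ck N (W i)) \<longrightarrow> W 0 = (\<lambda>x. 0) \<longrightarrow> integrable lborel w \<longrightarrow>
    (\<forall>i x. jet (1 / 2 ^ i) N (\<lambda>x. W (Suc i) x - W i x) x \<le> K * (\<Sum>a\<in>A. jet (1 / 2 ^ i) N (\<lambda>x. lp_approx N (Suc i) (f a) x - lp_approx N i (f a) x) x)) \<longrightarrow>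
    (\<forall>i x. \<bar>W i x - w x\<bar> \<le> K' * (\<Sum>a\<in>A. \<bar>lp_approx N i (f a) x - f a x\<bar>)) \<longrightarrow>
    sobolev_integral s w \<le> ennreal (C * K\<^sup>2 * real (card A)) * (\<Sum>a\<in>A. sobolev_integral s (f a))"
proof -
  obtain C1 where C1: "C1 \<ge> 0" "\<And>(f::'a \<Rightarrow> real) M n. integrable lborel f \<Longrightarrow> (\<forall>x. \<bar>f x\<bar> \<le> M) \<Longrightarrow>
    (\<Sum>i<n. ennreal ((2 ^ i) powr (2 * s)) * (\<integral>\<^sup>+x. ennreal ((jet (1 / 2 ^ i) N (\<lambda>x. lp_approx N (Suc i) f x - lp_approx N i f x) x)\<^sup>2) \<partial>lborel))
      \<le> ennreal C1 * sobolev_integral s f"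
    using lp_square_function[OF N s, where 'a='a] by blast
  obtain C2 where C2: "C2 \<ge> 0" "\<And>(W::nat \<Rightarrow> 'a \<Rightarrow> real) w I. (\<forall>i. Ck N (W i)) \<Longrightarrow> W 0 = (\<lambda>x. 0) \<Longrightarrow>
    (\<forall>i. integrable lborel (jet (1 / 2 ^ i) N (\<lambda>x. W (Suc i) x - W i x))) \<Longrightarrow> integrable lborel w \<Longrightarrow>
    (\<lambda>i. \<integral>\<^sup>+x. ennreal \<bar>W i x - w x\<bar> \<partial>lborel) \<longlonglongrightarrow> 0 \<Longrightarrow>
    (\<forall>n. (\<Sum>i<n. ennreal ((2 ^ i) powr (2 * s)) * (\<integral>\<^sup>+x. ennreal ((jet (1 / 2 ^ i) N (\<lambda>x. W (Suc i) x - W i x) x)\<^sup>2) \<partial>lborel)) \<le> I) \<Longrightarrow>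
    sobolev_integral s w \<le> ennreal C2 * I"
    using sobolev_synthesis[OF N s, where 'a='a] by blast
  have main: "sobolev_integral s w \<le> ennreal ((C2 * C1) * K\<^sup>2 * real (card A)) * (\<Sum>a\<in>A. sobolev_integral s (f a))"
    if A: "finite A" and K: "K \<ge> 0" and K': "K' \<ge> 0"
      and f': "\<forall>a\<in>A. integrable lborel (f a) \<and> (\<forall>x. \<bar>f a x\<bar> \<le> M) \<and> (\<forall>x. norm x > R \<longrightarrow> f a x = 0)"
      and CW': "\<forall>i. Ck N (W i)" and W0: "W 0 = (\<lambda>x. 0)" and wi: "integrable lborel w"
      and jW': "\<forall>i x. jet (1 / 2 ^ i) N (\<lambda>x. W (Suc i) x - W i x) x \<le> K * (\<Sum>a\<in>A. jet (1 / 2 ^ i) N (\<lambda>x. lp_approx N (Suc i) (f a) x - lp_approx N i (f a) x) x)"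
      and dW': "\<forall>i x. \<bar>W i x - w x\<bar> \<le> K' * (\<Sum>a\<in>A. \<bar>lp_approx N i (f a) x - f a x\<bar>)"
    for A :: "'i set" and f :: "'i \<Rightarrow> 'a \<Rightarrow> real" and M R W w K K'
  proof -
    note f = bspec[OF f'] and CW = spec[OF CW'] and jW = spec[OF spec[OF jW']] and dW = spec[OF spec[OF dW']]
    define D where "D i a = jet (1 / 2 ^ i) N (\<lambda>x. lp_approx N (Suc i) (f a) x - lp_approx N i (f a) x)" for i a
    have CS: "Ck N (lp_approx N i (f a))" if "a \<in> A" for i a
      using f[OF that] by (intro Ck_lp_approx[of _ M]) auto
    have Dm: "D i a \<in> borel_measurable borel" if "a \<in> A" for i a
      unfolding D_def by (intro jet_borel Ck_diff CS that) simp
    have Di: "integrable lborel (D i a)" if a: "a \<in> A" for i a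
    proof (rule Bochner_Integration.integrable_bound)
      have fa: "integrable lborel (f a)" "\<And>x. \<bar>f a x\<bar> \<le> M" using f[OF a] by auto
      show "integrable lborel (\<lambda>x. jet (1 / 2 ^ i) N (lp_approx N (Suc i) (f a)) x + jet (1 / 2 ^ i) N (lp_approx N i (f a)) x)"
        by (intro Bochner_Integration.integrable_add integrable_jet_lp_approx[OF fa]) auto
      show "AE x in lborel. norm (D i a x) \<le> norm (jet (1 / 2 ^ i) N (lp_approx N (Suc i) (f a)) x + jet (1 / 2 ^ i) N (lp_approx N i (f a)) x)"
      proof (rule AE_I2)
        fix x
        have "D i a x \<le> jet (1 / 2 ^ i) N (lp_approx N (Suc i) (f a)) x + jet (1 / 2 ^ i) N (lp_approx N i (f a)) x"
          unfolding D_def by (intro jet_diff CS a) simp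
        moreover have "D i a x \<ge> 0" unfolding D_def by (intro jet_nonneg) simp
        ultimately show "norm (D i a x) \<le> norm (jet (1 / 2 ^ i) N (lp_approx N (Suc i) (f a)) x + jet (1 / 2 ^ i) N (lp_approx N i (f a)) x)"
          unfolding real_norm_def by linarith
      qed
    qed (use Dm[OF a] in simp)
    define J where "J i = jet (1 / 2 ^ i) N (\<lambda>x. W (Suc i) x - W i x)" for i
    have J0: "J i x \<ge> 0" for i x unfolding J_def by (intro jet_nonneg) simp
    have JD: "J i x \<le> K * (\<Sum>a\<in>A. D i a x)" for i x unfolding J_def D_def by (rule jW)
    have Ji: "integrable lborel (J i)" for i
    proof (rule Bochner_Integration.integrable_bound)
      show "integrable lborel (\<lambda>x. K * (\<Sum>a\<in>A. D i a x))"
        by (intro integrable_mult_right Bochner_Integration.integrable_sum Di)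
      show "J i \<in> borel_measurable lborel" using jet_borel[OF _ Ck_diff[OF CW CW]] unfolding J_def by simp
      show "AE x in lborel. norm (J i x) \<le> norm (K * (\<Sum>a\<in>A. D i a x))"
        using J0 JD by (intro AE_I2) (simp add: order_trans[OF _ abs_ge_self])
    qed
    \<comment> \<open>K' has only to be finite: it carries over the L1 convergence of the
      approximations and is absent from the final constant.\<close>
    have lim: "(\<lambda>i. \<integral>\<^sup>+x. ennreal \<bar>W i x - w x\<bar> \<partial>lborel) \<longlonglongrightarrow> 0"
    proof (rule tendsto_sandwich[OF _ _ tendsto_const])
      let ?e = "\<lambda>a i. \<integral>\<^sup>+x. ennreal \<bar>lp_approx N i (f a) x - f a x\<bar> \<partial>lborel"
      have "(\<lambda>i. ennreal K' * (\<Sum>a\<in>A. ?e a i)) \<longlonglongrightarrow> ennreal K' * (\<Sum>a\<in>A. 0)"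
      proof (intro ennreal_tendsto_cmult tendsto_sum)
        fix a assume "a \<in> A"
        then show "(\<lambda>i. ?e a i) \<longlonglongrightarrow> 0" using f[of a] by (intro lp_approx_tendsto_L1[of _ M _ R] N) auto
      qed simp
      then show "(\<lambda>i. ennreal K' * (\<Sum>a\<in>A. ?e a i)) \<longlonglongrightarrow> 0" by simp
      have "(\<integral>\<^sup>+x. ennreal \<bar>W i x - w x\<bar> \<partial>lborel) \<le> ennreal K' * (\<Sum>a\<in>A. ?e a i)" for i
      proof -
        have "(\<integral>\<^sup>+x. ennreal \<bar>W i x - w x\<bar> \<partial>lborel) \<le> (\<integral>\<^sup>+x. ennreal K' * (\<Sum>a\<in>A. ennreal \<bar>lp_approx N i (f a) x - f a x\<bar>) \<partial>lborel)"
        proof (rule nn_integral_mono)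
          fix x
          have "ennreal \<bar>W i x - w x\<bar> \<le> ennreal (K' * (\<Sum>a\<in>A. \<bar>lp_approx N i (f a) x - f a x\<bar>))" by (intro ennreal_leI dW)
          then show "ennreal \<bar>W i x - w x\<bar> \<le> ennreal K' * (\<Sum>a\<in>A. ennreal \<bar>lp_approx N i (f a) x - f a x\<bar>)"
            using K' by (simp add: ennreal_mult sum_nonneg)
        qed
        also have "\<dots> = ennreal K' * (\<Sum>a\<in>A. ?e a i)"
        proof -
          have m: "(\<lambda>x. ennreal \<bar>lp_approx N i (f a) x - f a x\<bar>) \<in> borel_measurable lborel" if "a \<in> A" for a
          proof -
            have [measurable]: "f a \<in> borel_measurable borel" "lp_approx N i (f a) \<in> borel_measurable borel"
              using integrable_borel f[OF that] Ck_borel[OF CS[OF that]] by blast+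
            show ?thesis by measurable
          qed
          show ?thesis using m by (subst nn_integral_cmult) (auto simp: nn_integral_sum simp del: sum_ennreal)
        qed
        finally show ?thesis .
      qed
      then show "\<forall>\<^sub>F i in sequentially. (\<integral>\<^sup>+x. ennreal \<bar>W i x - w x\<bar> \<partial>lborel) \<le> ennreal K' * (\<Sum>a\<in>A. ?e a i)"
        by (intro always_eventually allI)
    qed simp
    have sq: "(\<Sum>i<n. ennreal ((2 ^ i) powr (2 * s)) * (\<integral>\<^sup>+x. ennreal ((J i x)\<^sup>2) \<partial>lborel)) \<le>
      ennreal (K\<^sup>2 * real (card A)) * (ennreal C1 * (\<Sum>a\<in>A. sobolev_integral s (f a)))" for n
    proof -
      have "(\<Sum>i<n. ennreal ((2 ^ i) powr (2 * s)) * (\<integral>\<^sup>+x. ennreal ((J i x)\<^sup>2) \<partial>lborel)) \<le>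
        (\<Sum>i<n. ennreal ((2 ^ i) powr (2 * s)) * (ennreal (K\<^sup>2 * real (card A)) * (\<Sum>a\<in>A. \<integral>\<^sup>+x. ennreal ((D i a x)\<^sup>2) \<partial>lborel)))"
        by (intro sum_mono mult_left_mono nn_integral_jet_sum_le A K Dm J0 JD) auto
      also have "\<dots> = ennreal (K\<^sup>2 * real (card A)) * (\<Sum>i<n. \<Sum>a\<in>A. ennreal ((2 ^ i) powr (2 * s)) * (\<integral>\<^sup>+x. ennreal ((D i a x)\<^sup>2) \<partial>lborel))"
        by (simp add: sum_distrib_left mult.left_commute)
      also have "(\<Sum>i<n. \<Sum>a\<in>A. ennreal ((2 ^ i) powr (2 * s)) * (\<integral>\<^sup>+x. ennreal ((D i a x)\<^sup>2) \<partial>lborel)) =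
         (\<Sum>a\<in>A. \<Sum>i<n. ennreal ((2 ^ i) powr (2 * s)) * (\<integral>\<^sup>+x. ennreal ((D i a x)\<^sup>2) \<partial>lborel))" by (rule sum.swap)
      also have "\<dots> \<le> (\<Sum>a\<in>A. ennreal C1 * sobolev_integral s (f a))"
        unfolding D_def using f by (intro sum_mono C1(2)[where M=M]) auto
      finally show ?thesis by (simp add: sum_distrib_left mult_left_mono)
    qed
    have "sobolev_integral s w \<le> ennreal C2 * (ennreal (K\<^sup>2 * real (card A)) * (ennreal C1 * (\<Sum>a\<in>A. sobolev_integral s (f a))))"
    proof (rule C2(2)[OF _ W0 _ wi lim])
      show "\<forall>i. Ck N (W i)" using CW by blast
      show "\<forall>i. integrable lborel (jet (1 / 2 ^ i) N (\<lambda>x. W (Suc i) x - W i x))" using Ji unfolding J_def by blast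
      show "\<forall>n. (\<Sum>i<n. ennreal ((2 ^ i) powr (2 * s)) * (\<integral>\<^sup>+x. ennreal ((jet (1 / 2 ^ i) N (\<lambda>x. W (Suc i) x - W i x) x)\<^sup>2) \<partial>lborel)) \<le>
        ennreal (K\<^sup>2 * real (card A)) * (ennreal C1 * (\<Sum>a\<in>A. sobolev_integral s (f a)))"
        using sq unfolding J_def by blast
    qed
    also have "\<dots> = ennreal ((C2 * C1) * K\<^sup>2 * real (card A)) * (\<Sum>a\<in>A. sobolev_integral s (f a))"
      using C1(1) C2(1) by (simp add: ennreal_mult mult_ac)
    finally show ?thesis .
  qed
  have "C2 * C1 \<ge> 0" using C1(1) C2(1) by simp
  then show ?thesis by (intro exI[of _ "C2 * C1"] conjI allI impI) (assumption, rule main)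
qed

text \<open>\<open>sobolev_transfer\<close> for a single function and the pieces m S_i f. Since the
  units 2^(-i) are at most 1, the jets of \<open>m\<close> stay below B at all scales, and
  \<open>jet_mult\<close> gives K = 3^N B.\<close>

lemma sobolev_multiplication:
  assumes N: "N > 0" and s: "0 < s" "s < real N"
  shows "\<exists>C\<ge>0. \<forall>(m::'a::euclidean_space \<Rightarrow> real) B f M R. Ck N m \<longrightarrow> (\<forall>x. jet 1 N m x \<le> B) \<longrightarrow> integrable lborel f \<longrightarrow>
    (\<forall>x. \<bar>f x\<bar> \<le> M) \<longrightarrow> (\<forall>x. norm x > R \<longrightarrow> f x = 0) \<longrightarrow>
    sobolev_integral s (\<lambda>x. m x * f x) \<le> ennreal (C * B\<^sup>2) * sobolev_integral s f"
proof -
  obtain C where C0: "C \<ge> 0" and C: "\<forall>(A::unit set) (f::unit \<Rightarrow> 'a \<Rightarrow> real) M R W w K K'.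
    finite A \<longrightarrow> K \<ge> 0 \<longrightarrow> K' \<ge> 0 \<longrightarrow>
    (\<forall>a\<in>A. integrable lborel (f a) \<and> (\<forall>x. \<bar>f a x\<bar> \<le> M) \<and> (\<forall>x. norm x > R \<longrightarrow> f a x = 0)) \<longrightarrow>
    (\<forall>i. Ck N (W i)) \<longrightarrow> W 0 = (\<lambda>x. 0) \<longrightarrow> integrable lborel w \<longrightarrow>
    (\<forall>i x. jet (1 / 2 ^ i) N (\<lambda>x. W (Suc i) x - W i x) x \<le> K * (\<Sum>a\<in>A. jet (1 / 2 ^ i) N (\<lambda>x. lp_approx N (Suc i) (f a) x - lp_approx N i (f a) x) x)) \<longrightarrow>
    (\<forall>i x. \<bar>W i x - w x\<bar> \<le> K' * (\<Sum>a\<in>A. \<bar>lp_approx N i (f a) x - f a x\<bar>)) \<longrightarrow>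
    sobolev_integral s w \<le> ennreal (C * K\<^sup>2 * real (card A)) * (\<Sum>a\<in>A. sobolev_integral s (f a))"
    using sobolev_transfer[OF N s, where 'a='a and 'i=unit] by (elim exE conjE) (rule that)
  have "sobolev_integral s (\<lambda>x. m x * f x) \<le> ennreal ((C * (3 ^ N)\<^sup>2) * B\<^sup>2) * sobolev_integral s f"
    if m: "Ck N m" and B: "\<And>x. jet 1 N m x \<le> B" and f: "integrable lborel f" and M: "\<And>x. \<bar>f x\<bar> \<le> M" and R: "\<And>x. norm x > R \<Longrightarrow> f x = 0"
    for m :: "'a \<Rightarrow> real" and B f M R
  proof -
    have mB: "\<bar>m x\<bar> \<le> B" for x using jet_ge_abs[of 1 m x N] B[of x] by simp
    then have B0: "B \<ge> 0" using abs_ge_zero order_trans by blast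
    have CS: "Ck N (lp_approx N i f)" for i by (rule Ck_lp_approx[OF f M])
    have "sobolev_integral s (\<lambda>x. m x * f x) \<le> ennreal (C * (3 ^ N * B)\<^sup>2 * real (card {()})) * (\<Sum>a\<in>{()}. sobolev_integral s f)"
    proof (rule C[THEN spec[where x="{()}"], THEN spec[where x="\<lambda>_. f"], THEN spec[where x="M"], THEN spec[where x="R"], THEN spec[where x="\<lambda>i x. m x * lp_approx N i f x"], THEN spec[where x="\<lambda>x. m x * f x"], THEN spec[where x="3 ^ N * B"], THEN spec[where x="B"], THEN mp, THEN mp, THEN mp, THEN mp, THEN mp, THEN mp, THEN mp, THEN mp, THEN mp])
      show "\<forall>i. Ck N (\<lambda>x. m x * lp_approx N i f x)" by (intro allI Ck_mult m CS)
      show "integrable lborel (\<lambda>x. m x * f x)"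
        by (rule integrable_bounded_mult[OF f Ck_borel[OF m]]) (use mB in simp)
      show "\<forall>i x. \<bar>m x * lp_approx N i f x - m x * f x\<bar> \<le> B * (\<Sum>a\<in>{()}. \<bar>lp_approx N i f x - f x\<bar>)"
        using mB by (auto simp: abs_mult right_diff_distrib[symmetric] intro: mult_right_mono)
      show "\<forall>i x. jet (1 / 2 ^ i) N (\<lambda>x. m x * lp_approx N (Suc i) f x - m x * lp_approx N i f x) x \<le>
         3 ^ N * B * (\<Sum>a\<in>{()}. jet (1 / 2 ^ i) N (\<lambda>x. lp_approx N (Suc i) f x - lp_approx N i f x) x)"
      proof (intro allI)
        fix i :: nat and x
        let ?D = "\<lambda>x. lp_approx N (Suc i) f x - lp_approx N i f x"
        have "jet (1 / 2 ^ i) N (\<lambda>x. m x * ?D x) x \<le> 3 ^ N * (jet (1 / 2 ^ i) N m x * jet (1 / 2 ^ i) N ?D x)"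
          by (intro jet_mult Ck_diff m CS) simp
        also have "\<dots> \<le> 3 ^ N * (B * jet (1 / 2 ^ i) N ?D x)"
          by (intro mult_left_mono mult_right_mono order_trans[OF jet_mono_scale[of _ 1] B] jet_nonneg) auto
        finally show "jet (1 / 2 ^ i) N (\<lambda>x. m x * lp_approx N (Suc i) f x - m x * lp_approx N i f x) x \<le>
         3 ^ N * B * (\<Sum>a\<in>{()}. jet (1 / 2 ^ i) N ?D x)" by (simp add: right_diff_distrib mult.assoc)
      qed
    qed (use f M R B0 in auto)
    then show ?thesis by (simp add: power_mult_distrib mult.assoc)
  qed
  note main = this
  have "C * (3 ^ N)\<^sup>2 \<ge> 0" using C0 by simp
  then show ?thesis
    by (intro exI[of _ "C * (3 ^ N)\<^sup>2"] conjI allI impI) (assumption, rule main, auto)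
qed

text \<open>The multiplier is carried along from the start, with pieces m G(S_i v), so that the
  localised nonlinearity is estimated in one go. The approximations may exceed the bound M of
  \<open>v\<close>, but only by a fixed factor; hence derivatives of G are controlled on a ball of
  radius C M, with the same C as in the estimate.\<close>

lemma sobolev_composition:
  assumes N: "N > 0" and s: "0 < s" "s < real N"
  shows "\<exists>C\<ge>1. \<forall>(m::'a::euclidean_space \<Rightarrow> real) B (G::'c::euclidean_space \<Rightarrow> real) L v M R.
    Ck N m \<longrightarrow> (\<forall>x. jet 1 N m x \<le> B) \<longrightarrow> Ck (Suc N) G \<longrightarrow> G 0 = 0 \<longrightarrow>
    (\<forall>a\<in>Basis. integrable lborel (\<lambda>x. v x \<bullet> a)) \<longrightarrow> (\<forall>a\<in>Basis. \<forall>x. \<bar>v x \<bullet> a\<bar> \<le> M) \<longrightarrow> (\<forall>x. norm x > R \<longrightarrow> v x = 0) \<longrightarrow>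
    (\<forall>\<beta>\<in>multi_indices. \<forall>a\<in>Basis. \<forall>y. length \<beta> \<le> N \<longrightarrow> norm y \<le> C * M \<longrightarrow> \<bar>iter_deriv \<beta> (dir_deriv a G) y\<bar> \<le> L) \<longrightarrow>
    sobolev_integral s (\<lambda>x. m x * G (v x)) \<le> ennreal (C * (B * L * (1 + M) ^ N)\<^sup>2) * (\<Sum>a\<in>Basis. sobolev_integral s (\<lambda>x. v x \<bullet> a))"
proof -
  obtain C where C0: "C \<ge> 0" and C: "\<forall>(A::'c set) (f::'c \<Rightarrow> 'a \<Rightarrow> real) M R W w K K'.
    finite A \<longrightarrow> K \<ge> 0 \<longrightarrow> K' \<ge> 0 \<longrightarrow>
    (\<forall>a\<in>A. integrable lborel (f a) \<and> (\<forall>x. \<bar>f a x\<bar> \<le> M) \<and> (\<forall>x. norm x > R \<longrightarrow> f a x = 0)) \<longrightarrow>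
    (\<forall>i. Ck N (W i)) \<longrightarrow> W 0 = (\<lambda>x. 0) \<longrightarrow> integrable lborel w \<longrightarrow>
    (\<forall>i x. jet (1 / 2 ^ i) N (\<lambda>x. W (Suc i) x - W i x) x \<le> K * (\<Sum>a\<in>A. jet (1 / 2 ^ i) N (\<lambda>x. lp_approx N (Suc i) (f a) x - lp_approx N i (f a) x) x)) \<longrightarrow>
    (\<forall>i x. \<bar>W i x - w x\<bar> \<le> K' * (\<Sum>a\<in>A. \<bar>lp_approx N i (f a) x - f a x\<bar>)) \<longrightarrow>
    sobolev_integral s w \<le> ennreal (C * K\<^sup>2 * real (card A)) * (\<Sum>a\<in>A. sobolev_integral s (f a))"
    using sobolev_transfer[OF N s, where 'a='a and 'i='c] by (elim exE conjE) (rule that)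
  \<comment> \<open>The sum bounds the jets of all approximations by the sup norm; the summand 1
    makes C1 M a bound for the components of \<open>v\<close> as well.\<close>
  define C1 where "C1 = 1 + (\<Sum>k\<in>{1..N}. \<bar>lp_coeff N k\<bar> * kern_norm 1 N (\<lambda>\<xi>::'a. complex_of_real (gauss (real k) \<xi>)))"
  have C1: "C1 \<ge> 1" unfolding C1_def by (auto intro!: sum_nonneg mult_nonneg_nonneg kern_norm_nonneg)
  define C2 where "C2 = compose_diff_const (DIM('a) * DIM('c)) N"
  have C2: "C2 \<ge> 0" unfolding C2_def by (rule compose_diff_const_nonneg)
  define d where "d = real DIM('c)"
  have d: "d \<ge> 1" unfolding d_def using DIM_positive[where 'a='c] by linarith
  \<comment> \<open>E has two duties, met by adding: d * C1 turns the bound C1 M on d components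
    into the radius of a ball, and the second summand is the constant of the estimate.\<close>
  define E where "E = d * C1 + C * (3 ^ N * C2 * C1 ^ N)\<^sup>2 * d"
  have E1: "E \<ge> d * C1" unfolding E_def using C0 d by simp
  also have "d * C1 \<ge> 1" using mult_mono[of 1 d 1 C1] d C1 by simp
  finally (order_trans[rotated]) have E: "E \<ge> 1" .
  have main: "sobolev_integral s (\<lambda>x. m x * G (v x)) \<le> ennreal (E * (B * L * (1 + M) ^ N)\<^sup>2) * (\<Sum>a\<in>Basis. sobolev_integral s (\<lambda>x. v x \<bullet> a))"
    if m: "Ck N m" and B': "\<forall>x. jet 1 N m x \<le> B" and G: "Ck (Suc N) G" and G0: "G 0 = 0"
      and v': "\<forall>a\<in>Basis. integrable lborel (\<lambda>x. v x \<bullet> a)" and M': "\<forall>a\<in>Basis. \<forall>x. \<bar>v x \<bullet> a\<bar> \<le> M"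
      and R': "\<forall>x. norm x > R \<longrightarrow> v x = 0"
      and L': "\<forall>\<beta>\<in>multi_indices. \<forall>a\<in>Basis. \<forall>y. length \<beta> \<le> N \<longrightarrow> norm y \<le> E * M \<longrightarrow> \<bar>iter_deriv \<beta> (dir_deriv a G) y\<bar> \<le> L"
    for m :: "'a \<Rightarrow> real" and B and G :: "'c \<Rightarrow> real" and L v M R
  proof -
    note B = spec[OF B'] and v = bspec[OF v'] and M = spec[OF bspec[OF M']] and R = mp[OF spec[OF R']]
    have L: "\<bar>iter_deriv \<beta> (dir_deriv a G) y\<bar> \<le> L" if "\<beta> \<in> multi_indices" "a \<in> Basis" "length \<beta> \<le> N" "norm y \<le> E * M" for \<beta> a y
      using L' that by blast
    have mB: "\<bar>m x\<bar> \<le> B" for x using jet_ge_abs[of 1 m x N] B[of x] by simp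
    then have B0: "B \<ge> 0" using abs_ge_zero order_trans by blast
    have M0: "M \<ge> 0" using M[OF SOME_Basis, of undefined] by linarith
    have L1: "\<bar>dir_deriv a G y\<bar> \<le> L" if "a \<in> Basis" "norm y \<le> E * M" for a y
      using L[of "[]" a y] that by (simp add: multi_indices_def iter_deriv_def)
    have L0: "L \<ge> 0" using L1[OF SOME_Basis, of 0] E M0 by fastforce
    let ?S = "cball (0::'c) (E * M)"
    define f where "f a = (\<lambda>x. v x \<bullet> a)" for a
    define V where "V i x = (\<Sum>a\<in>Basis. lp_approx N i (f a) x *\<^sub>R a)" for i x
    have fa: "integrable lborel (f a)" "\<And>x. \<bar>f a x\<bar> \<le> M" if "a \<in> Basis" for a
      using v[OF that] M[OF that] by (auto simp: f_def)
    have Va: "V i x \<bullet> a = lp_approx N i (f a) x" if "a \<in> Basis" for i x a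
      using that by (simp add: V_def inner_sum_left inner_Basis if_distrib cong: if_cong)
    have CS: "Ck N (lp_approx N i (f a))" if "a \<in> Basis" for i a by (rule Ck_lp_approx[OF fa[OF that]])
    have CV: "Ck N (\<lambda>x. V i x \<bullet> a)" if "a \<in> Basis" for i a using CS[OF that] Va[OF that] by simp
    \<comment> \<open>Index i has the scale 2^(i - 1). With the unit 2^(-i) both S_i and S_(i+1)
      qualify; truncated subtraction lets i = 0 through, where the approximation is zero.\<close>
    have jS: "jet l N (lp_approx N i (f a)) x \<le> C1 * M" if a: "a \<in> Basis" and l: "l \<ge> 0" "l * 2 ^ (i - 1) \<le> 1" for l i a x
    proof (cases i)
      case 0
      then show ?thesis using jet_zero[OF l(1), of N x] C1 M0 by simp
    next
      case (Suc j)
      have "jet l N (lp_approx N (Suc j) (f a)) x \<le> M * (C1 - 1)"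
        unfolding C1_def using jet_lp_approx_le[OF fa[OF a] l(1), of j N N x] l(2) Suc by simp
      then show ?thesis using Suc M0 by (simp add: algebra_simps)
    qed
    have in_ball: "y \<in> ?S" if "\<And>a. a \<in> Basis \<Longrightarrow> \<bar>y \<bullet> a\<bar> \<le> C1 * M" for y
    proof -
      have "norm y \<le> (\<Sum>a\<in>Basis. \<bar>y \<bullet> a\<bar>)" by (rule norm_le_l1)
      also have "\<dots> \<le> (\<Sum>a\<in>(Basis::'c set). C1 * M)" by (intro sum_mono that)
      also have "\<dots> = (d * C1) * M" by (simp add: d_def)
      also have "\<dots> \<le> E * M" by (intro mult_right_mono E1 M0)
      finally show ?thesis by simp
    qed
    have VS: "V i x \<in> ?S" for i x
    proof (rule in_ball)
      fix a :: 'c assume a: "a \<in> Basis"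
      have "\<bar>lp_approx N i (f a) x\<bar> \<le> jet (1 / 2 ^ i) N (lp_approx N i (f a)) x" by (rule jet_ge_abs) simp
      also have "\<dots> \<le> C1 * M" by (rule jS[OF a]) (auto simp: field_simps)
      finally show "\<bar>V i x \<bullet> a\<bar> \<le> C1 * M" by (simp add: Va[OF a])
    qed
    have vS: "v x \<in> ?S" for x
    proof (rule in_ball)
      fix a :: 'c assume a: "a \<in> Basis"
      show "\<bar>v x \<bullet> a\<bar> \<le> C1 * M" using M[OF a, of x] mult_right_mono[OF C1 M0] by simp
    qed
    have dG: "G differentiable (at y)" for y using G by simp
    have CG: "Ck N G" using G by (rule Ck_Suc_imp)
    have lip: "\<bar>G y - G z\<bar> \<le> L * (\<Sum>a\<in>Basis. \<bar>(y - z) \<bullet> a\<bar>)" if "y \<in> ?S" "z \<in> ?S" for y z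
      using L1 that by (intro abs_diff_le_dir_deriv[OF dG, where S="?S"]) auto
    have CW: "Ck N (\<lambda>x. G (V i x))" for i by (rule Ck_compose[OF CG CV])
    have vm: "v \<in> borel_measurable borel"
      using integrable_borel[OF v] by (subst borel_measurable_euclidean_space) auto
    have "sobolev_integral s (\<lambda>x. m x * G (v x)) \<le> ennreal (C * (3 ^ N * (B * (C2 * L * (1 + C1 * M) ^ N)))\<^sup>2 * real (card (Basis::'c set))) * (\<Sum>a\<in>Basis. sobolev_integral s (f a))"
    proof (rule C[THEN spec[where x="Basis"], THEN spec[where x="f"], THEN spec[where x="M"], THEN spec[where x="R"], THEN spec[where x="\<lambda>i x. m x * G (V i x)"], THEN spec[where x="\<lambda>x. m x * G (v x)"], THEN spec[where x="3 ^ N * (B * (C2 * L * (1 + C1 * M) ^ N))"], THEN spec[where x="B * L"], THEN mp, THEN mp, THEN mp, THEN mp, THEN mp, THEN mp, THEN mp, THEN mp, THEN mp])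
      show "\<forall>a\<in>Basis. integrable lborel (f a) \<and> (\<forall>x. \<bar>f a x\<bar> \<le> M) \<and> (\<forall>x. R < norm x \<longrightarrow> f a x = 0)"
        using fa R by (auto simp: f_def)
      show "\<forall>i. Ck N (\<lambda>x. m x * G (V i x))" by (intro allI Ck_mult m CW)
      \<comment> \<open>The vanishing of G at 0 starts the telescoping sum at the zero
        function.\<close>
      show "(\<lambda>x. m x * G (V 0 x)) = (\<lambda>x. 0)" by (simp add: V_def G0)
      show "\<forall>i x. \<bar>m x * G (V i x) - m x * G (v x)\<bar> \<le> B * L * (\<Sum>a\<in>Basis. \<bar>lp_approx N i (f a) x - f a x\<bar>)"
      proof (intro allI)
        fix i x
        have "\<bar>m x * G (V i x) - m x * G (v x)\<bar> = \<bar>m x\<bar> * \<bar>G (V i x) - G (v x)\<bar>" by (simp add: abs_mult flip: right_diff_distrib)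
        also have "\<dots> \<le> B * (L * (\<Sum>a\<in>Basis. \<bar>(V i x - v x) \<bullet> a\<bar>))"
          by (intro mult_mono mB lip VS vS B0) auto
        also have "(\<Sum>a\<in>Basis. \<bar>(V i x - v x) \<bullet> a\<bar>) = (\<Sum>a\<in>Basis. \<bar>lp_approx N i (f a) x - f a x\<bar>)"
          by (intro sum.cong refl) (simp add: inner_diff_left Va f_def)
        finally show "\<bar>m x * G (V i x) - m x * G (v x)\<bar> \<le> B * L * (\<Sum>a\<in>Basis. \<bar>lp_approx N i (f a) x - f a x\<bar>)" by (simp add: mult.assoc)
      qed
      show "integrable lborel (\<lambda>x. m x * G (v x))"
      proof (rule Bochner_Integration.integrable_bound)
        show "integrable lborel (\<lambda>x. B * (L * (\<Sum>a\<in>Basis. \<bar>v x \<bullet> a\<bar>)))"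
          by (intro integrable_mult_right Bochner_Integration.integrable_sum integrable_abs v)
        show "(\<lambda>x. m x * G (v x)) \<in> borel_measurable lborel"
          using Ck_borel[OF m] measurable_compose[OF vm Ck_borel[OF CG]] by measurable
        show "AE x in lborel. norm (m x * G (v x)) \<le> norm (B * (L * (\<Sum>a\<in>Basis. \<bar>v x \<bullet> a\<bar>)))"
        proof (rule AE_I2)
          fix x
          have "\<bar>G (v x) - G 0\<bar> \<le> L * (\<Sum>a\<in>Basis. \<bar>(v x - 0) \<bullet> a\<bar>)" using E M0 by (intro lip vS) auto
          then have "\<bar>m x\<bar> * \<bar>G (v x)\<bar> \<le> B * (L * (\<Sum>a\<in>Basis. \<bar>v x \<bullet> a\<bar>))" using G0 by (intro mult_mono mB B0) auto
          then show "norm (m x * G (v x)) \<le> norm (B * (L * (\<Sum>a\<in>Basis. \<bar>v x \<bullet> a\<bar>)))"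
            using B0 L0 by (simp add: abs_mult)
        qed
      qed
      show "\<forall>i x. jet (1 / 2 ^ i) N (\<lambda>x. m x * G (V (Suc i) x) - m x * G (V i x)) x \<le>
         3 ^ N * (B * (C2 * L * (1 + C1 * M) ^ N)) * (\<Sum>a\<in>Basis. jet (1 / 2 ^ i) N (\<lambda>x. lp_approx N (Suc i) (f a) x - lp_approx N i (f a) x) x)"
      proof (intro allI)
        fix i :: nat and x
        let ?l = "1 / 2 ^ i :: real"
        let ?s = "\<Sum>a\<in>Basis. jet ?l N (\<lambda>x. lp_approx N (Suc i) (f a) x - lp_approx N i (f a) x) x"
        have "jet ?l N (\<lambda>x. G (V (Suc i) x) - G (V i x)) x \<le> C2 * L * (1 + C1 * M) ^ N * (\<Sum>a\<in>Basis. jet ?l N (\<lambda>x. V (Suc i) x \<bullet> a - V i x \<bullet> a) x)"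
          unfolding C2_def
        proof (rule jet_compose_diff[where S="?S"])
          show "jet ?l N (\<lambda>x. V (Suc i) x \<bullet> a) x \<le> C1 * M" if a: "a \<in> Basis" for a
            unfolding Va[OF a] by (rule jS[OF a]) auto
          show "jet ?l N (\<lambda>x. V i x \<bullet> a) x \<le> C1 * M" if a: "a \<in> Basis" for a
            unfolding Va[OF a] by (rule jS[OF a]) (auto simp: field_simps)
        qed (use C1 M0 VS G CV L in auto)
        also have "(\<Sum>a\<in>Basis. jet ?l N (\<lambda>x. V (Suc i) x \<bullet> a - V i x \<bullet> a) x) = ?s"
          by (intro sum.cong refl) (simp add: Va)
        finally have 1: "jet ?l N (\<lambda>x. G (V (Suc i) x) - G (V i x)) x \<le> C2 * L * (1 + C1 * M) ^ N * ?s" .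
        have "jet ?l N (\<lambda>x. m x * (G (V (Suc i) x) - G (V i x))) x \<le> 3 ^ N * (jet ?l N m x * jet ?l N (\<lambda>x. G (V (Suc i) x) - G (V i x)) x)"
          by (intro jet_mult Ck_diff m CW) simp
        also have "\<dots> \<le> 3 ^ N * (B * (C2 * L * (1 + C1 * M) ^ N * ?s))"
          by (intro mult_left_mono mult_mono order_trans[OF jet_mono_scale[of _ 1] B] jet_nonneg 1 B0) auto
        finally show "jet ?l N (\<lambda>x. m x * G (V (Suc i) x) - m x * G (V i x)) x \<le>
          3 ^ N * (B * (C2 * L * (1 + C1 * M) ^ N)) * ?s" by (simp add: right_diff_distrib mult.assoc)
      qed
    qed (use B0 L0 C2 C1 M0 in auto)
    also have "\<dots> \<le> ennreal (E * (B * L * (1 + M) ^ N)\<^sup>2) * (\<Sum>a\<in>Basis. sobolev_integral s (f a))"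
    proof (intro mult_right_mono ennreal_leI)
      have "1 + C1 * M \<le> C1 * (1 + M)" using C1 by (simp add: algebra_simps)
      then have "(1 + C1 * M) ^ N \<le> (C1 * (1 + M)) ^ N" using C1 M0 by (intro power_mono) auto
      then have "3 ^ N * (B * (C2 * L * (1 + C1 * M) ^ N)) \<le> 3 ^ N * (B * (C2 * L * (C1 * (1 + M)) ^ N))"
        using B0 C2 L0 by (intro mult_left_mono) auto
      also have "\<dots> = (3 ^ N * C2 * C1 ^ N) * (B * L * (1 + M) ^ N)" by (simp add: power_mult_distrib mult_ac)
      finally have "(3 ^ N * (B * (C2 * L * (1 + C1 * M) ^ N)))\<^sup>2 \<le> ((3 ^ N * C2 * C1 ^ N) * (B * L * (1 + M) ^ N))\<^sup>2"
        using B0 C2 L0 C1 M0 by (intro power_mono) auto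
      then have "C * (3 ^ N * (B * (C2 * L * (1 + C1 * M) ^ N)))\<^sup>2 * d \<le> C * ((3 ^ N * C2 * C1 ^ N) * (B * L * (1 + M) ^ N))\<^sup>2 * d"
        using C0 d by (intro mult_right_mono mult_left_mono) auto
      also have "\<dots> = (C * (3 ^ N * C2 * C1 ^ N)\<^sup>2 * d) * (B * L * (1 + M) ^ N)\<^sup>2" by (simp add: power_mult_distrib mult_ac)
      also have "\<dots> \<le> E * (B * L * (1 + M) ^ N)\<^sup>2" unfolding E_def using d C1 by (intro mult_right_mono) auto
      finally show "C * (3 ^ N * (B * (C2 * L * (1 + C1 * M) ^ N)))\<^sup>2 * real (card (Basis::'c set)) \<le> E * (B * L * (1 + M) ^ N)\<^sup>2"
        by (simp add: d_def)
    qed auto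
    finally show ?thesis unfolding f_def .
  qed
  show ?thesis by (intro exI[of _ E] conjI allI impI E) (rule main)
qed

section \<open>Tempered distributions\<close>

lemma finite_multi_indices: "finite {\<beta>\<in>multi_indices. length \<beta> \<le> n}"
  using finite_lists_length_le[OF finite_Basis, of n] by (simp add: multi_indices_def)

lemma Schwartz_Ck: "\<phi> \<in> Schwartz \<Longrightarrow> Ck k \<phi>" by (simp add: Schwartz_def smooth_def)

lemma Schwartz_borel: "\<phi> \<in> Schwartz \<Longrightarrow> \<phi> \<in> borel_measurable borel"
  using Schwartz_Ck[of \<phi> 0] by (auto intro: borel_measurable_continuous_onI)

lemma fourier_eq_ft: "\<phi> \<in> Schwartz \<Longrightarrow> fourier \<phi> = (\<lambda>\<xi>. complex_of_real ((2 * pi) powr (-3/2)) * ft \<phi> \<xi>)"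
proof -
  assume S: "\<phi> \<in> Schwartz"
  note [measurable] = Schwartz_borel[OF S]
  have "(LINT x|lebesgue. cis (- (x \<bullet> \<xi>)) * \<phi> x) = ft \<phi> \<xi>" for \<xi>
    unfolding ft_def by (rule integral_completion) measurable
  then show ?thesis by (auto simp: fourier_def)
qed

lemma fourier_borel: "\<phi> \<in> Schwartz \<Longrightarrow> fourier \<phi> \<in> borel_measurable borel"
  using Schwartz_borel by (simp add: fourier_eq_ft)

text \<open>A supremum of reals bounds its members only if the family is bounded above. Each index
  word has its own bound, and there are finitely many words of length at most n.\<close>

lemma Schwartz_seminorm_bound:
  assumes "\<phi> \<in> Schwartz"
  shows "(1 + norm x) ^ n * norm (\<phi> x) \<le> Schwartz_seminorm n \<phi>"
proof -
  let ?g = "\<lambda>(\<beta>, x). (1 + norm x) ^ n * norm (iter_deriv \<beta> \<phi> x)"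
  let ?S = "{\<beta>\<in>(multi_indices :: (real^3) list set). length \<beta> \<le> n} \<times> (UNIV :: (real^3) set)"
  have "\<exists>B. \<forall>x. (1 + norm x) ^ n * norm (iter_deriv \<beta> \<phi> x) \<le> B" if "\<beta> \<in> multi_indices" for \<beta>
    using assms that by (simp add: Schwartz_def)
  then obtain B where B: "\<And>\<beta> x. \<beta> \<in> multi_indices \<Longrightarrow> (1 + norm x) ^ n * norm (iter_deriv \<beta> \<phi> x) \<le> B \<beta>"
    by metis
  have "bdd_above (?g ` ?S)"
  proof (rule bdd_aboveI2)
    fix p :: "(real^3) list \<times> (real^3)" assume p: "p \<in> ?S"
    obtain \<beta> x where px: "p = (\<beta>, x)" by (cases p)
    have "?g p \<le> B \<beta>" using B p px by auto
    also have "\<dots> \<le> \<bar>B \<beta>\<bar>" by simp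
    also have "\<dots> \<le> (\<Sum>\<beta>\<in>{\<beta>\<in>multi_indices. length \<beta> \<le> n}. \<bar>B \<beta>\<bar>)"
      using p px finite_multi_indices by (intro member_le_sum) auto
    finally show "?g p \<le> (\<Sum>\<beta>\<in>{\<beta>\<in>multi_indices. length \<beta> \<le> n}. \<bar>B \<beta>\<bar>)" .
  qed
  moreover have "([], x) \<in> ?S" by (simp add: multi_indices_def)
  ultimately have "?g ([], x) \<le> (SUP p\<in>?S. ?g p)" by (intro cSUP_upper)
  then show ?thesis by (simp add: Schwartz_seminorm_def iter_deriv_def)
qed

lemma Schwartz_integrable:
  assumes "\<phi> \<in> Schwartz" shows "integrable lborel \<phi>"
  using Schwartz_seminorm_bound[OF assms, of _ 6] Schwartz_borel[OF assms]
  by (intro integrable_of_decay[of _ "Schwartz_seminorm 6 \<phi>"]) auto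

section \<open>Gaussian test functions and uniqueness of the representing function\<close>

lemma poly_gauss_Schwartz: "poly_gauss a c \<phi> \<Longrightarrow> a > 0 \<Longrightarrow> \<phi> \<in> Schwartz"
  unfolding Schwartz_def smooth_def
  using poly_gauss_Ck poly_gauss_decay[OF poly_gauss_iter_deriv] by blast

text \<open>Completing the square; r = t / (1 + t) places the common centre at r y, between 0 and
  y.\<close>

lemma gauss_mult_gauss:
  fixes x y :: "'a::euclidean_space"
  assumes t: "t > 0"
  shows "gauss 1 x * gauss t (x - y) = exp (- (t / (1 + t) * (norm y)\<^sup>2)) * gauss (1 + t) (x - (t / (1 + t)) *\<^sub>R y)"
proof -
  define r where "r = t / (1 + t)"
  have r: "r * (1 + t) = t" using t by (simp add: r_def)
  have "(1 + t) * (norm (x - r *\<^sub>R y))\<^sup>2 = (1 + t) * (norm x)\<^sup>2 - 2 * (r * (1 + t)) * (x \<bullet> y) + r * (r * (1 + t)) * (norm y)\<^sup>2"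
    unfolding power2_norm_eq_inner by (simp add: inner_diff inner_commute algebra_simps)
  also have "\<dots> = (norm x)\<^sup>2 + t * (norm (x - y))\<^sup>2 - (t - r * t) * (norm y)\<^sup>2"
    unfolding r unfolding power2_norm_eq_inner by (simp add: inner_diff inner_commute algebra_simps)
  also have "t - r * t = r" using r by (simp add: algebra_simps)
  finally have "(norm x)\<^sup>2 + t * (norm (x - y))\<^sup>2 = r * (norm y)\<^sup>2 + (1 + t) * (norm (x - r *\<^sub>R y))\<^sup>2" by simp
  then have "- 1 * (norm x)\<^sup>2 + - t * (norm (x - y))\<^sup>2 = - (r * (norm y)\<^sup>2) + - (1 + t) * (norm (x - r *\<^sub>R y))\<^sup>2"
    unfolding mult_minus_left mult_1 by linarith
  then show ?thesis unfolding gauss_def r_def[symmetric] exp_add[symmetric] by simp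
qed

lemma gauss_mult_gauss_Schwartz:
  assumes "t > 0"
  shows "(\<lambda>x. complex_of_real (gauss 1 x * gauss t (x - y))) \<in> Schwartz"
proof -
  have "poly_gauss (1 + t) ((t / (1 + t)) *\<^sub>R y) (\<lambda>x. complex_of_real (exp (- (t / (1 + t) * (norm y)\<^sup>2))) * complex_of_real (gauss (1 + t) (x - (t / (1 + t)) *\<^sub>R y)))"
    by (intro poly_gauss.intros)
  then have "(\<lambda>x. complex_of_real (exp (- (t / (1 + t) * (norm y)\<^sup>2))) * complex_of_real (gauss (1 + t) (x - (t / (1 + t)) *\<^sub>R y))) \<in> Schwartz"
    by (rule poly_gauss_Schwartz) (use assms in simp)
  then show ?thesis unfolding gauss_mult_gauss[OF assms] by (simp only: of_real_mult)
qed

text \<open>Gaussian means are dense enough: for bounded \<phi> of bounded support they approach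
  \<phi> while staying bounded, and Fubini moves the mean from \<phi> to \<open>k\<close>, where it
  vanishes. So \<open>k\<close> annihilates all such \<phi>, in particular the signs of its own real
  and imaginary parts.\<close>

lemma integrable_eq_0_if_gauss_means_0:
  fixes k :: "'a::euclidean_space \<Rightarrow> complex"
  assumes k: "integrable lborel k" and 0: "\<And>t y. t > 0 \<Longrightarrow> (LINT x|lborel. k x * complex_of_real (gauss t (x - y))) = 0"
  shows "AE x in lborel. k x = 0"
proof -
  note [measurable] = integrable_borel[OF k]
  have test: "(LINT x|lborel. k x * complex_of_real (\<phi> x)) = 0"
    if \<phi>[measurable]: "\<phi> \<in> borel_measurable borel" and M: "\<And>x. \<bar>\<phi> x\<bar> \<le> 1" and R: "\<And>x. norm x > R \<Longrightarrow> \<phi> x = 0" for \<phi> :: "'a \<Rightarrow> real" and R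
  proof -
    have \<phi>i: "integrable lborel \<phi>"
    proof (rule Bochner_Integration.integrable_bound)
      show "integrable lborel (indicator (cball (0::'a) R) :: 'a \<Rightarrow> real)"
      proof (rule integrable_real_indicator)
        show "emeasure lborel (cball (0::'a) R) < \<infinity>" by (rule emeasure_lborel_cball_finite)
      qed simp
      show "AE x in lborel. norm (\<phi> x) \<le> norm (indicator (cball (0::'a) R) x :: real)"
        using M R by (auto simp: indicator_def not_le)
    qed simp
    then have \<phi>c: "integrable lborel (\<lambda>x. complex_of_real (\<phi> x))" by simp
    let ?m = "\<lambda>n \<xi>::'a. complex_of_real (gauss (1 / 4 ^ n) \<xi>)"
    let ?u = "\<lambda>n x. Re (ift (\<lambda>\<xi>. ?m n \<xi> * ft (\<lambda>x. complex_of_real (\<phi> x)) \<xi>) x)"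
    define c where "c n = sqrt (pi / (1 / 4 ^ n)) ^ DIM('a) / (2 * pi) ^ DIM('a)" for n :: nat
    define t :: "nat \<Rightarrow> real" where "t n = 4 ^ n / 4" for n
    have t: "t n > 0" for n by (simp add: t_def)
    have ig: "ift (?m n) x = complex_of_real (c n * gauss (t n) x)" for n x
      by (subst ift_gauss) (auto simp: c_def t_def)
    have urep: "complex_of_real (?u n x) = (LINT y|lborel. complex_of_real (\<phi> y) * complex_of_real (c n * gauss (t n) (x - y)))" for n x
    proof -
      have e: "(LINT y|lborel. complex_of_real (\<phi> y) * complex_of_real (c n * gauss (t n) (x - y))) = complex_of_real (LINT y|lborel. \<phi> y * (c n * gauss (t n) (x - y)))"
        by (simp only: of_real_mult[symmetric] integral_complex_of_real)
      have "ift (\<lambda>\<xi>. ?m n \<xi> * ft (\<lambda>x. complex_of_real (\<phi> x)) \<xi>) x = (LINT y|lborel. complex_of_real (\<phi> y) * complex_of_real (c n * gauss (t n) (x - y)))"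
        unfolding ig[symmetric] using \<phi>c integrable_gauss[of "1 / 4 ^ n", where 'a='a] by (intro ift_conv) auto
      then show ?thesis unfolding e by simp
    qed
    \<comment> \<open>Fubini puts \<open>k\<close> under the Gaussian centred at y, and the
      hypothesis applies for each y.\<close>
    have zero: "(LINT x|lborel. k x * complex_of_real (?u n x)) = 0" for n
    proof -
      let ?H = "\<lambda>x y. k x * (complex_of_real (\<phi> y) * complex_of_real (c n * gauss (t n) (x - y)))"
      have int: "integrable (lborel \<Otimes>\<^sub>M lborel) (\<lambda>(x, y). ?H x y)"
      proof (rule Bochner_Integration.integrable_bound)
        have "integrable (lborel \<Otimes>\<^sub>M lborel) (\<lambda>(x, y). k x * complex_of_real (\<phi> y))"
          by (rule lborel_pair.Fubini_integrable) (use k \<phi>i in \<open>auto simp: norm_mult\<close>)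
        then show "integrable (lborel \<Otimes>\<^sub>M lborel) (\<lambda>p. complex_of_real (c n) * (case p of (x, y) \<Rightarrow> k x * complex_of_real (\<phi> y)))"
          by (rule integrable_mult_right)
        show "AE p in lborel \<Otimes>\<^sub>M lborel. norm (case p of (x, y) \<Rightarrow> ?H x y) \<le> norm (complex_of_real (c n) * (case p of (x, y) \<Rightarrow> k x * complex_of_real (\<phi> y)))"
        proof (rule AE_I2, clarsimp simp: norm_mult)
          fix x y :: 'a
          have "gauss (t n) (x - y) \<le> 1" using t[of n] by (intro gauss_le_one) simp
          moreover have "gauss (t n) (x - y) > 0" by (rule gauss_pos)
          ultimately have "\<bar>c n\<bar> * \<bar>gauss (t n) (x - y)\<bar> \<le> \<bar>c n\<bar> * 1" by (intro mult_left_mono) simp_all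
          then have "(cmod (k x) * \<bar>\<phi> y\<bar>) * (\<bar>c n\<bar> * \<bar>gauss (t n) (x - y)\<bar>) \<le> (cmod (k x) * \<bar>\<phi> y\<bar>) * (\<bar>c n\<bar> * 1)" by (rule mult_left_mono) simp
          then show "cmod (k x) * (\<bar>\<phi> y\<bar> * (\<bar>c n\<bar> * \<bar>gauss (t n) (x - y)\<bar>)) \<le> \<bar>c n\<bar> * (cmod (k x) * \<bar>\<phi> y\<bar>)" by (simp add: mult_ac)
        qed
      qed measurable
      have "(LINT x|lborel. k x * complex_of_real (?u n x)) = (LINT x|lborel. LINT y|lborel. ?H x y)"
        unfolding urep by (simp only: integral_mult_right_zero)
      also have "\<dots> = (LINT y|lborel. LINT x|lborel. ?H x y)" using lborel_pair.Fubini_integral[OF int] by simp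
      also have "\<dots> = (LINT y|lborel. complex_of_real (\<phi> y) * complex_of_real (c n) * (LINT x|lborel. k x * complex_of_real (gauss (t n) (x - y))))"
        by (intro Bochner_Integration.integral_cong refl) (simp only: integral_mult_right_zero[symmetric] of_real_mult mult_ac)
      also have "\<dots> = 0" using 0[OF t] by simp
      finally show ?thesis .
    qed
    define \<kappa> where "\<kappa> = (LINT x|lborel. norm (ift (?m 0) x))"
    have um: "?u n \<in> borel_measurable borel" for n
      by (intro Ck_borel[of 0] Ck_Re_ift rapid_mult_ft[OF \<phi>i M] rapid_gauss) simp
    have ubd: "\<bar>?u n x\<bar> \<le> \<kappa>" for n x
    proof -
      have "\<bar>?u n x\<bar> \<le> 1 * (LINT x|lborel. norm (ift (?m n) x))"
        by (rule abs_Re_ift_le[OF \<phi>i M poly_gauss_gauss]) simp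
      also have "(LINT x|lborel. norm (ift (?m n) x)) = \<kappa>"
      proof -
        have "?m n = (\<lambda>\<xi>. ?m 0 (\<xi> /\<^sub>R 2 ^ n))"
          using gauss_scale[where c="2 ^ n" and a=1 and 'a='a] by (simp add: power2_eq_square flip: power_mult_distrib)
        then show ?thesis unfolding \<kappa>_def using integral_norm_ift_scale[of "2 ^ n" "?m 0"] by simp
      qed
      finally show ?thesis by simp
    qed
    have uint: "integrable lborel (?u n)" for n
      using integrable_jet_Re_ift[OF \<phi>i M _ _ poly_gauss_gauss[of "1 / 4 ^ n"], of 0 0] um[of n]
      by (simp add: jet.simps(1)[abs_def] integrable_abs_iff)
    have L1: "(\<lambda>n. LINT x|lborel. norm (?u n x - \<phi> x)) \<longlonglongrightarrow> 0"
    proof -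
      have "(\<lambda>n. \<integral>\<^sup>+x. ennreal \<bar>?u n x - \<phi> x\<bar> \<partial>lborel) \<longlonglongrightarrow> 0"
        using gauss_mean_tendsto_L1[OF \<phi> M, of R 1] R \<phi>i by simp
      moreover have "(\<integral>\<^sup>+x. ennreal \<bar>?u n x - \<phi> x\<bar> \<partial>lborel) = ennreal (LINT x|lborel. norm (?u n x - \<phi> x))" for n
        using uint[of n] \<phi>i by (subst nn_integral_eq_integral) auto
      ultimately have "(\<lambda>n. ennreal (LINT x|lborel. norm (?u n x - \<phi> x))) \<longlonglongrightarrow> ennreal 0" by simp
      then show ?thesis by (subst (asm) tendsto_ennreal_iff) auto
    qed
    \<comment> \<open>Dominated convergence calls for pointwise limits, whereas the means converge
      in L1; a subsequence converges almost everywhere.\<close>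
    have "\<exists>r. strict_mono r \<and> (AE x in lborel. (\<lambda>n. ?u (r n) x - \<phi> x) \<longlonglongrightarrow> 0)"
      by (rule tendsto_L1_AE_subseq[of lborel "\<lambda>n x. ?u n x - \<phi> x", OF Bochner_Integration.integrable_diff[OF uint \<phi>i] L1])
    then obtain r where "AE x in lborel. (\<lambda>n. ?u (r n) x - \<phi> x) \<longlonglongrightarrow> 0" by blast
    then have r: "AE x in lborel. (\<lambda>n. ?u (r n) x) \<longlonglongrightarrow> \<phi> x"
      by eventually_elim (rule LIM_zero_cancel)
    have "(\<lambda>n. LINT x|lborel. k x * complex_of_real (?u (r n) x)) \<longlonglongrightarrow> (LINT x|lborel. k x * complex_of_real (\<phi> x))"
    proof (rule integral_dominated_convergence[where w="\<lambda>x. \<kappa> * norm (k x)"])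
      show "AE x in lborel. (\<lambda>n. k x * complex_of_real (?u (r n) x)) \<longlonglongrightarrow> k x * complex_of_real (\<phi> x)"
        using r by eventually_elim (intro tendsto_intros)
      show "AE x in lborel. norm (k x * complex_of_real (?u (r n) x)) \<le> \<kappa> * norm (k x)" for n
        using mult_left_mono[OF ubd[of "r n"], of "norm (k _)"] by (intro AE_I2) (simp add: norm_mult mult.commute[of \<kappa>])
      show "(\<lambda>x. k x * complex_of_real (?u (r n) x)) \<in> borel_measurable lborel" for n using um[of "r n"] by measurable
      show "integrable lborel (\<lambda>x. \<kappa> * norm (k x))" using k by simp
    qed measurable
    then show ?thesis unfolding zero by (simp add: LIMSEQ_const_iff)
  qed
  have part: "AE x in lborel. p (k x) = 0"
    if p: "p = Re \<or> p = Im" for p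
  proof -
    have pm[measurable]: "(\<lambda>x. p (k x)) \<in> borel_measurable borel" using p by auto
    have pi: "integrable lborel (\<lambda>x. p (k x))" using p k by auto
    have p0: "p 0 = 0" using p by auto
    have pl: "p (z * complex_of_real r) = p z * r" for z r using p by auto
    have pint: "p (LINT x|lborel. g x) = (LINT x|lborel. p (g x))" if "integrable lborel g" for g :: "'a \<Rightarrow> complex"
      using p that by (auto simp: integral_Re integral_Im)
    have "AE x in lborel. norm x \<le> real n \<longrightarrow> p (k x) = 0" for n :: nat
    proof -
      \<comment> \<open>The sign of the chosen component on a ball: the vanishing integral becomes
        that of the absolute value there.\<close>
      define \<phi> where "\<phi> x = sgn (p (k x)) * indicator (cball 0 (real n)) x" for x :: 'a
      have "cball (0::'a) (real n) \<in> sets borel" by simp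
      then have \<phi>m[measurable]: "\<phi> \<in> borel_measurable borel" unfolding \<phi>_def[abs_def] by measurable
      have \<phi>1: "\<bar>\<phi> x\<bar> \<le> 1" for x by (auto simp: \<phi>_def indicator_def sgn_if)
      have "(LINT x|lborel. k x * complex_of_real (\<phi> x)) = 0"
        by (rule test[OF \<phi>m \<phi>1, of "real n"]) (simp add: \<phi>_def)
      moreover have i: "integrable lborel (\<lambda>x. k x * complex_of_real (\<phi> x))"
        using integrable_bounded_mult[OF k, of "\<lambda>x. complex_of_real (\<phi> x)" 1] \<phi>1 by (simp add: mult.commute)
      ultimately have z: "(LINT x|lborel. p (k x) * \<phi> x) = 0"
        using pint[OF i] p0 by (simp only: pl)
      have e: "p (k x) * \<phi> x = \<bar>p (k x)\<bar> * indicator (cball 0 (real n)) x" for x by (simp only: \<phi>_def abs_sgn mult.assoc)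
      have "integrable lborel (\<lambda>x. p (k x) * \<phi> x)"
        using integrable_bounded_mult[OF pi \<phi>m, of 1] \<phi>1 by (simp add: mult.commute)
      then have "AE x in lborel. \<bar>p (k x)\<bar> * indicator (cball 0 (real n)) x = 0"
        using z unfolding e by (subst (asm) integral_nonneg_eq_0_iff_AE) auto
      then show ?thesis by eventually_elim (auto simp: indicator_def split: if_splits)
    qed
    then have "AE x in lborel. \<forall>n::nat. norm x \<le> real n \<longrightarrow> p (k x) = 0" unfolding AE_all_countable ..
    then show ?thesis by eventually_elim (use real_arch_simple in blast)
  qed
  have "AE x in lborel. Re (k x) = 0 \<and> Im (k x) = 0" using part[of Re] part[of Im] by simp
  then show ?thesis by eventually_elim (simp add: complex_eq_iff)
qed

text \<open>Products of two Gaussians are Schwartz functions, so the Gaussian means of the integrable function \<open>(g - h) gauss 1\<close> vanish.\<close>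

lemma represents_unique:
  assumes "represents g T" "represents h T"
  shows "AE x in lebesgue. g x = h x"
proof -
  \<comment> \<open>Integrability of g and h is granted only against Schwartz functions, so one
    Gaussian is spent to make the difference integrable. It is positive and can be divided out at
    the end.\<close>
  define k where "k x = (g x - h x) * complex_of_real (gauss 1 x)" for x
  have S1: "(\<lambda>x. complex_of_real (gauss 1 x)) \<in> Schwartz"
    by (rule poly_gauss_Schwartz[OF poly_gauss_gauss]) simp
  have gi: "integrable lebesgue (\<lambda>x. g x * \<phi> x)" "integrable lebesgue (\<lambda>x. h x * \<phi> x)" "(LINT x|lebesgue. g x * \<phi> x) = (LINT x|lebesgue. h x * \<phi> x)"
    if "\<phi> \<in> Schwartz" for \<phi> using assms that by (auto simp: represents_def)
  have ki: "integrable lebesgue k"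
    unfolding k_def left_diff_distrib by (intro Bochner_Integration.integrable_diff gi S1)
  then have km: "k \<in> borel_measurable lebesgue" by (rule borel_measurable_integrable)
  have "Re \<in> borel_measurable borel" "Im \<in> borel_measurable borel"
    by (intro borel_measurable_continuous_onI continuous_intros)+
  from measurable_compose[OF km this(1)] measurable_compose[OF km this(2)]
  obtain k1 k2 where k12: "k1 \<in> borel_measurable lborel" "AE x in lborel. Re (k x) = k1 x" "k2 \<in> borel_measurable lborel" "AE x in lborel. Im (k x) = k2 x"
    by (elim completion_ex_borel_measurable_real[THEN bexE]) (rule that)
  \<comment> \<open>A Borel version of \<open>k\<close>, assembled from its parts, because the
    vanishing lemma is about \<open>lborel\<close> while \<open>k\<close> is only Lebesgue
    measurable.\<close>
  define k' where "k' x = Complex (k1 x) (k2 x)" for x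
  have k'e: "k' x = complex_of_real (k1 x) + \<i> * complex_of_real (k2 x)" for x by (simp add: k'_def complex_eq_iff)
  have k'm[measurable]: "k' \<in> borel_measurable borel" using k12 unfolding k'e[abs_def] by measurable
  have "AE x in lborel. k x = k' x" using k12(2,4) by eventually_elim (simp add: k'_def complex_eq_iff)
  then have ae: "AE x in lebesgue. k x = k' x" by (rule AE_completion)
  have k'l: "k' \<in> borel_measurable lebesgue" using k'm by (intro measurable_completion) simp
  have "integrable lebesgue k'" using integrable_cong_AE[OF km k'l ae] ki by simp
  then have k'i: "integrable lborel k'" using integrable_completion[of k' lborel] k'm by simp
  have z: "(LINT x|lborel. k' x * complex_of_real (gauss t (x - y))) = 0" if t: "t > 0" for t y
  proof -
    have "(LINT x|lborel. k' x * complex_of_real (gauss t (x - y))) = (LINT x|lebesgue. k' x * complex_of_real (gauss t (x - y)))"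
      by (rule integral_completion[symmetric]) measurable
    also have "\<dots> = (LINT x|lebesgue. k x * complex_of_real (gauss t (x - y)))"
    proof (rule integral_cong_AE)
      have "(\<lambda>x. complex_of_real (gauss t (x - y))) \<in> borel_measurable lebesgue" by (intro measurable_completion) measurable
      then show "(\<lambda>x. k' x * complex_of_real (gauss t (x - y))) \<in> borel_measurable lebesgue" "(\<lambda>x. k x * complex_of_real (gauss t (x - y))) \<in> borel_measurable lebesgue"
        using km k'l by (auto intro!: borel_measurable_times)
      show "AE x in lebesgue. k' x * complex_of_real (gauss t (x - y)) = k x * complex_of_real (gauss t (x - y))"
        using ae by eventually_elim simp
    qed
    also have "\<dots> = (LINT x|lebesgue. g x * complex_of_real (gauss 1 x * gauss t (x - y)) - h x * complex_of_real (gauss 1 x * gauss t (x - y)))"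
      by (intro Bochner_Integration.integral_cong refl) (simp add: k_def algebra_simps)
    also have "\<dots> = 0"
      using gi[OF gauss_mult_gauss_Schwartz[OF t, of y]] by (subst Bochner_Integration.integral_diff) auto
    finally show ?thesis .
  qed
  have "AE x in lebesgue. k' x = 0" by (rule AE_completion[OF integrable_eq_0_if_gauss_means_0[OF k'i z]])
  with ae show ?thesis
  proof eventually_elim
    case (elim x)
    then show ?case using gauss_pos[of 1 x] by (simp add: k_def)
  qed
qed

text \<open>By \<open>ft_mult_swap\<close> the normalised \<open>ft f\<close> represents the
  transform, and by \<open>represents_unique\<close> all competitors in the infimum give the same
  integral. T is prescribed only on transforms of Schwartz functions, because
  \<open>fourier_distr\<close> evaluates it nowhere else.\<close>

lemma Hs_norm_sq_eq:
  fixes f :: "real^3 \<Rightarrow> real"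
  assumes f: "integrable lborel f"
    and T: "\<And>\<phi>. \<phi> \<in> Schwartz \<Longrightarrow> T (fourier \<phi>) = (LINT x|lborel. complex_of_real (f x) * fourier \<phi> x)"
  shows "Hs_norm_sq s T = ennreal ((2 * pi) powr (- 3)) * sobolev_integral s f"
proof -
  define c where "c = (2 * pi) powr (-3/2)"
  have c0: "c > 0" by (simp add: c_def)
  have c2: "c\<^sup>2 = (2 * pi) powr (- 3)" unfolding c_def power2_eq_square powr_add[symmetric] by simp
  let ?F = "ft (\<lambda>x. complex_of_real (f x))"
  have fi: "integrable lborel (\<lambda>x. complex_of_real (f x))" using f by simp
  note [measurable] = integrable_borel[OF fi]
  define g where "g \<xi> = complex_of_real c * ?F \<xi>" for \<xi>
  have gm[measurable]: "g \<in> borel_measurable borel" unfolding g_def[abs_def] by measurable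
  have four: "fourier \<phi> = (\<lambda>\<xi>. complex_of_real c * ft \<phi> \<xi>)" if "\<phi> \<in> Schwartz" for \<phi>
    unfolding c_def by (rule fourier_eq_ft[OF that])
  have rep: "represents g (fourier_distr T)"
    unfolding represents_def
  proof (intro conjI ballI)
    show "g \<in> borel_measurable lebesgue" using gm by (intro measurable_completion) simp
    fix \<phi> assume S: "\<phi> \<in> Schwartz"
    note \<phi>i = Schwartz_integrable[OF S]
    note [measurable] = Schwartz_borel[OF S]
    have "integrable lborel (\<lambda>x. g x * \<phi> x)"
    proof (rule integrable_bounded_mult[OF \<phi>i gm])
      show "norm (g x) \<le> c * (LINT x|lborel. norm (complex_of_real (f x)))" for x
        unfolding g_def norm_mult using c0 norm_ft_le[OF fi, of x] by (simp add: mult_left_mono)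
    qed
    then show "integrable lebesgue (\<lambda>x. g x * \<phi> x)" by (subst integrable_completion) measurable
    have "fourier_distr T \<phi> = (LINT x|lborel. complex_of_real (f x) * (complex_of_real c * ft \<phi> x))"
      using T[OF S] by (simp add: fourier_distr_def four[OF S])
    also have "\<dots> = complex_of_real c * (LINT x|lborel. complex_of_real (f x) * ft \<phi> x)"
      by (simp add: mult.left_commute[of _ "complex_of_real c"])
    also have "(LINT x|lborel. complex_of_real (f x) * ft \<phi> x) = (LINT x|lborel. ?F x * \<phi> x)"
      by (rule ft_mult_swap[OF fi \<phi>i, symmetric])
    also have "complex_of_real c * \<dots> = (LINT x|lborel. g x * \<phi> x)"
      by (simp add: g_def mult.assoc)
    also have "\<dots> = (LINT x|lebesgue. g x * \<phi> x)" by (rule integral_completion[symmetric]) measurable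
    finally show "fourier_distr T \<phi> = (LINT x|lebesgue. g x * \<phi> x)" .
  qed
  let ?I = "\<lambda>g. \<integral>\<^sup>+ \<xi>. ennreal ((1 + (norm \<xi>)\<^sup>2) powr s * (norm (g \<xi>))\<^sup>2) \<partial>lebesgue"
  have "?I h = ?I g" if "represents h (fourier_distr T)" for h
  proof (rule nn_integral_cong_AE)
    show "AE \<xi> in lebesgue. ennreal ((1 + (norm \<xi>)\<^sup>2) powr s * (norm (h \<xi>))\<^sup>2) = ennreal ((1 + (norm \<xi>)\<^sup>2) powr s * (norm (g \<xi>))\<^sup>2)"
      using represents_unique[OF that rep] by eventually_elim simp
  qed
  then have "Hs_norm_sq s T = (INF h\<in>{h. represents h (fourier_distr T)}. ?I g)"
    unfolding Hs_norm_sq_def by (intro INF_cong) auto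
  also have "\<dots> = ?I g" using rep by (subst INF_const) auto
  also have "\<dots> = (\<integral>\<^sup>+ \<xi>. ennreal ((1 + (norm \<xi>)\<^sup>2) powr s * (norm (g \<xi>))\<^sup>2) \<partial>lborel)"
    by (rule nn_integral_completion)
  also have "\<dots> = (\<integral>\<^sup>+ \<xi>. ennreal (c\<^sup>2) * ennreal (japanese \<xi> powr (2 * s) * (norm (?F \<xi>))\<^sup>2) \<partial>lborel)"
  proof (intro nn_integral_cong)
    fix \<xi> :: "real^3"
    have "japanese \<xi> powr (2 * s) = (1 + (norm \<xi>)\<^sup>2) powr s"
      unfolding japanese_def by (simp add: powr_half_sqrt[symmetric] powr_powr add_nonneg_nonneg)
    then show "ennreal ((1 + (norm \<xi>)\<^sup>2) powr s * (norm (g \<xi>))\<^sup>2) = ennreal (c\<^sup>2) * ennreal (japanese \<xi> powr (2 * s) * (norm (?F \<xi>))\<^sup>2)"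
      by (simp add: g_def norm_mult power_mult_distrib mult_ac flip: ennreal_mult)
  qed
  also have "\<dots> = ennreal (c\<^sup>2) * sobolev_integral s f"
    unfolding sobolev_integral_def by (rule nn_integral_cmult) measurable
  finally show ?thesis unfolding c2 .
qed

section \<open>Distributions given by bounded functions\<close>

lemma borel_measurable_vec_nth: "u \<in> borel_measurable M \<Longrightarrow> (\<lambda>x. (u x :: real^'n) $ i) \<in> borel_measurable M"
  unfolding cart_eq_inner_axis by (intro borel_measurable_inner measurable_const) auto

text \<open>The factor 1 / e^3 in \<open>dilate\<close> is the inverse of the Jacobian in the change
  of variables, so the dilated distribution is the dilated function.\<close>

lemma Hs_norm_sq_dilate_mult:
  fixes u :: "real^3 \<Rightarrow> real^'n"
  assumes [measurable]: "u \<in> borel_measurable borel" "p \<in> borel_measurable borel"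
    and i: "integrable lborel (\<lambda>x. p (e *\<^sub>R x) * (u (e *\<^sub>R x) $ i))" and e: "e > 0"
  shows "Hs_norm_sq s (dilate e (mult_distr p (distr_of u i))) =
    ennreal ((2 * pi) powr (- 3)) * sobolev_integral s (\<lambda>x. p (e *\<^sub>R x) * (u (e *\<^sub>R x) $ i))"
proof (rule Hs_norm_sq_eq[OF i])
  have [measurable]: "(\<lambda>x. u x $ i) \<in> borel_measurable borel"
    by (rule borel_measurable_vec_nth) simp
  fix \<phi> assume S: "\<phi> \<in> Schwartz"
  note [measurable] = fourier_borel[OF S]
  have "dilate e (mult_distr p (distr_of u i)) (fourier \<phi>) = complex_of_real (1 / e ^ 3) *
     (LINT x|lebesgue. complex_of_real (u x $ i) * (complex_of_real (p x) * fourier \<phi> (x /\<^sub>R e)))"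
    by (simp add: dilate_def mult_distr_def distr_of_def)
  also have "(LINT x|lebesgue. complex_of_real (u x $ i) * (complex_of_real (p x) * fourier \<phi> (x /\<^sub>R e))) =
     (LINT x|lborel. complex_of_real (u x $ i) * (complex_of_real (p x) * fourier \<phi> (x /\<^sub>R e)))"
    by (rule integral_completion) measurable
  also have "\<dots> = (e ^ 3) *\<^sub>R (LINT x|lborel. complex_of_real (u (e *\<^sub>R x) $ i) * (complex_of_real (p (e *\<^sub>R x)) * fourier \<phi> x))"
    using e by (subst integral_lborel_affine[of e _ 0]) auto
  finally show "dilate e (mult_distr p (distr_of u i)) (fourier \<phi>) =
     (LINT x|lborel. complex_of_real (p (e *\<^sub>R x) * (u (e *\<^sub>R x) $ i)) * fourier \<phi> x)"
    using e by (simp add: scaleR_conv_of_real mult_ac)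
qed

text \<open>The seminorm of order 6 is enough, since (1 + |x|)^(-6) is integrable in dimension 3 by
  \<open>integrable_inverse_power\<close>.\<close>

lemma tempered_distr_of:
  fixes u :: "real^3 \<Rightarrow> real^'n"
  assumes u[measurable]: "u \<in> borel_measurable borel" and M: "\<And>x. norm (u x) \<le> M"
  shows "tempered (distr_of u i)"
proof -
  have um[measurable]: "(\<lambda>x. u x $ i) \<in> borel_measurable borel"
    by (rule borel_measurable_vec_nth) simp
  have ub: "\<bar>u x $ i\<bar> \<le> M" for x using component_le_norm_cart[of "u x" i] M[of x] by linarith
  have M0: "M \<ge> 0" using M[of 0] norm_ge_zero order_trans by blast
  have eq: "distr_of u i \<phi> = (LINT x|lborel. complex_of_real (u x $ i) * \<phi> x)" and int: "integrable lborel (\<lambda>x. complex_of_real (u x $ i) * \<phi> x)"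
    if S: "\<phi> \<in> Schwartz" for \<phi>
  proof -
    note [measurable] = Schwartz_borel[OF S]
    show "distr_of u i \<phi> = (LINT x|lborel. complex_of_real (u x $ i) * \<phi> x)"
      unfolding distr_of_def by (rule integral_completion) measurable
    show "integrable lborel (\<lambda>x. complex_of_real (u x $ i) * \<phi> x)"
      using ub by (intro integrable_bounded_mult[OF Schwartz_integrable[OF S], of _ M]) auto
  qed
  define J where "J = (LINT x|lborel. inverse ((1 + norm (x::real^3)) ^ 6))"
  have "distr_of u i (\<lambda>x. a * \<phi> x + b * \<eta> x) = a * distr_of u i \<phi> + b * distr_of u i \<eta>"
    if S: "\<phi> \<in> Schwartz" "\<eta> \<in> Schwartz" for \<phi> \<eta> a b
  proof -
    note [measurable] = Schwartz_borel[OF S(1)] Schwartz_borel[OF S(2)]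
    have "distr_of u i (\<lambda>x. a * \<phi> x + b * \<eta> x) = (LINT x|lborel. complex_of_real (u x $ i) * (a * \<phi> x + b * \<eta> x))"
      unfolding distr_of_def by (rule integral_completion) measurable
    also have "\<dots> = (LINT x|lborel. a * (complex_of_real (u x $ i) * \<phi> x) + b * (complex_of_real (u x $ i) * \<eta> x))"
      by (intro Bochner_Integration.integral_cong refl) (simp add: algebra_simps)
    also have "\<dots> = a * distr_of u i \<phi> + b * distr_of u i \<eta>"
      using int[OF S(1)] int[OF S(2)] by (simp add: eq[OF S(1)] eq[OF S(2)])
    finally show ?thesis .
  qed
  moreover have "norm (distr_of u i \<phi>) \<le> (M * J) * Schwartz_seminorm 6 \<phi>" if S: "\<phi> \<in> Schwartz" for \<phi>
  proof -
    have "norm (distr_of u i \<phi>) \<le> (LINT x|lborel. (M * Schwartz_seminorm 6 \<phi>) * inverse ((1 + norm (x::real^3)) ^ 6))"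
      unfolding eq[OF S]
    proof (rule Bochner_Integration.integral_norm_bound_integral[OF int[OF S]])
      show "integrable lborel (\<lambda>x::real^3. (M * Schwartz_seminorm 6 \<phi>) * inverse ((1 + norm x) ^ 6))"
        using integrable_inverse_power[where 'a="real^3"] by (intro integrable_mult_right) simp
      fix x :: "real^3"
      have "(1 + norm x) ^ 6 > 0" by (intro zero_less_power) (simp add: add_pos_nonneg)
      then have "norm (\<phi> x) \<le> Schwartz_seminorm 6 \<phi> * inverse ((1 + norm x) ^ 6)"
        using Schwartz_seminorm_bound[OF S, of x 6] by (simp add: divide_inverse[symmetric] pos_le_divide_eq mult.commute)
      then have "\<bar>u x $ i\<bar> * norm (\<phi> x) \<le> M * (Schwartz_seminorm 6 \<phi> * inverse ((1 + norm x) ^ 6))"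
        using ub[of x] M0 by (intro mult_mono) auto
      then show "norm (complex_of_real (u x $ i) * \<phi> x) \<le> (M * Schwartz_seminorm 6 \<phi>) * inverse ((1 + norm x) ^ 6)"
        by (simp add: norm_mult mult.assoc)
    qed
    also have "\<dots> = (M * J) * Schwartz_seminorm 6 \<phi>" by (simp add: J_def)
    finally show ?thesis .
  qed
  ultimately show ?thesis unfolding tempered_def by blast
qed

section \<open>Dyadic shells\<close>

lemma integrable_bounded_support:
  fixes f :: "'a::euclidean_space \<Rightarrow> real"
  assumes f: "f \<in> borel_measurable borel" and M: "\<And>x. \<bar>f x\<bar> \<le> M" and R: "\<And>x. norm x > R \<Longrightarrow> f x = 0"
  shows "integrable lborel f"
proof (rule Bochner_Integration.integrable_bound)
  have "integrable lborel (indicator (cball (0::'a) R) :: 'a \<Rightarrow> real)"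
  proof (rule integrable_real_indicator)
    show "emeasure lborel (cball (0::'a) R) < \<infinity>" by (rule emeasure_lborel_cball_finite)
  qed simp
  then show "integrable lborel (\<lambda>x. M * indicator (cball (0::'a) R) x)" by (rule integrable_mult_right)
  show "AE x in lborel. norm (f x) \<le> norm (M * indicator (cball (0::'a) R) x)"
  proof (rule AE_I2)
    fix x
    show "norm (f x) \<le> norm (M * indicator (cball (0::'a) R) x)"
      using M[of x] R[of x] by (cases "norm x \<le> R") (auto simp: indicator_def)
  qed
qed (use f in simp)

lemma sobolev_integral_add:
  assumes f: "integrable lborel f" and g: "integrable lborel g"
  shows "sobolev_integral s (\<lambda>x. f x + g x) \<le> 2 * sobolev_integral s f + 2 * sobolev_integral s g"
proof -
  let ?F = "\<lambda>h \<xi>. ft (\<lambda>x. complex_of_real (h x)) \<xi>"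
  note [measurable] = integrable_borel[OF f] integrable_borel[OF g]
  have "sobolev_integral s (\<lambda>x. f x + g x) \<le> (\<integral>\<^sup>+\<xi>. 2 * ennreal (japanese \<xi> powr (2 * s) * (norm (?F f \<xi>))\<^sup>2) + 2 * ennreal (japanese \<xi> powr (2 * s) * (norm (?F g \<xi>))\<^sup>2) \<partial>lborel)"
    unfolding sobolev_integral_def
  proof (rule nn_integral_mono)
    fix \<xi> :: 'a
    have "?F (\<lambda>x. f x + g x) \<xi> = ?F f \<xi> + ?F g \<xi>"
      using ft_add[of "\<lambda>x. complex_of_real (f x)" "\<lambda>x. complex_of_real (g x)"] f g by simp
    then have "(norm (?F (\<lambda>x. f x + g x) \<xi>))\<^sup>2 \<le> (norm (?F f \<xi>) + norm (?F g \<xi>))\<^sup>2"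
      by (simp add: norm_triangle_ineq power_mono)
    also have "\<dots> \<le> 2 * (norm (?F f \<xi>))\<^sup>2 + 2 * (norm (?F g \<xi>))\<^sup>2"
      using sum_squares_bound[of "norm (?F f \<xi>)" "norm (?F g \<xi>)"] by (simp add: power2_sum)
    finally have "japanese \<xi> powr (2 * s) * (norm (?F (\<lambda>x. f x + g x) \<xi>))\<^sup>2 \<le> japanese \<xi> powr (2 * s) * (2 * (norm (?F f \<xi>))\<^sup>2 + 2 * (norm (?F g \<xi>))\<^sup>2)"
      by (intro mult_left_mono) auto
    then have "ennreal (japanese \<xi> powr (2 * s) * (norm (?F (\<lambda>x. f x + g x) \<xi>))\<^sup>2) \<le>
      ennreal (2 * (japanese \<xi> powr (2 * s) * (norm (?F f \<xi>))\<^sup>2) + 2 * (japanese \<xi> powr (2 * s) * (norm (?F g \<xi>))\<^sup>2))"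
      by (intro ennreal_leI) (simp add: algebra_simps)
    also have "\<dots> = 2 * ennreal (japanese \<xi> powr (2 * s) * (norm (?F f \<xi>))\<^sup>2) + 2 * ennreal (japanese \<xi> powr (2 * s) * (norm (?F g \<xi>))\<^sup>2)"
      by (simp add: ennreal_mult)
    finally show "ennreal (japanese \<xi> powr (2 * s) * (norm (?F (\<lambda>x. f x + g x) \<xi>))\<^sup>2) \<le>
      2 * ennreal (japanese \<xi> powr (2 * s) * (norm (?F f \<xi>))\<^sup>2) + 2 * ennreal (japanese \<xi> powr (2 * s) * (norm (?F g \<xi>))\<^sup>2)" .
  qed
  also have "\<dots> = 2 * sobolev_integral s f + 2 * sobolev_integral s g"
    unfolding sobolev_integral_def by (simp add: nn_integral_add nn_integral_cmult)
  finally show ?thesis .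
qed

text \<open>The pieces of \<open>u\<close> seen from shell j carry the dilation 2^j, whereas the
  norm of \<open>u\<close> uses 2^k with k at most one step away; so only ratios between 1/2 and 2
  occur. Then the Japanese bracket grows at most twofold, and the Jacobian and the squared factor of
  the transform leave c^(-n) <= 2^n.\<close>

lemma sobolev_integral_dilate:
  fixes f :: "'a::euclidean_space \<Rightarrow> real"
  assumes f: "integrable lborel f" and c: "1/2 \<le> c" "c \<le> 2" and s: "s > 0"
  shows "sobolev_integral s (\<lambda>x. f (c *\<^sub>R x)) \<le> ennreal (2 ^ DIM('a) * 2 powr (2 * s)) * sobolev_integral s f"
proof -
  have c0: "c > 0" using c by simp
  note [measurable] = integrable_borel[OF f]
  let ?F = "ft (\<lambda>x. complex_of_real (f x))"
  have F: "ft (\<lambda>x. complex_of_real (f (c *\<^sub>R x))) (c *\<^sub>R \<eta>) = complex_of_real (1 / c ^ DIM('a)) * ?F \<eta>" for \<eta>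
  proof -
    have "?F \<eta> = complex_of_real (c ^ DIM('a)) * ft (\<lambda>x. complex_of_real (f (c *\<^sub>R x))) (c *\<^sub>R \<eta>)"
      unfolding ft_def using c0 by (subst integral_lborel_affine[of c _ 0]) (auto simp: scaleR_conv_of_real)
    then show ?thesis using c0 by simp
  qed
  have jm: "japanese (c *\<^sub>R \<eta>) powr (2 * s) \<le> 2 powr (2 * s) * japanese \<eta> powr (2 * s)" for \<eta> :: 'a
  proof -
    have "1 + (c * norm \<eta>)\<^sup>2 \<le> (2 * japanese \<eta>)\<^sup>2"
    proof -
      have "(c * norm \<eta>)\<^sup>2 \<le> (2 * norm \<eta>)\<^sup>2" using c c0 by (intro power_mono mult_right_mono) auto
      then show ?thesis by (simp add: power_mult_distrib japanese_square)
    qed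
    then have "japanese (c *\<^sub>R \<eta>) \<le> 2 * japanese \<eta>"
      unfolding japanese_def[of "c *\<^sub>R \<eta>"] using japanese_ge_one[of \<eta>] c0 by (intro real_le_lsqrt) (auto simp: add_nonneg_nonneg)
    then have "japanese (c *\<^sub>R \<eta>) powr (2 * s) \<le> (2 * japanese \<eta>) powr (2 * s)"
      using s japanese_ge_one[of "c *\<^sub>R \<eta>"] by (intro powr_mono2) auto
    then show ?thesis using japanese_ge_one[of \<eta>] by (simp add: powr_mult)
  qed
  have "sobolev_integral s (\<lambda>x. f (c *\<^sub>R x)) = ennreal (c ^ DIM('a)) *
     (\<integral>\<^sup>+\<eta>. ennreal (japanese (c *\<^sub>R \<eta>) powr (2 * s) * (norm (ft (\<lambda>x. complex_of_real (f (c *\<^sub>R x))) (c *\<^sub>R \<eta>)))\<^sup>2) \<partial>lborel)"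
    unfolding sobolev_integral_def using c0 by (subst nn_integral_lborel_affine[of c _ 0]) auto
  also have "\<dots> \<le> ennreal (c ^ DIM('a)) * (\<integral>\<^sup>+\<eta>. ennreal (2 powr (2 * s) * (1 / c ^ DIM('a))\<^sup>2) * ennreal (japanese \<eta> powr (2 * s) * (norm (?F \<eta>))\<^sup>2) \<partial>lborel)"
  proof (intro mult_left_mono nn_integral_mono)
    fix \<eta> :: 'a
    have "japanese (c *\<^sub>R \<eta>) powr (2 * s) * (norm (ft (\<lambda>x. complex_of_real (f (c *\<^sub>R x))) (c *\<^sub>R \<eta>)))\<^sup>2
       \<le> (2 powr (2 * s) * japanese \<eta> powr (2 * s)) * ((1 / c ^ DIM('a))\<^sup>2 * (norm (?F \<eta>))\<^sup>2)"
      unfolding F norm_mult power_mult_distrib norm_of_real power2_abs by (intro mult_right_mono jm) auto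
    then show "ennreal (japanese (c *\<^sub>R \<eta>) powr (2 * s) * (norm (ft (\<lambda>x. complex_of_real (f (c *\<^sub>R x))) (c *\<^sub>R \<eta>)))\<^sup>2) \<le>
       ennreal (2 powr (2 * s) * (1 / c ^ DIM('a))\<^sup>2) * ennreal (japanese \<eta> powr (2 * s) * (norm (?F \<eta>))\<^sup>2)"
      by (subst ennreal_mult[symmetric]) (auto intro!: ennreal_leI simp: mult_ac)
  qed auto
  also have "\<dots> = ennreal (c ^ DIM('a) * (2 powr (2 * s) * (1 / c ^ DIM('a))\<^sup>2)) * sobolev_integral s f"
    unfolding sobolev_integral_def using c0 by (subst nn_integral_cmult) (auto simp: ennreal_mult mult.assoc)
  also have "\<dots> \<le> ennreal (2 ^ DIM('a) * 2 powr (2 * s)) * sobolev_integral s f"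
  proof (intro mult_right_mono ennreal_leI)
    have "(1 / c) ^ DIM('a) \<le> 2 ^ DIM('a)" using c c0 by (intro power_mono) (auto simp: field_simps)
    then have "2 powr (2 * s) * (1 / c) ^ DIM('a) \<le> 2 powr (2 * s) * 2 ^ DIM('a)" by (intro mult_left_mono) auto
    moreover have "c ^ DIM('a) * (2 powr (2 * s) * (1 / c ^ DIM('a))\<^sup>2) = 2 powr (2 * s) * (1 / c) ^ DIM('a)"
      using c0 by (simp add: power2_eq_square power_divide)
    ultimately show "c ^ DIM('a) * (2 powr (2 * s) * (1 / c ^ DIM('a))\<^sup>2) \<le> 2 ^ DIM('a) * 2 powr (2 * s)" by (simp add: mult.commute)
  qed auto
  finally show ?thesis .
qed

lemma cutoff_support:
  assumes "dyadic_cutoffs \<psi>" "\<psi> k x \<noteq> 0" shows "x \<in> wide_shell k"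
  using assms closure_subset[of "{x. \<psi> k x \<noteq> 0}"] unfolding dyadic_cutoffs_def by blast

lemma wide_shell_norm_le: "x \<in> wide_shell k \<Longrightarrow> norm x \<le> 2 ^ (k + 3)"
  by (auto simp: wide_shell_def powr_add powr_realpow power_add split: if_splits)

text \<open>For j > 1, shell j - 1 covers radii up to 2^(j + 1) and shell j + 1 those from 2^(j - 2)
  on, so they overlap and together reach both ends of the wide shell. Shell j itself stops short of
  both ends. For j < 2 the lower neighbour is the ball; truncated subtraction makes it shell 0 also
  for j = 0.\<close>

lemma wide_shell_subset: "wide_shell j \<subseteq> dyadic_shell (j - 1) \<union> dyadic_shell (Suc j)"
proof
  fix x assume x: "x \<in> wide_shell j"
  show "x \<in> dyadic_shell (j - 1) \<union> dyadic_shell (Suc j)"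
  proof (cases "j \<le> 1")
    case True
    then consider "j = 0" | "j = 1" by linarith
    then show ?thesis
    proof cases
      case 1
      have "(2::real) powr (1 - 3) \<le> 4" "(2::real) powr (1 + 2) = 8" by (auto simp: powr_minus powr_numeral)
      then show ?thesis using x 1 by (cases "norm x \<le> 4") (auto simp: wide_shell_def dyadic_shell_def)
    next
      case 2
      have "(2::real) powr (2 - 3) \<le> 4" "(2::real) powr (2 + 2) = 16" "(2::real) powr (1 + 3) = 16" by (auto simp: powr_minus powr_numeral)
      then show ?thesis using x 2 by (cases "norm x \<le> 4") (auto simp: wide_shell_def dyadic_shell_def)
    qed
  next
    case False
    then obtain k where k: "j = Suc (Suc k)" by (metis One_nat_def Suc_le_mono le_zero_eq less_eq_Suc_le not0_implies_Suc nat.exhaust zero_le)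
    show ?thesis
    proof (cases "norm x \<le> 2 powr (real k + 3)")
      case True
      then show ?thesis using x k by (auto simp: wide_shell_def dyadic_shell_def algebra_simps)
    next
      case False
      have "(2::real) powr real k \<le> 2 powr (real k + 3)" by (intro powr_mono) auto
      then have "2 powr real k \<le> norm x" using False by linarith
      then show ?thesis using x k by (auto simp: wide_shell_def dyadic_shell_def algebra_simps)
    qed
  qed
qed

text \<open>The decay 2^(-k) per derivative of the k-th cutoff compensates the factor 2^j per
  derivative from the dilation, up to a factor 2 if j <= k + 1. This includes k = j - 1, j and j +
  1.\<close>

lemma cutoff_jet_bound:
  assumes \<psi>: "dyadic_cutoffs \<psi>"
  shows "\<exists>B\<ge>1. \<forall>j k x. j \<le> Suc k \<longrightarrow> jet 1 N (\<lambda>x. \<psi> k (2 ^ j *\<^sub>R x)) x \<le> B"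
proof -
  have "\<forall>\<beta>. \<exists>C. \<beta> \<in> multi_indices \<longrightarrow> (\<forall>k x. \<bar>iter_deriv \<beta> (\<psi> k) x\<bar> \<le> C * 2 powr (- real (length \<beta>) * real k))"
    using \<psi> unfolding dyadic_cutoffs_def by blast
  then obtain C where C: "\<And>\<beta> k x. \<beta> \<in> multi_indices \<Longrightarrow> \<bar>iter_deriv \<beta> (\<psi> k) x\<bar> \<le> C \<beta> * 2 powr (- real (length \<beta>) * real k)"
    by metis
  define M where "M = (\<Sum>\<beta>\<in>{\<beta>\<in>multi_indices. length \<beta> \<le> N}. \<bar>C \<beta>\<bar> * 2 ^ length \<beta>)"
  have M0: "M \<ge> 0" unfolding M_def by (intro sum_nonneg) auto
  have "jet 1 N (\<lambda>x. \<psi> k (2 ^ j *\<^sub>R x)) x \<le> 4 ^ N * M" if jk: "j \<le> Suc k" for j k x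
  proof -
    have Ck: "Ck N (\<psi> k)" using \<psi> by (simp add: dyadic_cutoffs_def smooth_def)
    have "jet 1 N (\<lambda>x. \<psi> k (2 ^ j *\<^sub>R x)) x = jet (2 ^ j) N (\<psi> k) (2 ^ j *\<^sub>R x)"
      using jet_dilate[of 1 "2 ^ j", OF _ _ Ck] by simp
    also have "\<dots> \<le> (1 + real DIM(real^3)) ^ N * M"
    proof (rule jet_le_iter_deriv)
      fix \<beta> :: "(real^3) list" assume \<beta>: "\<beta> \<in> multi_indices" "length \<beta> \<le> N"
      define n where "n = length \<beta>"
      have p: "2 powr (- real n * real k) = (1 / 2 ^ k) ^ n"
      proof -
        have "2 powr (- real n * real k) = 1 / 2 powr (real (k * n))" by (simp add: powr_minus divide_inverse mult.commute)
        also have "2 powr real (k * n) = 2 ^ (k * n)" by (rule powr_realpow) simp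
        finally show ?thesis by (simp add: power_mult power_divide)
      qed
      have "(2 ^ j) ^ n * \<bar>iter_deriv \<beta> (\<psi> k) (2 ^ j *\<^sub>R x)\<bar> \<le> (2 ^ j) ^ n * (\<bar>C \<beta>\<bar> * (1 / 2 ^ k) ^ n)"
        unfolding p[symmetric] using C[OF \<beta>(1), of k "2 ^ j *\<^sub>R x"]
        by (intro mult_left_mono) (auto simp: n_def intro: order_trans[OF _ mult_right_mono[OF abs_ge_self]])
      also have "\<dots> = \<bar>C \<beta>\<bar> * (2 ^ j * (1 / 2 ^ k)) ^ n" by (simp only: power_mult_distrib mult_ac)
      also have "\<dots> \<le> \<bar>C \<beta>\<bar> * 2 ^ n"
      proof (intro mult_left_mono power_mono)
        have "(2::real) ^ j \<le> 2 ^ Suc k" using jk by (intro power_increasing) auto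
        then show "2 ^ j * (1 / 2 ^ k) \<le> (2::real)" by (simp add: field_simps)
      qed auto
      also have "\<dots> \<le> M" unfolding M_def n_def using \<beta> finite_multi_indices by (intro member_le_sum) auto
      finally show "(2 ^ j) ^ length \<beta> * \<bar>iter_deriv \<beta> (\<psi> k) (2 ^ j *\<^sub>R x)\<bar> \<le> M" by (simp add: n_def)
    qed simp
    finally show ?thesis by simp
  qed
  then show ?thesis
    by (intro exI[of _ "max 1 (4 ^ N * M)"]) (auto simp: le_max_iff_disj)
qed

lemma jet_const: "l \<ge> 0 \<Longrightarrow> jet l k (\<lambda>x. c) x = \<bar>c\<bar>"
  by (cases k) (auto simp: jet_zero)

lemma one_plus_power_le: "R \<ge> 0 \<Longrightarrow> (1 + R) ^ N \<le> 2 ^ N * (1 + R ^ N)" for R :: real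
proof -
  assume R: "R \<ge> 0"
  have "(1 + R) ^ N \<le> (2 * max 1 R) ^ N" using R by (intro power_mono) auto
  also have "\<dots> = 2 ^ N * (max 1 R) ^ N" by (simp add: power_mult_distrib)
  also have "(max 1 R) ^ N \<le> 1 + R ^ N" using R by (auto simp: max_def)
  finally show ?thesis by simp
qed

text \<open>The composition estimate is applied with the dilated cutoff as multiplier and with
  \<open>v\<close> in place of \<open>u\<close>. It remains to bound the components of
  \<open>v\<close>: each consists of a piece cut off by the lower neighbour and a piece cut off by
  the upper one, the latter times a bounded smooth factor; \<open>sobolev_multiplication\<close> and
  \<open>sobolev_integral_dilate\<close> lead back to the norms of the neighbours.\<close>

lemma shell_estimate:
  fixes \<psi> :: "nat \<Rightarrow> real^3 \<Rightarrow> real"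
  assumes \<psi>: "dyadic_cutoffs \<psi>" and N: "N > 0" and s: "0 < s" "s < real N"
  shows "\<exists>D\<ge>0. \<exists>Y. \<forall>(u :: real^3 \<Rightarrow> 'c::euclidean_space) R G L j. u \<in> borel_measurable borel \<longrightarrow> (\<forall>x. norm (u x) \<le> R) \<longrightarrow>
    Ck (Suc N) G \<longrightarrow> G 0 = 0 \<longrightarrow>
    (\<forall>\<beta>\<in>multi_indices. \<forall>a\<in>Basis. \<forall>y. length \<beta> \<le> N \<longrightarrow> norm y \<le> Y * R \<longrightarrow> \<bar>iter_deriv \<beta> (dir_deriv a G) y\<bar> \<le> L) \<longrightarrow>
    sobolev_integral s (\<lambda>x. \<psi> j (2 ^ j *\<^sub>R x) * G (u (2 ^ j *\<^sub>R x))) \<le> ennreal (D * (L * (1 + R ^ N))\<^sup>2) *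
      (\<Sum>a\<in>Basis. \<Sum>k\<in>{j - 1, Suc j}. sobolev_integral s (\<lambda>x. \<psi> k (2 ^ k *\<^sub>R x) * (u (2 ^ k *\<^sub>R x) \<bullet> a)))"
proof -
  obtain B where B1: "B \<ge> 1" and B: "\<And>j k x. j \<le> Suc k \<Longrightarrow> jet 1 N (\<lambda>x. \<psi> k (2 ^ j *\<^sub>R x)) x \<le> B"
    using cutoff_jet_bound[OF \<psi>, of N] by blast
  obtain C1 where C1: "C1 \<ge> 0" and mult: "\<forall>(m::real^3 \<Rightarrow> real) B f M R. Ck N m \<longrightarrow> (\<forall>x. jet 1 N m x \<le> B) \<longrightarrow> integrable lborel f \<longrightarrow>
    (\<forall>x. \<bar>f x\<bar> \<le> M) \<longrightarrow> (\<forall>x. norm x > R \<longrightarrow> f x = 0) \<longrightarrow>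
    sobolev_integral s (\<lambda>x. m x * f x) \<le> ennreal (C1 * B\<^sup>2) * sobolev_integral s f"
    using sobolev_multiplication[OF N s, where 'a="real^3"] by (elim exE conjE) (rule that)
  obtain C2 where C2: "C2 \<ge> 1" and comp: "\<forall>(m::real^3 \<Rightarrow> real) B (G::'c \<Rightarrow> real) L v M R.
    Ck N m \<longrightarrow> (\<forall>x. jet 1 N m x \<le> B) \<longrightarrow> Ck (Suc N) G \<longrightarrow> G 0 = 0 \<longrightarrow>
    (\<forall>a\<in>Basis. integrable lborel (\<lambda>x. v x \<bullet> a)) \<longrightarrow> (\<forall>a\<in>Basis. \<forall>x. \<bar>v x \<bullet> a\<bar> \<le> M) \<longrightarrow> (\<forall>x. norm x > R \<longrightarrow> v x = 0) \<longrightarrow>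
    (\<forall>\<beta>\<in>multi_indices. \<forall>a\<in>Basis. \<forall>y. length \<beta> \<le> N \<longrightarrow> norm y \<le> C2 * M \<longrightarrow> \<bar>iter_deriv \<beta> (dir_deriv a G) y\<bar> \<le> L) \<longrightarrow>
    sobolev_integral s (\<lambda>x. m x * G (v x)) \<le> ennreal (C2 * (B * L * (1 + M) ^ N)\<^sup>2) * (\<Sum>a\<in>Basis. sobolev_integral s (\<lambda>x. v x \<bullet> a))"
    using sobolev_composition[OF N s, where 'a="real^3" and 'c='c] by (elim exE conjE) (rule that)
  \<comment> \<open>B + (1 + B) B, the bound for the coefficient of \<open>u\<close> in
    \<open>v\<close>; thus H R bounds the components of \<open>v\<close>.\<close>
  define H where "H = (2 + B) * B"
  have H1: "H \<ge> 1" unfolding H_def using mult_mono[of 1 "2 + B" 1 B] B1 by simp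
  \<comment> \<open>The constant of \<open>sobolev_integral_dilate\<close> in dimension 3.\<close>
  define E where "E = 2 ^ 3 * 2 powr (2 * s)"
  have E0: "E \<ge> 0" by (simp add: E_def)
  \<comment> \<open>Lower and upper piece of \<open>v\<close>, each doubled by
    \<open>sobolev_integral_add\<close>; the upper one also pays for its factor, whose jets are at
    most 1 + B.\<close>
  define V where "V = 2 * E + 2 * (C1 * (1 + B)\<^sup>2 * E)"
  have V0: "V \<ge> 0" unfolding V_def using E0 C1 by simp
  \<comment> \<open>H^N from pulling H out of (1 + H R)^N, and 2^N from comparing (1 + R)^N with 1 +
    R^N.\<close>
  define D where "D = C2 * (B * H ^ N * 2 ^ N)\<^sup>2 * V"
  have D0: "D \<ge> 0" unfolding D_def using C2 V0 by simp
  have main: "sobolev_integral s (\<lambda>x. \<psi> j (2 ^ j *\<^sub>R x) * G (u (2 ^ j *\<^sub>R x))) \<le> ennreal (D * (L * (1 + R ^ N))\<^sup>2) *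
      (\<Sum>a\<in>Basis. \<Sum>k\<in>{j - 1, Suc j}. sobolev_integral s (\<lambda>x. \<psi> k (2 ^ k *\<^sub>R x) * (u (2 ^ k *\<^sub>R x) \<bullet> a)))"
    if u[measurable]: "u \<in> borel_measurable borel" and R': "\<forall>x. norm (u x) \<le> R" and G: "Ck (Suc N) G" and G0: "G 0 = 0"
      and L: "\<forall>\<beta>\<in>multi_indices. \<forall>a\<in>Basis. \<forall>y. length \<beta> \<le> N \<longrightarrow> norm y \<le> (C2 * H) * R \<longrightarrow> \<bar>iter_deriv \<beta> (dir_deriv a G) y\<bar> \<le> L"
    for u :: "real^3 \<Rightarrow> 'c" and R G L j
  proof -
    note R = spec[OF R']
    have R0: "R \<ge> 0" using R[of 0] norm_ge_zero order_trans by blast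
    have L0: "L \<ge> 0"
    proof -
      obtain a :: 'c where a: "a \<in> Basis" using SOME_Basis by blast
      have "norm (0::'c) \<le> (C2 * H) * R" using C2 H1 R0 by simp
      with L a have "\<bar>iter_deriv [] (dir_deriv a G) 0\<bar> \<le> L" by (auto simp: multi_indices_def)
      then show ?thesis by linarith
    qed
    define p where "p k x = \<psi> k (2 ^ j *\<^sub>R x)" for k x
    let ?a = "j - 1" and ?c = "Suc j"
    have Ckp: "Ck n (p k)" for k n
      using \<psi> unfolding p_def by (intro Ck_dilate) (simp add: dyadic_cutoffs_def smooth_def)
    have pm[measurable]: "p k \<in> borel_measurable borel" for k by (rule Ck_borel[OF Ckp])
    have jp: "jet 1 N (p k) x \<le> B" if "j \<le> Suc k" for k x unfolding p_def by (rule B[OF that])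
    have pB: "\<bar>p k x\<bar> \<le> B" if "j \<le> Suc k" for k x
      using jet_ge_abs[of 1 "p k" x N] jp[OF that, of x] by simp
    \<comment> \<open>For k <= j + 1 the k-th cutoff lives in radius 2^(k + 3) <= 2^(j + 4), which
      after dilation by 2^j is the fixed radius 16.\<close>
    have psupp: "p k x = 0" if "k \<le> Suc j" "norm x > 16" for k x
    proof (rule ccontr)
      assume "p k x \<noteq> 0"
      then have "2 ^ j * norm x \<le> 2 ^ (k + 3)"
        using wide_shell_norm_le[OF cutoff_support[OF \<psi>]] by (force simp: p_def)
      also have "(2::real) ^ (k + 3) \<le> 2 ^ (j + 4)" using that by (intro power_increasing) auto
      also have "\<dots> = 2 ^ j * 16" by (simp add: power_add)
      finally show False using that(2) by simp
    qed
    have ak: "j \<le> Suc ?a" "?a \<le> Suc j" and ck: "j \<le> Suc ?c" "?c \<le> Suc j" by auto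
    define U where "U x = u (2 ^ j *\<^sub>R x)" for x
    have [measurable]: "U \<in> borel_measurable borel" unfolding U_def[abs_def] by measurable
    have Ub: "\<bar>U x \<bullet> b\<bar> \<le> R" if "b \<in> Basis" for x b
      using Basis_le_norm[OF that, of "U x"] R[of "2 ^ j *\<^sub>R x"] by (simp add: U_def)
    define g where "g k b x = p k x * (U x \<bullet> b)" for k b x
    have [measurable]: "g k b \<in> borel_measurable borel" for k b unfolding g_def[abs_def] by measurable
    have gb: "\<bar>g k b x\<bar> \<le> B * R" if "j \<le> Suc k" "b \<in> Basis" for k b x
      unfolding g_def abs_mult using pB[OF that(1)] Ub[OF that(2)] B1 by (intro mult_mono) auto
    have gs: "g k b x = 0" if "k \<le> Suc j" "norm x > 16" for k b x using psupp[OF that] by (simp add: g_def)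
    have gi: "integrable lborel (g k b)" if "j \<le> Suc k" "k \<le> Suc j" "b \<in> Basis" for k b
      using gb[OF that(1,3)] gs[OF that(2)] by (intro integrable_bounded_support[of _ "B * R" 16]) auto
    define Q where "Q k b = sobolev_integral s (\<lambda>x. \<psi> k (2 ^ k *\<^sub>R x) * (u (2 ^ k *\<^sub>R x) \<bullet> b))" for k b
    have gQ: "sobolev_integral s (g k b) \<le> ennreal E * Q k b" if k: "j \<le> Suc k" "k \<le> Suc j" and b: "b \<in> Basis" for k b
    proof -
      \<comment> \<open>The ratio of the two dilations: 1/2, 1 or 2.\<close>
      define c :: real where "c = 2 ^ j / 2 ^ k"
      have c0: "c > 0" by (simp add: c_def)
      have "(2::real) ^ j \<le> 2 ^ Suc k" "(2::real) ^ k \<le> 2 ^ Suc j" using k by (intro power_increasing; simp)+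
      then have c: "1/2 \<le> c" "c \<le> 2" by (auto simp: c_def field_simps)
      let ?f = "\<lambda>x. \<psi> k (2 ^ k *\<^sub>R x) * (u (2 ^ k *\<^sub>R x) \<bullet> b)"
      have ge: "g k b = (\<lambda>x. ?f (c *\<^sub>R x))" by (auto simp: g_def p_def U_def c_def)
      have fe: "?f = (\<lambda>x. g k b (0 + (1 / c) *\<^sub>R x))" unfolding ge using c0 by simp
      have "integrable lborel ?f" unfolding fe using c0 by (intro integrable_lborel_affine gi k b) auto
      from sobolev_integral_dilate[OF this c s(1)] show ?thesis unfolding ge[symmetric] Q_def E_def by simp
    qed
    \<comment> \<open>The coefficient is 1 - (1 - p_a)(1 - p_c), hence 1 wherever one of the
      neighbouring cutoffs is 1, and 0 where both vanish.\<close>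
    define v where "v x = (p ?a x + (1 - p ?a x) * p ?c x) *\<^sub>R U x" for x
    have vb: "v x \<bullet> b = g ?a b x + (1 - p ?a x) * g ?c b x" for x b
      by (simp add: v_def g_def algebra_simps)
    have one: "\<bar>1 - p ?a x\<bar> \<le> 1 + B" for x using pB[OF ak(1), of x] by linarith
    have vM: "\<bar>v x \<bullet> b\<bar> \<le> H * R" if b: "b \<in> Basis" for b x
    proof -
      have "\<bar>v x \<bullet> b\<bar> \<le> \<bar>g ?a b x\<bar> + \<bar>1 - p ?a x\<bar> * \<bar>g ?c b x\<bar>" unfolding vb abs_mult[symmetric] by (rule abs_triangle_ineq)
      also have "\<dots> \<le> B * R + (1 + B) * (B * R)"
        using B1 by (intro add_mono mult_mono one gb ak ck b) auto
      finally show ?thesis by (simp add: H_def algebra_simps)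
    qed
    have vs: "v x = 0" if "norm x > 16" for x using psupp[OF ak(2) that] psupp[OF ck(2) that] by (simp add: v_def)
    have [measurable]: "v \<in> borel_measurable borel" unfolding v_def[abs_def] by measurable
    have vi: "integrable lborel (\<lambda>x. v x \<bullet> b)" if b: "b \<in> Basis" for b
      using vM[OF b] vs by (intro integrable_bounded_support[of _ "H * R" 16]) auto
    have vQ: "sobolev_integral s (\<lambda>x. v x \<bullet> b) \<le> ennreal V * (\<Sum>k\<in>{?a, ?c}. Q k b)" if b: "b \<in> Basis" for b
    proof -
      have C1p: "Ck N (\<lambda>x. 1 - p ?a x)" by (intro Ck_diff Ck_const Ckp)
      have j1: "jet 1 N (\<lambda>x. 1 - p ?a x) x \<le> 1 + B" for x
        using jet_diff[of 1 N "\<lambda>x. 1" "p ?a" x] Ckp jp[OF ak(1), of x] by (simp add: jet_const)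
      have mi: "integrable lborel (\<lambda>x. (1 - p ?a x) * g ?c b x)"
        using one by (intro integrable_bounded_mult[OF gi[OF ck b], of _ "1 + B"]) auto
      have "sobolev_integral s (\<lambda>x. (1 - p ?a x) * g ?c b x) \<le> ennreal (C1 * (1 + B)\<^sup>2) * sobolev_integral s (g ?c b)"
        using C1p j1 gi[OF ck b] gb[OF ck(1) b] gs[OF ck(2)]
        by (intro mult[THEN spec[where x="\<lambda>x. 1 - p ?a x"], THEN spec[where x="1 + B"], THEN spec[where x="g ?c b"],
          THEN spec[where x="B * R"], THEN spec[where x=16], THEN mp, THEN mp, THEN mp, THEN mp, THEN mp]) auto
      also have "\<dots> \<le> ennreal (C1 * (1 + B)\<^sup>2) * (ennreal E * Q ?c b)" by (intro mult_left_mono gQ ck b) auto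
      also have "\<dots> = ennreal (C1 * (1 + B)\<^sup>2 * E) * Q ?c b"
        using C1 E0 by (simp add: ennreal_mult mult.assoc)
      finally have 2: "sobolev_integral s (\<lambda>x. (1 - p ?a x) * g ?c b x) \<le> ennreal (C1 * (1 + B)\<^sup>2 * E) * Q ?c b" .
      have "sobolev_integral s (\<lambda>x. v x \<bullet> b) \<le> 2 * sobolev_integral s (g ?a b) + 2 * sobolev_integral s (\<lambda>x. (1 - p ?a x) * g ?c b x)"
        unfolding vb by (rule sobolev_integral_add[OF gi[OF ak b] mi])
      also have "\<dots> \<le> 2 * (ennreal E * Q ?a b) + 2 * (ennreal (C1 * (1 + B)\<^sup>2 * E) * Q ?c b)"
        by (intro add_mono mult_left_mono gQ[OF ak b] 2) auto
      also have "\<dots> = ennreal (2 * E) * Q ?a b + ennreal (2 * (C1 * (1 + B)\<^sup>2 * E)) * Q ?c b"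
        using C1 E0 by (simp add: ennreal_mult mult.assoc)
      also have "\<dots> \<le> ennreal V * Q ?a b + ennreal V * Q ?c b"
        using C1 E0 by (intro add_mono mult_right_mono ennreal_leI) (auto simp: V_def)
      finally show ?thesis by (simp add: distrib_left)
    qed
    \<comment> \<open>Wherever the j-th cutoff is nonzero, one neighbour equals 1 and
      \<open>v\<close> is \<open>u\<close>; elsewhere both sides vanish.\<close>
    have eq: "\<psi> j (2 ^ j *\<^sub>R x) * G (u (2 ^ j *\<^sub>R x)) = p j x * G (v x)" for x
    proof (cases "p j x = 0")
      case False
      then have "2 ^ j *\<^sub>R x \<in> dyadic_shell ?a \<union> dyadic_shell ?c"
        using cutoff_support[OF \<psi>] wide_shell_subset[of j] unfolding p_def by blast
      then have "p ?a x = 1 \<or> p ?c x = 1" using \<psi> unfolding dyadic_cutoffs_def p_def by blast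
      then have "p ?a x + (1 - p ?a x) * p ?c x = 1" by auto
      then show ?thesis by (simp add: v_def p_def U_def)
    qed (simp add: p_def)
    have "sobolev_integral s (\<lambda>x. p j x * G (v x)) \<le> ennreal (C2 * (B * L * (1 + H * R) ^ N)\<^sup>2) * (\<Sum>a\<in>Basis. sobolev_integral s (\<lambda>x. v x \<bullet> a))"
    proof (rule comp[THEN spec[where x="p j"], THEN spec[where x=B], THEN spec[where x=G], THEN spec[where x=L], THEN spec[where x=v],
        THEN spec[where x="H * R"], THEN spec[where x=16], THEN mp, THEN mp, THEN mp, THEN mp, THEN mp, THEN mp, THEN mp, THEN mp])
      show "\<forall>\<beta>\<in>multi_indices. \<forall>a\<in>Basis. \<forall>y. length \<beta> \<le> N \<longrightarrow> norm y \<le> C2 * (H * R) \<longrightarrow> \<bar>iter_deriv \<beta> (dir_deriv a G) y\<bar> \<le> L"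
        using L by (simp add: mult.assoc)
      show "\<forall>x. jet 1 N (p j) x \<le> B" using jp by simp
      show "\<forall>a\<in>Basis. integrable lborel (\<lambda>x. v x \<bullet> a)" using vi by blast
      show "\<forall>a\<in>Basis. \<forall>x. \<bar>v x \<bullet> a\<bar> \<le> H * R" using vM by blast
      show "\<forall>x. 16 < norm x \<longrightarrow> v x = 0" using vs by blast
    qed (fact Ckp G G0)+
    also have "\<dots> \<le> ennreal (C2 * (B * L * (1 + H * R) ^ N)\<^sup>2) * (\<Sum>b\<in>Basis. ennreal V * (\<Sum>k\<in>{?a, ?c}. Q k b))"
      by (intro mult_left_mono sum_mono vQ) auto
    also have "\<dots> = ennreal (C2 * (B * L * (1 + H * R) ^ N)\<^sup>2 * V) * (\<Sum>b\<in>Basis. \<Sum>k\<in>{?a, ?c}. Q k b)"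
      using C2 V0 by (simp add: ennreal_mult mult.assoc sum_distrib_left)
    also have "\<dots> \<le> ennreal (D * (L * (1 + R ^ N))\<^sup>2) * (\<Sum>b\<in>Basis. \<Sum>k\<in>{?a, ?c}. Q k b)"
    proof (intro mult_right_mono ennreal_leI)
      have "1 + H * R \<le> H * (1 + R)" using H1 by (simp add: algebra_simps)
      then have "(1 + H * R) ^ N \<le> H ^ N * (1 + R) ^ N"
        unfolding power_mult_distrib[symmetric] using H1 R0 by (intro power_mono) auto
      also have "\<dots> \<le> H ^ N * (2 ^ N * (1 + R ^ N))" using H1 by (intro mult_left_mono one_plus_power_le R0) auto
      finally have "B * L * (1 + H * R) ^ N \<le> B * L * (H ^ N * (2 ^ N * (1 + R ^ N)))"
        using B1 L0 by (intro mult_left_mono) auto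
      then have "(B * L * (1 + H * R) ^ N)\<^sup>2 \<le> (B * L * (H ^ N * (2 ^ N * (1 + R ^ N))))\<^sup>2"
        using B1 L0 H1 R0 by (intro power_mono) auto
      then have "C2 * (B * L * (1 + H * R) ^ N)\<^sup>2 * V \<le> C2 * (B * L * (H ^ N * (2 ^ N * (1 + R ^ N))))\<^sup>2 * V"
        using C2 V0 by (intro mult_right_mono mult_left_mono) auto
      also have "\<dots> = D * (L * (1 + R ^ N))\<^sup>2" unfolding D_def by (simp only: power_mult_distrib mult_ac)
      finally show "C2 * (B * L * (1 + H * R) ^ N)\<^sup>2 * V \<le> D * (L * (1 + R ^ N))\<^sup>2" .
    qed auto
    finally show ?thesis unfolding eq Q_def .
  qed
  show ?thesis by (intro exI[of _ D] conjI D0 exI[of _ "C2 * H"] allI impI) (rule main)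
qed

section \<open>Vector values, Borel representatives and the sum over the shells\<close>

lemma dir_deriv_component:
  fixes F :: "'a::euclidean_space \<Rightarrow> real^'l"
  assumes "F differentiable (at y)"
  shows "dir_deriv b (\<lambda>y. F y $ c) y = dir_deriv b F y $ c" "(\<lambda>y. F y $ c) differentiable (at y)"
proof -
  have "((\<lambda>y. F y $ c) has_derivative (\<lambda>h. dir_deriv h F y $ c)) (at y)"
    using bounded_linear.has_derivative[OF bounded_linear_vec_nth has_derivative_frechet[OF assms]] .
  then show "dir_deriv b (\<lambda>y. F y $ c) y = dir_deriv b F y $ c" "(\<lambda>y. F y $ c) differentiable (at y)"
    by (auto intro!: dir_deriv_eqI differentiableI)
qed

lemma Ck_component:
  fixes F :: "'a::euclidean_space \<Rightarrow> real^'l"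
  shows "Ck k F \<Longrightarrow> Ck k (\<lambda>y. F y $ c)"
proof (induction k arbitrary: F)
  case 0
  then show ?case by (auto intro!: continuous_on_component)
next
  case (Suc k)
  then have "dir_deriv b (\<lambda>y. F y $ c) = (\<lambda>y. dir_deriv b F y $ c)" for b by (auto simp: dir_deriv_component)
  with Suc show ?case by (auto simp: dir_deriv_component)
qed

lemma iter_deriv_component:
  fixes F :: "'a::euclidean_space \<Rightarrow> real^'l"
  shows "Ck k F \<Longrightarrow> \<beta> \<in> multi_indices \<Longrightarrow> length \<beta> \<le> k \<Longrightarrow> iter_deriv \<beta> (\<lambda>y. F y $ c) = (\<lambda>y. iter_deriv \<beta> F y $ c)"
proof (induction \<beta> arbitrary: F k rule: rev_induct)
  case Nil
  then show ?case by (simp add: iter_deriv_def)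
next
  case (snoc b \<beta>)
  then obtain k' where k: "k = Suc k'" by (cases k) auto
  have "dir_deriv b (\<lambda>y. F y $ c) = (\<lambda>y. dir_deriv b F y $ c)" using snoc.prems(1) k by (auto simp: dir_deriv_component)
  moreover have "iter_deriv \<beta> (\<lambda>y. dir_deriv b F y $ c) = (\<lambda>y. iter_deriv \<beta> (dir_deriv b F) y $ c)"
    using snoc.prems k by (intro snoc.IH[of k']) (auto simp: multi_indices_def)
  ultimately show ?case by (simp add: iter_deriv_append_dir)
qed

lemma iter_deriv_continuous:
  "Ck k F \<Longrightarrow> \<beta> \<in> multi_indices \<Longrightarrow> length \<beta> \<le> k \<Longrightarrow> continuous_on UNIV (iter_deriv \<beta> F)"
proof (induction \<beta> arbitrary: F k rule: rev_induct)
  case Nil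
  then show ?case using Ck_continuous by (auto simp: iter_deriv_def)
next
  case (snoc b \<beta>)
  then obtain k' where k: "k = Suc k'" by (cases k) auto
  show ?case unfolding iter_deriv_append_dir
    using snoc.prems k by (intro snoc.IH[of k']) (auto simp: multi_indices_def)
qed

lemma norm_iter_deriv_le_Ck_norm:
  assumes "\<beta> \<in> multi_indices" "length \<beta> \<le> k"
  shows "ennreal (norm (iter_deriv \<beta> F y)) \<le> Ck_norm k F"
  unfolding Ck_norm_def using assms by (intro SUP_upper2[of \<beta>] SUP_upper2[of y]) auto

text \<open>For the case of an infinite \<open>Ck_norm\<close>: a finite K is still claimed there,
  and compactness of the ball supplies bounds on the derivatives that the estimate uses.\<close>

lemma iter_deriv_bounded_on_ball:
  assumes "Ck (Suc k) F"
  shows "\<exists>L\<ge>0. \<forall>\<beta>\<in>multi_indices. \<forall>y. length \<beta> \<le> Suc k \<longrightarrow> norm y \<le> r \<longrightarrow> norm (iter_deriv \<beta> F y) \<le> L"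
proof -
  have "\<exists>L. \<forall>y. norm y \<le> r \<longrightarrow> norm (iter_deriv \<beta> F y) \<le> L" if "\<beta> \<in> multi_indices" "length \<beta> \<le> Suc k" for \<beta>
  proof -
    have "compact (iter_deriv \<beta> F ` cball 0 r)"
      by (rule compact_continuous_image[OF continuous_on_subset[OF iter_deriv_continuous[OF assms that]]]) auto
    then obtain L where "\<And>z. z \<in> iter_deriv \<beta> F ` cball 0 r \<Longrightarrow> norm z \<le> L"
      using compact_imp_bounded bounded_iff by metis
    then show ?thesis by (intro exI[of _ L]) auto
  qed
  then obtain L where L: "\<And>\<beta> y. \<beta> \<in> multi_indices \<Longrightarrow> length \<beta> \<le> Suc k \<Longrightarrow> norm y \<le> r \<Longrightarrow> norm (iter_deriv \<beta> F y) \<le> L \<beta>"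
    by metis
  let ?A = "{\<beta>\<in>multi_indices. length \<beta> \<le> Suc k}"
  have "norm (iter_deriv \<beta> F y) \<le> (\<Sum>\<beta>\<in>?A. \<bar>L \<beta>\<bar>)" if "\<beta> \<in> multi_indices" "length \<beta> \<le> Suc k" "norm y \<le> r" for \<beta> y
  proof -
    have "norm (iter_deriv \<beta> F y) \<le> \<bar>L \<beta>\<bar>" using L[OF that] by linarith
    also have "\<dots> \<le> (\<Sum>\<beta>\<in>?A. \<bar>L \<beta>\<bar>)" using that finite_multi_indices by (intro member_le_sum) auto
    finally show ?thesis .
  qed
  moreover have "(\<Sum>\<beta>\<in>?A. \<bar>L \<beta>\<bar>) \<ge> 0" by (intro sum_nonneg) auto
  ultimately show ?thesis by blast
qed

text \<open>\<open>fourier_distr\<close> evaluates a distribution at transforms of Schwartz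
  functions only.\<close>

lemma Hs_norm_sq_cong:
  assumes "\<And>\<phi>. \<phi> \<in> Schwartz \<Longrightarrow> T (fourier \<phi>) = T' (fourier \<phi>)"
  shows "Hs_norm_sq s T = Hs_norm_sq s T'"
  unfolding Hs_norm_sq_def represents_def fourier_distr_def using assms by simp

text \<open>The functions that reach T are cutoffs times dilated Fourier transforms. Agreement on
  all Borel functions spares a proof that these are Schwartz functions again.\<close>

lemma Hsd_norm_sq_cong:
  assumes \<psi>: "\<And>j. \<psi> j \<in> borel_measurable borel"
    and T: "\<And>i \<phi>. \<phi> \<in> borel_measurable borel \<Longrightarrow> T i \<phi> = T' i \<phi>"
  shows "Hsd_norm_sq \<psi> s \<delta> T = Hsd_norm_sq \<psi> s \<delta> T'"
proof -
  have "Hs_norm_sq s (dilate (2 ^ j) (mult_distr (\<psi> j) (T i))) = Hs_norm_sq s (dilate (2 ^ j) (mult_distr (\<psi> j) (T' i)))" for i j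
  proof (rule Hs_norm_sq_cong)
    fix \<phi> assume "\<phi> \<in> Schwartz"
    then have [measurable]: "fourier \<phi> \<in> borel_measurable borel" by (rule fourier_borel)
    note [measurable] = \<psi>
    have "(\<lambda>x. complex_of_real (\<psi> j x) * fourier \<phi> (x /\<^sub>R 2 ^ j)) \<in> borel_measurable borel" by measurable
    then show "dilate (2 ^ j) (mult_distr (\<psi> j) (T i)) (fourier \<phi>) = dilate (2 ^ j) (mult_distr (\<psi> j) (T' i)) (fourier \<phi>)"
      unfolding dilate_def mult_distr_def by (simp add: T)
  qed
  then show ?thesis unfolding Hsd_norm_sq_def by simp
qed

lemma tempered_cong:
  assumes T: "\<And>\<phi>. \<phi> \<in> borel_measurable borel \<Longrightarrow> T \<phi> = T' \<phi>" and T': "tempered T'"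
  shows "tempered T"
proof -
  have "(\<lambda>x. a * \<phi> x + b * \<eta> x) \<in> borel_measurable borel" if "\<phi> \<in> Schwartz" "\<eta> \<in> Schwartz" for \<phi> \<eta> a b
    using Schwartz_borel[OF that(1)] Schwartz_borel[OF that(2)] by measurable
  then show ?thesis using T' unfolding tempered_def by (simp add: T Schwartz_borel)
qed

lemma distr_of_cong_AE:
  fixes u u' :: "real^3 \<Rightarrow> real^'n"
  assumes "u \<in> borel_measurable lebesgue" "u' \<in> borel_measurable lebesgue" "AE x in lebesgue. u x = u' x" "\<phi> \<in> borel_measurable borel"
  shows "distr_of u i \<phi> = distr_of u' i \<phi>"
  unfolding distr_of_def
proof (rule integral_cong_AE)
  have \<phi>: "\<phi> \<in> borel_measurable lebesgue" using assms(4) by (intro measurable_completion) simp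
  have "(\<lambda>x. complex_of_real (w x $ i)) \<in> borel_measurable lebesgue" if "w \<in> borel_measurable lebesgue" for w :: "real^3 \<Rightarrow> real^'n"
  proof -
    have "complex_of_real \<in> borel_measurable borel" by (intro borel_measurable_continuous_onI continuous_intros)
    then show ?thesis by (rule measurable_compose[OF borel_measurable_vec_nth[OF that]])
  qed
  then show "(\<lambda>x. complex_of_real (u x $ i) * \<phi> x) \<in> borel_measurable lebesgue" "(\<lambda>x. complex_of_real (u' x $ i) * \<phi> x) \<in> borel_measurable lebesgue"
    using \<phi> assms(1,2) by (auto intro!: borel_measurable_times)
  show "AE x in lebesgue. complex_of_real (u x $ i) * \<phi> x = complex_of_real (u' x $ i) * \<phi> x"
    using assms(3) by eventually_elim simp
qed

text \<open>The estimates are made for Borel functions bounded at every point. The essential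
  supremum is an almost everywhere bound, so changing \<open>u\<close> on a null set produces such a
  function with the same bound.\<close>

lemma bounded_borel_representative:
  fixes u :: "real^3 \<Rightarrow> real^'n"
  assumes u: "u \<in> Linf"
  shows "\<exists>u'. u' \<in> borel_measurable borel \<and> (\<forall>x. norm (u' x) \<le> enn2real (Linf_norm u)) \<and> (AE x in lebesgue. u x = u' x)"
proof -
  define R where "R = enn2real (Linf_norm u)"
  have um: "u \<in> borel_measurable lebesgue" and fin: "Linf_norm u < \<infinity>" using u by (auto simp: Linf_def)
  have LR: "Linf_norm u = ennreal R" unfolding R_def using fin by simp
  have "(\<lambda>x. ennreal (norm (u x))) \<in> borel_measurable lebesgue" using um by measurable
  from esssup_AE[of "\<lambda>x. ennreal (norm (u x))" lebesgue]
  have "AE x in lebesgue. ennreal (norm (u x)) \<le> ennreal R" using LR by (simp add: Linf_norm_def)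
  then have bd: "AE x in lebesgue. norm (u x) \<le> R"
    by eventually_elim (simp add: R_def ennreal_le_iff)
  have "\<exists>k\<in>borel_measurable lborel. AE x in lborel. u x $ i = k x" for i
    by (rule completion_ex_borel_measurable_real) (rule borel_measurable_vec_nth[OF um])
  then obtain k where k: "\<And>i. k i \<in> borel_measurable lborel" "\<And>i. AE x in lborel. u x $ i = k i x" by metis
  define w where "w x = (\<chi> i. k i x)" for x
  have wm[measurable]: "w \<in> borel_measurable borel"
    unfolding w_def[abs_def]
  proof (subst borel_measurable_euclidean_space, intro ballI)
    fix b :: "real^'n" assume "b \<in> Basis"
    then obtain i where "b = axis i 1" by (auto simp: Basis_vec_def)
    then show "(\<lambda>x. (\<chi> i. k i x) \<bullet> b) \<in> borel_measurable borel" using k(1)[of i] by (simp add: cart_eq_inner_axis[symmetric])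
  qed
  have "AE x in lborel. \<forall>i. u x $ i = k i x" using k(2) by (simp add: AE_all_countable)
  then have "AE x in lborel. u x = w x" by eventually_elim (simp add: w_def vec_eq_iff)
  then have ae: "AE x in lebesgue. u x = w x" by (rule AE_completion)
  \<comment> \<open>Values beyond R occur only on a null set and are replaced by 0.\<close>
  define u' where "u' x = (if norm (w x) \<le> R then w x else 0)" for x
  have "u' \<in> borel_measurable borel" unfolding u'_def[abs_def] by measurable
  moreover have "norm (u' x) \<le> R" for x by (simp add: u'_def R_def)
  moreover have "AE x in lebesgue. u x = u' x" using ae bd by eventually_elim (simp add: u'_def)
  ultimately show ?thesis unfolding R_def by blast
qed

lemma Basis_vec_sum: "(\<Sum>a\<in>(Basis :: (real^'n) set). f a) = (\<Sum>i\<in>UNIV. f (axis i 1))"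
proof -
  have B: "(Basis :: (real^'n) set) = range (\<lambda>i. axis i 1)" by (auto simp: Basis_vec_def)
  have i: "inj (\<lambda>i::'n. axis i (1::real))" by (auto simp: inj_def axis_eq_axis)
  show ?thesis unfolding B sum.reindex[OF i] comp_def ..
qed

lemma Hsd_norm_sq_distr_of:
  fixes u :: "real^3 \<Rightarrow> real^'n"
  assumes \<psi>: "dyadic_cutoffs \<psi>" and u: "u \<in> borel_measurable borel" "\<And>x. norm (u x) \<le> R"
  shows "Hsd_norm_sq \<psi> s \<delta> (distr_of u) = (\<Sum>i\<in>UNIV. \<Sum>j. ennreal (2 powr ((3/2 + \<delta>) * 2 * real j)) *
    (ennreal ((2 * pi) powr (- 3)) * sobolev_integral s (\<lambda>x. \<psi> j (2 ^ j *\<^sub>R x) * (u (2 ^ j *\<^sub>R x) $ i))))"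
proof -
  obtain B where B: "\<And>j k x. j \<le> Suc k \<Longrightarrow> jet 1 0 (\<lambda>x. \<psi> k (2 ^ j *\<^sub>R x)) x \<le> B"
    using cutoff_jet_bound[OF \<psi>, of 0] by blast
  have \<psi>m[measurable]: "\<psi> j \<in> borel_measurable borel" for j
    using \<psi> by (intro Ck_borel[of 0]) (simp add: dyadic_cutoffs_def smooth_def)
  have "Hs_norm_sq s (dilate (2 ^ j) (mult_distr (\<psi> j) (distr_of u i))) =
     ennreal ((2 * pi) powr (- 3)) * sobolev_integral s (\<lambda>x. \<psi> j (2 ^ j *\<^sub>R x) * (u (2 ^ j *\<^sub>R x) $ i))" for i j
  proof (rule Hs_norm_sq_dilate_mult[OF u(1) \<psi>m])
    show "integrable lborel (\<lambda>x. \<psi> j (2 ^ j *\<^sub>R x) * (u (2 ^ j *\<^sub>R x) $ i))"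
    proof (rule integrable_bounded_support)
      have [measurable]: "(\<lambda>x. u x $ i) \<in> borel_measurable borel" by (rule borel_measurable_vec_nth[OF u(1)])
      show "(\<lambda>x. \<psi> j (2 ^ j *\<^sub>R x) * (u (2 ^ j *\<^sub>R x) $ i)) \<in> borel_measurable borel" by measurable
      fix x :: "real^3"
      have "\<bar>\<psi> j (2 ^ j *\<^sub>R x)\<bar> \<le> B" using B[of j j x] by simp
      moreover have "\<bar>u (2 ^ j *\<^sub>R x) $ i\<bar> \<le> R"
        using component_le_norm_cart[of "u (2 ^ j *\<^sub>R x)" i] u(2)[of "2 ^ j *\<^sub>R x"] by linarith
      ultimately show "\<bar>\<psi> j (2 ^ j *\<^sub>R x) * (u (2 ^ j *\<^sub>R x) $ i)\<bar> \<le> B * R"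
        unfolding abs_mult by (intro mult_mono) auto
      \<comment> \<open>8 is 2^(j + 3) / 2^j, the radius of the wide shell after dilation.\<close>
      show "\<psi> j (2 ^ j *\<^sub>R x) * (u (2 ^ j *\<^sub>R x) $ i) = 0" if "norm x > 8"
      proof (rule ccontr)
        assume "\<psi> j (2 ^ j *\<^sub>R x) * (u (2 ^ j *\<^sub>R x) $ i) \<noteq> 0"
        then have "norm (2 ^ j *\<^sub>R x) \<le> 2 ^ (j + 3)"
          by (intro wide_shell_norm_le cutoff_support[OF \<psi>]) auto
        then show False using that by (simp add: power_add)
      qed
    qed
  qed simp
  then show ?thesis unfolding Hsd_norm_sq_def by simp
qed

text \<open>Moving one index up or down changes the weight by at most the factor e, where e =
  2^|\<theta>|. The upper neighbours contribute e X, the lower ones e X and one further X, since j =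
  0 is its own lower neighbour.\<close>

lemma weighted_neighbour_sum:
  fixes Q :: "nat \<Rightarrow> ennreal" and \<theta> :: real
  shows "(\<Sum>j. ennreal (2 powr (\<theta> * real j)) * (\<Sum>k\<in>{j - 1, Suc j}. Q k)) \<le> ennreal (1 + 2 * 2 powr \<bar>\<theta>\<bar>) * (\<Sum>j. ennreal (2 powr (\<theta> * real j)) * Q j)"
proof -
  define w where "w j = ennreal (2 powr (\<theta> * real j))" for j
  define e where "e = ennreal (2 powr \<bar>\<theta>\<bar>)"
  define X where "X = (\<Sum>j. w j * Q j)"
  have w1: "w (Suc j) \<le> e * w j" for j
  proof -
    have "2 powr (\<theta> * real (Suc j)) \<le> 2 powr (\<bar>\<theta>\<bar> + \<theta> * real j)" by (intro powr_mono) (auto simp: algebra_simps)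
    then show ?thesis by (simp add: w_def e_def powr_add ennreal_leI flip: ennreal_mult)
  qed
  have w2: "w j \<le> e * w (Suc j)" for j
  proof -
    have "2 powr (\<theta> * real j) \<le> 2 powr (\<bar>\<theta>\<bar> + \<theta> * real (Suc j))" by (intro powr_mono) (auto simp: algebra_simps)
    then show ?thesis by (simp add: w_def e_def powr_add ennreal_leI flip: ennreal_mult)
  qed
  have part: "(\<Sum>j<n. w j * Q j) \<le> X" for n unfolding X_def by (intro sum_le_suminf) auto
  have a: "(\<Sum>j<n. w j * Q (Suc j)) \<le> e * X" for n
  proof -
    have "(\<Sum>j<n. w j * Q (Suc j)) \<le> (\<Sum>j<n. e * (w (Suc j) * Q (Suc j)))"
      unfolding mult.assoc[symmetric] by (intro sum_mono mult_right_mono w2) auto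
    also have "\<dots> = e * (\<Sum>j<n. w (Suc j) * Q (Suc j))" by (simp add: sum_distrib_left)
    also have "(\<Sum>j<n. w (Suc j) * Q (Suc j)) \<le> (\<Sum>j<Suc n. w j * Q j)" unfolding sum.lessThan_Suc_shift by simp
    also have "\<dots> \<le> X" by (rule part)
    finally show ?thesis by (simp add: mult_left_mono)
  qed
  have b: "(\<Sum>j<n. w j * Q (j - 1)) \<le> X + e * X" for n
  proof (cases n)
    case (Suc m)
    have "(\<Sum>j<Suc m. w j * Q (j - 1)) = w 0 * Q 0 + (\<Sum>j<m. w (Suc j) * Q j)" unfolding sum.lessThan_Suc_shift by simp
    also have "\<dots> \<le> w 0 * Q 0 + (\<Sum>j<m. e * (w j * Q j))"
      unfolding mult.assoc[symmetric] by (intro add_left_mono sum_mono mult_right_mono w1) auto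
    also have "\<dots> = w 0 * Q 0 + e * (\<Sum>j<m. w j * Q j)" by (simp add: sum_distrib_left)
    also have "\<dots> \<le> X + e * X" using part[of 1] by (intro add_mono mult_left_mono part) auto
    finally show ?thesis using Suc by simp
  qed simp
  have ne: "j - 1 \<noteq> Suc j" for j :: nat by auto
  have "(\<Sum>j. w j * (\<Sum>k\<in>{j - 1, Suc j}. Q k)) \<le> (X + e * X) + e * X"
  proof (rule suminf_le_const[OF summableI])
    fix n
    have "(\<Sum>j<n. w j * (\<Sum>k\<in>{j - 1, Suc j}. Q k)) = (\<Sum>j<n. w j * Q (j - 1)) + (\<Sum>j<n. w j * Q (Suc j))"
      using ne by (simp add: distrib_left sum.distrib)
    also have "\<dots> \<le> (X + e * X) + e * X" by (intro add_mono a b)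
    finally show "(\<Sum>j<n. w j * (\<Sum>k\<in>{j - 1, Suc j}. Q k)) \<le> (X + e * X) + e * X" .
  qed
  also have "\<dots> = ennreal (1 + 2 * 2 powr \<bar>\<theta>\<bar>) * X"
  proof -
    have "ennreal (1 + 2 * 2 powr \<bar>\<theta>\<bar>) = ennreal (1 + (2 powr \<bar>\<theta>\<bar> + 2 powr \<bar>\<theta>\<bar>))" by simp
    also have "\<dots> = ennreal 1 + ennreal (2 powr \<bar>\<theta>\<bar> + 2 powr \<bar>\<theta>\<bar>)" by (rule ennreal_plus) auto
    also have "ennreal (2 powr \<bar>\<theta>\<bar> + 2 powr \<bar>\<theta>\<bar>) = e + e" unfolding e_def by (rule ennreal_plus) auto
    also have "ennreal 1 = 1" by simp
    finally show ?thesis by (simp only: distrib_right mult_1 add.assoc)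
  qed
  finally show ?thesis unfolding w_def X_def .
qed

text \<open>\<open>shell_estimate\<close> is applied to each component of F on each shell, with a
  constant that does not depend on the shell; \<open>weighted_neighbour_sum\<close> then collects
  the neighbours, and the components of F give the factor \<open>CARD('l)\<close>.\<close>

lemma weighted_composition_estimate:
  fixes \<psi> :: "nat \<Rightarrow> real^3 \<Rightarrow> real"
  assumes \<psi>: "dyadic_cutoffs \<psi>" and N: "N > 0" and s: "0 < s" "s < real N"
  shows "\<exists>C\<ge>0. \<exists>Y. \<forall>(F :: real^'m \<Rightarrow> real^'l) (u :: real^3 \<Rightarrow> real^'m) R L. u \<in> borel_measurable borel \<longrightarrow> (\<forall>x. norm (u x) \<le> R) \<longrightarrow>
    Ck (Suc N) F \<longrightarrow> F 0 = 0 \<longrightarrow>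
    (\<forall>\<beta>\<in>multi_indices. \<forall>y. length \<beta> \<le> Suc N \<longrightarrow> norm y \<le> Y * R \<longrightarrow> norm (iter_deriv \<beta> F y) \<le> L) \<longrightarrow>
    Hsd_norm_sq \<psi> s \<delta> (distr_of (F \<circ> u)) \<le> ennreal (C * (L * (1 + R ^ N))\<^sup>2) * Hsd_norm_sq \<psi> s \<delta> (distr_of u)"
proof -
  obtain D Y where D: "D \<ge> 0" and shell: "\<forall>(u :: real^3 \<Rightarrow> real^'m) R G L j. u \<in> borel_measurable borel \<longrightarrow> (\<forall>x. norm (u x) \<le> R) \<longrightarrow>
    Ck (Suc N) G \<longrightarrow> G 0 = 0 \<longrightarrow>
    (\<forall>\<beta>\<in>multi_indices. \<forall>a\<in>Basis. \<forall>y. length \<beta> \<le> N \<longrightarrow> norm y \<le> Y * R \<longrightarrow> \<bar>iter_deriv \<beta> (dir_deriv a G) y\<bar> \<le> L) \<longrightarrow>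
    sobolev_integral s (\<lambda>x. \<psi> j (2 ^ j *\<^sub>R x) * G (u (2 ^ j *\<^sub>R x))) \<le> ennreal (D * (L * (1 + R ^ N))\<^sup>2) *
      (\<Sum>a\<in>Basis. \<Sum>k\<in>{j - 1, Suc j}. sobolev_integral s (\<lambda>x. \<psi> k (2 ^ k *\<^sub>R x) * (u (2 ^ k *\<^sub>R x) \<bullet> a)))"
    using shell_estimate[OF \<psi> N s, where 'c="real^'m"] by (elim exE conjE) (rule that)
  \<comment> \<open>The weight of shell j is 2^(\<theta> j).\<close>
  define \<theta> where "\<theta> = (3/2 + \<delta>) * 2"
  define e where "e = 1 + 2 * 2 powr \<bar>\<theta>\<bar>"
  have e0: "e \<ge> 0" by (simp add: e_def)
  define C where "C = real CARD('l) * (D * e)"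
  have C0: "C \<ge> 0" unfolding C_def using D e0 by simp
  let ?\<kappa> = "ennreal ((2 * pi) powr (- 3))"
  let ?w = "\<lambda>j::nat. ennreal (2 powr (\<theta> * real j))"
  have main: "Hsd_norm_sq \<psi> s \<delta> (distr_of (F \<circ> u)) \<le> ennreal (C * (L * (1 + R ^ N))\<^sup>2) * Hsd_norm_sq \<psi> s \<delta> (distr_of u)"
    if u: "u \<in> borel_measurable borel" and R: "\<forall>x. norm (u x) \<le> R" and F: "Ck (Suc N) F" and F0: "F 0 = 0"
      and L: "\<forall>\<beta>\<in>multi_indices. \<forall>y. length \<beta> \<le> Suc N \<longrightarrow> norm y \<le> Y * R \<longrightarrow> norm (iter_deriv \<beta> F y) \<le> L"
    for F :: "real^'m \<Rightarrow> real^'l" and u :: "real^3 \<Rightarrow> real^'m" and R L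
  proof -
    define Q where "Q k a = sobolev_integral s (\<lambda>x. \<psi> k (2 ^ k *\<^sub>R x) * (u (2 ^ k *\<^sub>R x) \<bullet> a))" for k and a :: "real^'m"
    define K where "K = (L * (1 + R ^ N))\<^sup>2"
    have K0: "K \<ge> 0" by (simp add: K_def)
    have Fm: "F \<circ> u \<in> borel_measurable borel"
      unfolding comp_def
      by (rule measurable_compose[OF u borel_measurable_continuous_onI[OF Ck_continuous[OF F]]])
    \<comment> \<open>\<open>u\<close> takes values in a closed ball, so the continuous F is bounded
      along it; this makes the shell formula for the norm available for
      \<open>F \<circ> u\<close>.\<close>
    have "compact (F ` cball 0 R)"
      by (rule compact_continuous_image[OF continuous_on_subset[OF Ck_continuous[OF F]]]) auto
    then obtain R' where "\<And>z. z \<in> F ` cball 0 R \<Longrightarrow> norm z \<le> R'" using compact_imp_bounded bounded_iff by metis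
    then have Fb: "norm ((F \<circ> u) x) \<le> R'" for x using R by simp
    have term_le: "sobolev_integral s (\<lambda>x. \<psi> j (2 ^ j *\<^sub>R x) * ((F \<circ> u) (2 ^ j *\<^sub>R x) $ c)) \<le>
       ennreal (D * K) * (\<Sum>a\<in>Basis. \<Sum>k\<in>{j - 1, Suc j}. Q k a)" for j c
      unfolding Q_def K_def comp_def
    proof (rule shell[THEN spec[where x=u], THEN spec[where x=R], THEN spec[where x="\<lambda>y. F y $ c"], THEN spec[where x=L], THEN spec[where x=j],
        THEN mp, THEN mp, THEN mp, THEN mp, THEN mp, OF u R Ck_component[OF F]])
      show "F 0 $ c = 0" by (simp add: F0)
      show "\<forall>\<beta>\<in>multi_indices. \<forall>a\<in>Basis. \<forall>y. length \<beta> \<le> N \<longrightarrow> norm y \<le> Y * R \<longrightarrow> \<bar>iter_deriv \<beta> (dir_deriv a (\<lambda>y. F y $ c)) y\<bar> \<le> L"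
      proof (intro ballI allI impI)
        fix \<beta> :: "(real^'m) list" and a y :: "real^'m"
        assume *: "\<beta> \<in> multi_indices" "a \<in> (Basis :: (real^'m) set)" "length \<beta> \<le> N" "norm y \<le> Y * R"
        then have m: "\<beta> @ [a] \<in> multi_indices" "length (\<beta> @ [a]) \<le> Suc N" by (auto simp: multi_indices_def)
        have "iter_deriv \<beta> (dir_deriv a (\<lambda>y. F y $ c)) y = iter_deriv (\<beta> @ [a]) F y $ c"
          using iter_deriv_component[OF F m, of c] by (simp add: iter_deriv_append_dir)
        then show "\<bar>iter_deriv \<beta> (dir_deriv a (\<lambda>y. F y $ c)) y\<bar> \<le> L"
          using component_le_norm_cart[of "iter_deriv (\<beta> @ [a]) F y" c] L m *(4) by fastforce
      qed
    qed
    have comp: "(\<Sum>j. ?w j * (?\<kappa> * sobolev_integral s (\<lambda>x. \<psi> j (2 ^ j *\<^sub>R x) * ((F \<circ> u) (2 ^ j *\<^sub>R x) $ c)))) \<le>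
       ennreal (D * K * e) * (\<Sum>a\<in>Basis. \<Sum>j. ?w j * (?\<kappa> * Q j a))" for c
    proof -
      have "(\<Sum>j. ?w j * (?\<kappa> * sobolev_integral s (\<lambda>x. \<psi> j (2 ^ j *\<^sub>R x) * ((F \<circ> u) (2 ^ j *\<^sub>R x) $ c)))) \<le>
        (\<Sum>j. ?w j * (?\<kappa> * (ennreal (D * K) * (\<Sum>a\<in>Basis. \<Sum>k\<in>{j - 1, Suc j}. Q k a))))"
        by (intro suminf_le mult_left_mono term_le summableI) auto
      also have "\<dots> = (\<Sum>j. ennreal (D * K) * (\<Sum>a\<in>Basis. ?w j * (\<Sum>k\<in>{j - 1, Suc j}. ?\<kappa> * Q k a)))"
        by (intro suminf_cong) (simp only: sum_distrib_left mult_ac)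
      also have "\<dots> = ennreal (D * K) * (\<Sum>a\<in>Basis. \<Sum>j. ?w j * (\<Sum>k\<in>{j - 1, Suc j}. ?\<kappa> * Q k a))"
        by (simp only: ennreal_suminf_cmult suminf_sum summableI)
      also have "\<dots> \<le> ennreal (D * K) * (\<Sum>a\<in>Basis. ennreal e * (\<Sum>j. ?w j * (?\<kappa> * Q j a)))"
        unfolding e_def by (intro mult_left_mono sum_mono weighted_neighbour_sum) auto
      also have "\<dots> = ennreal (D * K * e) * (\<Sum>a\<in>Basis. \<Sum>j. ?w j * (?\<kappa> * Q j a))"
        unfolding sum_distrib_left[symmetric] mult.assoc[symmetric] using D K0 e0 by (simp add: ennreal_mult)
      finally show ?thesis .
    qed
    have Hu: "Hsd_norm_sq \<psi> s \<delta> (distr_of u) = (\<Sum>a\<in>Basis. \<Sum>j. ?w j * (?\<kappa> * Q j a))"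
      unfolding Hsd_norm_sq_distr_of[OF \<psi> u spec[OF R]] Basis_vec_sum Q_def \<theta>_def
      by (simp add: cart_eq_inner_axis)
    have "Hsd_norm_sq \<psi> s \<delta> (distr_of (F \<circ> u)) \<le> (\<Sum>c\<in>(UNIV :: 'l set). ennreal (D * K * e) * Hsd_norm_sq \<psi> s \<delta> (distr_of u))"
      unfolding Hu Hsd_norm_sq_distr_of[OF \<psi> Fm Fb] using comp unfolding \<theta>_def by (intro sum_mono) auto
    also have "\<dots> = ennreal (C * K) * Hsd_norm_sq \<psi> s \<delta> (distr_of u)"
      unfolding C_def using D K0 e0 by (simp add: ennreal_mult ennreal_of_nat_eq_real_of_nat mult_ac)
    finally show ?thesis unfolding K_def .
  qed
  show ?thesis by (intro exI[of _ C] conjI C0 exI[of _ Y] allI impI) (rule main)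
qed

text \<open>Three points remain after \<open>weighted_composition_estimate\<close>: \<open>u\<close>
  is exchanged for a bounded Borel representative, a bound L for the derivatives of F on the
  relevant ball is compared with \<open>Ck_norm\<close>, and square roots are taken of the squared
  norms.\<close>

theorem theorem8p11:
  fixes s \<delta> :: real and N :: nat and \<psi> :: "nat \<Rightarrow> real^3 \<Rightarrow> real"
  assumes "dyadic_cutoffs \<psi>"
    and "s > 0"
    and "N > 0" and "int N \<ge> \<lfloor>s\<rfloor> + 1"
  shows "\<exists>C>0. \<forall>(F :: real^'m \<Rightarrow> real^'l) (u :: real^3 \<Rightarrow> real^'m).
      Ck (N + 1) F \<longrightarrow> F 0 = 0 \<longrightarrow> u \<in> Linf \<longrightarrow> distr_of u \<in> Hsd \<psi> s \<delta> \<longrightarrow>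
        distr_of (F \<circ> u) \<in> Hsd \<psi> s \<delta> \<and>
        (\<exists>K\<ge>0. Hsd_norm \<psi> s \<delta> (distr_of (F \<circ> u)) \<le> K * Hsd_norm \<psi> s \<delta> (distr_of u) \<and>
           ennreal K \<le> ennreal C * Ck_norm (N + 1) F * (1 + Linf_norm u ^ N))"
proof -
  \<comment> \<open>The integer part plus 1 exceeds s strictly, which is the s < N of the
    estimates.\<close>
  have sN: "s < real N" using assms(4) by linarith
  obtain C Y where C: "C \<ge> 0" and est: "\<forall>(F :: real^'m \<Rightarrow> real^'l) (u :: real^3 \<Rightarrow> real^'m) R L. u \<in> borel_measurable borel \<longrightarrow> (\<forall>x. norm (u x) \<le> R) \<longrightarrow>
    Ck (Suc N) F \<longrightarrow> F 0 = 0 \<longrightarrow>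
    (\<forall>\<beta>\<in>multi_indices. \<forall>y. length \<beta> \<le> Suc N \<longrightarrow> norm y \<le> Y * R \<longrightarrow> norm (iter_deriv \<beta> F y) \<le> L) \<longrightarrow>
    Hsd_norm_sq \<psi> s \<delta> (distr_of (F \<circ> u)) \<le> ennreal (C * (L * (1 + R ^ N))\<^sup>2) * Hsd_norm_sq \<psi> s \<delta> (distr_of u)"
    using weighted_composition_estimate[OF assms(1,3,2) sN, of \<delta>, where 'm='m and 'l='l] by (elim exE conjE) (rule that)
  have main: "distr_of (F \<circ> u) \<in> Hsd \<psi> s \<delta> \<and>
        (\<exists>K\<ge>0. Hsd_norm \<psi> s \<delta> (distr_of (F \<circ> u)) \<le> K * Hsd_norm \<psi> s \<delta> (distr_of u) \<and>
           ennreal K \<le> ennreal (sqrt C + 1) * Ck_norm (N + 1) F * (1 + Linf_norm u ^ N))"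
    if F': "Ck (N + 1) F" and F0: "F 0 = 0" and u: "u \<in> Linf" and uH: "distr_of u \<in> Hsd \<psi> s \<delta>"
    for F :: "real^'m \<Rightarrow> real^'l" and u :: "real^3 \<Rightarrow> real^'m"
  proof -
    have F: "Ck (Suc N) F" using F' by simp
    define R where "R = enn2real (Linf_norm u)"
    have R0: "R \<ge> 0" by (simp add: R_def)
    have LR: "Linf_norm u = ennreal R" unfolding R_def using u by (simp add: Linf_def)
    obtain u' where u': "u' \<in> borel_measurable borel" "\<forall>x. norm (u' x) \<le> R" "AE x in lebesgue. u x = u' x"
      using bounded_borel_representative[OF u] unfolding R_def by blast
    have um: "u \<in> borel_measurable lebesgue" using u by (simp add: Linf_def)
    have u'm: "u' \<in> borel_measurable lebesgue" using u'(1) by (intro measurable_completion) simp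
    have Fm: "F \<in> borel_measurable borel" by (rule borel_measurable_continuous_onI[OF Ck_continuous[OF F]])
    have Fu': "F \<circ> u' \<in> borel_measurable borel" unfolding comp_def by (rule measurable_compose[OF u'(1) Fm])
    have \<psi>m: "\<psi> j \<in> borel_measurable borel" for j
      using assms(1) by (intro Ck_borel[of 0]) (simp add: dyadic_cutoffs_def smooth_def)
    have c1: "distr_of u i \<phi> = distr_of u' i \<phi>" if "\<phi> \<in> borel_measurable borel" for i \<phi>
      by (rule distr_of_cong_AE[OF um u'm u'(3) that])
    have c2: "distr_of (F \<circ> u) i \<phi> = distr_of (F \<circ> u') i \<phi>" if "\<phi> \<in> borel_measurable borel" for i \<phi>
    proof (rule distr_of_cong_AE[OF _ _ _ that])
      show "F \<circ> u \<in> borel_measurable lebesgue" "F \<circ> u' \<in> borel_measurable lebesgue"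
        unfolding comp_def by (rule measurable_compose[OF um Fm], rule measurable_compose[OF u'm Fm])
      show "AE x in lebesgue. (F \<circ> u) x = (F \<circ> u') x" using u'(3) by eventually_elim simp
    qed
    have n1: "Hsd_norm_sq \<psi> s \<delta> (distr_of u) = Hsd_norm_sq \<psi> s \<delta> (distr_of u')" by (rule Hsd_norm_sq_cong[OF \<psi>m c1])
    have n2: "Hsd_norm_sq \<psi> s \<delta> (distr_of (F \<circ> u)) = Hsd_norm_sq \<psi> s \<delta> (distr_of (F \<circ> u'))" by (rule Hsd_norm_sq_cong[OF \<psi>m c2])
    have bound: "Hsd_norm_sq \<psi> s \<delta> (distr_of (F \<circ> u)) \<le> ennreal (C * (L * (1 + R ^ N))\<^sup>2) * Hsd_norm_sq \<psi> s \<delta> (distr_of u)"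
      if L: "\<forall>\<beta>\<in>multi_indices. \<forall>y. length \<beta> \<le> Suc N \<longrightarrow> norm y \<le> Y * R \<longrightarrow> norm (iter_deriv \<beta> F y) \<le> L" for L
      unfolding n1 n2 using est F F0 u'(1,2) L by blast
    \<comment> \<open>If the norm of F is finite, L is that norm. Otherwise the comparison with
      \<open>Ck_norm\<close> is trivial, and L is any bound on the ball of radius Y R.\<close>
    obtain L where L0: "L \<ge> 0" and L: "\<forall>\<beta>\<in>multi_indices. \<forall>y. length \<beta> \<le> Suc N \<longrightarrow> norm y \<le> Y * R \<longrightarrow> norm (iter_deriv \<beta> F y) \<le> L"
      and LC: "ennreal L \<le> Ck_norm (N + 1) F"
    proof (cases "Ck_norm (N + 1) F = \<infinity>")
      case True
      then show ?thesis using iter_deriv_bounded_on_ball[OF F, of "Y * R"] that by auto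
    next
      case False
      then have "Ck_norm (N + 1) F \<noteq> top" by simp
      then have e: "ennreal (enn2real (Ck_norm (N + 1) F)) = Ck_norm (N + 1) F"
        by (intro ennreal_enn2real) (rule less_top[THEN iffD1])
      have "norm (iter_deriv \<beta> F y) \<le> enn2real (Ck_norm (N + 1) F)" if "\<beta> \<in> multi_indices" "length \<beta> \<le> Suc N" for \<beta> y
      proof -
        have "ennreal (norm (iter_deriv \<beta> F y)) \<le> ennreal (enn2real (Ck_norm (N + 1) F))"
          unfolding e by (rule norm_iter_deriv_le_Ck_norm) (use that in auto)
        then show ?thesis by (rule ennreal_le_iff[THEN iffD1, OF enn2real_nonneg])
      qed
      then show ?thesis using e by (intro that[of "enn2real (Ck_norm (N + 1) F)"]) auto
    qed
    \<comment> \<open>The estimate concerns squared norms, hence sqrt C.\<close>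
    define K where "K = sqrt C * (L * (1 + R ^ N))"
    have K0: "K \<ge> 0" unfolding K_def using C L0 R0 by simp
    have K2: "C * (L * (1 + R ^ N))\<^sup>2 = K\<^sup>2" unfolding K_def using C by (simp add: power_mult_distrib)
    have b: "Hsd_norm_sq \<psi> s \<delta> (distr_of (F \<circ> u)) \<le> ennreal (K\<^sup>2) * Hsd_norm_sq \<psi> s \<delta> (distr_of u)"
      using bound[OF L] unfolding K2 .
    have fin: "Hsd_norm_sq \<psi> s \<delta> (distr_of u) < \<infinity>" using uH by (simp add: Hsd_def)
    have fin2: "ennreal (K\<^sup>2) * Hsd_norm_sq \<psi> s \<delta> (distr_of u) < \<infinity>" using fin by (simp add: ennreal_mult_less_top)
    have "compact (F ` cball 0 R)"
      by (rule compact_continuous_image[OF continuous_on_subset[OF Ck_continuous[OF F]]]) auto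
    then obtain R' where "\<And>z. z \<in> F ` cball 0 R \<Longrightarrow> norm z \<le> R'" using compact_imp_bounded bounded_iff by metis
    then have "norm ((F \<circ> u') x) \<le> R'" for x using u'(2) by simp
    then have "tempered (distr_of (F \<circ> u) i)" for i by (intro tempered_cong[OF c2 tempered_distr_of[OF Fu']])
    then have 1: "distr_of (F \<circ> u) \<in> Hsd \<psi> s \<delta>" using le_less_trans[OF b fin2] by (simp add: Hsd_def)
    have "enn2real (Hsd_norm_sq \<psi> s \<delta> (distr_of (F \<circ> u))) \<le> enn2real (ennreal (K\<^sup>2) * Hsd_norm_sq \<psi> s \<delta> (distr_of u))"
      using b fin2 by (intro enn2real_mono) auto
    also have "\<dots> = K\<^sup>2 * enn2real (Hsd_norm_sq \<psi> s \<delta> (distr_of u))" by (simp add: enn2real_mult)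
    finally have "sqrt (enn2real (Hsd_norm_sq \<psi> s \<delta> (distr_of (F \<circ> u)))) \<le> sqrt (K\<^sup>2 * enn2real (Hsd_norm_sq \<psi> s \<delta> (distr_of u)))"
      by (rule real_sqrt_le_mono)
    then have 2: "Hsd_norm \<psi> s \<delta> (distr_of (F \<circ> u)) \<le> K * Hsd_norm \<psi> s \<delta> (distr_of u)"
      unfolding Hsd_norm_def using K0 by (simp add: real_sqrt_mult)
    have "ennreal K = ennreal (sqrt C) * ennreal L * ennreal (1 + R ^ N)"
      unfolding K_def using C L0 R0 by (simp add: ennreal_mult mult.assoc)
    also have "\<dots> \<le> ennreal (sqrt C + 1) * Ck_norm (N + 1) F * ennreal (1 + R ^ N)"
      by (intro mult_right_mono mult_mono ennreal_leI LC) auto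
    also have "ennreal (1 + R ^ N) = 1 + Linf_norm u ^ N"
      unfolding LR using R0 by (simp add: ennreal_power)
    finally have 3: "ennreal K \<le> ennreal (sqrt C + 1) * Ck_norm (N + 1) F * (1 + Linf_norm u ^ N)" .
    from 1 2 3 K0 show ?thesis by blast
  qed
  \<comment> \<open>C may be 0, whereas the claim wants a positive constant; hence the summand
    1.\<close>
  have "sqrt C + 1 > 0" using C by (simp add: add_nonneg_pos)
  then show ?thesis by (intro exI[of _ "sqrt C + 1"] conjI[OF \<open>sqrt C + 1 > 0\<close>] allI impI) (rule main)
qed

end
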